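(* Let $T\subset\mathbb R^n$ be a simplex and $v\in H^2(T)$. Then the $L^2(T)$ orthogonality $\nabla^2(v-R_TI_Tv)\perp\nabla^2P_{k+2}(T)$ holds, i.e. $(\nabla^2(v-R_TI_Tv),\nabla^2p)_T=0$ for all $p\in P_{k+2}(T)$. In particular, $$\|\nabla^2(v-R_TI_Tv)\|_T=\min_{p\in P_{k+2}(T)}\|\nabla^2(v-p)\|_T.$$
   Context: Let $n\in\{2,3\}$. $(\cdot,\cdot)_M$ and $\|\cdot\|_M$ denote the $L^2$ inner product and norm on $M$ (point evaluation if $M$ is a point). For a closed nondegenerate simplex $T\subset\mathbb R^n$, $\mathcal F(T)$ is the set of its $(n-1)$-dimensional sides (faces), $\mathcal E(T)$ the set of its $(n-2)$-dimensional sides ("edges"; vertices if $n=2$), and $\mathcal E(F)$ the set of edges contained in the face $F$. $P_k(M)$ denotes polynomials of degree $\le k$ on $M$; $P_k(\mathcal F(T))$, $P_k(\mathcal E(T))$ the piecewise polynomials on faces, resp. edges; $\Pi_M^k$ the $L^2(M)$ projection onto $P_k(M)$ (point evaluation if $M$ is a vertex), $\Pi^k_{\mathcal F(T)},\Pi^k_{\mathcal E(T)}$ the piecewise versions. On a face $F$ of $T$ with outer normal $\nu_{\partial T}$: $\partial_np=\nabla p\cdot\nu_{\partial T}$, $\partial_{nn}p=\nu_{\partial T}\cdot(\nabla^2p)\nu_{\partial T}$, $\partial_{tn}p$ is the tangential gradient on $F$ of $\partial_np$, $\Delta_t$ is the tangential Laplacian on $F$, and $\nu_{\partial F}$ is the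 outer unit normal of $\partial F$ within the hyperplane of $F$; integrals over $\partial F$ are sums over $\mathcal E(F)$. Let $k\ge0$, $\ell\ge\max\{k-2,1\}$, $m:=\max\{k-1,0\}$. Local space $V_h(T):=P_\ell(T)\times P_m(\mathcal F(T))\times P_k(\mathcal F(T))\times P_k(\mathcal E(T))$; interpolation $I_Tv:=(\Pi_T^\ell v,\Pi_{\mathcal F(T)}^mv,\Pi_{\mathcal F(T)}^k\partial_nv,\Pi_{\mathcal E(T)}^kv)\in V_h(T)$. The reconstruction $R_T:V_h(T)\to P_{k+2}(T)$ maps $v_h=(v_T,v_{\mathcal F(T)},\beta_{\mathcal F(T)},v_{\mathcal E(T)})$ to the unique $R_Tv_h$ with, for all $p\in P_{k+2}(T)$, $$(\nabla^2R_Tv_h,\nabla^2p)_T=(v_T,\Delta^2p)_T-(v_{\mathcal F(T)},\partial_n\Delta p)_{\partial T}+(\beta_{\mathcal F(T)},\partial_{nn}p)_{\partial T}-(v_{\mathcal F(T)},\Delta_t\partial_np)_{\partial T}+\sum_{F\in\mathcal F(T)}(v_{\mathcal E(T)},\partial_{tn}p\cdot\nu_{\partial F})_{\partial F},$$ together with $\int_T\nabla R_Tv_h\,dx=\int_{\partial T}v_{\mathcal F(T)}\nu_{\partial T}\,ds$ and $\int_TR_Tv_h\,dx=\int_Tv_T\,dx$. *)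

theory Defs
  imports "HOL-Analysis.Analysis"
begin

section \<open>Classical derivatives and polynomials\<close>

definition dderiv :: "real^'n \<Rightarrow> (real^'n \<Rightarrow> real) \<Rightarrow> real^'n \<Rightarrow> real" where
  "dderiv e f x = frechet_derivative f (at x) e"

definition pderiv_at :: "'n \<Rightarrow> (real^'n \<Rightarrow> real) \<Rightarrow> real^'n \<Rightarrow> real" where
  "pderiv_at i = dderiv (axis i 1)"

definition grad :: "(real^'n \<Rightarrow> real) \<Rightarrow> real^'n \<Rightarrow> real^'n" where
  "grad f x = (\<chi> i. pderiv_at i f x)"

definition hess :: "(real^'n \<Rightarrow> real) \<Rightarrow> real^'n \<Rightarrow> real^'n^'n" where
  "hess f x = (\<chi> i j. pderiv_at j (pderiv_at i f) x)"

definition laplacian :: "(real^'n \<Rightarrow> real) \<Rightarrow> real^'n \<Rightarrow> real" where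
  "laplacian f x = (\<Sum>i\<in>UNIV. pderiv_at i (pderiv_at i f) x)"

text \<open>\<open>C\<^sup>\<infinity>\<close> on the whole space: all iterated partial derivatives exist and are differentiable.\<close>
definition smooth :: "(real^'n \<Rightarrow> real) \<Rightarrow> bool" where
  "smooth f \<longleftrightarrow> (\<forall>js x. (foldr pderiv_at js f) differentiable (at x))"

definition polys :: "nat \<Rightarrow> (real^'n \<Rightarrow> real) set" where
  "polys k = {p. \<exists>c :: ('n \<Rightarrow> nat) \<Rightarrow> real.
     \<forall>x. p x = (\<Sum>\<alpha> | sum \<alpha> UNIV \<le> k. c \<alpha> * (\<Prod>i\<in>UNIV. (x $ i) ^ \<alpha> i))}"

text \<open>Polynomials on a lower-dimensional \<open>M\<close> are restrictions to \<open>M\<close>, made extensional by the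
  value 0 off \<open>M\<close>, so that two of them are equal iff they agree on \<open>M\<close>. Polynomials on the
  full-dimensional simplex \<open>T\<close> are identified with the elements of \<^term>\<open>polys k\<close>.\<close>
definition polys_on :: "nat \<Rightarrow> (real^'n) set \<Rightarrow> (real^'n \<Rightarrow> real) set" where
  "polys_on k M = (\<lambda>p x. if x \<in> M then p x else 0) ` polys k"


section \<open>Sides of a simplex, normals, tangential derivatives\<close>

definition faces :: "(real^'n) set \<Rightarrow> (real^'n) set set" where
  "faces T = {F. F facet_of T}"

definition edges :: "(real^'n) set \<Rightarrow> (real^'n) set set" where
  "edges T = {E. E face_of T \<and> aff_dim E = aff_dim T - 2}"

definition face_edges :: "(real^'n) set \<Rightarrow> (real^'n) set \<Rightarrow> (real^'n) set set" where
  "face_edges T F = {E \<in> edges T. E \<subseteq> F}"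

definition direction_space :: "(real^'n) set \<Rightarrow> (real^'n) set" where
  "direction_space M = span {x - y | x y. x \<in> M \<and> y \<in> M}"

definition tangent_basis :: "(real^'n) set \<Rightarrow> (real^'n) set" where
  "tangent_basis M = (SOME B. pairwise orthogonal B \<and> (\<forall>b\<in>B. norm b = 1)
     \<and> span B = direction_space M)"

text \<open>The unit normal of \<open>M\<close> within the affine hull of \<open>S\<close>, pointing out of the convex set \<open>S\<close>:
  it gives \<open>\<nu>\<^bsub>\<partial>T\<^esub>\<close> on \<open>F\<close> for \<open>S = T\<close>, \<open>M = F\<close>, and \<open>\<nu>\<^bsub>\<partial>F\<^esub>\<close> on \<open>E\<close> for \<open>S = F\<close>, \<open>M = E\<close>.\<close>
definition outer_normal :: "(real^'n) set \<Rightarrow> (real^'n) set \<Rightarrow> real^'n" where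
  "outer_normal S M = (THE \<nu>. norm \<nu> = 1 \<and> \<nu> \<in> direction_space S
     \<and> (\<forall>x\<in>M. \<forall>y\<in>M. \<nu> \<bullet> (x - y) = 0) \<and> (\<forall>x\<in>S. \<forall>y\<in>M. \<nu> \<bullet> (x - y) \<le> 0))"

definition dn :: "(real^'n) set \<Rightarrow> (real^'n) set \<Rightarrow> (real^'n \<Rightarrow> real) \<Rightarrow> real^'n \<Rightarrow> real" where
  "dn T F p x = grad p x \<bullet> outer_normal T F"

definition dnn :: "(real^'n) set \<Rightarrow> (real^'n) set \<Rightarrow> (real^'n \<Rightarrow> real) \<Rightarrow> real^'n \<Rightarrow> real" where
  "dnn T F p x = outer_normal T F \<bullet> (hess p x *v outer_normal T F)"

text \<open>Since \<open>F\<close> is flat, tangential derivatives are directional derivatives along a (any)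
  orthonormal basis of its direction space.\<close>
definition tgrad :: "(real^'n) set \<Rightarrow> (real^'n \<Rightarrow> real) \<Rightarrow> real^'n \<Rightarrow> real^'n" where
  "tgrad F q x = (\<Sum>b\<in>tangent_basis F. dderiv b q x *\<^sub>R b)"

definition tlaplacian :: "(real^'n) set \<Rightarrow> (real^'n \<Rightarrow> real) \<Rightarrow> real^'n \<Rightarrow> real" where
  "tlaplacian F q x = (\<Sum>b\<in>tangent_basis F. dderiv b (dderiv b q) x)"

definition dtn :: "(real^'n) set \<Rightarrow> (real^'n) set \<Rightarrow> (real^'n \<Rightarrow> real) \<Rightarrow> real^'n \<Rightarrow> real^'n" where
  "dtn T F p = tgrad F (dn T F p)"


section \<open>Surface measures, \<open>L\<^sup>2\<close> products and projections\<close>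

text \<open>The Lebesgue measure of the affine hull of \<open>M\<close>, restricted to \<open>M\<close>. It is transported by an
  isometric parametrisation, as \<^const>\<open>lborel\<close> itself is from its coordinates. If \<open>M\<close> is a single
  point then \<^term>\<open>tangent_basis M\<close> is empty and this is the unit point mass.\<close>
definition surf :: "(real^'n) set \<Rightarrow> (real^'n) measure" where
  "surf M = restrict_space
     (distr (\<Pi>\<^sub>M b\<in>tangent_basis M. lborel) borel
        (\<lambda>c. (SOME a. a \<in> M) + (\<Sum>b\<in>tangent_basis M. c b *\<^sub>R b))) M"

definition L2 :: "'a measure \<Rightarrow> ('a \<Rightarrow> real) set" where
  "L2 \<mu> = {f \<in> borel_measurable \<mu>. integrable \<mu> (\<lambda>x. (f x)\<^sup>2)}"

definition l2_inner :: "'a measure \<Rightarrow> ('a \<Rightarrow> 'b::euclidean_space) \<Rightarrow> ('a \<Rightarrow> 'b) \<Rightarrow> real" where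
  "l2_inner \<mu> f g = (\<integral>x. f x \<bullet> g x \<partial>\<mu>)"

definition l2_norm :: "'a measure \<Rightarrow> ('a \<Rightarrow> 'b::euclidean_space) \<Rightarrow> real" where
  "l2_norm \<mu> f = sqrt (l2_inner \<mu> f f)"

definition l2_proj :: "'a measure \<Rightarrow> ('a \<Rightarrow> real) set \<Rightarrow> ('a \<Rightarrow> real) \<Rightarrow> 'a \<Rightarrow> real" where
  "l2_proj \<mu> V f = (THE q. q \<in> V \<and> (\<forall>p\<in>V. l2_inner \<mu> (\<lambda>x. f x - q x) p = 0))"

definition proj_cell :: "nat \<Rightarrow> (real^'n) set \<Rightarrow> (real^'n \<Rightarrow> real) \<Rightarrow> real^'n \<Rightarrow> real" where
  "proj_cell k T = l2_proj (lebesgue_on T) (polys k)"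

definition proj_side :: "nat \<Rightarrow> (real^'n) set \<Rightarrow> (real^'n \<Rightarrow> real) \<Rightarrow> real^'n \<Rightarrow> real" where
  "proj_side k M = l2_proj (surf M) (polys_on k M)"


section \<open>Sobolev functions and traces\<close>

definition test_functions :: "(real^'n) set \<Rightarrow> (real^'n \<Rightarrow> real) set" where
  "test_functions U = {\<phi>. smooth \<phi> \<and> compact (closure {x. \<phi> x \<noteq> 0}) \<and> closure {x. \<phi> x \<noteq> 0} \<subseteq> U}"

text \<open>Test functions live on the interior of \<open>T\<close>; integrating over \<open>T\<close> makes no difference
  since the boundary of a convex set is a null set.\<close>
definition is_weak_pderiv :: "(real^'n) set \<Rightarrow> 'n \<Rightarrow> (real^'n \<Rightarrow> real) \<Rightarrow> (real^'n \<Rightarrow> real) \<Rightarrow> bool" where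
  "is_weak_pderiv T i u w \<longleftrightarrow> (\<forall>\<phi>\<in>test_functions (interior T).
     (\<integral>x. u x * pderiv_at i \<phi> x \<partial>lebesgue_on T) = - (\<integral>x. w x * \<phi> x \<partial>lebesgue_on T))"

definition weak_pderiv :: "(real^'n) set \<Rightarrow> 'n \<Rightarrow> (real^'n \<Rightarrow> real) \<Rightarrow> real^'n \<Rightarrow> real" where
  "weak_pderiv T i u = (SOME w. w \<in> L2 (lebesgue_on T) \<and> is_weak_pderiv T i u w)"

definition weak_grad :: "(real^'n) set \<Rightarrow> (real^'n \<Rightarrow> real) \<Rightarrow> real^'n \<Rightarrow> real^'n" where
  "weak_grad T u x = (\<chi> i. weak_pderiv T i u x)"

definition weak_hess :: "(real^'n) set \<Rightarrow> (real^'n \<Rightarrow> real) \<Rightarrow> real^'n \<Rightarrow> real^'n^'n" where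
  "weak_hess T u x = (\<chi> i j. weak_pderiv T j (weak_pderiv T i u) x)"

definition H1 :: "(real^'n) set \<Rightarrow> (real^'n \<Rightarrow> real) set" where
  "H1 T = {u \<in> L2 (lebesgue_on T). \<forall>i. \<exists>w \<in> L2 (lebesgue_on T). is_weak_pderiv T i u w}"

definition H2 :: "(real^'n) set \<Rightarrow> (real^'n \<Rightarrow> real) set" where
  "H2 T = {u \<in> H1 T. \<forall>i. weak_pderiv T i u \<in> H1 T}"

text \<open>The trace operator from \<open>H\<^sup>1(T)\<close> to \<open>L\<^sup>2(F)\<close> is the continuous extension of the restriction
  of smooth functions to \<open>F\<close>.\<close>
definition is_trace :: "(real^'n) set \<Rightarrow> (real^'n) set \<Rightarrow> (real^'n \<Rightarrow> real) \<Rightarrow> (real^'n \<Rightarrow> real) \<Rightarrow> bool" where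
  "is_trace T F u g \<longleftrightarrow> g \<in> L2 (surf F) \<and>
     (\<exists>\<phi> :: nat \<Rightarrow> real^'n \<Rightarrow> real. (\<forall>j. smooth (\<phi> j))
        \<and> (\<lambda>j. l2_norm (lebesgue_on T) (\<lambda>x. \<phi> j x - u x)) \<longlonglongrightarrow> 0
        \<and> (\<lambda>j. l2_norm (lebesgue_on T) (\<lambda>x. grad (\<phi> j) x - weak_grad T u x)) \<longlonglongrightarrow> 0
        \<and> (\<lambda>j. l2_norm (surf F) (\<lambda>x. \<phi> j x - g x)) \<longlonglongrightarrow> 0)"

definition face_trace :: "(real^'n) set \<Rightarrow> (real^'n) set \<Rightarrow> (real^'n \<Rightarrow> real) \<Rightarrow> real^'n \<Rightarrow> real" where
  "face_trace T F u = (SOME g. is_trace T F u g)"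

definition normal_trace :: "(real^'n) set \<Rightarrow> (real^'n) set \<Rightarrow> (real^'n \<Rightarrow> real) \<Rightarrow> real^'n \<Rightarrow> real" where
  "normal_trace T F v = face_trace T F (\<lambda>x. weak_grad T v x \<bullet> outer_normal T F)"

text \<open>In dimension at most 3, functions in \<open>H\<^sup>2(T)\<close> are continuous on \<open>T\<close>; values on edges and at
  vertices are those of the continuous representative.\<close>
definition cont_rep :: "(real^'n) set \<Rightarrow> (real^'n \<Rightarrow> real) \<Rightarrow> real^'n \<Rightarrow> real" where
  "cont_rep T v = (SOME w. continuous_on T w \<and> (AE x in lebesgue_on T. w x = v x))"


section \<open>Local space, interpolation, reconstruction\<close>

type_synonym 'n hho =
  "(real^'n \<Rightarrow> real) \<times> ((real^'n) set \<Rightarrow> real^'n \<Rightarrow> real)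
   \<times> ((real^'n) set \<Rightarrow> real^'n \<Rightarrow> real) \<times> ((real^'n) set \<Rightarrow> real^'n \<Rightarrow> real)"

text \<open>Here \<open>m = max {k - 1, 0}\<close> is the truncated subtraction \<^term>\<open>k - 1\<close> on \<^typ>\<open>nat\<close>.\<close>
definition local_space :: "nat \<Rightarrow> nat \<Rightarrow> (real^'n) set \<Rightarrow> 'n hho set" where
  "local_space k l T =
     polys l \<times> (\<Pi>\<^sub>E F\<in>faces T. polys_on (k - 1) F) \<times> (\<Pi>\<^sub>E F\<in>faces T. polys_on k F)
       \<times> (\<Pi>\<^sub>E E\<in>edges T. polys_on k E)"

definition interpolation :: "nat \<Rightarrow> nat \<Rightarrow> (real^'n) set \<Rightarrow> (real^'n \<Rightarrow> real) \<Rightarrow> 'n hho" where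
  "interpolation k l T v =
     (proj_cell l T v,
      \<lambda>F\<in>faces T. proj_side (k - 1) F (face_trace T F v),
      \<lambda>F\<in>faces T. proj_side k F (normal_trace T F v),
      \<lambda>E\<in>edges T. proj_side k E (cont_rep T v))"

definition is_reconstruction :: "nat \<Rightarrow> (real^'n) set \<Rightarrow> 'n hho \<Rightarrow> (real^'n \<Rightarrow> real) \<Rightarrow> bool" where
  "is_reconstruction k T = (\<lambda>(vT, vF, \<beta>F, vE) r.
     r \<in> polys (k + 2)
     \<and> (\<forall>p\<in>polys (k + 2). l2_inner (lebesgue_on T) (hess r) (hess p) =
          l2_inner (lebesgue_on T) vT (laplacian (laplacian p))
          - (\<Sum>F\<in>faces T. l2_inner (surf F) (vF F) (dn T F (laplacian p)))
          + (\<Sum>F\<in>faces T. l2_inner (surf F) (\<beta>F F) (dnn T F p))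
          - (\<Sum>F\<in>faces T. l2_inner (surf F) (vF F) (tlaplacian F (dn T F p)))
          + (\<Sum>F\<in>faces T. \<Sum>E\<in>face_edges T F.
               l2_inner (surf E) (vE E) (\<lambda>x. dtn T F p x \<bullet> outer_normal F E)))
     \<and> (\<integral>x. grad r x \<partial>lebesgue_on T)
          = (\<Sum>F\<in>faces T. \<integral>x. vF F x *\<^sub>R outer_normal T F \<partial>surf F)
     \<and> (\<integral>x. r x \<partial>lebesgue_on T) = (\<integral>x. vT x \<partial>lebesgue_on T))"

definition reconstruction :: "nat \<Rightarrow> nat \<Rightarrow> (real^'n) set \<Rightarrow> 'n hho \<Rightarrow> real^'n \<Rightarrow> real" where
  "reconstruction k l T = (\<lambda>vh\<in>local_space k l T. THE r. is_reconstruction k T vh r)"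

end

theory Submission
  imports Defs
begin

text \<open>Smooth functions are dense in \<open>H\<^sup>2(T)\<close>: the mollification
  \<open>\<integral> v ((1 - \<epsilon>) x + \<epsilon> y) \<eta> y dy\<close> with a bump function \<open>\<eta>\<close> on the interior of the convex set \<open>T\<close> is
  smooth and never looks outside \<open>T\<close>. For smooth functions, Green's formula on \<open>T\<close> and on its
  faces turns \<open>(\<nabla>\<^sup>2 v, \<nabla>\<^sup>2 p)\<close> into the cell, face and edge terms that define the reconstruction.
  It extends to \<open>H\<^sup>2(T)\<close> by the trace inequality and the Sobolev embedding. The test functions
  in these terms are polynomials of the degrees onto which the interpolation projects, so the
  Hessian of the reconstruction is the \<open>L\<^sup>2\<close> projection of \<open>\<nabla>\<^sup>2 v\<close>.\<close>

section \<open>Smooth functions\<close>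

text \<open>The obstacle is that nearly every notion of the statement is a choice or a definite
  description: tangent basis and base point behind \<open>surf\<close>, normals, projections,
  \<open>weak_pderiv\<close>, \<open>face_trace\<close>, \<open>cont_rep\<close>, the
  reconstruction. Each must be shown to exist and to be determined, at least almost everywhere,
  before anything can be computed. For \<open>surf\<close> this is the uniqueness of an invariant
  measure, for weak derivatives the fundamental lemma, for traces the trace inequality, for
  \<open>cont_rep\<close> the rigidity of continuous functions. Up to the boundary, the derivative
  of the mollification is \<open>1 - \<epsilon>\<close> times the mollified weak derivative. Hence a
  single sequence converges with all its derivatives up to order two, on the sides and on the edges.
  Integrals over a simplex and its sides are related by fibring along an edge direction, so the
  divergence theorem needs only the fundamental theorem of calculus on segments and is proved once
  for simplices of every positive dimension. The bound \<open>n \<ge> 2\<close> makes the faces such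
  simplices; the bound \<open>n \<le> 3\<close> enters through the Sobolev embedding.\<close>

lemma smooth_differentiable: "smooth f \<Longrightarrow> f differentiable (at x)"
  unfolding smooth_def by (metis foldr.simps(1) id_apply)

lemma smooth_pderiv:
  assumes "smooth f" shows "smooth (pderiv_at i f)"
  unfolding smooth_def
proof (intro allI)
  fix js x
  have "foldr pderiv_at (js @ [i]) f differentiable (at x)"
    using assms unfolding smooth_def by blast
  then show "foldr pderiv_at js (pderiv_at i f) differentiable (at x)"
    by simp
qed

text \<open>Smoothness is the greatest property that implies differentiability and survives every
  partial derivative, so an invariant \<open>K\<close> suffices. The invariants used below carry
  along sums or scalar factors, which avoids formulas for iterated derivatives.\<close>

lemma smooth_coinduct:
  assumes "K f" and diff: "\<And>g x. K g \<Longrightarrow> g differentiable (at x)"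
    and pd: "\<And>g i. K g \<Longrightarrow> K (pderiv_at i g)"
  shows "smooth f"
proof -
  have "K (foldr pderiv_at js f)" for js
    by (induction js) (auto intro: assms)
  then show ?thesis unfolding smooth_def using diff by blast
qed

section \<open>Directional and partial derivatives\<close>

lemma dderiv_eqI:
  assumes "(f has_derivative D) (at x)" shows "dderiv e f x = D e"
  using frechet_derivative_at[OF assms] by (simp add: dderiv_def)

lemma pderiv_eqI:
  assumes "(f has_derivative D) (at x)" shows "pderiv_at i f x = D (axis i 1)"
  using dderiv_eqI[OF assms] by (simp add: pderiv_at_def)

lemma dderiv_eq_grad:
  fixes f :: "real^'n \<Rightarrow> real"
  assumes "f differentiable (at x)"
  shows "dderiv e f x = grad f x \<bullet> e"
proof -
  obtain D where D: "(f has_derivative D) (at x)"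
    using assms unfolding differentiable_def by blast
  then have lin: "linear D" by (rule has_derivative_linear)
  have "dderiv e f x = D (\<Sum>i\<in>UNIV. (e $ i) *\<^sub>R axis i 1)"
    using dderiv_eqI[OF D] basis_expansion[of e] by (simp add: scalar_mult_eq_scaleR)
  also have "\<dots> = (\<Sum>i\<in>UNIV. e $ i * pderiv_at i f x)"
    using lin by (simp add: linear_sum linear_cmul pderiv_eqI[OF D])
  finally show ?thesis
    by (simp add: inner_vec_def grad_def mult.commute)
qed

lemma has_derivative_grad:
  fixes f :: "real^'n \<Rightarrow> real"
  assumes "f differentiable (at x)"
  shows "(f has_derivative (\<lambda>h. grad f x \<bullet> h)) (at x)"
proof -
  have "(f has_derivative frechet_derivative f (at x)) (at x)"
    using assms by (simp add: frechet_derivative_works)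
  moreover have "frechet_derivative f (at x) = (\<lambda>h. grad f x \<bullet> h)"
    using dderiv_eq_grad[OF assms] by (auto simp: dderiv_def)
  ultimately show ?thesis by simp
qed

lemma has_real_derivative_along:
  fixes f :: "real^'n \<Rightarrow> real"
  assumes "f differentiable (at (x + t *\<^sub>R e))"
  shows "((\<lambda>s. f (x + s *\<^sub>R e)) has_real_derivative grad f (x + t *\<^sub>R e) \<bullet> e) (at t within A)"
proof -
  have "((\<lambda>s. f (x + s *\<^sub>R e)) has_derivative (\<lambda>h. grad f (x + t *\<^sub>R e) \<bullet> (h *\<^sub>R e))) (at t within A)"
    by (rule has_derivative_compose[where g=f]) (auto intro!: derivative_eq_intros has_derivative_grad assms)
  then show ?thesis
    by (simp add: has_field_derivative_def mult_commute_abs)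
qed

text \<open>Reduces a partial derivative to a derivative in one real variable; monomials are
  differentiated in this way.\<close>

lemma pderiv_at_along:
  fixes f :: "real^'n \<Rightarrow> real"
  assumes "f differentiable (at x)"
    and "((\<lambda>s. f (x + s *\<^sub>R axis i 1)) has_real_derivative D) (at 0)"
  shows "pderiv_at i f x = D"
proof -
  have "((\<lambda>s. f (x + s *\<^sub>R axis i 1)) has_real_derivative grad f x \<bullet> axis i 1) (at 0)"
    using has_real_derivative_along[of f x 0 "axis i 1"] assms(1) by simp
  then have "D = grad f x \<bullet> axis i 1" using assms(2) DERIV_unique by blast
  then show ?thesis by (simp add: grad_def inner_axis)
qed

lemma pderiv_const [simp]: "pderiv_at i (\<lambda>x. c) = (\<lambda>x. 0)"
  by (rule ext, subst pderiv_eqI) (auto intro!: derivative_eq_intros)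

lemma pderiv_add:
  fixes f g :: "real^'n \<Rightarrow> real"
  assumes "f differentiable (at x)" "g differentiable (at x)"
  shows "pderiv_at i (\<lambda>x. f x + g x) x = pderiv_at i f x + pderiv_at i g x"
  by (subst pderiv_eqI[OF has_derivative_add[OF has_derivative_grad[OF assms(1)] has_derivative_grad[OF assms(2)]]])
     (simp add: grad_def inner_axis)

lemma pderiv_mult:
  fixes f g :: "real^'n \<Rightarrow> real"
  assumes "f differentiable (at x)" "g differentiable (at x)"
  shows "pderiv_at i (\<lambda>x. f x * g x) x = pderiv_at i f x * g x + f x * pderiv_at i g x"
  by (subst pderiv_eqI[OF has_derivative_mult[OF has_derivative_grad[OF assms(1)] has_derivative_grad[OF assms(2)]]])
     (simp add: grad_def inner_axis)

lemma pderiv_cmult: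
  fixes f :: "real^'n \<Rightarrow> real"
  assumes "f differentiable (at x)"
  shows "pderiv_at i (\<lambda>x. c * f x) x = c * pderiv_at i f x"
  using pderiv_mult[of "\<lambda>x. c" x f i] assms by simp

lemma pderiv_sum:
  fixes f :: "'a \<Rightarrow> real^'n \<Rightarrow> real"
  assumes "\<And>a. a \<in> A \<Longrightarrow> f a differentiable (at x)"
  shows "pderiv_at i (\<lambda>x. \<Sum>a\<in>A. f a x) x = (\<Sum>a\<in>A. pderiv_at i (f a) x)"
proof -
  have "((\<lambda>x. \<Sum>a\<in>A. f a x) has_derivative (\<lambda>h. \<Sum>a\<in>A. grad (f a) x \<bullet> h)) (at x)"
    by (intro has_derivative_sum has_derivative_grad assms)
  from pderiv_eqI[OF this] show ?thesis by (simp add: grad_def inner_axis)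
qed

lemma pderiv_affine:
  fixes f :: "real^'n \<Rightarrow> real"
  assumes "f differentiable (at (c *\<^sub>R x + a))"
  shows "pderiv_at i (\<lambda>x. f (c *\<^sub>R x + a)) x = c * pderiv_at i f (c *\<^sub>R x + a)"
    and "(\<lambda>x. f (c *\<^sub>R x + a)) differentiable (at x)"
proof -
  have "((\<lambda>x. f (c *\<^sub>R x + a)) has_derivative (\<lambda>h. grad f (c *\<^sub>R x + a) \<bullet> (c *\<^sub>R h))) (at x)"
    by (rule has_derivative_compose[where g=f]) (auto intro!: derivative_eq_intros has_derivative_grad assms)
  from pderiv_eqI[OF this] this
  show "pderiv_at i (\<lambda>x. f (c *\<^sub>R x + a)) x = c * pderiv_at i f (c *\<^sub>R x + a)"
    "(\<lambda>x. f (c *\<^sub>R x + a)) differentiable (at x)"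
    by (auto simp add: grad_def inner_axis differentiable_def)
qed

section \<open>Closure properties of the smooth functions\<close>

lemma smooth_const [simp]: "smooth (\<lambda>x. c)"
  by (rule smooth_coinduct[where K="\<lambda>g. \<exists>c. g = (\<lambda>x. c)"]) auto

lemma smooth_add:
  assumes "smooth f" "smooth g" shows "smooth (\<lambda>x. f x + g x)"
proof (rule smooth_coinduct[where K="\<lambda>h. \<exists>f g. smooth f \<and> smooth g \<and> h = (\<lambda>x. f x + g x)"], goal_cases)
  case (3 h i)
  then obtain f g where *: "smooth f" "smooth g" "h = (\<lambda>x. f x + g x)" by blast
  then have "pderiv_at i h = (\<lambda>x. pderiv_at i f x + pderiv_at i g x)"
    using pderiv_add smooth_differentiable by blast
  then show ?case using * smooth_pderiv by blast
qed (use assms in \<open>auto intro!: differentiable_add dest: smooth_differentiable\<close>)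

text \<open>The invariant for products: by the Leibniz rule a derivative of a product is a sum of
  two products, so finite sums of products are closed under differentiation while single products
  are not.\<close>

inductive sum_of_products :: "(real^'n \<Rightarrow> real) \<Rightarrow> bool" where
  prod: "smooth f \<Longrightarrow> smooth g \<Longrightarrow> sum_of_products (\<lambda>x. f x * g x)"
| add: "sum_of_products u \<Longrightarrow> sum_of_products w \<Longrightarrow> sum_of_products (\<lambda>x. u x + w x)"

lemma smooth_mult:
  assumes "smooth f" "smooth g" shows "smooth (\<lambda>x. f x * g x)"
proof (rule smooth_coinduct[where K=sum_of_products])
  show "sum_of_products (\<lambda>x. f x * g x)" using assms by (rule sum_of_products.prod)
  show diff: "h differentiable (at x)" if "sum_of_products h" for h :: "real^'n \<Rightarrow> real" and x
    using that by induction (auto intro!: differentiable_add differentiable_mult dest: smooth_differentiable)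
  show "sum_of_products (pderiv_at i h)" if "sum_of_products h" for h :: "real^'n \<Rightarrow> real" and i
    using that
  proof induction
    case (prod f g)
    then have "pderiv_at i (\<lambda>x. f x * g x) = (\<lambda>x. pderiv_at i f x * g x + f x * pderiv_at i g x)"
      using pderiv_mult smooth_differentiable by blast
    then show ?case using prod by (auto intro!: sum_of_products.intros smooth_pderiv)
  next
    case (add u w)
    then have "pderiv_at i (\<lambda>x. u x + w x) = (\<lambda>x. pderiv_at i u x + pderiv_at i w x)"
      using pderiv_add diff by blast
    then show ?case using add by (auto intro!: sum_of_products.intros)
  qed
qed

lemma smooth_cmult: "smooth f \<Longrightarrow> smooth (\<lambda>x. c * f x)"
  by (intro smooth_mult smooth_const)

lemma pderiv_diff:
  fixes f g :: "real^'n \<Rightarrow> real"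
  assumes "smooth f" "smooth g"
  shows "pderiv_at i (\<lambda>x. f x - g x) = (\<lambda>x. pderiv_at i f x - pderiv_at i g x)"
proof
  fix x
  have "pderiv_at i (\<lambda>x. f x + (-1) * g x) x = pderiv_at i f x + pderiv_at i (\<lambda>x. (-1) * g x) x"
    using assms by (intro pderiv_add smooth_differentiable smooth_cmult)
  also have "pderiv_at i (\<lambda>x. (-1) * g x) x = (-1) * pderiv_at i g x"
    using assms by (intro pderiv_cmult smooth_differentiable)
  finally show "pderiv_at i (\<lambda>x. f x - g x) x = pderiv_at i f x - pderiv_at i g x" by simp
qed

lemma pderiv2_add:
  fixes f g :: "real^'n \<Rightarrow> real"
  assumes "smooth f" "smooth g"
  shows "pderiv_at j (pderiv_at i (\<lambda>x. f x + g x)) = (\<lambda>x. pderiv_at j (pderiv_at i f) x + pderiv_at j (pderiv_at i g) x)"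
proof -
  have "pderiv_at i (\<lambda>x. f x + g x) = (\<lambda>x. pderiv_at i f x + pderiv_at i g x)"
    using assms by (intro ext pderiv_add smooth_differentiable)
  then show ?thesis using assms by (simp only:) (intro ext pderiv_add smooth_differentiable smooth_pderiv)
qed

lemma pderiv2_cmult:
  fixes f :: "real^'n \<Rightarrow> real"
  assumes "smooth f"
  shows "pderiv_at j (pderiv_at i (\<lambda>x. c * f x)) = (\<lambda>x. c * pderiv_at j (pderiv_at i f) x)"
proof -
  have "pderiv_at i (\<lambda>x. c * f x) = (\<lambda>x. c * pderiv_at i f x)"
    using assms by (intro ext pderiv_cmult smooth_differentiable)
  then show ?thesis using assms by (simp only:) (intro ext pderiv_cmult smooth_differentiable smooth_pderiv)
qed

lemma smooth_diff: "smooth f \<Longrightarrow> smooth g \<Longrightarrow> smooth (\<lambda>x. f x - g x)"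
  using smooth_add[of f "\<lambda>x. (-1) * g x"] smooth_cmult[of g "-1"] by simp

lemma smooth_sum: "(\<And>a. a \<in> A \<Longrightarrow> smooth (f a)) \<Longrightarrow> smooth (\<lambda>x. \<Sum>a\<in>A. f a x)"
  by (induction A rule: infinite_finite_induct) (auto intro: smooth_add)

lemma smooth_prod: "(\<And>a. a \<in> A \<Longrightarrow> smooth (f a)) \<Longrightarrow> smooth (\<lambda>x. \<Prod>a\<in>A. f a x)"
  by (induction A rule: infinite_finite_induct) (auto intro: smooth_mult)

lemma smooth_power: "smooth f \<Longrightarrow> smooth (\<lambda>x. f x ^ k)"
  by (induction k) (auto intro: smooth_mult)

lemma pderiv_inner: "pderiv_at i (\<lambda>x::real^'n. x \<bullet> a) = (\<lambda>x. a $ i)"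
proof
  fix x
  have "((\<lambda>x. x \<bullet> a) has_derivative (\<lambda>h. h \<bullet> a)) (at x)"
    by (auto intro!: derivative_eq_intros)
  from pderiv_eqI[OF this] show "pderiv_at i (\<lambda>x. x \<bullet> a) x = a $ i"
    by (simp add: inner_axis' )
qed

lemma smooth_inner: "smooth (\<lambda>x::real^'n. x \<bullet> a)"
proof (rule smooth_coinduct[where K="\<lambda>g. (\<exists>c. g = (\<lambda>x. c)) \<or> g = (\<lambda>x. x \<bullet> a)"])
  fix g :: "real^'n \<Rightarrow> real" and x
  assume "(\<exists>c. g = (\<lambda>x. c)) \<or> g = (\<lambda>x. x \<bullet> a)"
  then show "g differentiable (at x)"
    using bounded_linear_imp_differentiable[OF bounded_linear_inner_left, of a] by auto
next
  fix g :: "real^'n \<Rightarrow> real" and i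
  assume "(\<exists>c. g = (\<lambda>x. c)) \<or> g = (\<lambda>x. x \<bullet> a)"
  then show "(\<exists>c. pderiv_at i g = (\<lambda>x. c)) \<or> pderiv_at i g = (\<lambda>x. x \<bullet> a)"
    by (auto simp: pderiv_inner)
qed simp

lemma smooth_nth: "smooth (\<lambda>x::real^'n. x $ i)"
  using smooth_inner[of "axis i 1"] by (simp add: inner_axis)

lemma smooth_affine:
  fixes f :: "real^'n \<Rightarrow> real"
  assumes "smooth f" shows "smooth (\<lambda>x. f (c *\<^sub>R x + a))"
\<comment> \<open>Each derivative of \<open>f (c x + a)\<close> brings a factor \<open>c\<close>;
  the invariant collects these factors in \<open>b\<close>.\<close>
proof (rule smooth_coinduct[where K="\<lambda>h. \<exists>f b. smooth f \<and> h = (\<lambda>x. b * f (c *\<^sub>R x + a))"])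
  show "\<exists>f' b. smooth f' \<and> (\<lambda>x. f (c *\<^sub>R x + a)) = (\<lambda>x. b * f' (c *\<^sub>R x + a))"
    using assms by (intro exI[of _ f] exI[of _ 1]) simp
next
  fix g :: "real^'n \<Rightarrow> real" and x assume "\<exists>f b. smooth f \<and> g = (\<lambda>x. b * f (c *\<^sub>R x + a))"
  then obtain f b where *: "smooth f" "g = (\<lambda>x. b * f (c *\<^sub>R x + a))" by (elim exE conjE)
  show "g differentiable (at x)"
    unfolding *(2) by (rule differentiable_mult[OF differentiable_const pderiv_affine(2)[OF smooth_differentiable[OF *(1)]]])
next
  fix g :: "real^'n \<Rightarrow> real" and i assume "\<exists>f b. smooth f \<and> g = (\<lambda>x. b * f (c *\<^sub>R x + a))"
  then obtain f b where *: "smooth f" "g = (\<lambda>x. b * f (c *\<^sub>R x + a))" by (elim exE conjE)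
  have "pderiv_at i g = (\<lambda>x. (b * c) * pderiv_at i f (c *\<^sub>R x + a))"
    unfolding *(2)
    by (rule ext, subst pderiv_cmult[OF pderiv_affine(2)[OF smooth_differentiable[OF *(1)]]],
        subst pderiv_affine(1)[OF smooth_differentiable[OF *(1)]], rule mult.assoc[symmetric])
  then show "\<exists>f b. smooth f \<and> pderiv_at i g = (\<lambda>x. b * f (c *\<^sub>R x + a))"
    using smooth_pderiv[OF *(1)] by (intro exI[of _ "pderiv_at i f"] exI[of _ "b * c"] conjI)
qed

lemma smooth_continuous: "smooth f \<Longrightarrow> continuous_on A f"
  by (meson continuous_at_imp_continuous_on differentiable_imp_continuous_within smooth_differentiable)

lemma smooth_dderiv:
  fixes f :: "real^'n \<Rightarrow> real"
  assumes "smooth f"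
  shows dderiv_eq_sum: "dderiv e f = (\<lambda>x. \<Sum>i\<in>UNIV. e $ i * pderiv_at i f x)"
    and "smooth (dderiv e f)"
proof -
  show *: "dderiv e f = (\<lambda>x. \<Sum>i\<in>UNIV. e $ i * pderiv_at i f x)"
    using dderiv_eq_grad[OF smooth_differentiable[OF assms]]
    by (simp add: fun_eq_iff inner_vec_def grad_def mult.commute)
  show "smooth (dderiv e f)"
    unfolding * by (intro smooth_sum smooth_cmult smooth_pderiv assms)
qed

lemma smooth_dderiv_grad: "smooth f \<Longrightarrow> dderiv e f = (\<lambda>x. grad f x \<bullet> e)" for f :: "real^'n \<Rightarrow> real"
  using dderiv_eq_grad smooth_differentiable by blast

lemma continuous_on_grad:
  fixes f :: "real^'n \<Rightarrow> real"
  assumes "smooth f" shows "continuous_on A (grad f)"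
proof -
  have "continuous_on A (\<lambda>x. \<chi> i. pderiv_at i f x)"
    by (intro continuous_on_vec_lambda smooth_continuous smooth_pderiv assms)
  then show ?thesis by (simp add: grad_def[abs_def])
qed

lemma smooth_inner_grad: "smooth f \<Longrightarrow> smooth (\<lambda>x. grad f x \<bullet> e)" for f :: "real^'n \<Rightarrow> real"
  using smooth_dderiv(2)[of f e] smooth_dderiv_grad[of f e] by simp

lemma smooth_laplacian: "smooth f \<Longrightarrow> smooth (laplacian f)"
  unfolding laplacian_def[abs_def] by (intro smooth_sum smooth_pderiv)

section \<open>Polynomials\<close>

definition monom_fun :: "('n \<Rightarrow> nat) \<Rightarrow> real^'n \<Rightarrow> real" where
  "monom_fun \<alpha> x = (\<Prod>i\<in>UNIV. (x $ i) ^ \<alpha> i)"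

lemma finite_multi_index: "finite {\<alpha> :: 'n::finite \<Rightarrow> nat. sum \<alpha> UNIV \<le> k}"
proof (rule finite_subset)
  have "\<alpha> i \<le> k" if "sum \<alpha> UNIV \<le> k" for \<alpha> :: "'n \<Rightarrow> nat" and i
    using member_le_sum[of i UNIV \<alpha>] that by simp
  then show "{\<alpha> :: 'n \<Rightarrow> nat. sum \<alpha> UNIV \<le> k} \<subseteq> (\<Pi>\<^sub>E i\<in>UNIV. {..k})"
    by (auto simp: PiE_def extensional_def)
qed (intro finite_PiE, auto)

section \<open>The polynomial spaces as vector spaces\<close>

lemma polys_altdef:
  "polys k = {p. \<exists>c. p = (\<lambda>x. \<Sum>\<alpha> | sum \<alpha> UNIV \<le> k. c \<alpha> * monom_fun \<alpha> x)}"
  unfolding polys_def monom_fun_def fun_eq_iff ..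

lemma polysI: "p = (\<lambda>x. \<Sum>\<alpha> | sum \<alpha> UNIV \<le> k. c \<alpha> * monom_fun \<alpha> x) \<Longrightarrow> p \<in> polys k"
  unfolding polys_altdef by blast

lemma monom_in_polys:
  assumes "sum \<alpha> UNIV \<le> k" shows "monom_fun \<alpha> \<in> polys k"
proof -
  have "monom_fun \<alpha> x = (\<Sum>\<beta> | sum \<beta> UNIV \<le> k. (if \<beta> = \<alpha> then 1 else 0) * monom_fun \<beta> x)" for x
    by (subst sum.remove[OF finite_multi_index, of \<alpha>]) (use assms in auto)
  then show ?thesis by (intro polysI[where c="\<lambda>\<beta>. if \<beta> = \<alpha> then 1 else 0"] ext)
qed

lemma polys_add: assumes "p \<in> polys k" "q \<in> polys k" shows "(\<lambda>x. p x + q x) \<in> polys k"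
proof -
  obtain c d where "p = (\<lambda>x. \<Sum>\<alpha> | sum \<alpha> UNIV \<le> k. c \<alpha> * monom_fun \<alpha> x)"
    "q = (\<lambda>x. \<Sum>\<alpha> | sum \<alpha> UNIV \<le> k. d \<alpha> * monom_fun \<alpha> x)"
    using assms unfolding polys_altdef by blast
  then have "(\<lambda>x. p x + q x) = (\<lambda>x. \<Sum>\<alpha> | sum \<alpha> UNIV \<le> k. (c \<alpha> + d \<alpha>) * monom_fun \<alpha> x)"
    by (simp add: sum.distrib algebra_simps)
  then show ?thesis by (rule polysI)
qed

lemma polys_cmult: assumes "p \<in> polys k" shows "(\<lambda>x. a * p x) \<in> polys k"
proof -
  obtain c where "p = (\<lambda>x. \<Sum>\<alpha> | sum \<alpha> UNIV \<le> k. c \<alpha> * monom_fun \<alpha> x)"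
    using assms unfolding polys_altdef by blast
  then have "(\<lambda>x. a * p x) = (\<lambda>x. \<Sum>\<alpha> | sum \<alpha> UNIV \<le> k. (a * c \<alpha>) * monom_fun \<alpha> x)"
    by (simp add: sum_distrib_left algebra_simps)
  then show ?thesis by (rule polysI)
qed

lemma polys_diff: "p \<in> polys k \<Longrightarrow> q \<in> polys k \<Longrightarrow> (\<lambda>x. p x - q x) \<in> polys k"
  using polys_add[of p k "\<lambda>x. (-1) * q x"] polys_cmult[of q k "-1"] by simp

lemma polys_zero: "(\<lambda>x. 0) \<in> polys k"
  unfolding polys_def by (auto intro!: exI[of _ "\<lambda>_. 0"])

lemma polys_sum: "(\<And>a. a \<in> A \<Longrightarrow> f a \<in> polys k) \<Longrightarrow> (\<lambda>x. \<Sum>a\<in>A. f a x) \<in> polys k"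
  by (induction A rule: infinite_finite_induct) (auto intro: polys_add polys_zero)

lemma polys_mono:
  assumes "p \<in> polys k" "k \<le> k'" shows "p \<in> polys k'"
proof -
  obtain c where p: "p = (\<lambda>x. \<Sum>\<alpha> | sum \<alpha> UNIV \<le> k. c \<alpha> * monom_fun \<alpha> x)"
    using assms unfolding polys_altdef by blast
  show ?thesis unfolding p using assms(2) by (intro polys_sum polys_cmult monom_in_polys) auto
qed

lemma polys_const: "(\<lambda>x. c) \<in> polys k"
  using polys_cmult[OF monom_in_polys[of "\<lambda>_. 0" k], of c] by (simp add: monom_fun_def)

lemma polys_nth: "(\<lambda>x. x $ i) \<in> polys (Suc k)"
proof -
  have "monom_fun (\<lambda>j. if j = i then 1 else 0) = (\<lambda>x. x $ i)"
    unfolding monom_fun_def by (rule ext) (simp add: prod.remove[of UNIV i])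
  then show ?thesis using monom_in_polys[of "\<lambda>j. if j = i then 1 else 0" "Suc k"] by simp
qed

lemma polys_inner: "(\<lambda>x. x \<bullet> a) \<in> polys (Suc k)"
proof -
  have "(\<lambda>x. x \<bullet> a) = (\<lambda>x. \<Sum>i\<in>UNIV. a $ i * x $ i)"
    by (simp add: inner_vec_def mult.commute)
  then show ?thesis by (auto intro!: polys_sum polys_cmult polys_nth)
qed

section \<open>Derivatives and degrees of polynomials\<close>

lemma smooth_monom: "smooth (monom_fun \<alpha>)"
  unfolding monom_fun_def[abs_def] by (intro smooth_prod smooth_power smooth_nth)

lemma smooth_polys: "p \<in> polys k \<Longrightarrow> smooth p"
  unfolding polys_altdef by (auto intro!: smooth_sum smooth_cmult smooth_monom)

text \<open>Restricting to the line in direction \<open>axis i 1\<close> leaves a power of one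
  variable. For \<open>\<alpha> i = 0\<close> the truncated exponent is harmless, because the factor
  \<open>real (\<alpha> i)\<close> is zero.\<close>

lemma pderiv_monom:
  "pderiv_at i (monom_fun \<alpha>) = (\<lambda>x. real (\<alpha> i) * monom_fun (\<alpha>(i := \<alpha> i - 1)) x)"
proof
  fix x :: "real^'a"
  let ?c = "\<Prod>j\<in>UNIV - {i}. (x $ j) ^ \<alpha> j"
  have eq: "monom_fun \<alpha> (x + s *\<^sub>R axis i 1) = (x $ i + s) ^ \<alpha> i * ?c" for s
    unfolding monom_fun_def by (subst prod.remove[of UNIV i]) (auto simp: axis_def)
  have eq2: "monom_fun (\<alpha>(i := \<alpha> i - 1)) x = (x $ i) ^ (\<alpha> i - 1) * ?c"
    unfolding monom_fun_def by (subst prod.remove[of UNIV i]) auto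
  show "pderiv_at i (monom_fun \<alpha>) x = real (\<alpha> i) * monom_fun (\<alpha>(i := \<alpha> i - 1)) x"
    by (rule pderiv_at_along[OF smooth_differentiable[OF smooth_monom]], unfold eq eq2)
       (auto intro!: derivative_eq_intros)
qed

text \<open>Every monomial loses one degree or is annihilated. The truncated \<open>k - 1\<close> is
  right for \<open>k = 0\<close> too, where only constants occur, and it matches the truncated
  degree of the face unknowns.\<close>

lemma polys_pderiv:
  assumes "p \<in> polys k" shows "pderiv_at i p \<in> polys (k - 1)"
proof -
  obtain c where p: "p = (\<lambda>x. \<Sum>\<alpha> | sum \<alpha> UNIV \<le> k. c \<alpha> * monom_fun \<alpha> x)"
    using assms unfolding polys_altdef by blast
  have *: "pderiv_at i p = (\<lambda>x. \<Sum>\<alpha> | sum \<alpha> UNIV \<le> k. c \<alpha> * (real (\<alpha> i) * monom_fun (\<alpha>(i := \<alpha> i - 1)) x))"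
    unfolding p
    by (rule ext, subst pderiv_sum)
       (auto simp: pderiv_cmult smooth_differentiable[OF smooth_monom] pderiv_monom
          intro!: differentiable_mult smooth_differentiable[OF smooth_monom])
  have "(\<lambda>x. real (\<alpha> i) * monom_fun (\<alpha>(i := \<alpha> i - 1)) x) \<in> polys (k - 1)"
    if "sum \<alpha> UNIV \<le> k" for \<alpha>
  proof (cases "\<alpha> i = 0")
    case False
    have "sum (\<alpha>(i := \<alpha> i - 1)) UNIV = \<alpha> i - 1 + sum \<alpha> (UNIV - {i})"
      by (subst sum.remove[of UNIV i]) auto
    moreover have "sum \<alpha> UNIV = \<alpha> i + sum \<alpha> (UNIV - {i})"
      by (subst sum.remove[of UNIV i]) auto
    ultimately have "sum (\<alpha>(i := \<alpha> i - 1)) UNIV \<le> k - 1" using that False by linarith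
    then show ?thesis by (intro polys_cmult monom_in_polys)
  qed (simp add: polys_zero)
  then show ?thesis unfolding * by (intro polys_sum polys_cmult[where p="\<lambda>x. real _ * _ x"]) simp_all
qed

lemma polys_dderiv: "p \<in> polys k \<Longrightarrow> dderiv e p \<in> polys (k - 1)"
  by (subst dderiv_eq_sum[OF smooth_polys]) (assumption, intro polys_sum polys_cmult polys_pderiv)

lemma polys_laplacian: "p \<in> polys k \<Longrightarrow> laplacian p \<in> polys (k - 2)"
  unfolding laplacian_def[abs_def]
  using polys_pderiv[OF polys_pderiv, of p k] by (intro polys_sum) (simp add: numeral_2_eq_2)

text \<open>On a monomial both orders produce the same coefficient and the same exponent, since
  updates at different indices commute. Green's formula uses this symmetry for the polynomial
  \<open>p\<close>.\<close>

lemma polys_pderiv_commute: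
  assumes "p \<in> polys k"
  shows "pderiv_at i (pderiv_at j p) = pderiv_at j (pderiv_at i p)"
proof -
  obtain c where p: "p = (\<lambda>x. \<Sum>\<alpha> | sum \<alpha> UNIV \<le> k. c \<alpha> * monom_fun \<alpha> x)"
    using assms unfolding polys_altdef by blast
  have *: "pderiv_at i (\<lambda>x. \<Sum>\<alpha> | sum \<alpha> UNIV \<le> k. d \<alpha> * monom_fun (h \<alpha>) x)
    = (\<lambda>x. \<Sum>\<alpha> | sum \<alpha> UNIV \<le> k. (d \<alpha> * h \<alpha> i) * monom_fun ((h \<alpha>)(i := h \<alpha> i - 1)) x)" for d h i
    by (rule ext, subst pderiv_sum)
       (auto simp: pderiv_cmult smooth_differentiable[OF smooth_monom] pderiv_monom mult.assoc
          intro!: differentiable_mult smooth_differentiable[OF smooth_monom])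
  show ?thesis
  proof (cases "i = j")
    case False
    then show ?thesis unfolding p * by (auto simp: * fun_upd_twist ac_simps)
  qed simp
qed

text \<open>Gives access to the theory of roots in one variable, along lines.\<close>

lemma polys_real_polynomial:
  assumes "p \<in> polys k" shows "real_polynomial_function p"
proof -
  obtain c where p: "p = (\<lambda>x. \<Sum>\<alpha> | sum \<alpha> UNIV \<le> k. c \<alpha> * monom_fun \<alpha> x)"
    using assms unfolding polys_altdef by blast
  have "real_polynomial_function (monom_fun \<alpha>)" for \<alpha> :: "'a \<Rightarrow> nat"
    unfolding monom_fun_def[abs_def]
    by (intro real_polynomial_function_prod real_polynomial_function_power
        real_polynomial_function.intros(1) bounded_linear_vec_nth finite)
  then show ?thesis unfolding p
    by (intro real_polynomial_function_sum finite_multi_index real_polynomial_function.intros(2,4)) simp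
qed

section \<open>Lebesgue measure on affine subspaces\<close>

text \<open>\<open>surf\<close> without its choices: the base point \<open>a\<close> and the basis
  \<open>B\<close> are arguments, so that independence of both can be stated and proved.\<close>

definition aff_lborel :: "'a::euclidean_space \<Rightarrow> 'a set \<Rightarrow> 'a measure" where
  "aff_lborel a B = distr (\<Pi>\<^sub>M b\<in>B. lborel) borel (\<lambda>c. a + (\<Sum>b\<in>B. c b *\<^sub>R b))"

section \<open>Orthonormal bases of subspaces\<close>

definition onb :: "'a::euclidean_space set \<Rightarrow> 'a set \<Rightarrow> bool" where
  "onb B W \<longleftrightarrow> pairwise orthogonal B \<and> (\<forall>b\<in>B. norm b = 1) \<and> span B = W"

lemma onb_independent: "onb B W \<Longrightarrow> independent B"
  unfolding onb_def by (intro pairwise_orthogonal_independent) auto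

lemma onb_finite: "onb B W \<Longrightarrow> finite B"
  using onb_independent independent_imp_finite by blast

lemma onb_card: "onb B W \<Longrightarrow> card B = dim W"
  using onb_independent dim_span_eq_card_independent onb_def by metis

lemma onb_inner: "onb B W \<Longrightarrow> b \<in> B \<Longrightarrow> c \<in> B \<Longrightarrow> b \<bullet> c = (if b = c then 1 else 0)"
  unfolding onb_def pairwise_def orthogonal_def by (auto simp: norm_eq_1)

lemma onb_inner_sum:
  assumes "onb B W" "b \<in> B" shows "(\<Sum>b\<in>B. c b *\<^sub>R b) \<bullet> b = c b"
proof -
  have "(\<Sum>b\<in>B. c b *\<^sub>R b) \<bullet> b = (\<Sum>b'\<in>B. if b' = b then c b else 0)"
    unfolding inner_sum_left using assms by (intro sum.cong) (auto simp: onb_inner)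
  then show ?thesis using assms(2) onb_finite[OF assms(1)] by simp
qed

lemma onb_exists: "subspace W \<Longrightarrow> \<exists>B. onb B W"
  unfolding onb_def by (metis orthonormal_basis_subspace)

lemma onb_expand:
  assumes "onb B W" "x \<in> W" shows "x = (\<Sum>b\<in>B. (x \<bullet> b) *\<^sub>R b)"
proof -
  have "x \<in> span B" using assms unfolding onb_def by simp
  then obtain c where c: "x = (\<Sum>b\<in>B. c b *\<^sub>R b)"
    using span_finite[OF onb_finite[OF assms(1)]] by auto
  show ?thesis
    by (subst (1) c, rule sum.cong) (auto simp: c onb_inner_sum[OF assms(1)])
qed

lemma onb_insert:
  assumes "onb B W" "norm \<nu> = 1" "\<And>x. x \<in> W \<Longrightarrow> \<nu> \<bullet> x = 0"
  shows "onb (insert \<nu> B) (span (insert \<nu> W))" "\<nu> \<notin> B"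
proof -
  have "b \<in> W" if "b \<in> B" for b using assms(1) that span_base unfolding onb_def by blast
  then have *: "\<nu> \<bullet> b = 0" if "b \<in> B" for b using assms(3) that by blast
  then show "\<nu> \<notin> B" using assms(2) by (auto simp: norm_eq_1)
  have "span (insert \<nu> B) = span (insert \<nu> W)"
    using assms(1) unfolding onb_def by (auto simp: span_insert span_span)
  then show "onb (insert \<nu> B) (span (insert \<nu> W))"
    using assms * unfolding onb_def
    by (auto simp: pairwise_insert orthogonal_def inner_commute)
qed

lemma measurable_aff_map [measurable]:
  fixes a :: "'a::euclidean_space"
  shows "(\<lambda>c. a + (\<Sum>b\<in>B. c b *\<^sub>R b)) \<in> (\<Pi>\<^sub>M b\<in>B. lborel) \<rightarrow>\<^sub>M borel"
proof (intro borel_measurable_add measurable_const borel_measurable_sum borel_measurable_scaleR)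
  fix b assume "b \<in> B"
  then show "(\<lambda>c. c b) \<in> borel_measurable (\<Pi>\<^sub>M b\<in>B. lborel)"
    using measurable_component_singleton[of b B "\<lambda>_. lborel :: real measure"] by simp
qed simp_all

lemma sets_aff_lborel [simp, measurable_cong]: "sets (aff_lborel a B) = sets borel"
  and space_aff_lborel [simp]: "space (aff_lborel a B) = UNIV"
  by (simp_all add: aff_lborel_def)

text \<open>The measure is the image under a map into \<open>a + span B\<close>, hence integrands
  matter only there. This lets membership in the subspace be assumed pointwise under the
  integral.\<close>

lemma aff_lborel_cong:
  assumes "\<And>x. x - a \<in> span B \<Longrightarrow> f x = g x"
    "f \<in> borel_measurable borel" "g \<in> borel_measurable borel"
  shows "(\<integral>\<^sup>+x. f x \<partial>aff_lborel a B) = (\<integral>\<^sup>+x. g x \<partial>aff_lborel a B)"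
proof -
  have "a + (\<Sum>b\<in>B. c b *\<^sub>R b) - a \<in> span B" for c
    by (simp add: span_sum span_scale span_base)
  then show ?thesis
    unfolding aff_lborel_def using assms by (simp add: nn_integral_distr)
qed

lemma AE_aff_lborel:
  assumes "\<And>x. x - a \<in> span B \<Longrightarrow> P x" "Measurable.pred borel P"
  shows "AE x in aff_lborel a B. P x"
proof -
  have "a + (\<Sum>b\<in>B. c b *\<^sub>R b) - a \<in> span B" for c
    by (simp add: span_sum span_scale span_base)
  then show ?thesis
    unfolding aff_lborel_def using assms by (subst AE_distr_iff) (auto simp: pred_def)
qed

lemma nn_integral_aff_lborel_empty:
  assumes "f \<in> borel_measurable borel"
  shows "(\<integral>\<^sup>+x. f x \<partial>aff_lborel a {}) = f a"
proof -
  interpret product_sigma_finite "\<lambda>_. lborel :: real measure" ..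
  have [simp]: "(\<lambda>c. a) \<in> Pi\<^sub>M {} (\<lambda>_. lborel :: real measure) \<rightarrow>\<^sub>M borel" by simp
  show ?thesis
    using assms unfolding aff_lborel_def by (simp add: nn_integral_distr PiM_empty nn_integral_count_space_finite space_PiM_empty)
qed

text \<open>Tonelli's theorem for the product of the coordinate measures: one coordinate is
  integrated separately. It drives the inductions over the basis and the integration along
  fibres.\<close>

lemma nn_integral_aff_lborel_insert:
  assumes "finite B" "b \<notin> B" and [measurable]: "f \<in> borel_measurable borel"
  shows "(\<integral>\<^sup>+x. f x \<partial>aff_lborel a (insert b B)) = (\<integral>\<^sup>+x. (\<integral>\<^sup>+t. f (x + t *\<^sub>R b) \<partial>lborel) \<partial>aff_lborel a B)"
proof -
  interpret product_sigma_finite "\<lambda>_. lborel :: real measure" ..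
  have "(\<integral>\<^sup>+x. f x \<partial>aff_lborel a (insert b B)) =
      (\<integral>\<^sup>+c. f (a + (\<Sum>b\<in>insert b B. c b *\<^sub>R b)) \<partial>(\<Pi>\<^sub>M b\<in>insert b B. lborel))"
    unfolding aff_lborel_def by (subst nn_integral_distr) auto
  also have "\<dots> = (\<integral>\<^sup>+c. (\<integral>\<^sup>+t. f (a + (\<Sum>b'\<in>insert b B. (c(b := t)) b' *\<^sub>R b')) \<partial>lborel) \<partial>(\<Pi>\<^sub>M b\<in>B. lborel))"
    using assms by (intro product_nn_integral_insert) auto
  also have "\<dots> = (\<integral>\<^sup>+c. (\<integral>\<^sup>+t. f (a + (\<Sum>b\<in>B. c b *\<^sub>R b) + t *\<^sub>R b) \<partial>lborel) \<partial>(\<Pi>\<^sub>M b\<in>B. lborel))"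
  proof (intro nn_integral_cong arg_cong[of _ _ f])
    fix c t
    have "(\<Sum>b'\<in>B. (c(b := t)) b' *\<^sub>R b') = (\<Sum>b\<in>B. c b *\<^sub>R b)"
      using assms by (intro sum.cong) auto
    then show "a + (\<Sum>b'\<in>insert b B. (c(b := t)) b' *\<^sub>R b') = a + (\<Sum>b\<in>B. c b *\<^sub>R b) + t *\<^sub>R b"
      using assms by (simp add: ac_simps)
  qed
  also have "\<dots> = (\<integral>\<^sup>+x. (\<integral>\<^sup>+t. f (x + t *\<^sub>R b) \<partial>lborel) \<partial>aff_lborel a B)"
    unfolding aff_lborel_def by (subst nn_integral_distr) auto
  finally show ?thesis .
qed

text \<open>Coordinate by coordinate this is the translation invariance of \<open>lborel\<close> on
  the real line; an element of \<open>span B\<close> shifts each coordinate by a constant.\<close>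

lemma nn_integral_aff_lborel_translate:
  assumes "finite B" "y \<in> span B" "f \<in> borel_measurable borel"
  shows "(\<integral>\<^sup>+x. f (x + y) \<partial>aff_lborel a B) = (\<integral>\<^sup>+x. f x \<partial>aff_lborel a B)"
proof -
  have "(\<integral>\<^sup>+x. f (x + (\<Sum>b\<in>B. d b *\<^sub>R b)) \<partial>aff_lborel a B) = (\<integral>\<^sup>+x. f x \<partial>aff_lborel a B)" for d
    using assms(1,3)
  proof (induction B arbitrary: f rule: finite_induct)
    case (insert b B)
    note [measurable] = insert.prems
    have shift: "(\<integral>\<^sup>+t. f (x + t *\<^sub>R b + d b *\<^sub>R b) \<partial>lborel) = (\<integral>\<^sup>+t. f (x + t *\<^sub>R b) \<partial>lborel)" for x
      using nn_integral_real_affine[of "\<lambda>t. f (x + t *\<^sub>R b)" 1 "d b"]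
      by (simp add: scaleR_left_distrib ac_simps)
    have "(\<integral>\<^sup>+x. f (x + (\<Sum>b\<in>insert b B. d b *\<^sub>R b)) \<partial>aff_lborel a (insert b B))
        = (\<integral>\<^sup>+x. (\<integral>\<^sup>+t. f (x + (\<Sum>b\<in>B. d b *\<^sub>R b) + t *\<^sub>R b + d b *\<^sub>R b) \<partial>lborel) \<partial>aff_lborel a B)"
      using insert.hyps by (subst nn_integral_aff_lborel_insert) (auto simp: ac_simps)
    also have "\<dots> = (\<integral>\<^sup>+x. (\<integral>\<^sup>+t. f (x + t *\<^sub>R b) \<partial>lborel) \<partial>aff_lborel a B)"
      unfolding shift by (rule insert.IH[of "\<lambda>x. \<integral>\<^sup>+t. f (x + t *\<^sub>R b) \<partial>lborel"]) simp
    also have "\<dots> = (\<integral>\<^sup>+x. f x \<partial>aff_lborel a (insert b B))"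
      using insert.hyps by (subst nn_integral_aff_lborel_insert) auto
    finally show ?case .
  qed simp
  moreover obtain d where "y = (\<Sum>b\<in>B. d b *\<^sub>R b)"
    using assms(2) span_finite[OF assms(1)] by auto
  ultimately show ?thesis by simp
qed

lemma nn_integral_aff_lborel_base:
  assumes [measurable]: "f \<in> borel_measurable borel"
  shows "(\<integral>\<^sup>+x. f x \<partial>aff_lborel (a + a') B) = (\<integral>\<^sup>+x. f (x + a') \<partial>aff_lborel a B)"
  unfolding aff_lborel_def by (simp add: nn_integral_distr ac_simps)

lemma aff_lborel_eqI:
  assumes "\<And>f :: 'a::euclidean_space \<Rightarrow> ennreal. f \<in> borel_measurable borel \<Longrightarrow> (\<integral>\<^sup>+x. f x \<partial>M) = (\<integral>\<^sup>+x. f x \<partial>N)"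
    "sets M = sets borel" "sets N = sets borel"
  shows "M = N"
proof (rule measure_eqI)
  fix A assume "A \<in> sets M"
  then have "A \<in> sets borel" using assms by simp
  then show "emeasure M A = emeasure N A"
    using assms(1)[of "indicator A"] assms(2,3) by (simp add: nn_integral_indicator)
qed (use assms in simp)

lemma aff_lborel_base:
  assumes "finite B" "a - a' \<in> span B" shows "aff_lborel a B = aff_lborel a' B"
  using nn_integral_aff_lborel_base[of _ a' "a - a'" B] nn_integral_aff_lborel_translate[OF assms]
  by (intro aff_lborel_eqI) auto

lemma lborel_eq_aff_lborel: "lborel = aff_lborel 0 Basis"
  unfolding aff_lborel_def by (subst lborel_eq) simp

lemma emeasure_PiM_box:
  assumes "finite B" "r \<ge> 0"
  shows "emeasure (\<Pi>\<^sub>M b\<in>B. lborel :: real measure) (\<Pi>\<^sub>E b\<in>B. {-r..r}) = ennreal ((2 * r) ^ card B)"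
proof -
  interpret product_sigma_finite "\<lambda>_. lborel :: real measure" ..
  have "emeasure (\<Pi>\<^sub>M b\<in>B. lborel :: real measure) (\<Pi>\<^sub>E b\<in>B. {-r..r}) = (\<Prod>b\<in>B. emeasure lborel {-r..r})"
    using assms by (intro emeasure_PiM) auto
  also have "\<dots> = ennreal ((2 * r) ^ card B)"
    using assms by (simp add: ennreal_power)
  finally show ?thesis .
qed

text \<open>In coordinates a ball lies between two cubes: a small one is inside by the triangle
  inequality, and a large one contains it because each coordinate is an inner product with a unit
  vector.\<close>

lemma emeasure_aff_lborel_ball:
  assumes "onb B W" "r > 0"
  shows "emeasure (aff_lborel a B) (ball a r) > 0" "emeasure (aff_lborel a B) (cball a r) < \<infinity>"
proof -
  have fin: "finite B" using assms onb_finite by blast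
  let ?F = "\<lambda>c. a + (\<Sum>b\<in>B. c b *\<^sub>R b)"
  let ?M = "\<Pi>\<^sub>M b\<in>B. lborel :: real measure"
  have box: "(\<Pi>\<^sub>E b\<in>B. {-s..s}) \<in> sets ?M" for s :: real
    by (intro sets_PiM_I_finite fin) auto
  \<comment> \<open>The triangle inequality sums \<open>card B\<close> coordinates of size at most
    \<open>s\<close>; dividing by \<open>card B + 1\<close> keeps the sum strictly below
    \<open>r\<close>, also for the empty basis.\<close>
  define s where "s = r / (card B + 1)"
  have "s > 0" using assms by (simp add: s_def)
  have "?F c \<in> ball a r" if c: "c \<in> (\<Pi>\<^sub>E b\<in>B. {-s..s})" for c
  proof -
    have "norm (\<Sum>b\<in>B. c b *\<^sub>R b) \<le> (\<Sum>b\<in>B. norm (c b *\<^sub>R b))" by (rule norm_sum)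
    also have "\<dots> \<le> (\<Sum>b\<in>B. s)"
      using c assms(1) unfolding onb_def by (intro sum_mono) (force simp: PiE_iff)
    also have "\<dots> < r" using assms by (simp add: s_def field_simps)
    finally show ?thesis by (simp add: dist_norm norm_minus_commute)
  qed
  then have "emeasure ?M (\<Pi>\<^sub>E b\<in>B. {-s..s}) \<le> emeasure ?M (?F -` ball a r \<inter> space ?M)"
    by (intro emeasure_mono measurable_sets[OF measurable_aff_map]) (auto simp: space_PiM PiE_iff extensional_def)
  then have "ennreal ((2 * s) ^ card B) \<le> emeasure (aff_lborel a B) (ball a r)"
    using \<open>s > 0\<close> fin by (simp add: emeasure_PiM_box aff_lborel_def emeasure_distr)
  moreover have "0 < ennreal ((2 * s) ^ card B)" using \<open>s > 0\<close> by simp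
  ultimately show "emeasure (aff_lborel a B) (ball a r) > 0" by (rule less_le_trans[rotated])
  have "c \<in> (\<Pi>\<^sub>E b\<in>B. {-r..r})" if c: "?F c \<in> cball a r" "c \<in> space ?M" for c
  proof -
    have "norm (\<Sum>b\<in>B. c b *\<^sub>R b) \<le> r" using c by (simp add: dist_norm)
    have "\<bar>c b\<bar> \<le> r" if "b \<in> B" for b
    proof -
      have "\<bar>c b\<bar> = \<bar>(\<Sum>b\<in>B. c b *\<^sub>R b) \<bullet> b\<bar>" using onb_inner_sum[OF assms(1) that] by simp
      also have "\<dots> \<le> norm (\<Sum>b\<in>B. c b *\<^sub>R b) * norm b" by (rule Cauchy_Schwarz_ineq2)
      also have "\<dots> \<le> r" using \<open>norm _ \<le> r\<close> assms(1) that unfolding onb_def by simp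
      finally show ?thesis .
    qed
    then show ?thesis using c by (auto simp: space_PiM PiE_iff abs_le_iff minus_le_iff)
  qed
  then have "?F -` cball a r \<inter> space ?M \<subseteq> (\<Pi>\<^sub>E b\<in>B. {-r..r})" by blast
  then have "emeasure ?M (?F -` cball a r \<inter> space ?M) \<le> emeasure ?M (\<Pi>\<^sub>E b\<in>B. {-r..r})"
    by (rule emeasure_mono[OF _ box])
  then have "emeasure (aff_lborel a B) (cball a r) \<le> ennreal ((2 * r) ^ card B)"
    using assms fin by (simp add: emeasure_PiM_box aff_lborel_def emeasure_distr)
  then show "emeasure (aff_lborel a B) (cball a r) < \<infinity>"
    using order.strict_trans1[OF _ ennreal_less_top] by simp
qed

lemma sigma_finite_aff_lborel:
  assumes "onb B W" shows "sigma_finite_measure (aff_lborel a B)"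
proof
  show "\<exists>A. countable A \<and> A \<subseteq> sets (aff_lborel a B) \<and> \<Union> A = space (aff_lborel a B) \<and>
        (\<forall>x\<in>A. emeasure (aff_lborel a B) x \<noteq> \<infinity>)"
  proof (intro exI conjI)
    let ?A = "range (\<lambda>n. cball a (real (Suc n)))"
    show "\<forall>x\<in>?A. emeasure (aff_lborel a B) x \<noteq> \<infinity>"
    proof safe
      fix n assume "emeasure (aff_lborel a B) (cball a (real (Suc n))) = \<infinity>"
      then show False using emeasure_aff_lborel_ball(2)[OF assms, of "real (Suc n)" a] by simp
    qed
    have "\<exists>n. dist a x \<le> real (Suc n)" for x
    proof -
      obtain n where "dist a x \<le> real n" using real_arch_simple by blast
      then show ?thesis by (intro exI[of _ n]) simp
    qed
    then show "\<Union> ?A = space (aff_lborel a B)" by auto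
  qed auto
qed

text \<open>The integral of \<open>h (norm x ^ 2)\<close> over an \<open>n\<close>-dimensional
  space, with the coordinates integrated out one at a time. Its point is that it depends on
  \<open>n\<close> only and not on a basis.\<close>

primrec radial_int :: "nat \<Rightarrow> (real \<Rightarrow> ennreal) \<Rightarrow> ennreal" where
  "radial_int 0 h = h 0"
| "radial_int (Suc n) h = radial_int n (\<lambda>r. \<integral>\<^sup>+t. h (r + t\<^sup>2) \<partial>lborel)"

text \<open>Pythagoras: a coordinate \<open>t\<close> in a new orthonormal direction adds
  \<open>t^2\<close> to the squared norm, which is one step of the recursion.\<close>

lemma nn_integral_aff_lborel_radial:
  assumes "finite B" "pairwise orthogonal B" "\<forall>b\<in>B. norm b = 1" "h \<in> borel_measurable borel"
  shows "(\<integral>\<^sup>+x. h ((norm x)\<^sup>2) \<partial>aff_lborel 0 B) = radial_int (card B) h"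
  using assms
proof (induction B arbitrary: h rule: finite_induct)
  case empty
  then show ?case by (simp add: nn_integral_aff_lborel_empty)
next
  case (insert b B)
  note [measurable] = insert.prems(3)
  have orth: "x \<bullet> b = 0" if "x \<in> span B" for x
    using that insert.prems(1) insert.hyps
    by (induction x rule: span_induct_alt) (auto simp: inner_add_left pairwise_insert orthogonal_def)
  have "(\<integral>\<^sup>+x. h ((norm x)\<^sup>2) \<partial>aff_lborel 0 (insert b B))
      = (\<integral>\<^sup>+x. (\<integral>\<^sup>+t. h ((norm (x + t *\<^sub>R b))\<^sup>2) \<partial>lborel) \<partial>aff_lborel 0 B)"
    using insert.hyps by (subst nn_integral_aff_lborel_insert) auto
  also have "\<dots> = (\<integral>\<^sup>+x. (\<integral>\<^sup>+t. h ((norm x)\<^sup>2 + t\<^sup>2) \<partial>lborel) \<partial>aff_lborel 0 B)"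
  proof (rule aff_lborel_cong)
    fix x assume "x - 0 \<in> span B"
    then have "(norm (x + t *\<^sub>R b))\<^sup>2 = (norm x)\<^sup>2 + t\<^sup>2" for t
      using orth[of x] insert.prems(2)
      unfolding power2_norm_eq_inner
      by (auto simp: inner_add_left inner_add_right inner_commute power2_eq_square norm_eq_1)
    then show "(\<integral>\<^sup>+t. h ((norm (x + t *\<^sub>R b))\<^sup>2) \<partial>lborel) = (\<integral>\<^sup>+t. h ((norm x)\<^sup>2 + t\<^sup>2) \<partial>lborel)"
      by simp
  qed auto
  also have "\<dots> = radial_int (card B) (\<lambda>r. \<integral>\<^sup>+t. h (r + t\<^sup>2) \<partial>lborel)"
    using insert.prems by (intro insert.IH) (auto simp: pairwise_insert)
  finally show ?case using insert.hyps by simp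
qed

text \<open>The standard argument for uniqueness of Haar measure; the unit ball, whose mass depends on
  the dimension only, fixes the normalisation.\<close>
lemma aff_lborel_unique:
  assumes "onb B W" "onb B' W" shows "aff_lborel a B = aff_lborel a B'"
proof -
  let ?M = "aff_lborel 0 B" and ?N = "aff_lborel 0 B'"
  have fin: "finite B" "finite B'" and span: "span B = W" "span B' = W"
    using assms onb_finite unfolding onb_def by blast+
  interpret M: sigma_finite_measure ?M by (rule sigma_finite_aff_lborel[OF assms(1)])
  interpret N: sigma_finite_measure ?N by (rule sigma_finite_aff_lborel[OF assms(2)])
  interpret P: pair_sigma_finite ?M ?N ..
  define g :: "'a \<Rightarrow> ennreal" where "g = indicator (ball 0 1)"
  have gm [measurable]: "g \<in> borel_measurable borel" unfolding g_def by (intro borel_measurable_indicator) simp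
  have trM: "(\<integral>\<^sup>+x. f (x + y) \<partial>?M) = (\<integral>\<^sup>+x. f x \<partial>?M)" if "y \<in> W" "f \<in> borel_measurable borel" for f :: "'a \<Rightarrow> ennreal" and y
    using nn_integral_aff_lborel_translate fin span that by blast
  have trN: "(\<integral>\<^sup>+x. f (x + y) \<partial>?N) = (\<integral>\<^sup>+x. f x \<partial>?N)" if "y \<in> W" "f \<in> borel_measurable borel" for f :: "'a \<Rightarrow> ennreal" and y
    using nn_integral_aff_lborel_translate fin span that by blast
  have W: "subspace W" using span subspace_span by blast
  have hm [measurable]: "(\<lambda>r. indicator {..<1} r) \<in> borel_measurable (borel :: real measure)" by simp
  have g_eq: "g x = indicator {..<1} ((norm x)\<^sup>2)" for x
    by (auto simp: g_def indicator_def power_less_one_iff)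
  have ball_eq: "(\<integral>\<^sup>+x. g x \<partial>?M) = (\<integral>\<^sup>+x. g x \<partial>?N)"
    unfolding g_eq using assms fin onb_card[OF assms(1)] onb_card[OF assms(2)]
    unfolding onb_def by (simp add: nn_integral_aff_lborel_radial[where h="indicator {..<1}"])
  have ball_pos: "(\<integral>\<^sup>+x. g x \<partial>?N) \<noteq> 0"
    using emeasure_aff_lborel_ball(1)[OF assms(2), of 1 0] by (simp add: g_def)
  have "emeasure ?N (ball 0 1) \<le> emeasure ?N (cball 0 1)" by (intro emeasure_mono) auto
  then have ball_fin: "(\<integral>\<^sup>+x. g x \<partial>?N) \<noteq> \<infinity>"
    using emeasure_aff_lborel_ball(2)[OF assms(2), of 1 0] by (auto simp: g_def top_unique)
  have "?M = ?N"
  proof (rule aff_lborel_eqI)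
    \<comment> \<open>The double integral of \<open>f (x + y) * g y\<close> is computed twice.
      Shifting \<open>x\<close> by \<open>y\<close> leaves the mass of \<open>g\<close> under
      \<open>?N\<close> as a factor; shifting \<open>y\<close> by \<open>x\<close> leaves the mass
      of \<open>g\<close> under \<open>?M\<close>, because \<open>g\<close> is even. The two masses
      agree by \<open>ball_eq\<close>.\<close>
    fix f :: "'a \<Rightarrow> ennreal" assume fm [measurable]: "f \<in> borel_measurable borel"
    have "(\<integral>\<^sup>+x. f x \<partial>?M) * (\<integral>\<^sup>+y. g y \<partial>?N) = (\<integral>\<^sup>+y. (\<integral>\<^sup>+x. f x \<partial>?M) * g y \<partial>?N)"
      by (simp add: nn_integral_cmult)
    also have "\<dots> = (\<integral>\<^sup>+y. (\<integral>\<^sup>+x. f (x + y) \<partial>?M) * g y \<partial>?N)"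
      by (rule aff_lborel_cong) (auto simp: span trM)
    also have "\<dots> = (\<integral>\<^sup>+y. (\<integral>\<^sup>+x. f (x + y) * g y \<partial>?M) \<partial>?N)"
      by (simp add: nn_integral_multc)
    also have "\<dots> = (\<integral>\<^sup>+x. (\<integral>\<^sup>+y. f (x + y) * g y \<partial>?N) \<partial>?M)"
      by (rule P.Fubini') measurable
    also have "\<dots> = (\<integral>\<^sup>+x. (\<integral>\<^sup>+y. f y * g (y - x) \<partial>?N) \<partial>?M)"
    proof (rule aff_lborel_cong)
      fix x assume "x - 0 \<in> span B"
      then show "(\<integral>\<^sup>+y. f (x + y) * g y \<partial>?N) = (\<integral>\<^sup>+y. f y * g (y - x) \<partial>?N)"
        using trN[of x "\<lambda>y. f y * g (y - x)"] by (simp add: span ac_simps)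
    qed auto
    also have "\<dots> = (\<integral>\<^sup>+y. (\<integral>\<^sup>+x. f y * g (y - x) \<partial>?M) \<partial>?N)"
      by (rule P.Fubini'[symmetric]) measurable
    also have "\<dots> = (\<integral>\<^sup>+y. f y * (\<integral>\<^sup>+x. g (x - y) \<partial>?M) \<partial>?N)"
      by (simp add: nn_integral_cmult g_def indicator_def dist_norm norm_minus_commute)
    also have "\<dots> = (\<integral>\<^sup>+y. f y * (\<integral>\<^sup>+x. g x \<partial>?M) \<partial>?N)"
    proof (rule aff_lborel_cong)
      fix y assume "y - 0 \<in> span B'"
      then have "- y \<in> W" using W by (simp add: span subspace_neg)
      then show "f y * (\<integral>\<^sup>+x. g (x - y) \<partial>?M) = f y * (\<integral>\<^sup>+x. g x \<partial>?M)"
        using trM[of "- y" g] by simp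
    qed auto
    also have "\<dots> = (\<integral>\<^sup>+x. f x \<partial>?N) * (\<integral>\<^sup>+y. g y \<partial>?N)"
      by (simp add: nn_integral_multc ball_eq)
    finally have "(\<integral>\<^sup>+x. f x \<partial>?M) * (\<integral>\<^sup>+y. g y \<partial>?N) = (\<integral>\<^sup>+x. f x \<partial>?N) * (\<integral>\<^sup>+y. g y \<partial>?N)" .
    then show "(\<integral>\<^sup>+x. f x \<partial>?M) = (\<integral>\<^sup>+x. f x \<partial>?N)"
      using ball_pos ball_fin ennreal_mult_cancel_left[of "\<integral>\<^sup>+y. g y \<partial>?N"] by (simp add: mult.commute)
  qed auto
  then show ?thesis
    using nn_integral_aff_lborel_base[of _ 0 a B] nn_integral_aff_lborel_base[of _ 0 a B']
    by (intro aff_lborel_eqI) auto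
qed

text \<open>The vector \<open>e\<close> is its normal part
  \<open>(e \<bullet> \<nu>) *\<^sub>R \<nu>\<close> plus a vector of \<open>W\<close>. Rescaling
  the normal coordinate gives the factor \<open>\<bar>e \<bullet> \<nu>\<bar>\<close>; the remaining
  shear is, for each fixed \<open>s\<close>, a translation within \<open>W\<close> and does not
  change the integral.\<close>

lemma nn_integral_aff_lborel_oblique:
  assumes B: "onb B W" "\<nu> \<notin> B" "e - (e \<bullet> \<nu>) *\<^sub>R \<nu> \<in> W" "e \<bullet> \<nu> \<noteq> 0"
    and [measurable]: "f \<in> borel_measurable borel"
  shows "(\<integral>\<^sup>+x. f x \<partial>aff_lborel a (insert \<nu> B)) =
    ennreal \<bar>e \<bullet> \<nu>\<bar> * (\<integral>\<^sup>+x. (\<integral>\<^sup>+s. f (x + s *\<^sub>R e) \<partial>lborel) \<partial>aff_lborel a B)"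
proof -
  interpret M: sigma_finite_measure "aff_lborel a B" by (rule sigma_finite_aff_lborel[OF B(1)])
  interpret P: pair_sigma_finite "aff_lborel a B" "lborel :: real measure" ..
  define w where "w = e - (e \<bullet> \<nu>) *\<^sub>R \<nu>"
  have span: "span B = W" and W: "subspace W" using B unfolding onb_def by auto
  have "(\<integral>\<^sup>+x. f x \<partial>aff_lborel a (insert \<nu> B)) = (\<integral>\<^sup>+x. (\<integral>\<^sup>+t. f (x + t *\<^sub>R \<nu>) \<partial>lborel) \<partial>aff_lborel a B)"
    using onb_finite[OF B(1)] B(2) by (intro nn_integral_aff_lborel_insert) auto
  also have "\<dots> = (\<integral>\<^sup>+x. ennreal \<bar>e \<bullet> \<nu>\<bar> * (\<integral>\<^sup>+s. f (x + (s * (e \<bullet> \<nu>)) *\<^sub>R \<nu>) \<partial>lborel) \<partial>aff_lborel a B)"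
    by (subst nn_integral_real_affine[where c="e \<bullet> \<nu>" and t=0]) (use B(4) in \<open>auto simp: mult.commute\<close>)
  also have "\<dots> = ennreal \<bar>e \<bullet> \<nu>\<bar> * (\<integral>\<^sup>+x. (\<integral>\<^sup>+s. f (x + (s * (e \<bullet> \<nu>)) *\<^sub>R \<nu>) \<partial>lborel) \<partial>aff_lborel a B)"
    by (rule nn_integral_cmult) simp
  also have "(\<integral>\<^sup>+x. (\<integral>\<^sup>+s. f (x + (s * (e \<bullet> \<nu>)) *\<^sub>R \<nu>) \<partial>lborel) \<partial>aff_lborel a B) =
      (\<integral>\<^sup>+s. (\<integral>\<^sup>+x. f (x + (s * (e \<bullet> \<nu>)) *\<^sub>R \<nu>) \<partial>aff_lborel a B) \<partial>lborel)"
    by (rule P.Fubini'[symmetric]) measurable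
  also have "\<dots> = (\<integral>\<^sup>+s. (\<integral>\<^sup>+x. f (x + s *\<^sub>R e) \<partial>aff_lborel a B) \<partial>lborel)"
  proof (rule nn_integral_cong)
    fix s
    have "s *\<^sub>R w \<in> span B" using B(3) W span by (simp add: w_def subspace_scale)
    from nn_integral_aff_lborel_translate[OF onb_finite[OF B(1)] this, of "\<lambda>x. f (x + (s * (e \<bullet> \<nu>)) *\<^sub>R \<nu>)" a]
    show "(\<integral>\<^sup>+x. f (x + (s * (e \<bullet> \<nu>)) *\<^sub>R \<nu>) \<partial>aff_lborel a B) = (\<integral>\<^sup>+x. f (x + s *\<^sub>R e) \<partial>aff_lborel a B)"
      by (simp add: w_def scaleR_diff_right ac_simps)
  qed
  also have "\<dots> = (\<integral>\<^sup>+x. (\<integral>\<^sup>+s. f (x + s *\<^sub>R e) \<partial>lborel) \<partial>aff_lborel a B)"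
    by (rule P.Fubini') measurable
  finally show ?thesis .
qed

text \<open>The formula for nonnegative functions is first read as an identity of measures, a
  density on the image of a product measure; Fubini for integrable functions then applies.\<close>

lemma integral_aff_lborel_oblique:
  fixes f :: "'a::euclidean_space \<Rightarrow> real"
  assumes B: "onb B W" "\<nu> \<notin> B" "e - (e \<bullet> \<nu>) *\<^sub>R \<nu> \<in> W" "e \<bullet> \<nu> \<noteq> 0"
    and f: "integrable (aff_lborel a (insert \<nu> B)) f"
  shows "(\<integral>x. f x \<partial>aff_lborel a (insert \<nu> B)) =
    \<bar>e \<bullet> \<nu>\<bar> * (\<integral>x. (\<integral>s. f (x + s *\<^sub>R e) \<partial>lborel) \<partial>aff_lborel a B)"
proof -
  interpret M: sigma_finite_measure "aff_lborel a B" by (rule sigma_finite_aff_lborel[OF B(1)])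
  interpret P: pair_sigma_finite "aff_lborel a B" "lborel :: real measure" ..
  let ?D = "distr (aff_lborel a B \<Otimes>\<^sub>M lborel) borel (\<lambda>(x, s). x + s *\<^sub>R e)"
  have eq: "aff_lborel a (insert \<nu> B) = density ?D (\<lambda>_. ennreal \<bar>e \<bullet> \<nu>\<bar>)"
  proof (rule aff_lborel_eqI)
    fix f :: "'a \<Rightarrow> ennreal" assume [measurable]: "f \<in> borel_measurable borel"
    show "(\<integral>\<^sup>+x. f x \<partial>aff_lborel a (insert \<nu> B)) = (\<integral>\<^sup>+x. f x \<partial>density ?D (\<lambda>_. ennreal \<bar>e \<bullet> \<nu>\<bar>))"
      using nn_integral_aff_lborel_oblique[OF B, of f a]
      by (simp add: nn_integral_density nn_integral_distr nn_integral_cmult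
          lborel.nn_integral_fst[symmetric] split_beta')
  qed auto
  have fm [measurable]: "f \<in> borel_measurable borel" using borel_measurable_integrable[OF f] by simp
  have "integrable ?D (\<lambda>x. \<bar>e \<bullet> \<nu>\<bar> *\<^sub>R f x)"
    using f unfolding eq by (subst (asm) integrable_density) auto
  then have "integrable ?D f" using B(4) by simp
  then have int: "integrable (aff_lborel a B \<Otimes>\<^sub>M lborel) (\<lambda>(x, s). f (x + s *\<^sub>R e))"
    by (subst (asm) integrable_distr_eq) (auto simp: split_beta')
  have "(\<integral>x. f x \<partial>aff_lborel a (insert \<nu> B)) = (\<integral>x. \<bar>e \<bullet> \<nu>\<bar> *\<^sub>R f x \<partial>?D)"
    unfolding eq by (subst integral_density) auto
  also have "\<dots> = \<bar>e \<bullet> \<nu>\<bar> * (\<integral>z. (\<lambda>(x, s). f (x + s *\<^sub>R e)) z \<partial>(aff_lborel a B \<Otimes>\<^sub>M lborel))"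
    by (subst integral_distr) (auto simp: split_beta')
  also have "\<dots> = \<bar>e \<bullet> \<nu>\<bar> * (\<integral>x. (\<integral>s. f (x + s *\<^sub>R e) \<partial>lborel) \<partial>aff_lborel a B)"
    by (subst P.integral_fst'[OF int, symmetric]) simp
  finally show ?thesis .
qed

section \<open>Surface measures\<close>

lemma direction_space_diff: "x \<in> M \<Longrightarrow> y \<in> M \<Longrightarrow> x - y \<in> direction_space M"
  unfolding direction_space_def by (intro span_base) blast

lemma subspace_direction_space: "subspace (direction_space M)"
  unfolding direction_space_def by simp

lemma direction_space_eq_span:
  assumes "a \<in> M" shows "direction_space M = span ((\<lambda>x. x - a) ` M)"
proof
  show "direction_space M \<subseteq> span ((\<lambda>x. x - a) ` M)"
    unfolding direction_space_def
  proof (rule span_minimal)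
    show "{x - y |x y. x \<in> M \<and> y \<in> M} \<subseteq> span ((\<lambda>x. x - a) ` M)"
    proof safe
      fix x y assume "x \<in> M" "y \<in> M"
      then have "(x - a) - (y - a) \<in> span ((\<lambda>x. x - a) ` M)"
        by (intro span_diff span_base) auto
      then show "x - y \<in> span ((\<lambda>x. x - a) ` M)" by simp
    qed
  qed simp
  show "span ((\<lambda>x. x - a) ` M) \<subseteq> direction_space M"
    by (rule span_minimal) (use assms in \<open>auto intro: direction_space_diff subspace_direction_space\<close>)
qed

lemma affine_hull_iff_direction_space:
  assumes "a \<in> M" shows "z \<in> affine hull M \<longleftrightarrow> z - a \<in> direction_space M"
proof -
  have "(\<lambda>x. x - a) ` M = insert 0 {x - a |x. x \<in> M - {a}}" using assms by auto
  then have "direction_space M = span {x - a |x. x \<in> M - {a}}"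
    unfolding direction_space_eq_span[OF assms] by (simp add: span_insert_0)
  then show ?thesis
    using affine_hull_span[OF assms] by (auto simp: algebra_simps)
qed

lemma direction_space_convex_hull: "direction_space (convex hull C) = direction_space C"
proof (cases "C = {}")
  case False
  then obtain a where a: "a \<in> C" by blast
  have aff: "x - a \<in> direction_space C" if "x \<in> convex hull C" for x
    using that convex_hull_subset_affine_hull affine_hull_iff_direction_space[OF a] by blast
  show ?thesis
  proof
    show "direction_space (convex hull C) \<subseteq> direction_space C"
      unfolding direction_space_eq_span[OF hull_inc[OF a]]
      by (rule span_minimal) (auto simp: aff subspace_direction_space)
    show "direction_space C \<subseteq> direction_space (convex hull C)"
      unfolding direction_space_def using hull_subset[of C convex] by (intro span_mono) blast
  qed
qed simp

lemma tangent_basis_onb: "onb (tangent_basis M) (direction_space M)"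
  unfolding tangent_basis_def onb_def
  by (rule someI_ex) (use onb_exists[OF subspace_direction_space[of M]] in \<open>simp add: onb_def\<close>)

text \<open>Frees \<open>surf\<close> from its two choices: translation invariance changes the base
  point, uniqueness of the invariant measure changes the tangent basis. Later computations can pick
  a basis that suits their fibres.\<close>

lemma surf_eq:
  assumes "p \<in> M" "onb B (direction_space M)"
  shows "surf M = restrict_space (aff_lborel p B) M"
proof -
  let ?a = "SOME a. a \<in> M"
  have "?a \<in> M" using assms(1) by (rule someI)
  then have "?a - p \<in> span (tangent_basis M)"
    using direction_space_diff assms(1) tangent_basis_onb[of M] unfolding onb_def by blast
  then have "aff_lborel ?a (tangent_basis M) = aff_lborel p (tangent_basis M)"
    by (intro aff_lborel_base onb_finite[OF tangent_basis_onb])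
  also have "\<dots> = aff_lborel p B"
    by (rule aff_lborel_unique[OF tangent_basis_onb assms(2)])
  finally show ?thesis unfolding surf_def aff_lborel_def by simp
qed

lemma sets_surf [measurable_cong]: "sets (surf M) = sets (restrict_space borel M)"
  unfolding surf_def by (rule sets_restrict_space_cong) simp

lemma space_surf [simp]: "space (surf M) = M"
  unfolding surf_def by (simp add: space_restrict_space)

lemma integral_surf:
  fixes f :: "real^'n \<Rightarrow> real"
  assumes "p \<in> M" "onb B (direction_space M)" "M \<in> sets borel"
  shows "(\<integral>x. f x \<partial>surf M) = (\<integral>x. indicator M x * f x \<partial>aff_lborel p B)"
  unfolding surf_eq[OF assms(1,2)] using assms(3) by (simp add: integral_restrict_space)

lemma integrable_surf:
  fixes f :: "real^'n \<Rightarrow> real"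
  assumes "p \<in> M" "onb B (direction_space M)" "M \<in> sets borel"
  shows "integrable (surf M) f \<longleftrightarrow> integrable (aff_lborel p B) (\<lambda>x. indicator M x * f x)"
  unfolding surf_eq[OF assms(1,2)] using assms(3) by (simp add: integrable_restrict_space)

lemma integrable_aff_lborel_bounded:
  fixes f :: "'a::euclidean_space \<Rightarrow> real"
  assumes "onb B W" "f \<in> borel_measurable borel" "\<And>x. \<bar>f x\<bar> \<le> K" "\<And>x. x \<notin> cball a R \<Longrightarrow> f x = 0" "R > 0"
  shows "integrable (aff_lborel a B) f"
proof (rule Bochner_Integration.integrable_bound)
  show "integrable (aff_lborel a B) (\<lambda>x. K * indicator (cball a R) x)"
    using emeasure_aff_lborel_ball(2)[OF assms(1,5), of a]
    by (intro integrable_mult_right integrable_real_indicator) auto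
  show "AE x in aff_lborel a B. norm (f x) \<le> norm (K * indicator (cball a R) x)"
    using assms(3,4) by (intro AE_I2) (auto simp: indicator_def intro: order_trans[OF _ abs_ge_self])
qed (use assms in simp)

lemma finite_measure_surf:
  assumes "compact M" shows "finite_measure (surf M)"
proof (cases "M = {}")
  case True
  then show ?thesis by (intro finite_measureI) (simp add: emeasure_space)
next
  case False
  then obtain p where p: "p \<in> M" by blast
  obtain R0 where "M \<subseteq> cball p R0"
    using compact_imp_bounded[OF assms] unfolding bounded_any_center[where a=p] by (auto simp: subset_iff)
  then have R: "\<bar>R0\<bar> + 1 > 0" "M \<subseteq> cball p (\<bar>R0\<bar> + 1)" by auto
  define R where "R = \<bar>R0\<bar> + 1"
  note R = R[folded R_def]
  note * = tangent_basis_onb[of M]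
  have M: "M \<in> sets borel" using assms by (simp add: borel_compact)
  have "emeasure (surf M) M = emeasure (aff_lborel p (tangent_basis M)) M"
    unfolding surf_eq[OF p *] using M by (subst emeasure_restrict_space) auto
  also have "\<dots> \<le> emeasure (aff_lborel p (tangent_basis M)) (cball p R)"
    using R M by (intro emeasure_mono) auto
  also have "\<dots> < \<infinity>" by (rule emeasure_aff_lborel_ball(2)[OF * R(1)])
  finally show ?thesis by (intro finite_measureI) simp
qed

lemma borel_measurable_surf_continuous:
  fixes f :: "real^'n \<Rightarrow> 'b::{second_countable_topology, real_normed_vector}"
  assumes "continuous_on M f" shows "f \<in> borel_measurable (surf M)"
  using borel_measurable_continuous_on_restrict[OF assms] by (simp cong: measurable_cong_sets add: sets_surf)

lemma integrable_surf_continuous: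
  fixes f :: "real^'n \<Rightarrow> 'b::{second_countable_topology, banach}"
  assumes "compact M" "continuous_on M f" shows "integrable (surf M) f"
proof -
  interpret finite_measure "surf M" by (rule finite_measure_surf[OF assms(1)])
  have "bounded (f ` M)" using assms compact_continuous_image compact_imp_bounded by blast
  then obtain K where "\<And>x. x \<in> M \<Longrightarrow> norm (f x) \<le> K" unfolding bounded_iff by auto
  then show ?thesis
    by (intro integrable_const_bound[of f K] AE_I2 borel_measurable_surf_continuous assms) auto
qed

section \<open>Barycentric coordinates and the divergence theorem on a simplex\<close>

text \<open>\<open>w c\<close> is the gradient of the barycentric coordinate of \<open>c\<close>
  within the affine hull. It is the component of \<open>c - a0\<close> orthogonal to the opposite
  side, nonzero by affine independence, divided by its squared length so that \<open>c\<close> gets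
  height one in this scaling. Its norm is thus the reciprocal of the geometric height.\<close>

lemma simplex_heights:
  fixes C :: "(real^'n) set"
  assumes C: "\<not> affine_dependent C" "card C \<ge> 2"
  obtains w where "\<And>c. c \<in> C \<Longrightarrow> w c \<in> direction_space C"
    "\<And>c a b. c \<in> C \<Longrightarrow> a \<in> C - {c} \<Longrightarrow> b \<in> C - {c} \<Longrightarrow> w c \<bullet> (a - b) = 0"
    "\<And>c a. c \<in> C \<Longrightarrow> a \<in> C - {c} \<Longrightarrow> w c \<bullet> (c - a) = 1"
proof -
  have "\<exists>w. w \<in> direction_space C \<and> (\<forall>a\<in>C - {c}. \<forall>b\<in>C - {c}. w \<bullet> (a - b) = 0) \<and>
      (\<forall>a\<in>C - {c}. w \<bullet> (c - a) = 1)" if c: "c \<in> C" for c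
  proof -
    have "\<not> C \<subseteq> {c}"
      using C(2) card_mono[of "{c}" C] by auto
    then obtain a0 where a0: "a0 \<in> C - {c}" by blast
    let ?U = "direction_space (C - {c})"
    have nU: "c - a0 \<notin> ?U"
      using affine_hull_iff_direction_space[OF a0] C(1) c unfolding affine_dependent_def by blast
    obtain y z where yz: "y \<in> span ?U" "\<And>v. v \<in> span ?U \<Longrightarrow> orthogonal z v" "c - a0 = y + z"
      using orthogonal_subspace_decomp_exists[of ?U "c - a0"] by blast
    have span: "span ?U = ?U" by (simp add: subspace_direction_space span_eq_iff)
    have z0: "z \<noteq> 0" using yz nU span by auto
    have "?U \<subseteq> direction_space C" unfolding direction_space_def by (intro span_mono) blast
    then have "y \<in> direction_space C" using yz span by blast
    moreover have "c - a0 \<in> direction_space C" using a0 c by (intro direction_space_diff) auto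
    ultimately have zC: "z \<in> direction_space C"
      using yz(3) subspace_diff[OF subspace_direction_space] by (metis add_diff_cancel_left')
    have orth: "z \<bullet> (a - b) = 0" if "a \<in> C - {c}" "b \<in> C - {c}" for a b
      using yz(2) span direction_space_diff[OF that] unfolding orthogonal_def by blast
    have "z \<bullet> (c - a0) = z \<bullet> z"
      using yz unfolding orthogonal_def by (simp add: inner_add_right)
    then have "z \<bullet> (c - a) = z \<bullet> z" if "a \<in> C - {c}" for a
      using orth[OF that a0] by (simp add: inner_diff_right)
    then show ?thesis
      using z0 zC orth
      by (intro exI[of _ "z /\<^sub>R (z \<bullet> z)"]) (auto intro: subspace_scale subspace_direction_space)
  qed
  then obtain w where "\<forall>c\<in>C. w c \<in> direction_space C \<and> (\<forall>a\<in>C - {c}. \<forall>b\<in>C - {c}. w c \<bullet> (a - b) = 0) \<and>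
      (\<forall>a\<in>C - {c}. w c \<bullet> (c - a) = 1)" by metis
  then show thesis by (intro that[of w]) blast+
qed

text \<open>A simplex within any affine subspace, so that one divergence theorem serves the cell and
  its faces. The bound on \<open>card C\<close> keeps every side nonempty.\<close>

locale simplex_coords =
  fixes C :: "(real^'n) set" and w :: "real^'n \<Rightarrow> real^'n"
  assumes indep: "\<not> affine_dependent C" and card: "card C \<ge> 2"
    and w_dir: "\<And>c. c \<in> C \<Longrightarrow> w c \<in> direction_space C"
    and w_orth: "\<And>c a b. c \<in> C \<Longrightarrow> a \<in> C - {c} \<Longrightarrow> b \<in> C - {c} \<Longrightarrow> w c \<bullet> (a - b) = 0"
    and w_height: "\<And>c a. c \<in> C \<Longrightarrow> a \<in> C - {c} \<Longrightarrow> w c \<bullet> (c - a) = 1"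
begin

abbreviation side :: "real^'n \<Rightarrow> (real^'n) set" where "side c \<equiv> convex hull (C - {c})"

text \<open>The barycentric coordinate of \<open>c\<close>, extended to the whole space as an affine
  function with gradient \<open>w c\<close>, hence constant orthogonally to the simplex.\<close>

definition bary :: "real^'n \<Rightarrow> real^'n \<Rightarrow> real" where "bary c z = 1 + w c \<bullet> (z - c)"

lemma fin: "finite C"
  using card by (metis card.infinite not_numeral_le_zero)

lemma ex_other: "\<exists>a. a \<in> C - {c}"
proof (rule ccontr)
  assume "\<nexists>a. a \<in> C - {c}"
  then have "C \<subseteq> {c}" by blast
  then have "card C \<le> 1" using card_mono[of "{c}" C] by simp
  then show False using card by simp
qed

lemma w_nonzero: "c \<in> C \<Longrightarrow> w c \<noteq> 0"
  using ex_other[of c] w_height by force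

lemma bary_vertex: "c \<in> C \<Longrightarrow> d \<in> C \<Longrightarrow> bary c d = (if d = c then 1 else 0)"
  using w_height[of c d] by (auto simp: bary_def inner_diff_right)

section \<open>The simplex, its sides and its normals in barycentric coordinates\<close>

lemma bary_sum:
  assumes "c \<in> C" "sum u C = 1" shows "bary c (\<Sum>d\<in>C. u d *\<^sub>R d) = u c"
proof -
  have "(\<Sum>d\<in>C. u d *\<^sub>R d) - c = (\<Sum>d\<in>C. u d *\<^sub>R (d - c))"
    using assms by (simp add: scaleR_diff_right sum_subtractf flip: scaleR_left.sum)
  then have "bary c (\<Sum>d\<in>C. u d *\<^sub>R d) = sum u C + (\<Sum>d\<in>C. u d * (w c \<bullet> (d - c)))"
    by (simp add: bary_def inner_sum_right assms)
  also have "\<dots> = (\<Sum>d\<in>C. u d * bary c d)"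
    by (simp add: bary_def distrib_left sum.distrib)
  also have "\<dots> = (\<Sum>d\<in>C. if d = c then u d else 0)"
    using assms by (intro sum.cong) (auto simp: bary_vertex)
  finally show ?thesis using assms fin by simp
qed

lemma simplex_iff:
  assumes "a \<in> C"
  shows "z \<in> convex hull C \<longleftrightarrow> z - a \<in> direction_space C \<and> (\<forall>c\<in>C. bary c z \<ge> 0)"
proof
  assume "z \<in> convex hull C"
  then obtain u where u: "\<forall>x\<in>C. 0 \<le> u x" "sum u C = 1" "(\<Sum>x\<in>C. u x *\<^sub>R x) = z"
    unfolding convex_hull_finite[OF fin] by blast
  moreover have "z - a \<in> direction_space C"
    using affine_hull_iff_direction_space[OF assms] convex_hull_subset_affine_hull \<open>z \<in> _\<close> by blast
  ultimately show "z - a \<in> direction_space C \<and> (\<forall>c\<in>C. bary c z \<ge> 0)"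
    using bary_sum by auto
next
  assume *: "z - a \<in> direction_space C \<and> (\<forall>c\<in>C. bary c z \<ge> 0)"
  then have "z \<in> affine hull C" using affine_hull_iff_direction_space[OF assms] by blast
  then obtain u where "sum u C = 1" "(\<Sum>x\<in>C. u x *\<^sub>R x) = z"
    unfolding affine_hull_finite[OF fin] by blast
  then show "z \<in> convex hull C"
    using * bary_sum[of _ u] unfolding convex_hull_finite[OF fin] by (auto intro!: exI[of _ u])
qed

lemma side_iff:
  assumes "c \<in> C" shows "z \<in> side c \<longleftrightarrow> z \<in> convex hull C \<and> bary c z = 0"
proof
  assume z: "z \<in> side c"
  then obtain u where u: "\<forall>x\<in>C - {c}. 0 \<le> u x" "sum u (C - {c}) = 1" "(\<Sum>x\<in>C - {c}. u x *\<^sub>R x) = z"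
    using convex_hull_finite[of "C - {c}"] fin by auto
  define u' where "u' = u(c := 0)"
  have *: "sum u' (C - {c}) = sum u (C - {c})" "(\<Sum>x\<in>C - {c}. u' x *\<^sub>R x) = (\<Sum>x\<in>C - {c}. u x *\<^sub>R x)"
    by (intro sum.cong; simp add: u'_def)+
  have "sum u' C = 1" "(\<Sum>x\<in>C. u' x *\<^sub>R x) = z"
    using u * by (simp_all add: sum.remove[OF fin assms] u'_def)
  then have "bary c z = u' c" using bary_sum[OF assms] by blast
  then show "z \<in> convex hull C \<and> bary c z = 0"
    using z hull_mono[of "C - {c}" C convex] by (auto simp: u'_def)
next
  assume *: "z \<in> convex hull C \<and> bary c z = 0"
  then obtain u where u: "\<forall>x\<in>C. 0 \<le> u x" "sum u C = 1" "(\<Sum>x\<in>C. u x *\<^sub>R x) = z"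
    unfolding convex_hull_finite[OF fin] by blast
  then have "u c = 0" using bary_sum[OF assms, of u] * by simp
  then have "sum u (C - {c}) = 1" "(\<Sum>x\<in>C - {c}. u x *\<^sub>R x) = z"
    using u by (simp_all add: sum.remove[OF fin assms])
  then show "z \<in> side c"
    using u convex_hull_finite[of "C - {c}"] fin by auto
qed

text \<open>A direction orthogonal to \<open>w c\<close> keeps the coordinate of \<open>c\<close> at
  zero, so the affine combination that it produces does not involve \<open>c\<close>.\<close>

lemma direction_space_side:
  assumes c: "c \<in> C"
  shows "direction_space (side c) = {v \<in> direction_space C. w c \<bullet> v = 0}"
proof -
  obtain a where a: "a \<in> C - {c}" using ex_other by blast
  then have aC: "a \<in> C" by blast
  have "v \<in> direction_space C \<and> w c \<bullet> v = 0" if "v \<in> direction_space (C - {c})" for v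
  proof -
    have "direction_space (C - {c}) \<subseteq> direction_space C"
      unfolding direction_space_def by (intro span_mono) blast
    moreover have "w c \<bullet> v = 0"
      using that unfolding direction_space_def
      by (induction rule: span_induct_alt) (auto simp: inner_add_right w_orth[OF c])
    ultimately show ?thesis using that by blast
  qed
  moreover have "v \<in> direction_space (C - {c})" if v: "v \<in> direction_space C" "w c \<bullet> v = 0" for v
  proof -
    have "v + a \<in> affine hull C" using v affine_hull_iff_direction_space[OF aC] by simp
    then obtain u where u: "sum u C = 1" "(\<Sum>x\<in>C. u x *\<^sub>R x) = v + a"
      unfolding affine_hull_finite[OF fin] by blast
    have "u c = bary c (v + a)" using bary_sum[OF c u(1)] u(2) by simp
    also have "\<dots> = bary c a" using v(2) by (simp add: bary_def inner_add_right inner_diff_right)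
    also have "\<dots> = 0" using bary_vertex[OF c aC] a by auto
    finally have "u c = 0" .
    then have "sum u (C - {c}) = 1" "(\<Sum>x\<in>C - {c}. u x *\<^sub>R x) = v + a"
      using u by (simp_all add: sum.remove[OF fin c])
    then have "v + a \<in> affine hull (C - {c})"
      using affine_hull_finite[of "C - {c}"] fin by auto
    then show ?thesis using affine_hull_iff_direction_space[OF a] by simp
  qed
  ultimately show ?thesis unfolding direction_space_convex_hull by blast
qed

text \<open>Outward means that the coordinate of \<open>c\<close> decreases, whence the minus sign.
  For uniqueness, a competitor minus its component along \<open>w c\<close> is a direction of the
  side that is orthogonal to both vectors, hence zero; testing with \<open>c - a\<close> fixes the
  sign.\<close>

lemma outer_normal_side:
  assumes c: "c \<in> C"
  shows "outer_normal (convex hull C) (side c) = - (w c /\<^sub>R norm (w c))"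
  unfolding outer_normal_def
proof (rule the_equality)
  let ?\<nu> = "- (w c /\<^sub>R norm (w c))"
  have w0: "norm (w c) > 0" using w_nonzero[OF c] by simp
  have "w c \<bullet> (x - y) = bary c x - bary c y" for x y by (simp add: bary_def inner_diff_right)
  moreover have "bary c x = 0" if "x \<in> side c" for x using side_iff[OF c] that by blast
  moreover have "bary c x \<ge> 0" if "x \<in> convex hull C" for x using simplex_iff[OF c] that c by blast
  ultimately show "norm ?\<nu> = 1 \<and> ?\<nu> \<in> direction_space (convex hull C) \<and>
      (\<forall>x\<in>side c. \<forall>y\<in>side c. ?\<nu> \<bullet> (x - y) = 0) \<and> (\<forall>x\<in>convex hull C. \<forall>y\<in>side c. ?\<nu> \<bullet> (x - y) \<le> 0)"
    using w0 subspace_neg[OF subspace_direction_space subspace_scale[OF subspace_direction_space w_dir[OF c]]]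
    by (auto simp: direction_space_convex_hull mult_nonneg_nonneg)
next
  fix \<nu> assume \<nu>: "norm \<nu> = 1 \<and> \<nu> \<in> direction_space (convex hull C) \<and>
      (\<forall>x\<in>side c. \<forall>y\<in>side c. \<nu> \<bullet> (x - y) = 0) \<and> (\<forall>x\<in>convex hull C. \<forall>y\<in>side c. \<nu> \<bullet> (x - y) \<le> 0)"
  define t where "t = (w c \<bullet> \<nu>) / (w c \<bullet> w c)"
  have w0: "w c \<bullet> w c > 0" using w_nonzero[OF c] by simp
  define v where "v = \<nu> - t *\<^sub>R w c"
  have "w c \<bullet> v = 0" using w0 by (simp add: v_def t_def inner_diff_right)
  moreover have "v \<in> direction_space C"
    using \<nu> w_dir[OF c] by (auto simp: v_def direction_space_convex_hull
        intro: subspace_diff subspace_scale subspace_direction_space)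
  ultimately have "v \<in> direction_space (side c)" using direction_space_side[OF c] by blast
  then have "\<nu> \<bullet> v = 0"
    unfolding direction_space_def using \<nu>
    by (induction rule: span_induct_alt) (auto simp: inner_add_right)
  with \<open>w c \<bullet> v = 0\<close> have "v \<bullet> v = 0" by (simp add: v_def inner_diff_left)
  then have \<nu>_eq: "\<nu> = t *\<^sub>R w c" by (simp add: v_def)
  obtain a where a: "a \<in> C - {c}" using ex_other by blast
  have "\<nu> \<bullet> (c - a) \<le> 0" using \<nu> c a by (simp add: hull_inc)
  then have "t \<le> 0" using w_height[OF c a] by (simp add: \<nu>_eq)
  moreover have "\<bar>t\<bar> * norm (w c) = 1" using \<nu> by (simp add: \<nu>_eq)
  ultimately have "t = - inverse (norm (w c))" using w0 by (simp add: field_simps)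
  then show "\<nu> = - (w c /\<^sub>R norm (w c))" by (simp add: \<nu>_eq)
qed

text \<open>Splits coordinates of the simplex into those of a side and a normal one, the setting in
  which the fibre formula applies.\<close>

lemma onb_side:
  assumes c: "c \<in> C" and B: "onb B (direction_space (side c))"
  shows "onb (insert (w c /\<^sub>R norm (w c)) B) (direction_space (convex hull C))" "w c /\<^sub>R norm (w c) \<notin> B"
proof -
  let ?\<nu> = "w c /\<^sub>R norm (w c)" and ?W = "direction_space (side c)"
  have w0: "norm (w c) > 0" using w_nonzero[OF c] by simp
  have \<nu>: "norm ?\<nu> = 1" "\<And>x. x \<in> ?W \<Longrightarrow> ?\<nu> \<bullet> x = 0"
    using w0 direction_space_side[OF c] by auto
  have "span (insert ?\<nu> ?W) = direction_space C"
  proof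
    show "span (insert ?\<nu> ?W) \<subseteq> direction_space C"
      using direction_space_side[OF c] w_dir[OF c]
      by (intro span_minimal) (auto intro: subspace_scale subspace_direction_space)
    show "direction_space C \<subseteq> span (insert ?\<nu> ?W)"
    proof
      fix v assume v: "v \<in> direction_space C"
      have "w c \<bullet> w c > 0" using w_nonzero[OF c] by simp
      then have "v - ((w c \<bullet> v) / (w c \<bullet> w c)) *\<^sub>R w c \<in> ?W"
        using direction_space_side[OF c] v w_dir[OF c]
        by (auto simp: inner_diff_right intro: subspace_diff subspace_scale subspace_direction_space)
      then have "v - ((w c \<bullet> v) / (w c \<bullet> w c)) *\<^sub>R w c \<in> span (insert ?\<nu> ?W)" by (simp add: span_base)
      moreover have "w c = norm (w c) *\<^sub>R ?\<nu>" using w0 by simp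
      then have "w c \<in> span (insert ?\<nu> ?W)" by (metis insertI1 span_base span_scale)
      ultimately show "v \<in> span (insert ?\<nu> ?W)"
        by (metis diff_add_cancel span_add span_scale)
    qed
  qed
  then show "onb (insert ?\<nu> B) (direction_space (convex hull C))" "?\<nu> \<notin> B"
    using onb_insert[OF B \<nu>] direction_space_convex_hull by metis+
qed


section \<open>Integration along the edges of a simplex\<close>

lemma inner_edge:
  assumes "a \<in> C" "b \<in> C" "a \<noteq> b" "c \<in> C"
  shows "w c \<bullet> (b - a) = (if c = b then 1 else if c = a then -1 else 0)"
  using assms w_height[of b a] w_height[of a b] w_orth[of c b a]
  by (auto simp: inner_diff_right)

lemma bary_move: "bary c (x + s *\<^sub>R e) = bary c x + s * (w c \<bullet> e)"
  by (simp add: bary_def inner_add_right inner_diff_right)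

lemma continuous_on_bary [continuous_intros]: "continuous_on A (bary c)"
  unfolding bary_def[abs_def] by (intro continuous_intros)

lemma borel_measurable_bary [measurable]: "bary c \<in> borel_measurable borel"
  by (intro borel_measurable_continuous_onI continuous_on_bary)

lemma compact_side: "compact (side c)" and compact_simplex: "compact (convex hull C)"
  using fin by (auto intro: finite_imp_compact_convex_hull)

lemma sides_borel [measurable]: "side c \<in> sets borel" "convex hull C \<in> sets borel"
  by (simp_all add: borel_compact compact_side compact_simplex)

text \<open>Lines parallel to \<open>e\<close> fibre the simplex over \<open>side b\<close>. Along
  such a line only the coordinates of \<open>a\<close> and \<open>b\<close> change, in opposite
  directions, so it runs inside from \<open>s = 0\<close> to \<open>s = bary a x\<close>, where it
  leaves through \<open>side a\<close>. The fundamental theorem of calculus applies on each fibre;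
  \<open>1 / norm (w b)\<close> is the normal component of \<open>e\<close>.\<close>

lemma integral_edge_derivative:
  fixes f :: "real^'n \<Rightarrow> real"
  assumes ab: "a \<in> C" "b \<in> C" "a \<noteq> b" and f: "smooth f"
  defines "e \<equiv> b - a"
  shows "(\<integral>x. dderiv e f x \<partial>surf (convex hull C)) =
     (\<integral>x. f (x + bary a x *\<^sub>R e) - f x \<partial>surf (side b)) / norm (w b)"
proof -
  let ?S = "convex hull C" and ?F = "side b"
  have aS: "a \<in> ?S" and aF: "a \<in> ?F" using ab by (auto intro: hull_inc)
  obtain B where B: "onb B (direction_space ?F)" using onb_exists subspace_direction_space by blast
  define \<nu> where "\<nu> = w b /\<^sub>R norm (w b)"
  note B' = onb_side[OF ab(2) B, folded \<nu>_def]
  have wb: "norm (w b) > 0" using w_nonzero[OF ab(2)] by simp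
  have web: "w b \<bullet> e = 1"
    using inner_edge[OF ab] ab by (auto simp: e_def)
  have e\<nu>: "e \<bullet> \<nu> = 1 / norm (w b)" using web by (simp add: \<nu>_def inner_commute field_simps)
  have eC: "e \<in> direction_space C" unfolding e_def using ab by (intro direction_space_diff)
  have ob: "e - (e \<bullet> \<nu>) *\<^sub>R \<nu> \<in> direction_space ?F"
  proof -
    have "w b \<bullet> (e - (e \<bullet> \<nu>) *\<^sub>R \<nu>) = 0"
      using web wb unfolding e\<nu>
      by (simp add: inner_diff_right \<nu>_def dot_square_norm power2_eq_square field_simps)
    then show ?thesis using direction_space_side[OF ab(2)] eC w_dir[OF ab(2)]
      by (auto simp: \<nu>_def intro: subspace_diff subspace_scale subspace_direction_space)
  qed
  define g where "g = (\<lambda>x. indicator ?S x * dderiv e f x)"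
  have cd: "continuous_on A (dderiv e f)" for A by (intro smooth_continuous smooth_dderiv f)
  have gm [measurable]: "g \<in> borel_measurable borel"
    unfolding g_def using borel_measurable_continuous_onI[OF cd] by measurable
  have fm [measurable]: "f \<in> borel_measurable borel"
    by (intro borel_measurable_continuous_onI smooth_continuous f)
  have "integrable (surf ?S) (dderiv e f)" by (intro integrable_surf_continuous compact_simplex cd)
  then have gi: "integrable (aff_lborel a (insert \<nu> B)) g"
    unfolding integrable_surf[OF aS B'(1) sides_borel(2)] g_def .
  have "(\<integral>x. dderiv e f x \<partial>surf ?S) = (\<integral>x. g x \<partial>aff_lborel a (insert \<nu> B))"
    unfolding integral_surf[OF aS B'(1) sides_borel(2)] g_def ..
  also have "\<dots> = \<bar>e \<bullet> \<nu>\<bar> * (\<integral>x. (\<integral>s. g (x + s *\<^sub>R e) \<partial>lborel) \<partial>aff_lborel a B)"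
    by (rule integral_aff_lborel_oblique[OF B B'(2) ob _ gi]) (use wb in \<open>simp add: e\<nu>\<close>)
  also have "(\<integral>x. (\<integral>s. g (x + s *\<^sub>R e) \<partial>lborel) \<partial>aff_lborel a B) =
     (\<integral>x. indicator ?F x * (f (x + bary a x *\<^sub>R e) - f x) \<partial>aff_lborel a B)"
  proof (rule integral_cong_AE)
    show "AE x in aff_lborel a B. (\<integral>s. g (x + s *\<^sub>R e) \<partial>lborel) = indicator ?F x * (f (x + bary a x *\<^sub>R e) - f x)"
    proof (rule AE_aff_lborel)
      fix x assume "x - a \<in> span B"
      then have x: "x - a \<in> direction_space C" "w b \<bullet> (x - a) = 0"
        using B direction_space_side[OF ab(2)] unfolding onb_def by auto
      have bx: "bary b x = 0"
        using x(2) bary_vertex[OF ab(2) ab(1)] ab(3) by (simp add: bary_def inner_diff_right)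
      have dir: "x + s *\<^sub>R e - a \<in> direction_space C" for s
        using subspace_add[OF subspace_direction_space x(1) subspace_scale[OF subspace_direction_space eC]]
        by (simp add: algebra_simps)
      have bc: "bary c (x + s *\<^sub>R e) = (if c = b then s else if c = a then bary a x - s else bary c x)" if "c \<in> C" for c s
        using inner_edge[OF ab that] bx by (simp add: bary_move e_def)
      show "(\<integral>s. g (x + s *\<^sub>R e) \<partial>lborel) = indicator ?F x * (f (x + bary a x *\<^sub>R e) - f x)"
      proof (cases "x \<in> ?F")
        case True
        then have pos: "\<forall>c\<in>C. bary c x \<ge> 0" using side_iff[OF ab(2)] simplex_iff[OF ab(1)] by blast
        have "x + s *\<^sub>R e \<in> ?S \<longleftrightarrow> s \<in> {0..bary a x}" for s
          unfolding simplex_iff[OF ab(1)] using dir[of s] bc[of _ s] pos ab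
          by (auto split: if_splits)
        then have "(\<integral>s. g (x + s *\<^sub>R e) \<partial>lborel) = (\<integral>s. indicator {0..bary a x} s *\<^sub>R dderiv e f (x + s *\<^sub>R e) \<partial>lborel)"
          unfolding g_def by (intro Bochner_Integration.integral_cong) (auto simp: indicator_def)
        also have "\<dots> = f (x + bary a x *\<^sub>R e) - f (x + 0 *\<^sub>R e)"
        proof (rule integral_FTC_atLeastAtMost)
          show "0 \<le> bary a x" using pos ab by blast
          show "((\<lambda>s. f (x + s *\<^sub>R e)) has_vector_derivative dderiv e f (x + t *\<^sub>R e)) (at t within {0..bary a x})" for t
            using has_real_derivative_along[OF smooth_differentiable[OF f], where x=x and t=t and e=e]
            by (simp add: smooth_dderiv_grad[OF f] has_real_derivative_iff_has_vector_derivative)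
          show "continuous_on {0..bary a x} (\<lambda>s. dderiv e f (x + s *\<^sub>R e))"
            by (rule continuous_on_compose2[OF cd[of UNIV]]) (auto intro!: continuous_intros)
        qed
        finally show ?thesis using True by simp
      next
        case False
        have "x + s *\<^sub>R e \<notin> ?S" for s
        proof
          assume "x + s *\<^sub>R e \<in> ?S"
          then have *: "bary c (x + s *\<^sub>R e) \<ge> 0" if "c \<in> C" for c
            using simplex_iff[OF ab(1)] that by blast
          have s: "0 \<le> s" "s \<le> bary a x" using *[of a] *[of b] bc[of a s] bc[of b s] ab by auto
          have "bary c x \<ge> 0" if "c \<in> C" for c
            using *[OF that] bc[OF that, of s] s bx by (auto split: if_splits)
          then have "x \<in> ?F" using simplex_iff[OF ab(1)] side_iff[OF ab(2)] x(1) bx by blast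
          then show False using False by blast
        qed
        then show ?thesis using False by (simp add: g_def)
      qed
    qed measurable
  qed measurable
  also have "\<dots> = (\<integral>x. f (x + bary a x *\<^sub>R e) - f x \<partial>surf ?F)"
    unfolding integral_surf[OF aF B sides_borel(1)] ..
  finally show ?thesis using wb by (simp add: e\<nu>)
qed

text \<open>Both sides are the integral of one function over the prism swept out by \<open>side a\<close> along \<open>b - a\<close>,
  fibred once over \<open>side a\<close> and once over \<open>side b\<close>; this replaces the Jacobian of the projection
  between the two sides.\<close>
lemma integral_shear_side:
  fixes f :: "real^'n \<Rightarrow> real"
  assumes ab: "a \<in> C" "b \<in> C" "a \<noteq> b" and f: "continuous_on UNIV f"
  defines "e \<equiv> b - a"
  shows "(\<integral>x. f (x + bary a x *\<^sub>R e) \<partial>surf (side b)) / norm (w b) = (\<integral>x. f x \<partial>surf (side a)) / norm (w a)"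
proof -
  \<comment> \<open>Each \<open>z\<close> is slid along \<open>e\<close> onto the hyperplane where
    \<open>bary a\<close> is zero, by the amount \<open>bary a z\<close>, since
    \<open>w a \<bullet> e = -1\<close>. \<open>G\<close> is the value of \<open>f\<close> there,
    cut off to the prism: the foot lies in \<open>side a\<close> and the parameter
    \<open>- bary a z\<close> lies between zero and one.\<close>
  define G where "G = (\<lambda>z. f (z + bary a z *\<^sub>R e) * indicator (side a) (z + bary a z *\<^sub>R e) * indicator {0..1} (- bary a z))"
  have fm [measurable]: "f \<in> borel_measurable borel" by (intro borel_measurable_continuous_onI f)
  have Gm [measurable]: "G \<in> borel_measurable borel" unfolding G_def by measurable
  have ab': "b \<noteq> a" using ab by simp
  have web: "w b \<bullet> e = 1" and wea: "w a \<bullet> e = -1"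
    using inner_edge[OF ab] ab by (auto simp: e_def)
  have eC: "e \<in> direction_space C" unfolding e_def using ab by (intro direction_space_diff)
  have bound: "\<exists>K R. R > 0 \<and> (\<forall>x. \<bar>G x\<bar> \<le> K) \<and> (\<forall>x. x \<notin> cball p R \<longrightarrow> G x = 0)" for p
  proof -
    have "compact (f ` side a)" by (rule compact_continuous_image[OF continuous_on_subset[OF f] compact_side]) simp
    then obtain K where K: "\<And>x. x \<in> side a \<Longrightarrow> \<bar>f x\<bar> \<le> K"
      using compact_imp_bounded[of "f ` side a"] unfolding bounded_iff by auto
    obtain R where R: "\<And>x. x \<in> side a \<Longrightarrow> dist p x \<le> R"
      using compact_imp_bounded[OF compact_side[of a]] unfolding bounded_any_center[where a=p] by blast
    have far: "G x = 0" if "x \<notin> cball p (\<bar>R\<bar> + norm e + 1)" for x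
    proof (rule ccontr)
      assume "G x \<noteq> 0"
      then have "x + bary a x *\<^sub>R e \<in> side a" and s: "\<bar>bary a x\<bar> \<le> 1"
        unfolding G_def by (auto simp: indicator_def split: if_splits)
      then have "dist p (x + bary a x *\<^sub>R e) \<le> \<bar>R\<bar>" using R by force
      moreover have "norm (bary a x *\<^sub>R e) \<le> norm e" using s by (simp add: mult_left_le_one_le)
      moreover have "dist p x \<le> dist p (x + bary a x *\<^sub>R e) + dist (x + bary a x *\<^sub>R e) x" by (rule dist_triangle)
      ultimately show False using that by (simp add: dist_norm)
    qed
    have "\<bar>G x\<bar> \<le> \<bar>K\<bar>" for x
      using K[of "x + bary a x *\<^sub>R e"] unfolding G_def by (auto simp: indicator_def)
    then show ?thesis using far by (intro exI[of _ "\<bar>K\<bar>"] exI[of _ "\<bar>R\<bar> + norm e + 1"]) (auto simp: add_nonneg_pos)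
  qed
  \<comment> \<open>Covers both fibrations: for \<open>c = a\<close> and for \<open>c = b\<close>
    one has \<open>\<bar>w c \<bullet> e\<bar> = 1\<close>, so the fibre formula has the weight
    \<open>1 / norm (w c)\<close>; only the fibre integral, prescribed by \<open>h\<close>,
    differs.\<close>
  have main: "(\<integral>x. G x \<partial>aff_lborel p (insert (w c /\<^sub>R norm (w c)) B)) = (\<integral>x. h x \<partial>surf (side c)) / norm (w c)"
    if c: "c \<in> {a, b}" and p: "p \<in> C - {c}" and B: "onb B (direction_space (side c))"
      and hm: "h \<in> borel_measurable borel"
      and h: "\<And>x. x - p \<in> direction_space C \<Longrightarrow> bary c x = 0 \<Longrightarrow> (\<integral>s. G (x + s *\<^sub>R e) \<partial>lborel) = indicator (side c) x * h x"
    for c p B h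
  proof -
    have cC: "c \<in> C" and we: "\<bar>w c \<bullet> e\<bar> = 1" using c ab web wea by auto
    have pF: "p \<in> side c" using p by (auto intro: hull_inc)
    define \<nu> where "\<nu> = w c /\<^sub>R norm (w c)"
    note B' = onb_side[OF cC B, folded \<nu>_def]
    have wc: "norm (w c) > 0" using w_nonzero[OF cC] by simp
    have e\<nu>: "e \<bullet> \<nu> = (w c \<bullet> e) / norm (w c)" by (simp add: \<nu>_def inner_commute field_simps)
    have ob: "e - (e \<bullet> \<nu>) *\<^sub>R \<nu> \<in> direction_space (side c)"
    proof -
      have "w c \<bullet> (e - (e \<bullet> \<nu>) *\<^sub>R \<nu>) = 0"
        using wc unfolding e\<nu>
        by (simp add: inner_diff_right \<nu>_def dot_square_norm power2_eq_square field_simps)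
      then show ?thesis using direction_space_side[OF cC] eC w_dir[OF cC]
        by (auto simp: \<nu>_def intro: subspace_diff subspace_scale subspace_direction_space)
    qed
    obtain K R where KR: "R > 0" "\<And>x. \<bar>G x\<bar> \<le> K" "\<And>x. x \<notin> cball p R \<Longrightarrow> G x = 0" using bound[of p] by blast
    have "(\<integral>x. G x \<partial>aff_lborel p (insert \<nu> B)) = \<bar>e \<bullet> \<nu>\<bar> * (\<integral>x. (\<integral>s. G (x + s *\<^sub>R e) \<partial>lborel) \<partial>aff_lborel p B)"
      by (rule integral_aff_lborel_oblique[OF B B'(2) ob])
         (use wc we in \<open>auto simp: e\<nu> intro!: integrable_aff_lborel_bounded[OF B'(1) Gm KR(2,3,1)]\<close>)
    also have "(\<integral>x. (\<integral>s. G (x + s *\<^sub>R e) \<partial>lborel) \<partial>aff_lborel p B) = (\<integral>x. indicator (side c) x * h x \<partial>aff_lborel p B)"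
    proof (rule integral_cong_AE)
      show "AE x in aff_lborel p B. (\<integral>s. G (x + s *\<^sub>R e) \<partial>lborel) = indicator (side c) x * h x"
      proof (rule AE_aff_lborel)
        fix x assume "x - p \<in> span B"
        then have x: "x - p \<in> direction_space C" "w c \<bullet> (x - p) = 0"
          using B direction_space_side[OF cC] unfolding onb_def by auto
        have "bary c x = 0"
          using x(2) bary_vertex[OF cC, of p] p by (auto simp: bary_def inner_diff_right)
        then show "(\<integral>s. G (x + s *\<^sub>R e) \<partial>lborel) = indicator (side c) x * h x" using h x(1) by blast
      qed (use hm in measurable)
    qed (use hm in measurable)
    also have "\<dots> = (\<integral>x. h x \<partial>surf (side c))"
      unfolding integral_surf[OF pF B sides_borel(1)] ..
    also have "\<bar>e \<bullet> \<nu>\<bar> = 1 / norm (w c)" using we wc by (simp add: e\<nu> abs_divide)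
    finally show ?thesis by (simp add: \<nu>_def)
  qed
  obtain A where A: "onb A (direction_space (side a))" using onb_exists subspace_direction_space by blast
  obtain B where B: "onb B (direction_space (side b))" using onb_exists subspace_direction_space by blast
  have "(\<integral>x. G x \<partial>aff_lborel b (insert (w a /\<^sub>R norm (w a)) A)) = (\<integral>x. f x \<partial>surf (side a)) / norm (w a)"
  proof (rule main[OF _ _ A fm])
    fix x assume x: "x - b \<in> direction_space C" "bary a x = 0"
    have "bary a (x + s *\<^sub>R e) = - s" for s by (simp add: bary_move wea x)
    then have "(\<integral>s. G (x + s *\<^sub>R e) \<partial>lborel) = (\<integral>s. (f x * indicator (side a) x) * indicator {0..1::real} s \<partial>lborel)"
      unfolding G_def by simp
    then show "(\<integral>s. G (x + s *\<^sub>R e) \<partial>lborel) = indicator (side a) x * f x" by simp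
  qed (use ab in auto)
  moreover have "(\<integral>x. G x \<partial>aff_lborel a (insert (w b /\<^sub>R norm (w b)) B)) =
      (\<integral>x. f (x + bary a x *\<^sub>R e) \<partial>surf (side b)) / norm (w b)"
  proof (rule main[OF _ _ B])
    fix x assume x: "x - a \<in> direction_space C" "bary b x = 0"
    let ?y = "x + bary a x *\<^sub>R e"
    have m: "bary a (x + s *\<^sub>R e) = bary a x - s" for s by (simp add: bary_move wea)
    \<comment> \<open>Sliding moves the coordinate of \<open>a\<close> onto \<open>b\<close>, so
      \<open>?y\<close> lies in \<open>side a\<close> exactly if \<open>x\<close> lies in
      \<open>side b\<close>.\<close>
    have bc: "bary c ?y = (if c = b then bary a x else if c = a then 0 else bary c x)" if "c \<in> C" for c
      using inner_edge[OF ab that] x(2) by (simp add: bary_move e_def)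
    have dir: "?y - a \<in> direction_space C"
      using subspace_add[OF subspace_direction_space x(1) subspace_scale[OF subspace_direction_space eC]]
      by (simp add: algebra_simps)
    have "(\<forall>c\<in>C. bary c ?y \<ge> 0) \<longleftrightarrow> (\<forall>c\<in>C. bary c x \<ge> 0)"
    proof (intro iffI ballI)
      fix c assume c: "\<forall>c\<in>C. bary c ?y \<ge> 0" "c \<in> C"
      then show "bary c x \<ge> 0"
        using bc[OF ab(2)] bc[OF c(2)] ab x(2) by (cases "c = a"; cases "c = b") force+
    next
      fix c assume c: "\<forall>c\<in>C. bary c x \<ge> 0" "c \<in> C"
      then show "bary c ?y \<ge> 0" using bc[OF c(2)] ab by auto
    qed
    then have iff: "?y \<in> side a \<longleftrightarrow> x \<in> side b"
      unfolding side_iff[OF ab(1)] side_iff[OF ab(2)] simplex_iff[OF ab(1)]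
      using x dir bc[OF ab(1)] ab by auto
    have *: "x + s *\<^sub>R e + bary a (x + s *\<^sub>R e) *\<^sub>R e = ?y" for s
      by (simp add: m algebra_simps)
    \<comment> \<open>All points of a fibre have the same foot \<open>?y\<close>, and the fibre
      meets the prism, if at all, in an interval of length one.\<close>
    have "G (x + s *\<^sub>R e) = (f ?y * indicator (side b) x) * indicator {bary a x..bary a x + 1} s" for s
      unfolding G_def * using iff by (auto simp: m indicator_def)
    then have "(\<integral>s. G (x + s *\<^sub>R e) \<partial>lborel) = (\<integral>s. (f ?y * indicator (side b) x) * indicator {bary a x..bary a x + 1} s \<partial>lborel)"
      by simp
    then show "(\<integral>s. G (x + s *\<^sub>R e) \<partial>lborel) = indicator (side b) x * f ?y" by simp
  qed (use ab in auto)
  moreover have "aff_lborel b (insert (w a /\<^sub>R norm (w a)) A) = aff_lborel a (insert (w b /\<^sub>R norm (w b)) B)"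
  proof -
    note oA = onb_side(1)[OF ab(1) A] and oB = onb_side(1)[OF ab(2) B]
    have "b - a \<in> span (insert (w a /\<^sub>R norm (w a)) A)"
      using oA eC unfolding onb_def by (simp add: e_def direction_space_convex_hull)
    then have "aff_lborel b (insert (w a /\<^sub>R norm (w a)) A) = aff_lborel a (insert (w a /\<^sub>R norm (w a)) A)"
      by (intro aff_lborel_base onb_finite[OF oA])
    then show ?thesis using aff_lborel_unique[OF oA oB] by simp
  qed
  ultimately show ?thesis by simp
qed

lemma side_inj: "inj_on side C"
proof (rule inj_onI)
  fix c d assume cd: "c \<in> C" "d \<in> C" "side c = side d"
  show "c = d"
  proof (rule ccontr)
    assume "c \<noteq> d"
    then have "c \<in> side d" using cd by (auto intro: hull_inc)
    then show False using cd side_iff[OF cd(1)] bary_vertex[OF cd(1) cd(1)] by simp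
  qed
qed

lemma faces_eq: "faces (convex hull C) = side ` C"
  unfolding faces_def facet_of_convex_hull_affine_independent_alt[OF indep] using card by auto

text \<open>Both sides are linear in \<open>e\<close>, and the edge vectors span the direction
  space. For an edge \<open>b - a\<close> only the sides opposite to \<open>a\<close> and
  \<open>b\<close> carry flux, with opposite signs; fibre integration gives the difference of these
  two side integrals once one of them has been sheared onto the other side.\<close>

theorem divergence_theorem:
  fixes f :: "real^'n \<Rightarrow> real"
  assumes e: "e \<in> direction_space (convex hull C)" and f: "smooth f"
  shows "(\<integral>x. dderiv e f x \<partial>surf (convex hull C)) =
    (\<Sum>F\<in>faces (convex hull C). (e \<bullet> outer_normal (convex hull C) F) * (\<integral>x. f x \<partial>surf F))"
proof -
  let ?S = "convex hull C"
  let ?R = "\<lambda>e. \<Sum>c\<in>C. (e \<bullet> (- (w c /\<^sub>R norm (w c)))) * (\<integral>x. f x \<partial>surf (side c))"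
  have int: "integrable (surf ?S) (dderiv d f)" for d
    by (intro integrable_surf_continuous compact_simplex smooth_continuous smooth_dderiv f)
  have edge: "(\<integral>x. dderiv (b - a) f x \<partial>surf ?S) = ?R (b - a)" if ab: "a \<in> C" "b \<in> C" for a b
  proof (cases "a = b")
    case True
    then show ?thesis by (simp add: smooth_dderiv_grad[OF f])
  next
    case False
    have sm: "continuous_on UNIV f" using f by (rule smooth_continuous)
    have i1: "integrable (surf (side b)) (\<lambda>x. f (x + bary a x *\<^sub>R (b - a)))"
      by (intro integrable_surf_continuous compact_side continuous_on_compose2[OF sm] continuous_intros) auto
    have i2: "integrable (surf (side b)) f"
      by (intro integrable_surf_continuous compact_side smooth_continuous f)
    have "(\<integral>x. dderiv (b - a) f x \<partial>surf ?S) =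
        (\<integral>x. f x \<partial>surf (side a)) / norm (w a) - (\<integral>x. f x \<partial>surf (side b)) / norm (w b)"
      using integral_edge_derivative[OF ab False f] integral_shear_side[OF ab False sm] i1 i2
      by (simp add: diff_divide_distrib)
    moreover have "(b - a) \<bullet> w c = (if c = b then 1 else if c = a then -1 else 0)" if "c \<in> C" for c
      using inner_edge[OF ab False that] by (simp add: inner_commute)
    then have "?R (b - a) = (\<Sum>c\<in>C. (if c = b then - inverse (norm (w c)) * (\<integral>x. f x \<partial>surf (side c)) else 0)
       + (if c = a then inverse (norm (w c)) * (\<integral>x. f x \<partial>surf (side c)) else 0))"
      using False by (intro sum.cong) auto
    ultimately show ?thesis
      using ab fin by (simp add: sum.distrib divide_inverse mult.commute)
  qed
  have "e \<in> span {x - y |x y. x \<in> C \<and> y \<in> C}"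
    using e direction_space_convex_hull[of C] unfolding direction_space_def by simp
  then have "(\<integral>x. dderiv e f x \<partial>surf ?S) = ?R e"
  proof (induction rule: span_induct_alt)
    case base
    then show ?case by (simp add: smooth_dderiv_grad[OF f])
  next
    case (step r x y)
    have "dderiv (r *\<^sub>R x + y) f = (\<lambda>z. r * dderiv x f z + dderiv y f z)"
      by (simp add: smooth_dderiv_grad[OF f] inner_add_right)
    moreover have "?R (r *\<^sub>R x + y) = r * ?R x + ?R y"
      by (simp add: inner_add_left inner_diff_left algebra_simps sum_distrib_left sum.distrib sum_subtractf sum_negf)
    ultimately show ?case using step edge int by auto
  qed
  also have "?R e = (\<Sum>F\<in>faces ?S. (e \<bullet> outer_normal ?S F) * (\<integral>x. f x \<partial>surf F))"
    unfolding faces_eq by (subst sum.reindex[OF side_inj]) (auto intro!: sum.cong simp: outer_normal_side)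
  finally show ?thesis .
qed

end

section \<open>Test functions\<close>

text \<open>Closed under differentiation: the exponential beats every polynomial in \<open>1 / t\<close> at \<open>0\<close>.\<close>
definition flat :: "real poly \<Rightarrow> real \<Rightarrow> real" where
  "flat P t = (if t > 0 then poly P (1 / t) * exp (- (1 / t)) else 0)"

lemma poly_times_exp_tendsto_0: "((\<lambda>s. poly P s * exp (- s)) \<longlongrightarrow> (0::real)) at_top"
proof -
  have "((\<lambda>s. \<Sum>i\<le>degree P. coeff P i * (s ^ i / exp s)) \<longlongrightarrow> (\<Sum>i\<le>degree P. coeff P i * 0)) at_top"
    by (intro tendsto_intros tendsto_power_div_exp_0)
  moreover have "(\<lambda>s. \<Sum>i\<le>degree P. coeff P i * (s ^ i / exp s)) = (\<lambda>s. poly P s * exp (- s))"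
    by (simp add: poly_altdef sum_distrib_right exp_minus divide_inverse mult.assoc)
  ultimately show ?thesis by simp
qed

text \<open>\<open>pCons 0\<close> multiplies by the variable: differentiating
  \<open>P (1 / t) * exp (- 1 / t)\<close> gives \<open>(P - P') (1 / t) / t^2\<close> times the
  exponential. At \<open>t = 0\<close> the difference quotient from the right is the function
  belonging to \<open>pCons 0 P\<close>, which tends to zero.\<close>

lemma flat_has_derivative:
  "(flat P has_real_derivative flat (pCons 0 (pCons 0 (P - pderiv P))) t) (at t)"
proof -
  let ?Q = "pCons 0 (pCons 0 (P - pderiv P))"
  consider "t > 0" | "t < 0" | "t = 0" by linarith
  then show ?thesis
  proof cases
    case 1
    have "((\<lambda>t. poly P (1 / t) * exp (- (1 / t))) has_real_derivative
        poly (pderiv P) (1 / t) * (- 1 / t\<^sup>2) * exp (- (1 / t)) + poly P (1 / t) * (exp (- (1 / t)) * (1 / t\<^sup>2))) (at t)"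
      using 1 by (auto intro!: derivative_eq_intros DERIV_chain2[OF poly_DERIV] simp: field_simps power2_eq_square)
    moreover have "poly (pderiv P) (1 / t) * (- 1 / t\<^sup>2) * exp (- (1 / t)) + poly P (1 / t) * (exp (- (1 / t)) * (1 / t\<^sup>2)) = flat ?Q t"
      using 1 by (simp add: flat_def field_simps power2_eq_square)
    ultimately have "((\<lambda>t. poly P (1 / t) * exp (- (1 / t))) has_real_derivative flat ?Q t) (at t)" by simp
    then show ?thesis
      by (rule has_field_derivative_transform_within_open[of _ _ _ "{0<..}"]) (use 1 in \<open>auto simp: flat_def\<close>)
  next
    case 2
    have "((\<lambda>t. 0) has_real_derivative flat ?Q t) (at t)" using 2 by (simp add: flat_def)
    then show ?thesis
      by (rule has_field_derivative_transform_within_open[of _ _ _ "{..<0}"]) (use 2 in \<open>auto simp: flat_def\<close>)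
  next
    case 3
    have "((\<lambda>h. (flat P (0 + h) - flat P 0) / h) \<longlongrightarrow> 0) (at 0)"
    proof (rule filterlim_split_at)
      show "((\<lambda>h. (flat P (0 + h) - flat P 0) / h) \<longlongrightarrow> 0) (at_left 0)"
        by (rule tendsto_eventually) (auto simp: flat_def eventually_at_filter)
      have "((\<lambda>h. poly (pCons 0 P) (inverse h) * exp (- inverse h)) \<longlongrightarrow> 0) (at_right (0::real))"
        by (rule filterlim_compose[OF poly_times_exp_tendsto_0 filterlim_inverse_at_top_right])
      then show "((\<lambda>h. (flat P (0 + h) - flat P 0) / h) \<longlongrightarrow> 0) (at_right 0)"
        by (rule Lim_transform_eventually) (auto simp: flat_def eventually_at_filter field_simps)
    qed
    then show ?thesis using 3 by (simp add: DERIV_def flat_def)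
  qed
qed

lemma smooth_flat: "smooth (\<lambda>x::real^'n. flat P (\<alpha> * x $ i + \<beta>))"
proof -
  have d: "((\<lambda>x::real^'n. b * flat P (\<alpha> * x $ i + \<beta>)) has_derivative
       (\<lambda>h. b * (flat (pCons 0 (pCons 0 (P - pderiv P))) (\<alpha> * x $ i + \<beta>) * (\<alpha> * h $ i)))) (at x)" for b P x
  proof -
    have "((\<lambda>x::real^'n. \<alpha> * x $ i + \<beta>) has_derivative (\<lambda>h. \<alpha> * h $ i)) (at x)"
      by (auto intro!: derivative_eq_intros bounded_linear_imp_has_derivative bounded_linear_vec_nth)
    from has_derivative_compose[OF this flat_has_derivative[of P "\<alpha> * x $ i + \<beta>", unfolded has_field_derivative_def]]
    show ?thesis by (intro has_derivative_mult_right)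
  qed
  show ?thesis
  proof (rule smooth_coinduct[where K="\<lambda>g. \<exists>b P. g = (\<lambda>x. b * flat P (\<alpha> * x $ i + \<beta>))"])
    show "\<exists>b P'. (\<lambda>x. flat P (\<alpha> * x $ i + \<beta>)) = (\<lambda>x. b * flat P' (\<alpha> * x $ i + \<beta>))"
      by (intro exI[of _ 1] exI[of _ P]) simp
  next
    fix g :: "real^'n \<Rightarrow> real" and x assume "\<exists>b P. g = (\<lambda>x. b * flat P (\<alpha> * x $ i + \<beta>))"
    then obtain b P where g: "g = (\<lambda>x. b * flat P (\<alpha> * x $ i + \<beta>))" by (elim exE)
    show "g differentiable (at x)" unfolding g differentiable_def using d by (intro exI)
  next
    fix g :: "real^'n \<Rightarrow> real" and j assume "\<exists>b P. g = (\<lambda>x. b * flat P (\<alpha> * x $ i + \<beta>))"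
    then obtain b P where g: "g = (\<lambda>x. b * flat P (\<alpha> * x $ i + \<beta>))" by (elim exE)
    have "pderiv_at j g = (\<lambda>x. (b * \<alpha> * axis j 1 $ i) * flat (pCons 0 (pCons 0 (P - pderiv P))) (\<alpha> * x $ i + \<beta>))"
      unfolding g by (rule ext, subst pderiv_eqI[OF d]) simp
    then show "\<exists>b P. pderiv_at j g = (\<lambda>x. b * flat P (\<alpha> * x $ i + \<beta>))" by (intro exI)
  qed
qed

text \<open>A product of one-dimensional bumps \<open>flat 1 (x - a) * flat 1 (b - x)\<close> over
  the coordinates is positive exactly on an open box. Its integral is positive because the box is
  not a null set, so it can be normalised.\<close>

lemma test_function_exists:
  fixes U :: "(real^'n) set"
  assumes "open U" "U \<noteq> {}"
  obtains \<eta> where "\<eta> \<in> test_functions U" "\<And>x. \<eta> x \<ge> 0" "(\<integral>x. \<eta> x \<partial>lborel) = 1"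
proof -
  obtain x0 where "x0 \<in> U" using assms by blast
  then obtain a b where ab: "cbox a b \<subseteq> U" "x0 \<in> box a b" using open_contains_cbox[OF assms(1)] by metis
  define f where "f = (\<lambda>x::real^'n. \<Prod>i\<in>UNIV. flat 1 (x $ i - a $ i) * flat 1 (b $ i - x $ i))"
  have sm: "smooth f" unfolding f_def
  proof (intro smooth_prod smooth_mult)
    fix i
    show "smooth (\<lambda>x. flat 1 (x $ i - a $ i))" using smooth_flat[of 1 1 i "- a $ i"] by simp
    show "smooth (\<lambda>x. flat 1 (b $ i - x $ i))" using smooth_flat[of 1 "-1" i "b $ i"] by simp
  qed
  have fb: "f x > 0" if "x \<in> box a b" for x
    using that unfolding f_def by (intro prod_pos) (auto simp: flat_def mem_box_cart)
  have f0: "f x = 0" if "x \<notin> box a b" for x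
  proof -
    obtain i where "\<not> (a $ i < x $ i \<and> x $ i < b $ i)" using \<open>x \<notin> box a b\<close> by (auto simp: mem_box_cart)
    then have "flat 1 (x $ i - a $ i) * flat 1 (b $ i - x $ i) = 0" by (auto simp: flat_def)
    then show ?thesis unfolding f_def by (intro prod_zero) auto
  qed
  have nn: "f x \<ge> 0" for x using fb[of x] f0[of x] by (cases "x \<in> box a b") auto
  have cl: "closure {x. f x \<noteq> 0} \<subseteq> cbox a b"
    using f0 box_subset_cbox[of a b] by (intro closure_minimal) (auto simp: closed_cbox)
  have cpt: "compact (closure {x. f x \<noteq> 0})"
    using cl compact_Int_closed[OF compact_cbox closed_closure, of a b "{x. f x \<noteq> 0}"] by (simp add: Int_absorb1)
  have eq: "f = (\<lambda>x. indicator (cbox a b) x *\<^sub>R f x)"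
    using f0 box_subset_cbox[of a b] by (auto simp: indicator_def fun_eq_iff)
  have int: "integrable lborel f"
    using borel_integrable_compact[OF compact_cbox smooth_continuous[OF sm, of "cbox a b"]] eq by (simp add: indicator_scaleR_eq_if)
  have pos: "(\<integral>x. f x \<partial>lborel) > 0"
  proof -
    have "(\<integral>x. f x \<partial>lborel) \<noteq> 0"
    proof
      assume "(\<integral>x. f x \<partial>lborel) = 0"
      then have "AE x in lborel. f x = 0"
        using integral_nonneg_eq_0_iff_AE[OF int] nn by simp
      then have "AE x in lborel. x \<notin> box a b" by eventually_elim (use fb in force)
      then have "emeasure lborel (box a b) = 0" by (subst (asm) AE_iff_measurable[of "box a b"]) auto
      moreover have "emeasure lborel (box a b) > 0"
      proof -
        have lt: "a \<bullet> i < b \<bullet> i" if "i \<in> Basis" for i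
          using ab(2) that unfolding mem_box by (meson order_less_trans)
        then have "0 < (\<Prod>i\<in>Basis. (b - a) \<bullet> i)" by (intro prod_pos) (simp add: inner_diff_left)
        then show ?thesis using lt by (simp add: emeasure_lborel_box_eq less_imp_le)
      qed
      ultimately show False by simp
    qed
    moreover have "(\<integral>x. f x \<partial>lborel) \<ge> 0" by (intro Bochner_Integration.integral_nonneg nn)
    ultimately show ?thesis by simp
  qed
  define c where "c = inverse (\<integral>x. f x \<partial>lborel)"
  show thesis
  proof (rule that[of "\<lambda>x. c * f x"])
    have "{x. c * f x \<noteq> 0} = {x. f x \<noteq> 0}" using pos by (auto simp: c_def)
    then show "(\<lambda>x. c * f x) \<in> test_functions U"
      unfolding test_functions_def using cpt cl ab(1) smooth_cmult[OF sm] by auto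
    show "c * f x \<ge> 0" for x using pos nn by (simp add: c_def)
    show "(\<integral>x. c * f x \<partial>lborel) = 1" using pos by (simp add: c_def)
  qed
qed

section \<open>Integral operators with smooth kernels\<close>

text \<open>No domain is prescribed, unlike for test functions. Compact support makes values,
  Lipschitz constants and Taylor remainders bounded uniformly in the point.\<close>

definition csmooth :: "(real^'n \<Rightarrow> real) \<Rightarrow> bool" where
  "csmooth f \<longleftrightarrow> smooth f \<and> compact (closure {x. f x \<noteq> 0})"

lemma csmooth_bounded:
  assumes "csmooth f" shows "\<exists>K. \<forall>x. \<bar>f x\<bar> \<le> K"
proof -
  let ?S = "closure {x. f x \<noteq> 0}"
  have "compact (f ` ?S)"
    using assms unfolding csmooth_def by (intro compact_continuous_image smooth_continuous) auto
  then obtain K where K: "\<forall>y\<in>f ` ?S. \<bar>y\<bar> \<le> K"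
    using compact_imp_bounded[of "f ` ?S"] unfolding bounded_iff by auto
  have "\<bar>f x\<bar> \<le> \<bar>K\<bar>" for x
  proof (cases "f x = 0")
    case False
    then have "x \<in> ?S" using closure_subset[of "{x. f x \<noteq> 0}"] by auto
    then have "\<bar>f x\<bar> \<le> K" using K by (intro bspec[OF K] imageI)
    then show ?thesis by simp
  qed simp
  then show ?thesis by blast
qed

lemma csmooth_pderiv:
  assumes "csmooth f" shows "csmooth (pderiv_at i f)"
proof -
  have "pderiv_at i f x = 0" if "x \<notin> closure {x. f x \<noteq> 0}" for x
  proof -
    have "((\<lambda>x. 0) has_derivative (\<lambda>h. 0)) (at x)" by simp
    then have "(f has_derivative (\<lambda>h. 0)) (at x)"
      by (rule has_derivative_transform_within_open[of _ _ _ _ "- closure {x. f x \<noteq> 0}"])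
         (use that closure_subset[of "{x. f x \<noteq> 0}"] in \<open>auto simp: subset_iff\<close>)
    then show ?thesis using pderiv_eqI by metis
  qed
  then have "closure {x. pderiv_at i f x \<noteq> 0} \<subseteq> closure {x. f x \<noteq> 0}"
    by (intro closure_minimal) auto
  then show ?thesis
    using assms unfolding csmooth_def
    by (metis closed_closure compact_Int_closed inf.absorb_iff2 smooth_pderiv)
qed

lemma csmooth_lipschitz:
  assumes "csmooth f" shows "\<exists>K\<ge>0. \<forall>x y. \<bar>f y - f x\<bar> \<le> K * norm (y - x)"
proof -
  have sm: "smooth f" using assms csmooth_def by blast
  have "\<forall>i. \<exists>K. \<forall>x. \<bar>pderiv_at i f x\<bar> \<le> K" using csmooth_bounded csmooth_pderiv assms by blast
  then obtain K where K: "\<And>i x. \<bar>pderiv_at i f x\<bar> \<le> K i" by metis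
  have "norm (grad f x) \<le> (\<Sum>i\<in>UNIV. K i)" for x
    using norm_le_l1_cart[of "grad f x"] K by (intro order_trans[OF norm_le_l1_cart] sum_mono) (simp add: grad_def)
  then have g: "\<bar>grad f x \<bullet> h\<bar> \<le> (\<Sum>i\<in>UNIV. K i) * norm h" for x h
    by (meson Cauchy_Schwarz_ineq2 mult_right_mono norm_ge_zero order_trans)
  have "\<bar>f y - f x\<bar> \<le> (\<Sum>i\<in>UNIV. K i) * norm (y - x)" for x y
  proof -
    have "((\<lambda>s. f (x + s *\<^sub>R (y - x))) has_real_derivative grad f (x + t *\<^sub>R (y - x)) \<bullet> (y - x)) (at t)" for t
      by (rule has_real_derivative_along[OF smooth_differentiable[OF sm]])
    from MVT2[of 0 1 "\<lambda>s. f (x + s *\<^sub>R (y - x))", OF _ this]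
    obtain z where "f (x + 1 *\<^sub>R (y - x)) - f (x + 0 *\<^sub>R (y - x)) = (1 - 0) * (grad f (x + z *\<^sub>R (y - x)) \<bullet> (y - x))"
      by auto
    then show ?thesis using g by simp
  qed
  moreover have "(\<Sum>i\<in>UNIV. K i) \<ge> 0" using K by (intro sum_nonneg) (meson abs_ge_zero order_trans)
  ultimately show ?thesis by blast
qed

text \<open>The mean value theorem on the segment, combined with the Lipschitz bound for the
  gradient. The constant is the same for all points, so the remainder can be integrated against a
  merely integrable function.\<close>

lemma csmooth_taylor:
  assumes "csmooth f" shows "\<exists>K\<ge>0. \<forall>x y. \<bar>f y - f x - grad f x \<bullet> (y - x)\<bar> \<le> K * (norm (y - x))\<^sup>2"
proof -
  have sm: "smooth f" using assms csmooth_def by blast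
  have "\<forall>i. \<exists>K\<ge>0. \<forall>x y. \<bar>pderiv_at i f y - pderiv_at i f x\<bar> \<le> K * norm (y - x)"
    using csmooth_lipschitz csmooth_pderiv assms by blast
  then obtain K where K: "\<And>i. K i \<ge> 0" "\<And>i x y. \<bar>pderiv_at i f y - pderiv_at i f x\<bar> \<le> K i * norm (y - x)" by metis
  let ?K = "\<Sum>i\<in>UNIV. K i"
  have K0: "?K \<ge> 0" using K by (intro sum_nonneg) auto
  have "norm (grad f y - grad f x) \<le> ?K * norm (y - x)" for x y
    unfolding sum_distrib_right
    using K by (intro order_trans[OF norm_le_l1_cart] sum_mono) (simp add: grad_def)
  then have g: "\<bar>(grad f y - grad f x) \<bullet> h\<bar> \<le> ?K * norm (y - x) * norm h" for x y h
    by (meson Cauchy_Schwarz_ineq2 mult_right_mono norm_ge_zero order_trans)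
  have "\<bar>f y - f x - grad f x \<bullet> (y - x)\<bar> \<le> ?K * (norm (y - x))\<^sup>2" for x y
  proof -
    have "((\<lambda>s. f (x + s *\<^sub>R (y - x))) has_real_derivative grad f (x + t *\<^sub>R (y - x)) \<bullet> (y - x)) (at t)" for t
      by (rule has_real_derivative_along[OF smooth_differentiable[OF sm]])
    from MVT2[of 0 1 "\<lambda>s. f (x + s *\<^sub>R (y - x))", OF _ this]
    obtain z where z: "0 < z" "z < 1"
      "f (x + 1 *\<^sub>R (y - x)) - f (x + 0 *\<^sub>R (y - x)) = (1 - 0) * (grad f (x + z *\<^sub>R (y - x)) \<bullet> (y - x))"
      by auto
    then have "\<bar>f y - f x - grad f x \<bullet> (y - x)\<bar> = \<bar>(grad f (x + z *\<^sub>R (y - x)) - grad f x) \<bullet> (y - x)\<bar>"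
      by (simp add: inner_diff_left)
    also have "\<dots> \<le> ?K * norm (z *\<^sub>R (y - x)) * norm (y - x)" using g[of "x + z *\<^sub>R (y - x)" x "y - x"] by simp
    also have "\<dots> \<le> ?K * norm (y - x) * norm (y - x)"
      using z K0 by (intro mult_right_mono mult_left_mono) (auto simp: mult_left_le_one_le)
    finally show ?thesis by (simp add: power2_eq_square mult.assoc)
  qed
  then show ?thesis using K0 by blast
qed

lemma csmooth_measurable [measurable_dest]: "csmooth f \<Longrightarrow> f \<in> borel_measurable borel"
  unfolding csmooth_def by (intro borel_measurable_continuous_onI smooth_continuous) auto

lemma integrable_mult_csmooth:
  fixes u :: "real^'n \<Rightarrow> real"
  assumes "integrable lborel u" "csmooth f" "\<phi> \<in> borel \<rightarrow>\<^sub>M borel"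
  shows "integrable lborel (\<lambda>z. u z * f (\<phi> z))"
proof -
  note [measurable] = csmooth_measurable[OF assms(2)] assms(3)
  obtain K where K: "\<And>x. \<bar>f x\<bar> \<le> K" using csmooth_bounded assms(2) by blast
  have [measurable]: "u \<in> borel_measurable borel" using borel_measurable_integrable[OF assms(1)] by simp
  show ?thesis
  proof (rule Bochner_Integration.integrable_bound)
    show "integrable lborel (\<lambda>z. K * u z)" using assms(1) by simp
    show "AE z in lborel. norm (u z * f (\<phi> z)) \<le> norm (K * u z)"
    proof (rule AE_I2)
      fix z
      have "\<bar>f (\<phi> z)\<bar> \<le> \<bar>K\<bar>" using K[of "\<phi> z"] by linarith
      then show "norm (u z * f (\<phi> z)) \<le> norm (K * u z)"
        using mult_left_mono[of "\<bar>f (\<phi> z)\<bar>" "\<bar>K\<bar>" "\<bar>u z\<bar>"] by (simp add: abs_mult mult.commute)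
    qed
  qed measurable
qed

text \<open>Differentiation under the integral by the uniform Taylor bound: the remainder,
  integrated against \<open>\<bar>u z\<bar>\<close>, is at most \<open>M * norm (y - x) ^ 2\<close>.
  The derivative is an operator of the same form up to the factor \<open>a\<close>, so coinduction
  yields smoothness.\<close>

lemma kernel_operator:
  fixes u :: "real^'n \<Rightarrow> real"
  assumes u: "integrable lborel u" and \<phi>: "csmooth \<phi>"
  shows smooth_kernel_operator: "smooth (\<lambda>x. \<integral>z. u z * \<phi> (a *\<^sub>R x + b *\<^sub>R z) \<partial>lborel)"
    and pderiv_kernel_operator: "pderiv_at i (\<lambda>x. \<integral>z. u z * \<phi> (a *\<^sub>R x + b *\<^sub>R z) \<partial>lborel)
      = (\<lambda>x. a * (\<integral>z. u z * pderiv_at i \<phi> (a *\<^sub>R x + b *\<^sub>R z) \<partial>lborel))"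
proof -
  let ?F = "\<lambda>\<phi> x. \<integral>z. u z * \<phi> (a *\<^sub>R x + b *\<^sub>R z) \<partial>lborel"
  have int: "integrable lborel (\<lambda>z. u z * \<phi> (a *\<^sub>R x + b *\<^sub>R z))" if "csmooth \<phi>" for \<phi> x
    by (rule integrable_mult_csmooth[OF u that]) measurable
  have d: "(?F \<phi> has_derivative (\<lambda>h. \<Sum>i\<in>UNIV. (a * ?F (pderiv_at i \<phi>) x) * h $ i)) (at x)"
    if \<phi>: "csmooth \<phi>" for \<phi> x
  proof -
    obtain K where K: "K \<ge> 0" "\<And>x y. \<bar>\<phi> y - \<phi> x - grad \<phi> x \<bullet> (y - x)\<bar> \<le> K * (norm (y - x))\<^sup>2"
      using csmooth_taylor[OF \<phi>] by blast
    let ?D = "\<lambda>h. \<Sum>i\<in>UNIV. (a * ?F (pderiv_at i \<phi>) x) * h $ i"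
    define M where "M = K * a\<^sup>2 * (\<integral>z. \<bar>u z\<bar> \<partial>lborel)"
    have D: "?D h = (\<integral>z. u z * (grad \<phi> (a *\<^sub>R x + b *\<^sub>R z) \<bullet> (a *\<^sub>R h)) \<partial>lborel)"
      "integrable lborel (\<lambda>z. u z * (grad \<phi> (a *\<^sub>R x + b *\<^sub>R z) \<bullet> (a *\<^sub>R h)))" for h
    proof -
      have eq: "u z * (grad \<phi> y \<bullet> (a *\<^sub>R h)) = (\<Sum>i\<in>UNIV. (a * h $ i) * (u z * pderiv_at i \<phi> y))" for y z
        by (simp add: inner_vec_def grad_def sum_distrib_left algebra_simps)
      show "?D h = (\<integral>z. u z * (grad \<phi> (a *\<^sub>R x + b *\<^sub>R z) \<bullet> (a *\<^sub>R h)) \<partial>lborel)"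
        unfolding eq by (subst Bochner_Integration.integral_sum)
          (auto intro!: int csmooth_pderiv \<phi> sum.cong)
      show "integrable lborel (\<lambda>z. u z * (grad \<phi> (a *\<^sub>R x + b *\<^sub>R z) \<bullet> (a *\<^sub>R h)))"
        unfolding eq by (intro Bochner_Integration.integrable_sum integrable_mult_right int csmooth_pderiv \<phi>)
    qed
    have bound: "\<bar>?F \<phi> y - ?F \<phi> x - ?D (y - x)\<bar> \<le> M * (norm (y - x))\<^sup>2" for y
    proof -
      have "?F \<phi> y - ?F \<phi> x - ?D (y - x) = (\<integral>z. u z * \<phi> (a *\<^sub>R y + b *\<^sub>R z) - u z * \<phi> (a *\<^sub>R x + b *\<^sub>R z)
          - u z * (grad \<phi> (a *\<^sub>R x + b *\<^sub>R z) \<bullet> (a *\<^sub>R (y - x))) \<partial>lborel)"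
        unfolding D(1)
        by (subst Bochner_Integration.integral_diff[OF Bochner_Integration.integrable_diff[OF int[OF \<phi>] int[OF \<phi>]] D(2)],
            subst Bochner_Integration.integral_diff[OF int[OF \<phi>] int[OF \<phi>]]) (rule refl)
      also have "\<bar>\<dots>\<bar> \<le> (\<integral>z. K * a\<^sup>2 * (norm (y - x))\<^sup>2 * \<bar>u z\<bar> \<partial>lborel)"
      proof (rule integral_abs_bound_integral)
        show "\<bar>u z * \<phi> (a *\<^sub>R y + b *\<^sub>R z) - u z * \<phi> (a *\<^sub>R x + b *\<^sub>R z)
          - u z * (grad \<phi> (a *\<^sub>R x + b *\<^sub>R z) \<bullet> (a *\<^sub>R (y - x)))\<bar> \<le> K * a\<^sup>2 * (norm (y - x))\<^sup>2 * \<bar>u z\<bar>" for z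
        proof -
          have e: "a *\<^sub>R y + b *\<^sub>R z - (a *\<^sub>R x + b *\<^sub>R z) = a *\<^sub>R (y - x)" by (simp add: algebra_simps)
          have "\<bar>u z * \<phi> (a *\<^sub>R y + b *\<^sub>R z) - u z * \<phi> (a *\<^sub>R x + b *\<^sub>R z)
              - u z * (grad \<phi> (a *\<^sub>R x + b *\<^sub>R z) \<bullet> (a *\<^sub>R (y - x)))\<bar>
            = \<bar>u z\<bar> * \<bar>\<phi> (a *\<^sub>R y + b *\<^sub>R z) - \<phi> (a *\<^sub>R x + b *\<^sub>R z) - grad \<phi> (a *\<^sub>R x + b *\<^sub>R z) \<bullet> (a *\<^sub>R (y - x))\<bar>"
            by (simp add: abs_mult[symmetric] algebra_simps)
          also have "\<dots> \<le> \<bar>u z\<bar> * (K * (norm (a *\<^sub>R (y - x)))\<^sup>2)"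
            using K(2)[of "a *\<^sub>R y + b *\<^sub>R z" "a *\<^sub>R x + b *\<^sub>R z"] unfolding e by (intro mult_left_mono) auto
          finally show ?thesis unfolding norm_scaleR power_mult_distrib power2_abs by (simp add: mult_ac)
        qed
      next
        show "integrable lborel (\<lambda>z. u z * \<phi> (a *\<^sub>R y + b *\<^sub>R z) - u z * \<phi> (a *\<^sub>R x + b *\<^sub>R z)
          - u z * (grad \<phi> (a *\<^sub>R x + b *\<^sub>R z) \<bullet> (a *\<^sub>R (y - x))))"
          by (rule Bochner_Integration.integrable_diff[OF Bochner_Integration.integrable_diff[OF int[OF \<phi>] int[OF \<phi>]] D(2)])
        show "integrable lborel (\<lambda>z. K * a\<^sup>2 * (norm (y - x))\<^sup>2 * \<bar>u z\<bar>)" using u by simp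
      qed
      finally show ?thesis by (simp add: M_def algebra_simps)
    qed
    show ?thesis
    proof (rule has_derivativeI_sandwich[where e=1 and H="\<lambda>y. M * norm (y - x)"])
      show "bounded_linear ?D"
        by (intro bounded_linear_sum bounded_linear_const_mult bounded_linear_vec_nth)
      show "norm (?F \<phi> y - ?F \<phi> x - ?D (y - x)) / norm (y - x) \<le> M * norm (y - x)" if "y \<noteq> x" for y
        using bound[of y] that by (simp add: divide_le_eq power2_eq_square mult.assoc)
      have "((\<lambda>y. M * norm (y - x)) \<longlongrightarrow> M * norm (x - x)) (at x)"
        by (intro tendsto_intros)
      then show "((\<lambda>y. M * norm (y - x)) \<longlongrightarrow> 0) (at x)" by simp
    qed simp
  qed
  have pd: "pderiv_at i (?F \<phi>) = (\<lambda>x. a * ?F (pderiv_at i \<phi>) x)" if "csmooth \<phi>" for \<phi> i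
    by (rule ext, subst pderiv_eqI[OF d[OF that]]) (simp add: axis_def sum.delta' if_distrib[of "\<lambda>x. _ * x"] cong: if_cong)
  then show "pderiv_at i (?F \<phi>) = (\<lambda>x. a * ?F (pderiv_at i \<phi>) x)" using \<phi> by blast
  show "smooth (?F \<phi>)"
  proof (rule smooth_coinduct[where K="\<lambda>g. \<exists>c \<phi>. csmooth \<phi> \<and> g = (\<lambda>x. c * ?F \<phi> x)"])
    show "\<exists>c \<phi>'. csmooth \<phi>' \<and> ?F \<phi> = (\<lambda>x. c * ?F \<phi>' x)"
      using \<phi> by (intro exI[of _ 1] exI[of _ \<phi>]) simp
  next
    fix g :: "real^'n \<Rightarrow> real" and x assume "\<exists>c \<phi>. csmooth \<phi> \<and> g = (\<lambda>x. c * ?F \<phi> x)"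
    then obtain c \<phi> where g: "csmooth \<phi>" "g = (\<lambda>x. c * ?F \<phi> x)" by (elim exE conjE)
    have "?F \<phi> differentiable (at x)" unfolding differentiable_def using d[OF g(1)] by (intro exI)
    then show "g differentiable (at x)" unfolding g(2) by (intro differentiable_mult differentiable_const)
  next
    fix g :: "real^'n \<Rightarrow> real" and j assume "\<exists>c \<phi>. csmooth \<phi> \<and> g = (\<lambda>x. c * ?F \<phi> x)"
    then obtain c \<phi> where g: "csmooth \<phi>" "g = (\<lambda>x. c * ?F \<phi> x)" by (elim exE conjE)
    have "?F \<phi> differentiable (at x)" for x unfolding differentiable_def using d[OF g(1)] by (intro exI)
    then have "pderiv_at j g = (\<lambda>x. (c * a) * ?F (pderiv_at j \<phi>) x)"
      unfolding g(2) by (intro ext, subst pderiv_cmult) (simp_all add: pd[OF g(1)])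
    then show "\<exists>c \<phi>. csmooth \<phi> \<and> pderiv_at j g = (\<lambda>x. c * ?F \<phi> x)"
      using csmooth_pderiv[OF g(1)] by (intro exI conjI)
  qed
qed

section \<open>Square-integrable functions\<close>

lemma L2_measurable: "f \<in> L2 M \<Longrightarrow> f \<in> borel_measurable M"
  and L2_integrable_sq: "f \<in> L2 M \<Longrightarrow> integrable M (\<lambda>x. (f x)\<^sup>2)"
  unfolding L2_def by auto

lemma L2_integrable_mult:
  assumes "f \<in> L2 M" "g \<in> L2 M" shows "integrable M (\<lambda>x. f x * g x)"
proof (rule Bochner_Integration.integrable_bound)
  show "integrable M (\<lambda>x. (f x)\<^sup>2 + (g x)\<^sup>2)" using assms L2_integrable_sq by (intro Bochner_Integration.integrable_add) auto
  show "(\<lambda>x. f x * g x) \<in> borel_measurable M" using assms L2_measurable by (intro borel_measurable_times) auto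
  show "AE x in M. norm (f x * g x) \<le> norm ((f x)\<^sup>2 + (g x)\<^sup>2)"
  proof (rule AE_I2)
    fix x
    have "0 \<le> (\<bar>f x\<bar> - \<bar>g x\<bar>)\<^sup>2" by simp
    then have "2 * (\<bar>f x\<bar> * \<bar>g x\<bar>) \<le> (f x)\<^sup>2 + (g x)\<^sup>2" by (simp add: power2_diff)
    moreover have "0 \<le> \<bar>f x\<bar> * \<bar>g x\<bar>" by simp
    ultimately have "\<bar>f x * g x\<bar> \<le> (f x)\<^sup>2 + (g x)\<^sup>2" unfolding abs_mult by linarith
    then show "norm (f x * g x) \<le> norm ((f x)\<^sup>2 + (g x)\<^sup>2)" by simp
  qed
qed

lemma L2_add: assumes "f \<in> L2 M" "g \<in> L2 M" shows "(\<lambda>x. f x + g x) \<in> L2 M"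
proof -
  have "integrable M (\<lambda>x. (f x)\<^sup>2 + (g x)\<^sup>2 + 2 * (f x * g x))"
    using assms by (intro Bochner_Integration.integrable_add integrable_mult_right L2_integrable_mult L2_integrable_sq)
  then show ?thesis using assms borel_measurable_add[of f M g] unfolding L2_def by (simp add: power2_sum mult.assoc)
qed

lemma L2_cmult: "f \<in> L2 M \<Longrightarrow> (\<lambda>x. c * f x) \<in> L2 M"
  unfolding L2_def by (auto simp: power_mult_distrib)

lemma L2_diff: assumes "f \<in> L2 M" "g \<in> L2 M" shows "(\<lambda>x. f x - g x) \<in> L2 M"
  using L2_add[OF assms(1) L2_cmult[OF assms(2), of "-1"]] by simp

lemma L2_zero: "(\<lambda>x. 0) \<in> L2 M"
  unfolding L2_def by simp

lemma L2_sum: "(\<And>a. a \<in> A \<Longrightarrow> f a \<in> L2 M) \<Longrightarrow> (\<lambda>x. \<Sum>a\<in>A. f a x) \<in> L2 M"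
  by (induction A rule: infinite_finite_induct) (auto intro: L2_add L2_zero)

lemma L2_cong_AE:
  assumes "f \<in> L2 M" "g \<in> borel_measurable M" "AE x in M. f x = g x" shows "g \<in> L2 M"
proof -
  have "integrable M (\<lambda>x. (g x)\<^sup>2)"
  proof (rule integrable_cong_AE_imp[OF L2_integrable_sq[OF assms(1)]])
    show "(\<lambda>x. (g x)\<^sup>2) \<in> borel_measurable M" using assms(2) by measurable
    show "AE x in M. (f x)\<^sup>2 = (g x)\<^sup>2" using assms(3) by eventually_elim simp
  qed
  then show ?thesis using assms(2) unfolding L2_def by simp
qed

lemma L2_integrable: assumes "finite_measure M" "f \<in> L2 M" shows "integrable M f"
proof -
  interpret finite_measure M by fact
  have "(\<lambda>x. 1) \<in> L2 M" unfolding L2_def by simp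
  from L2_integrable_mult[OF assms(2) this] show ?thesis by simp
qed

lemma L2_Cauchy_Schwarz:
  assumes "f \<in> L2 M" "g \<in> L2 M"
  shows "(\<integral>x. f x * g x \<partial>M)\<^sup>2 \<le> (\<integral>x. (f x)\<^sup>2 \<partial>M) * (\<integral>x. (g x)\<^sup>2 \<partial>M)"
proof -
  let ?a = "\<integral>x. (f x)\<^sup>2 \<partial>M" and ?b = "\<integral>x. f x * g x \<partial>M" and ?c = "\<integral>x. (g x)\<^sup>2 \<partial>M"
  note i = L2_integrable_sq[OF assms(1)] L2_integrable_sq[OF assms(2)] L2_integrable_mult[OF assms]
  have c: "?c \<ge> 0" by (intro Bochner_Integration.integral_nonneg) auto
  have quad: "0 \<le> ?a - 2 * t * ?b + t\<^sup>2 * ?c" for t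
  proof -
    have "(\<lambda>x. (f x - t * g x)\<^sup>2) = (\<lambda>x. (f x)\<^sup>2 - 2 * t * (f x * g x) + t\<^sup>2 * (g x)\<^sup>2)"
      by (auto simp: power2_diff power_mult_distrib fun_eq_iff)
    then have "(\<integral>x. (f x - t * g x)\<^sup>2 \<partial>M) = ?a - 2 * t * ?b + t\<^sup>2 * ?c"
      using i by simp
    moreover have "0 \<le> (\<integral>x. (f x - t * g x)\<^sup>2 \<partial>M)"
      by (intro Bochner_Integration.integral_nonneg) auto
    ultimately show ?thesis by simp
  qed
  show ?thesis
  proof (cases "?c = 0")
    case True
    have "?b = 0"
    proof (rule ccontr)
      assume b: "?b \<noteq> 0"
      \<comment> \<open>For \<open>?c = 0\<close> the quadratic is affine in \<open>t\<close>; this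
        value of \<open>t\<close> would make it equal to \<open>-1\<close>.\<close>
      have "0 \<le> ?a - 2 * ((?a + 1) / (2 * ?b)) * ?b" using quad[of "(?a + 1) / (2 * ?b)"] True by simp
      then show False using b by (simp add: field_simps)
    qed
    then show ?thesis using True by simp
  next
    case False
    then have "?c > 0" using c by (metis order_le_less)
    have "0 \<le> ?a - 2 * (?b / ?c) * ?b + (?b / ?c)\<^sup>2 * ?c" by (rule quad)
    also have "\<dots> = ?a - ?b\<^sup>2 / ?c" using \<open>?c > 0\<close> by (simp add: field_simps power2_eq_square)
    finally show ?thesis using \<open>?c > 0\<close> by (simp add: field_simps)
  qed
qed

text \<open>Cauchy-Schwarz applied to \<open>f j - f0\<close>. Each integral against a fixed
  polynomial passes to the limit in this way.\<close>

lemma L2_tendsto_mult: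
  assumes "\<And>j. f j \<in> L2 M" "f0 \<in> L2 M" "g \<in> L2 M"
    and "(\<lambda>j. \<integral>x. (f j x - f0 x)\<^sup>2 \<partial>M) \<longlonglongrightarrow> 0"
  shows "(\<lambda>j. \<integral>x. f j x * g x \<partial>M) \<longlonglongrightarrow> (\<integral>x. f0 x * g x \<partial>M)"
proof -
  let ?d = "\<lambda>j. \<integral>x. (f j x - f0 x) * g x \<partial>M"
  have "(\<lambda>j. (?d j)\<^sup>2) \<longlonglongrightarrow> 0"
  proof (rule tendsto_sandwich[of "\<lambda>_. 0"])
    show "\<forall>\<^sub>F j in sequentially. (?d j)\<^sup>2 \<le> (\<integral>x. (f j x - f0 x)\<^sup>2 \<partial>M) * (\<integral>x. (g x)\<^sup>2 \<partial>M)"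
      by (intro always_eventually allI L2_Cauchy_Schwarz L2_diff assms)
    show "(\<lambda>j. (\<integral>x. (f j x - f0 x)\<^sup>2 \<partial>M) * (\<integral>x. (g x)\<^sup>2 \<partial>M)) \<longlonglongrightarrow> 0"
      by (rule tendsto_mult_left_zero[OF assms(4)])
  qed auto
  then have "(\<lambda>j. sqrt ((?d j)\<^sup>2)) \<longlonglongrightarrow> sqrt 0" by (rule tendsto_real_sqrt)
  then have "?d \<longlonglongrightarrow> 0" by (simp add: tendsto_rabs_zero_iff)
  moreover have "?d = (\<lambda>j. (\<integral>x. f j x * g x \<partial>M) - (\<integral>x. f0 x * g x \<partial>M))"
    using assms by (simp add: left_diff_distrib L2_integrable_mult)
  ultimately show ?thesis by (simp add: LIM_zero_iff)
qed

lemma L2_dist_triangle: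
  assumes "f \<in> L2 M" "g \<in> L2 M" "h \<in> L2 M"
  shows "(\<integral>x. (f x - h x)\<^sup>2 \<partial>M) \<le> 2 * (\<integral>x. (f x - g x)\<^sup>2 \<partial>M) + 2 * (\<integral>x. (g x - h x)\<^sup>2 \<partial>M)"
proof -
  have "(\<integral>x. (f x - h x)\<^sup>2 \<partial>M) \<le> (\<integral>x. 2 * (f x - g x)\<^sup>2 + 2 * (g x - h x)\<^sup>2 \<partial>M)"
  proof (intro integral_mono Bochner_Integration.integrable_add integrable_mult_right L2_integrable_sq L2_diff assms)
    fix x
    have "0 \<le> ((f x - g x) - (g x - h x))\<^sup>2" by simp
    then show "(f x - h x)\<^sup>2 \<le> 2 * (f x - g x)\<^sup>2 + 2 * (g x - h x)\<^sup>2"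
      by (simp add: power2_eq_square algebra_simps)
  qed
  also have "\<dots> = 2 * (\<integral>x. (f x - g x)\<^sup>2 \<partial>M) + 2 * (\<integral>x. (g x - h x)\<^sup>2 \<partial>M)"
    using assms by (simp add: L2_integrable_sq L2_diff)
  finally show ?thesis .
qed

lemma L2_lborel_restrict:
  fixes T :: "'a::euclidean_space set" and h :: "'a \<Rightarrow> 'b::{banach, second_countable_topology}"
  assumes "T \<in> sets borel" "h \<in> borel_measurable borel"
  shows integral_lebesgue_on_lborel: "(\<integral>x. h x \<partial>lebesgue_on T) = (\<integral>x. indicator T x *\<^sub>R h x \<partial>lborel)"
    and integrable_lebesgue_on_lborel: "integrable (lebesgue_on T) h \<longleftrightarrow> integrable lborel (\<lambda>x. indicator T x *\<^sub>R h x)"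
proof -
  have m: "(\<lambda>x. indicator T x *\<^sub>R h x) \<in> borel_measurable lborel" using assms by simp
  have T: "T \<inter> space lebesgue \<in> sets lebesgue" using assms(1) by auto
  show "(\<integral>x. h x \<partial>lebesgue_on T) = (\<integral>x. indicator T x *\<^sub>R h x \<partial>lborel)"
    unfolding integral_restrict_space[OF T] by (rule integral_completion[OF m])
  show "integrable (lebesgue_on T) h \<longleftrightarrow> integrable lborel (\<lambda>x. indicator T x *\<^sub>R h x)"
    unfolding integrable_restrict_space[OF T] by (rule integrable_completion[OF m])
qed

lemma borel_measurable_lebesgue_on: "h \<in> borel_measurable borel \<Longrightarrow> h \<in> borel_measurable (lebesgue_on T)"
  by (intro measurable_restrict_space1) (simp add: measurable_completion)

text \<open>Members of \<open>L2 (lebesgue_on T)\<close> are only Lebesgue measurable, and arbitrary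
  off \<open>T\<close>. Fubini and affine substitution are applied to this Borel representative,
  which vanishes outside \<open>T\<close>.\<close>

definition L2_rep :: "'a::euclidean_space set \<Rightarrow> ('a \<Rightarrow> real) \<Rightarrow> ('a \<Rightarrow> real) \<Rightarrow> bool" where
  "L2_rep T u u' \<longleftrightarrow> u' \<in> borel_measurable borel \<and> (\<forall>x. x \<notin> T \<longrightarrow> u' x = 0) \<and>
     (AE x in lebesgue_on T. u x = u' x) \<and> integrable lborel (\<lambda>x. (u' x)\<^sup>2) \<and> integrable lborel u'"

lemma L2_rep_exists:
  fixes T :: "'a::euclidean_space set"
  assumes "compact T" "u \<in> L2 (lebesgue_on T)"
  shows "\<exists>u'. L2_rep T u u'"
proof -
  have T: "T \<in> sets borel" using assms(1) by (simp add: borel_compact)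
  then have T': "T \<inter> space lebesgue \<in> sets lebesgue" "T \<in> sets lebesgue" by auto
  have eq: "(\<lambda>x. indicator T x *\<^sub>R u x) = (\<lambda>x. if x \<in> T then u x else 0)"
    by (simp add: fun_eq_iff indicator_def)
  have "(\<lambda>x. if x \<in> T then u x else 0) \<in> borel_measurable lebesgue"
    using L2_measurable[OF assms(2)] unfolding borel_measurable_restrict_space_iff[OF T'(1)] eq .
  then obtain v where v: "v \<in> borel_measurable lborel" "AE x in lborel. (if x \<in> T then u x else 0) = v x"
    using completion_ex_borel_measurable_real by blast
  define u' where "u' = (\<lambda>x. indicator T x * v x)"
  have m: "u' \<in> borel_measurable borel" unfolding u'_def using v(1) T by simp
  have "AE x in lborel. x \<in> T \<longrightarrow> u x = u' x" using v(2) by eventually_elim (auto simp: u'_def)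
  then have ae: "AE x in lebesgue_on T. u x = u' x"
    unfolding AE_restrict_space_iff[OF T'(1)] by (simp add: AE_completion_iff)
  have L: "u' \<in> L2 (lebesgue_on T)"
    by (rule L2_cong_AE[OF assms(2) borel_measurable_lebesgue_on[OF m] ae])
  have ind: "(\<lambda>x. indicator T x *\<^sub>R (u' x)\<^sup>2) = (\<lambda>x. (u' x)\<^sup>2)" "(\<lambda>x. indicator T x *\<^sub>R u' x) = u'"
    by (auto simp: u'_def indicator_def fun_eq_iff)
  have "integrable lborel (\<lambda>x. (u' x)\<^sup>2)"
    using L2_integrable_sq[OF L] integrable_lebesgue_on_lborel[OF T, of "\<lambda>x. (u' x)\<^sup>2"] m unfolding ind by simp
  moreover have "finite_measure (lebesgue_on T)"
    using assms(1) by (intro finite_measure_lebesgue_on) (rule lmeasurable_compact)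
  then have "integrable lborel u'"
    using L2_integrable[OF _ L] integrable_lebesgue_on_lborel[OF T m] unfolding ind by simp
  moreover have "\<forall>x. x \<notin> T \<longrightarrow> u' x = 0" by (simp add: u'_def)
  ultimately show ?thesis unfolding L2_rep_def using m ae by blast
qed

lemma L2_rep_integral:
  fixes T :: "'a::euclidean_space set"
  assumes "L2_rep T u u'" "T \<in> sets borel" "g \<in> borel_measurable borel" "u \<in> L2 (lebesgue_on T)"
  shows "(\<integral>x. u x * g x \<partial>lebesgue_on T) = (\<integral>x. u' x * g x \<partial>lborel)"
proof -
  have u': "u' \<in> borel_measurable borel" using assms(1) unfolding L2_rep_def by blast
  have "(\<integral>x. u x * g x \<partial>lebesgue_on T) = (\<integral>x. u' x * g x \<partial>lebesgue_on T)"
  proof (rule integral_cong_AE)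
    show "AE x in lebesgue_on T. u x * g x = u' x * g x"
      using assms(1) unfolding L2_rep_def by (auto elim!: eventually_mono)
  qed (intro borel_measurable_times L2_measurable assms borel_measurable_lebesgue_on u')+
  also have "\<dots> = (\<integral>x. indicator T x *\<^sub>R (u' x * g x) \<partial>lborel)"
    using assms u' by (intro integral_lebesgue_on_lborel) auto
  also have "\<dots> = (\<integral>x. u' x * g x \<partial>lborel)"
    using assms(1) unfolding L2_rep_def by (intro Bochner_Integration.integral_cong) (auto simp: indicator_def)
  finally show ?thesis .
qed

section \<open>Density of continuous functions\<close>

text \<open>Induction over integrable functions. For an indicator, Urysohn's lemma interpolates
  between a closed set inside and an open set around \<open>A\<close>; the error is supported in the
  difference of the two sets.\<close>

lemma L1_dense_continuous:
  fixes f :: "'a::euclidean_space \<Rightarrow> real"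
  assumes "integrable lborel f"
  shows "\<forall>\<delta>>0. \<exists>g. continuous_on UNIV g \<and> integrable lborel g \<and> (\<integral>x. \<bar>f x - g x\<bar> \<partial>lborel) < \<delta>"
  using assms
proof (induction f rule: integrable_induct)
  case (base A c)
  show ?case
  proof (intro allI impI)
    fix \<delta> :: real assume "\<delta> > 0"
    \<comment> \<open>The error will be at most \<open>\<bar>c\<bar> * (2 * e)\<close>, which this
      choice puts strictly below \<open>\<delta>\<close>, also for \<open>c = 0\<close>.\<close>
    define e where "e = \<delta> / (2 * (\<bar>c\<bar> + 1))"
    have e: "e > 0" using \<open>\<delta> > 0\<close> by (simp add: e_def)
    have A: "A \<in> sets lebesgue" "A \<in> sets borel" using base(1) by auto
    obtain U where U: "open U" "A \<subseteq> U" "emeasure lebesgue (U - A) < ennreal e"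
      using sets_lebesgue_outer_open[OF A(1) e] by metis
    obtain K where K: "closed K" "K \<subseteq> A" "emeasure lebesgue (A - K) < ennreal e"
      using sets_lebesgue_inner_closed[OF A(1) e] by metis
    have UA: "emeasure lborel (U - A) < ennreal e" and AK: "emeasure lborel (A - K) < ennreal e"
      using U K A(2) by (simp_all add: emeasure_completion)
    obtain h :: "'a \<Rightarrow> real" where h: "continuous_on UNIV h" "\<And>x. h x \<in> closed_segment 1 0"
      "\<And>x. x \<in> K \<Longrightarrow> h x = 1" "\<And>x. x \<in> - U \<Longrightarrow> h x = 0"
      using Urysohn[of K "- U" 1 0] K U by auto
    have h01: "0 \<le> h x" "h x \<le> 1" for x using h(2)[of x] by (auto simp: closed_segment_eq_real_ivl)
    have hm [measurable]: "h \<in> borel_measurable borel" using h(1) by (rule borel_measurable_continuous_onI)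
    have Um [measurable]: "U \<in> sets borel" and Km [measurable]: "K \<in> sets borel" and Am [measurable]: "A \<in> sets borel"
      using U K A by auto
    have "emeasure lborel (U - K) \<le> emeasure lborel ((U - A) \<union> (A - K))" by (intro emeasure_mono) auto
    also have "\<dots> \<le> emeasure lborel (U - A) + emeasure lborel (A - K)" by (intro emeasure_subadditive) auto
    also have "\<dots> < ennreal e + ennreal e" using UA AK by (intro add_strict_mono)
    also have "\<dots> = ennreal (2 * e)" using e by (simp add: ennreal_plus[symmetric] del: ennreal_plus)
    finally have UK: "emeasure lborel (U - K) < ennreal (2 * e)" .
    have "emeasure lborel U \<le> emeasure lborel (A \<union> (U - A))" by (intro emeasure_mono) auto
    also have "\<dots> \<le> emeasure lborel A + emeasure lborel (U - A)" by (intro emeasure_subadditive) auto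
    also have "\<dots> < \<infinity>" using base(2) UA by (auto simp: less_top[symmetric])
    finally have Ufin: "emeasure lborel U < \<infinity>" .
    have hint: "integrable lborel h"
    proof (rule Bochner_Integration.integrable_bound)
      show "integrable lborel (indicator U :: 'a \<Rightarrow> real)" using Ufin by (intro integrable_real_indicator) auto
      show "AE x in lborel. norm (h x) \<le> norm (indicator U x :: real)"
        using h(4) h01 by (intro AE_I2) (auto simp: indicator_def)
    qed simp
    have UKint: "integrable lborel (indicator (U - K) :: 'a \<Rightarrow> real)"
      using UK by (intro integrable_real_indicator) (auto intro: less_trans)
    have "(\<integral>x. \<bar>indicator A x *\<^sub>R c - c * h x\<bar> \<partial>lborel) \<le> (\<integral>x. \<bar>c\<bar> * indicator (U - K) x \<partial>lborel)"
    proof (rule integral_mono)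
      show "integrable lborel (\<lambda>x. \<bar>indicator A x *\<^sub>R c - c * h x\<bar>)"
        using base(2) hint by (intro integrable_abs Bochner_Integration.integrable_diff integrable_scaleR_left integrable_real_indicator integrable_mult_right) auto
      show "\<bar>indicator A x *\<^sub>R c - c * h x\<bar> \<le> \<bar>c\<bar> * indicator (U - K) x" for x
      proof -
        have "\<bar>indicator A x - h x\<bar> \<le> indicator (U - K) x"
          using h01[of x] h(3,4)[of x] U(2) K(2) by (auto simp: indicator_def)
        then have "\<bar>c\<bar> * \<bar>indicator A x - h x\<bar> \<le> \<bar>c\<bar> * indicator (U - K) x" by (intro mult_left_mono) auto
        then show ?thesis by (simp add: abs_mult[symmetric] algebra_simps)
      qed
    qed (use UKint in simp)
    also have "\<dots> = \<bar>c\<bar> * measure lborel (U - K)" by simp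
    also have "measure lborel (U - K) \<le> 2 * e"
      unfolding measure_def using UK e by (intro enn2real_leI less_imp_le) auto
    finally have "(\<integral>x. \<bar>indicator A x *\<^sub>R c - c * h x\<bar> \<partial>lborel) \<le> \<bar>c\<bar> * (2 * e)" by (simp add: mult_left_mono)
    also have "\<bar>c\<bar> * (2 * e) < \<delta>" using \<open>\<delta> > 0\<close> by (simp add: e_def field_simps)
    finally show "\<exists>g. continuous_on UNIV g \<and> integrable lborel g \<and> (\<integral>x. \<bar>indicator A x *\<^sub>R c - g x\<bar> \<partial>lborel) < \<delta>"
      using h(1) hint by (intro exI[of _ "\<lambda>x. c * h x"]) (auto intro: continuous_intros)
  qed
next
  case (add f g)
  show ?case
  proof (intro allI impI)
    fix \<delta> :: real assume "\<delta> > 0"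
    then obtain f' g' where *: "continuous_on UNIV f'" "integrable lborel f'" "(\<integral>x. \<bar>f x - f' x\<bar> \<partial>lborel) < \<delta> / 2"
      "continuous_on UNIV g'" "integrable lborel g'" "(\<integral>x. \<bar>g x - g' x\<bar> \<partial>lborel) < \<delta> / 2"
      using add.IH by (meson half_gt_zero)
    have "(\<integral>x. \<bar>f x + g x - (f' x + g' x)\<bar> \<partial>lborel) \<le> (\<integral>x. \<bar>f x - f' x\<bar> + \<bar>g x - g' x\<bar> \<partial>lborel)"
      using add.hyps * by (intro integral_mono) auto
    also have "\<dots> = (\<integral>x. \<bar>f x - f' x\<bar> \<partial>lborel) + (\<integral>x. \<bar>g x - g' x\<bar> \<partial>lborel)"
      using add.hyps * by (intro Bochner_Integration.integral_add) auto
    also have "\<dots> < \<delta>" using * by simp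
    finally show "\<exists>h. continuous_on UNIV h \<and> integrable lborel h \<and> (\<integral>x. \<bar>f x + g x - h x\<bar> \<partial>lborel) < \<delta>"
      using * by (intro exI[of _ "\<lambda>x. f' x + g' x"]) (auto intro: continuous_intros)
  qed
next
  case (lim f s)
  show ?case
  proof (intro allI impI)
    fix \<delta> :: real assume "\<delta> > 0"
    have "(\<lambda>i. \<integral>x. \<bar>f x - s i x\<bar> \<partial>lborel) \<longlonglongrightarrow> (\<integral>x. 0 \<partial>(lborel :: 'a measure))"
    proof (rule integral_dominated_convergence[where w="\<lambda>x. 3 * \<bar>f x\<bar>"])
      show "AE x in lborel. (\<lambda>i. \<bar>f x - s i x\<bar>) \<longlonglongrightarrow> 0"
      proof (rule AE_I2)
        fix x :: 'a
        have "(\<lambda>i. \<bar>f x - s i x\<bar>) \<longlonglongrightarrow> \<bar>f x - f x\<bar>" using lim.hyps(2)[of x] by (intro tendsto_intros) auto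
        then show "(\<lambda>i. \<bar>f x - s i x\<bar>) \<longlonglongrightarrow> 0" by simp
      qed
      show "AE x in lborel. norm \<bar>f x - s i x\<bar> \<le> 3 * \<bar>f x\<bar>" for i
      proof (rule AE_I2)
        fix x :: 'a
        have "\<bar>s i x\<bar> \<le> 2 * \<bar>f x\<bar>" using lim.hyps(3)[of x i] by simp
        then show "norm \<bar>f x - s i x\<bar> \<le> 3 * \<bar>f x\<bar>" by simp
      qed
      show "(\<lambda>x. \<bar>f x - s i x\<bar>) \<in> borel_measurable lborel" for i
        using lim.hyps(1)[of i] lim.hyps(4) by (intro borel_measurable_abs borel_measurable_diff borel_measurable_integrable)
      show "integrable lborel (\<lambda>x. 3 * \<bar>f x\<bar>)" using lim.hyps(4) by auto
    qed simp
    then have "\<forall>\<^sub>F i in sequentially. (\<integral>x. \<bar>f x - s i x\<bar> \<partial>lborel) < \<delta> / 2"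
      using \<open>\<delta> > 0\<close> by (intro order_tendstoD(2)) auto
    then have "\<exists>i. (\<integral>x. \<bar>f x - s i x\<bar> \<partial>lborel) < \<delta> / 2"
      by (rule eventually_happens'[OF sequentially_bot])
    then obtain i where i: "(\<integral>x. \<bar>f x - s i x\<bar> \<partial>lborel) < \<delta> / 2" by (elim exE)
    obtain g where g: "continuous_on UNIV g" "integrable lborel g" "(\<integral>x. \<bar>s i x - g x\<bar> \<partial>lborel) < \<delta> / 2"
      using lim.IH[of i] \<open>\<delta> > 0\<close> by (meson half_gt_zero)
    have "(\<integral>x. \<bar>f x - g x\<bar> \<partial>lborel) \<le> (\<integral>x. \<bar>f x - s i x\<bar> + \<bar>s i x - g x\<bar> \<partial>lborel)"
      using lim.hyps(1)[of i] lim.hyps(4) g by (intro integral_mono) auto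
    also have "\<dots> = (\<integral>x. \<bar>f x - s i x\<bar> \<partial>lborel) + (\<integral>x. \<bar>s i x - g x\<bar> \<partial>lborel)"
      using lim.hyps(1)[of i] lim.hyps(4) g by (intro Bochner_Integration.integral_add) auto
    also have "\<dots> < \<delta>" using i g by simp
    finally show "\<exists>g. continuous_on UNIV g \<and> integrable lborel g \<and> (\<integral>x. \<bar>f x - g x\<bar> \<partial>lborel) < \<delta>"
      using g by blast
  qed
qed

text \<open>Truncation at a high level \<open>N\<close> costs little in the square mean, by
  dominated convergence. For functions bounded by \<open>N\<close>, closeness in the mean implies
  closeness in the square mean, since \<open>(s - t)^2 \<le> 2 N \<bar>s - t\<bar>\<close>. The
  continuous approximant is truncated as well.\<close>

lemma L2_dense_continuous:
  fixes u :: "'a::euclidean_space \<Rightarrow> real"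
  assumes u: "integrable lborel u" "integrable lborel (\<lambda>x. (u x)\<^sup>2)" and "\<delta> > 0"
  shows "\<exists>g. continuous_on UNIV g \<and> integrable lborel (\<lambda>x. (u x - g x)\<^sup>2) \<and> (\<integral>x. (u x - g x)\<^sup>2 \<partial>lborel) \<le> \<delta>"
proof -
  define cl where "cl = (\<lambda>N t :: real. max (- N) (min N t))"
  have um [measurable]: "u \<in> borel_measurable borel" using borel_measurable_integrable[OF u(1)] by simp
  have clm [measurable]: "cl N \<in> borel_measurable borel" for N unfolding cl_def by measurable
  have cl1: "\<bar>cl N s - cl N t\<bar> \<le> \<bar>s - t\<bar>" if "N \<ge> 0" for N s t using that unfolding cl_def by linarith
  have cl2: "\<bar>cl N s - cl N t\<bar> \<le> 2 * N" if "N \<ge> 0" for N s t using that unfolding cl_def by linarith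
  have cl3: "\<bar>t - cl N t\<bar> \<le> \<bar>t\<bar>" "\<bar>cl N t\<bar> \<le> \<bar>t\<bar>" if "N \<ge> 0" for N t using that unfolding cl_def by linarith+
  have cl4: "(t - cl N t)\<^sup>2 \<le> t\<^sup>2" if "N \<ge> 0" for N t using cl3(1)[OF that, of t] by (simp add: abs_le_square_iff)
  have "(\<lambda>N. \<integral>x. (u x - cl (real N) (u x))\<^sup>2 \<partial>lborel) \<longlonglongrightarrow> (\<integral>x. 0 \<partial>(lborel :: 'a measure))"
  proof (rule integral_dominated_convergence[where w="\<lambda>x. (u x)\<^sup>2"])
    show "AE x in lborel. (\<lambda>N. (u x - cl (real N) (u x))\<^sup>2) \<longlonglongrightarrow> 0"
    proof (rule AE_I2, rule tendsto_eventually)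
      fix x :: 'a
      obtain n where n: "\<bar>u x\<bar> \<le> real n" using real_arch_simple by blast
      then have "(u x - cl (real N) (u x))\<^sup>2 = 0" if "N \<ge> n" for N
        using that unfolding cl_def by (auto simp: max_def min_def abs_le_iff)
      then show "\<forall>\<^sub>F N in sequentially. (u x - cl (real N) (u x))\<^sup>2 = 0"
        unfolding eventually_sequentially by blast
    qed
  qed (use u cl4 in auto)
  then have "\<forall>\<^sub>F N in sequentially. (\<integral>x. (u x - cl (real N) (u x))\<^sup>2 \<partial>lborel) < \<delta> / 4"
    using \<open>\<delta> > 0\<close> by (intro order_tendstoD(2)) auto
  then obtain n0 where n0: "\<And>N. N \<ge> n0 \<Longrightarrow> (\<integral>x. (u x - cl (real N) (u x))\<^sup>2 \<partial>lborel) < \<delta> / 4"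
    unfolding eventually_sequentially by blast
  \<comment> \<open>The successor makes \<open>N\<close> positive, so that it may stand in a
    denominator.\<close>
  define N where "N = real (n0 + 1)"
  have N: "N > 0" "(\<integral>x. (u x - cl N (u x))\<^sup>2 \<partial>lborel) < \<delta> / 4" unfolding N_def using n0[of "n0 + 1"] by auto
  let ?v = "\<lambda>x. cl N (u x)"
  have vint: "integrable lborel ?v"
    by (rule Bochner_Integration.integrable_bound[OF u(1)]) (use N cl3 in auto)
  obtain h where h: "continuous_on UNIV h" "integrable lborel h" "(\<integral>x. \<bar>?v x - h x\<bar> \<partial>lborel) < \<delta> / (8 * N)"
  proof -
    have "\<delta> / (8 * N) > 0" using \<open>\<delta> > 0\<close> N by simp
    from L1_dense_continuous[OF vint, rule_format, OF this] show ?thesis using that by blast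
  qed
  define g where "g = (\<lambda>x. cl N (h x))"
  have hm [measurable]: "h \<in> borel_measurable borel" using borel_measurable_integrable[OF h(2)] by simp
  have gc: "continuous_on UNIV g" unfolding g_def cl_def by (intro continuous_intros h(1))
  have pt: "(u x - g x)\<^sup>2 \<le> 2 * (u x - ?v x)\<^sup>2 + 4 * N * \<bar>?v x - h x\<bar>" for x
  proof -
    have clcl: "cl N (cl N t) = cl N t" for t using N unfolding cl_def by auto
    have d: "\<bar>?v x - g x\<bar> \<le> \<bar>?v x - h x\<bar>" using cl1[of N "?v x" "h x"] N unfolding g_def clcl by simp
    have "(?v x - g x)\<^sup>2 = \<bar>?v x - g x\<bar> * \<bar>?v x - g x\<bar>" by (simp add: power2_eq_square)
    also have "\<dots> \<le> (2 * N) * \<bar>?v x - h x\<bar>"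
      using d cl2[of N "u x" "h x"] N by (intro mult_mono) (auto simp: g_def)
    finally have b: "(?v x - g x)\<^sup>2 \<le> 2 * N * \<bar>?v x - h x\<bar>" .
    have "0 \<le> ((u x - ?v x) - (?v x - g x))\<^sup>2" by simp
    then have "(u x - g x)\<^sup>2 \<le> 2 * (u x - ?v x)\<^sup>2 + 2 * (?v x - g x)\<^sup>2"
      by (simp add: power2_eq_square algebra_simps)
    then show ?thesis using b by linarith
  qed
  have i1: "integrable lborel (\<lambda>x. (u x - ?v x)\<^sup>2)"
    by (rule Bochner_Integration.integrable_bound[OF u(2)]) (use N cl4 in auto)
  have i2: "integrable lborel (\<lambda>x. 2 * (u x - ?v x)\<^sup>2 + 4 * N * \<bar>?v x - h x\<bar>)"
    using i1 vint h(2) by (intro Bochner_Integration.integrable_add integrable_mult_right integrable_abs Bochner_Integration.integrable_diff)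
  have [measurable]: "g \<in> borel_measurable borel" unfolding g_def by measurable
  have i3: "integrable lborel (\<lambda>x. (u x - g x)\<^sup>2)"
    by (rule Bochner_Integration.integrable_bound[OF i2]) (use pt N in \<open>auto intro: order_trans[OF _ abs_ge_self]\<close>)
  have "(\<integral>x. (u x - g x)\<^sup>2 \<partial>lborel) \<le> (\<integral>x. 2 * (u x - ?v x)\<^sup>2 + 4 * N * \<bar>?v x - h x\<bar> \<partial>lborel)"
    by (intro integral_mono i2 i3 pt)
  also have "\<dots> = 2 * (\<integral>x. (u x - ?v x)\<^sup>2 \<partial>lborel) + 4 * N * (\<integral>x. \<bar>?v x - h x\<bar> \<partial>lborel)"
    using i1 vint h(2) by simp
  also have "\<dots> \<le> 2 * (\<delta> / 4) + 4 * N * (\<delta> / (8 * N))"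
    using N h(3) by (intro add_mono mult_left_mono less_imp_le) auto
  also have "\<dots> = \<delta>" using N by simp
  finally show ?thesis using gc i3 by blast
qed

section \<open>Mollification\<close>

lemma L2_continuous_lebesgue:
  fixes T :: "'a::euclidean_space set"
  assumes "compact T" "continuous_on UNIV g" shows "g \<in> L2 (lebesgue_on T)"
proof -
  have T: "T \<in> sets borel" using assms(1) by (simp add: borel_compact)
  have m: "g \<in> borel_measurable borel" using assms(2) by (rule borel_measurable_continuous_onI)
  have "integrable lborel (\<lambda>x. indicator T x *\<^sub>R (g x)\<^sup>2)"
    by (intro borel_integrable_compact assms(1) continuous_intros continuous_on_subset[OF assms(2)]) auto
  then have "integrable (lebesgue_on T) (\<lambda>x. (g x)\<^sup>2)"
    by (subst integrable_lebesgue_on_lborel[OF T]) (use m in auto)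
  then show ?thesis unfolding L2_def using borel_measurable_lebesgue_on[OF m] by simp
qed

lemma L2_smooth: "compact T \<Longrightarrow> smooth g \<Longrightarrow> g \<in> L2 (lebesgue_on T)"
  by (intro L2_continuous_lebesgue smooth_continuous)

lemma lborel_affine_integrals:
  fixes t :: "'a::euclidean_space"
  assumes "c > 0"
  shows lborel_integral_affine: "\<And>g :: 'a \<Rightarrow> real. g \<in> borel_measurable borel \<Longrightarrow>
      (\<integral>x. g x \<partial>lborel) = c ^ DIM('a) * (\<integral>x. g (t + c *\<^sub>R x) \<partial>lborel)"
    and lborel_nn_integral_affine: "\<And>h :: 'a \<Rightarrow> ennreal. h \<in> borel_measurable borel \<Longrightarrow>
      (\<integral>\<^sup>+x. h x \<partial>lborel) = ennreal (c ^ DIM('a)) * (\<integral>\<^sup>+x. h (t + c *\<^sub>R x) \<partial>lborel)"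
    and lborel_integrable_affine: "\<And>g :: 'a \<Rightarrow> real. g \<in> borel_measurable borel \<Longrightarrow>
      integrable lborel g \<Longrightarrow> integrable lborel (\<lambda>x. g (t + c *\<^sub>R x))"
proof -
  let ?D = "density (distr lborel borel (\<lambda>x. t + c *\<^sub>R x)) (\<lambda>_. ennreal (c ^ DIM('a)))"
  have eq: "lborel = ?D" using lborel_affine[of c t] assms by simp
  show "(\<integral>x. g x \<partial>lborel) = c ^ DIM('a) * (\<integral>x. g (t + c *\<^sub>R x) \<partial>lborel)" if "g \<in> borel_measurable borel" for g :: "'a \<Rightarrow> real"
  proof -
    have "(\<integral>x. g x \<partial>lborel) = (\<integral>x. g x \<partial>?D)" by (rule arg_cong[OF eq])
    then show ?thesis using that assms by (simp add: integral_density integral_distr)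
  qed
  show *: "(\<integral>\<^sup>+x. h x \<partial>lborel) = ennreal (c ^ DIM('a)) * (\<integral>\<^sup>+x. h (t + c *\<^sub>R x) \<partial>lborel)" if "h \<in> borel_measurable borel" for h :: "'a \<Rightarrow> ennreal"
  proof -
    have "(\<integral>\<^sup>+x. h x \<partial>lborel) = (\<integral>\<^sup>+x. h x \<partial>?D)" by (rule arg_cong[OF eq])
    then show ?thesis using that assms by (simp add: nn_integral_density nn_integral_distr nn_integral_cmult)
  qed
  show "integrable lborel (\<lambda>x. g (t + c *\<^sub>R x))" if g: "g \<in> borel_measurable borel" "integrable lborel g" for g :: "'a \<Rightarrow> real"
  proof (rule integrableI_bounded)
    have "ennreal (c ^ DIM('a)) * (\<integral>\<^sup>+x. norm (g (t + c *\<^sub>R x)) \<partial>lborel) < \<infinity>"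
      using *[of "\<lambda>x. ennreal (norm (g x))"] g unfolding integrable_iff_bounded by simp
    then show "(\<integral>\<^sup>+x. norm (g (t + c *\<^sub>R x)) \<partial>lborel) < \<infinity>"
      using assms by (auto simp add: ennreal_mult_less_top)
  qed (use g in measurable)
qed

lemma L2_repD:
  assumes "L2_rep T u u'"
  shows "u' \<in> borel_measurable borel" "integrable lborel u'" "integrable lborel (\<lambda>x. (u' x)\<^sup>2)"
    "\<And>x. x \<notin> T \<Longrightarrow> u' x = 0" "AE x in lebesgue_on T. u x = u' x"
  using assms unfolding L2_rep_def by blast+

text \<open>Mollification is set up for compact convex sets in general. The bump with integral one
  also forces the interior to be nonempty.\<close>

locale mollifier =
  fixes T :: "(real^'n) set" and \<eta> :: "real^'n \<Rightarrow> real"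
  assumes compact_T: "compact T" and convex_T: "convex T"
    and \<eta>_test: "\<eta> \<in> test_functions (interior T)" and \<eta>_nonneg: "\<And>x. \<eta> x \<ge> 0"
    and \<eta>_integral: "(\<integral>x. \<eta> x \<partial>lborel) = 1"
begin

lemma T_borel: "T \<in> sets borel"
  using compact_T by (simp add: borel_compact)

lemma csmooth_\<eta>: "csmooth \<eta>" and \<eta>_support: "\<eta> y \<noteq> 0 \<Longrightarrow> y \<in> interior T"
  and \<eta>_measurable [measurable]: "\<eta> \<in> borel_measurable borel"
proof -
  show *: "csmooth \<eta>" using \<eta>_test unfolding test_functions_def csmooth_def by blast
  show "\<eta> y \<noteq> 0 \<Longrightarrow> y \<in> interior T"
    using \<eta>_test closure_subset[of "{x. \<eta> x \<noteq> 0}"] unfolding test_functions_def by auto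
  show "\<eta> \<in> borel_measurable borel" using csmooth_measurable[OF *] .
qed

lemma combination_interior:
  assumes "x \<in> T" "y \<in> interior T" "0 < \<epsilon>" "\<epsilon> < 1"
  shows "(1 - \<epsilon>) *\<^sub>R x + \<epsilon> *\<^sub>R y \<in> interior T"
  using mem_interior_convex_shrink[OF convex_T assms(2,1,3)] assms(4)
  by (simp add: algebra_simps)

lemma \<eta>_integrable: "integrable lborel \<eta>"
  using \<eta>_integral by (metis not_integrable_integral_eq zero_neq_one)

definition mol :: "real \<Rightarrow> (real^'n \<Rightarrow> real) \<Rightarrow> real^'n \<Rightarrow> real" where
  "mol \<epsilon> u x = (\<integral>y. u ((1 - \<epsilon>) *\<^sub>R x + \<epsilon> *\<^sub>R y) * \<eta> y \<partial>lborel)"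

text \<open>The substitution \<open>z = (1 - \<epsilon>) x + \<epsilon> y\<close> moves the
  dependence on \<open>x\<close> from \<open>u\<close> into the smooth function
  \<open>\<eta>\<close>, which makes the mollification a kernel operator.\<close>

lemma mol_eq:
  assumes "u \<in> borel_measurable borel" "0 < \<epsilon>"
  shows "mol \<epsilon> u x = (1 / \<epsilon>) ^ CARD('n) * (\<integral>z. u z * \<eta> ((- (1 - \<epsilon>) / \<epsilon>) *\<^sub>R x + (1 / \<epsilon>) *\<^sub>R z) \<partial>lborel)"
proof -
  have "(- (1 - \<epsilon>) / \<epsilon>) *\<^sub>R x + (1 / \<epsilon>) *\<^sub>R ((1 - \<epsilon>) *\<^sub>R x + \<epsilon> *\<^sub>R y) = y" for y
    using assms(2) by (simp add: scaleR_add_right field_simps flip: scaleR_add_left)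
  then show ?thesis
    using assms lborel_integral_affine[OF assms(2), of "\<lambda>z. u z * \<eta> ((- (1 - \<epsilon>) / \<epsilon>) *\<^sub>R x + (1 / \<epsilon>) *\<^sub>R z)" "(1 - \<epsilon>) *\<^sub>R x"]
    by (simp add: mol_def power_divide)
qed

lemma smooth_mol:
  assumes "u \<in> borel_measurable borel" "integrable lborel u" "0 < \<epsilon>" shows "smooth (mol \<epsilon> u)"
  unfolding mol_eq[OF assms(1,3), abs_def]
  by (intro smooth_cmult smooth_kernel_operator assms csmooth_\<eta>)

text \<open>The support in \<open>z\<close> is the copy of the support of \<open>\<eta>\<close>
  contracted towards \<open>x\<close>. By convexity it stays in the interior of \<open>T\<close>
  even when \<open>x\<close> is a boundary point, so the kernel may be inserted into the definition
  of the weak derivative.\<close>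

lemma kernel_test_function:
  assumes "x \<in> T" "0 < \<epsilon>" "\<epsilon> < 1"
  defines "\<phi> \<equiv> \<lambda>z. \<eta> ((- (1 - \<epsilon>) / \<epsilon>) *\<^sub>R x + (1 / \<epsilon>) *\<^sub>R z)"
  shows "\<phi> \<in> test_functions (interior T)"
    and "pderiv_at i \<phi> z = (1 / \<epsilon>) * pderiv_at i \<eta> ((- (1 - \<epsilon>) / \<epsilon>) *\<^sub>R x + (1 / \<epsilon>) *\<^sub>R z)"
proof -
  have sm: "smooth \<eta>" using csmooth_\<eta> unfolding csmooth_def by blast
  have \<phi>: "\<phi> = (\<lambda>z. \<eta> ((1 / \<epsilon>) *\<^sub>R z + (- (1 - \<epsilon>) / \<epsilon>) *\<^sub>R x))" unfolding \<phi>_def by (simp add: add.commute)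
  have s\<phi>: "smooth \<phi>" unfolding \<phi> by (rule smooth_affine[OF sm])
  let ?A = "(\<lambda>y. (1 - \<epsilon>) *\<^sub>R x + \<epsilon> *\<^sub>R y) ` closure {y. \<eta> y \<noteq> 0}"
  have A: "compact ?A"
    using csmooth_\<eta> unfolding csmooth_def by (intro compact_continuous_image continuous_intros) auto
  have sub: "?A \<subseteq> interior T"
    using \<eta>_test combination_interior[OF assms(1) _ assms(2,3)] unfolding test_functions_def by auto
  have "{z. \<phi> z \<noteq> 0} \<subseteq> ?A"
  proof
    fix z assume "z \<in> {z. \<phi> z \<noteq> 0}"
    then have "(- (1 - \<epsilon>) / \<epsilon>) *\<^sub>R x + (1 / \<epsilon>) *\<^sub>R z \<in> closure {y. \<eta> y \<noteq> 0}"
      using closure_subset[of "{y. \<eta> y \<noteq> 0}"] unfolding \<phi>_def by auto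
    moreover have "\<epsilon> *\<^sub>R ((- (1 - \<epsilon>) / \<epsilon>) *\<^sub>R x + (1 / \<epsilon>) *\<^sub>R z) = (\<epsilon> * (- (1 - \<epsilon>) / \<epsilon>)) *\<^sub>R x + (\<epsilon> * (1 / \<epsilon>)) *\<^sub>R z"
      by (simp add: scaleR_add_right)
    moreover have "\<epsilon> * (- (1 - \<epsilon>) / \<epsilon>) = - (1 - \<epsilon>)" "\<epsilon> * (1 / \<epsilon>) = 1" using assms(2) by auto
    ultimately have "z = (1 - \<epsilon>) *\<^sub>R x + \<epsilon> *\<^sub>R ((- (1 - \<epsilon>) / \<epsilon>) *\<^sub>R x + (1 / \<epsilon>) *\<^sub>R z)"
      by (simp only: scaleR_minus_left scaleR_one) simp
    moreover have "(- (1 - \<epsilon>) / \<epsilon>) *\<^sub>R x + (1 / \<epsilon>) *\<^sub>R z \<in> closure {y. \<eta> y \<noteq> 0}" by fact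
    ultimately show "z \<in> ?A" by blast
  qed
  then have "closure {z. \<phi> z \<noteq> 0} \<subseteq> ?A" using compact_imp_closed[OF A] by (rule closure_minimal)
  moreover from this have "compact (closure {z. \<phi> z \<noteq> 0})"
    using compact_Int_closed[OF A closed_closure, of "{z. \<phi> z \<noteq> 0}"] by (simp add: Int_absorb1)
  ultimately show "\<phi> \<in> test_functions (interior T)"
    unfolding test_functions_def using s\<phi> sub by auto
  show "pderiv_at i \<phi> z = (1 / \<epsilon>) * pderiv_at i \<eta> ((- (1 - \<epsilon>) / \<epsilon>) *\<^sub>R x + (1 / \<epsilon>) *\<^sub>R z)"
    unfolding \<phi> add.commute[of "(- (1 - \<epsilon>) / \<epsilon>) *\<^sub>R x" "(1 / \<epsilon>) *\<^sub>R z"]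
    by (rule pderiv_affine(1)[OF smooth_differentiable[OF sm]])
qed

text \<open>A derivative in \<open>x\<close> costs the chain-rule factor
  \<open>- (1 - \<epsilon>) / \<epsilon>\<close>, a derivative in \<open>z\<close> the factor
  \<open>1 / \<epsilon>\<close>. Their quotient, together with the sign in the definition of the
  weak derivative, is \<open>1 - \<epsilon>\<close>.\<close>

lemma pderiv_mol:
  assumes u: "u \<in> borel_measurable borel" "integrable lborel u"
    and w: "w \<in> borel_measurable borel"
    and weak: "\<And>\<phi>. \<phi> \<in> test_functions (interior T) \<Longrightarrow>
      (\<integral>x. u x * pderiv_at i \<phi> x \<partial>lborel) = - (\<integral>x. w x * \<phi> x \<partial>lborel)"
    and x: "x \<in> T" and \<epsilon>: "0 < \<epsilon>" "\<epsilon> < 1"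
  shows "pderiv_at i (mol \<epsilon> u) x = (1 - \<epsilon>) * mol \<epsilon> w x"
proof -
  let ?a = "- (1 - \<epsilon>) / \<epsilon>" and ?b = "1 / \<epsilon>"
  have mu: "mol \<epsilon> u = (\<lambda>x. ?b ^ CARD('n) * (\<integral>z. u z * \<eta> (?a *\<^sub>R x + ?b *\<^sub>R z) \<partial>lborel))"
    by (rule ext, rule mol_eq[OF u(1) \<epsilon>(1)])
  let ?\<phi> = "\<lambda>z. \<eta> (?a *\<^sub>R x + ?b *\<^sub>R z)"
  have aux: "P * (?a * (\<epsilon> * - I)) = (1 - \<epsilon>) * (P * I)" for P I :: real
  proof -
    have "?a * (\<epsilon> * - I) = (?a * \<epsilon>) * - I" by (rule mult.assoc[symmetric])
    also have "?a * \<epsilon> = - (1 - \<epsilon>)" using \<epsilon> by simp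
    also have "- (1 - \<epsilon>) * - I = (1 - \<epsilon>) * I" by (simp only: minus_mult_minus)
    finally have h: "?a * (\<epsilon> * - I) = (1 - \<epsilon>) * I" .
    show ?thesis unfolding h by (rule mult.left_commute)
  qed
  note ker = kernel_test_function[OF x \<epsilon>]
  have "pderiv_at i (mol \<epsilon> u) x = ?b ^ CARD('n) * (?a * (\<integral>z. u z * pderiv_at i \<eta> (?a *\<^sub>R x + ?b *\<^sub>R z) \<partial>lborel))"
    unfolding mu
    by (subst pderiv_cmult[OF smooth_differentiable[OF smooth_kernel_operator[OF u(2) csmooth_\<eta>]]],
        subst pderiv_kernel_operator[OF u(2) csmooth_\<eta>]) (rule refl)
  also have "(\<integral>z. u z * pderiv_at i \<eta> (?a *\<^sub>R x + ?b *\<^sub>R z) \<partial>lborel) = (\<integral>z. \<epsilon> * (u z * pderiv_at i ?\<phi> z) \<partial>lborel)"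
    unfolding ker(2) using \<epsilon> by (intro Bochner_Integration.integral_cong) auto
  also have "\<dots> = \<epsilon> * - (\<integral>z. w z * ?\<phi> z \<partial>lborel)"
    by (subst integral_mult_right_zero, subst weak[OF ker(1)]) (rule refl)
  also have "?b ^ CARD('n) * (?a * (\<epsilon> * - (\<integral>z. w z * ?\<phi> z \<partial>lborel))) = (1 - \<epsilon>) * mol \<epsilon> w x"
    unfolding mol_eq[OF w \<epsilon>(1)] by (rule aux)
  finally show ?thesis .
qed

text \<open>Cauchy-Schwarz for the probability density \<open>\<eta>\<close>, then Tonelli. For
  fixed \<open>y\<close> the substitution \<open>(1 - \<epsilon>) x + \<epsilon> y\<close> produces
  the constant, which is the same for all \<open>y\<close>.\<close>

lemma mol_contraction:
  assumes f [measurable]: "f \<in> borel_measurable borel" and \<epsilon>: "0 < \<epsilon>" "\<epsilon> < 1"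
  shows "(\<integral>\<^sup>+x. ennreal ((mol \<epsilon> f x)\<^sup>2) \<partial>lborel) \<le> ennreal ((1 / (1 - \<epsilon>)) ^ CARD('n)) * (\<integral>\<^sup>+x. ennreal ((f x)\<^sup>2) \<partial>lborel)"
proof -
  have \<eta>1: "(\<integral>\<^sup>+y. ennreal (\<eta> y) \<partial>lborel) = 1"
    using nn_integral_eq_integral[OF \<eta>_integrable] \<eta>_nonneg \<eta>_integral by simp
  have pt: "ennreal ((mol \<epsilon> f x)\<^sup>2) \<le> (\<integral>\<^sup>+y. ennreal ((f ((1 - \<epsilon>) *\<^sub>R x + \<epsilon> *\<^sub>R y))\<^sup>2 * \<eta> y) \<partial>lborel)" for x
  proof -
    let ?g = "\<lambda>y. f ((1 - \<epsilon>) *\<^sub>R x + \<epsilon> *\<^sub>R y)"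
    have "ennreal \<bar>mol \<epsilon> f x\<bar> \<le> (\<integral>\<^sup>+y. ennreal \<bar>?g y * \<eta> y\<bar> \<partial>lborel)"
    \<comment> \<open>If the integrand is not integrable, \<open>mol\<close> is zero by the
      convention for the Bochner integral.\<close>
    proof (cases "integrable lborel (\<lambda>y. ?g y * \<eta> y)")
      case True
      then show ?thesis using integral_norm_bound_ennreal[OF True] unfolding mol_def by simp
    qed (simp add: mol_def not_integrable_integral_eq)
    also have "\<dots> = (\<integral>\<^sup>+y. ennreal (\<bar>?g y\<bar> * sqrt (\<eta> y)) * ennreal (sqrt (\<eta> y)) \<partial>lborel)"
      using \<eta>_nonneg by (intro nn_integral_cong) (simp add: ennreal_mult'[symmetric] abs_mult)
    finally have "(ennreal \<bar>mol \<epsilon> f x\<bar>)\<^sup>2 \<le> (\<integral>\<^sup>+y. ennreal (\<bar>?g y\<bar> * sqrt (\<eta> y)) * ennreal (sqrt (\<eta> y)) \<partial>lborel)\<^sup>2"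
      by (intro power_mono) auto
    also have "\<dots> \<le> (\<integral>\<^sup>+y. (ennreal (\<bar>?g y\<bar> * sqrt (\<eta> y)))\<^sup>2 \<partial>lborel) * (\<integral>\<^sup>+y. (ennreal (sqrt (\<eta> y)))\<^sup>2 \<partial>lborel)"
      by (intro Cauchy_Schwarz_nn_integral) measurable
    also have "\<dots> = (\<integral>\<^sup>+y. ennreal ((?g y)\<^sup>2 * \<eta> y) \<partial>lborel)"
      using \<eta>_nonneg by (simp add: ennreal_power power_mult_distrib \<eta>1)
    finally show ?thesis by (simp add: ennreal_power)
  qed
  have "(\<integral>\<^sup>+x. ennreal ((mol \<epsilon> f x)\<^sup>2) \<partial>lborel)
      \<le> (\<integral>\<^sup>+x. (\<integral>\<^sup>+y. ennreal ((f ((1 - \<epsilon>) *\<^sub>R x + \<epsilon> *\<^sub>R y))\<^sup>2 * \<eta> y) \<partial>lborel) \<partial>lborel)"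
    by (intro nn_integral_mono pt)
  also have "\<dots> = (\<integral>\<^sup>+y. (\<integral>\<^sup>+x. ennreal ((f ((1 - \<epsilon>) *\<^sub>R x + \<epsilon> *\<^sub>R y))\<^sup>2 * \<eta> y) \<partial>lborel) \<partial>lborel)"
    by (rule lborel_pair.Fubini') measurable
  also have "\<dots> = (\<integral>\<^sup>+y. ennreal ((1 / (1 - \<epsilon>)) ^ CARD('n)) * (\<integral>\<^sup>+x. ennreal ((f x)\<^sup>2) \<partial>lborel) * ennreal (\<eta> y) \<partial>lborel)"
  proof (rule nn_integral_cong)
    fix y
    have "(\<integral>\<^sup>+x. ennreal ((f x)\<^sup>2) \<partial>lborel) = ennreal ((1 - \<epsilon>) ^ CARD('n)) * (\<integral>\<^sup>+x. ennreal ((f ((1 - \<epsilon>) *\<^sub>R x + \<epsilon> *\<^sub>R y))\<^sup>2) \<partial>lborel)"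
      using lborel_nn_integral_affine[of "1 - \<epsilon>" "\<lambda>x. ennreal ((f x)\<^sup>2)" "\<epsilon> *\<^sub>R y"] \<epsilon> by (simp add: add.commute)
    then have "ennreal ((1 / (1 - \<epsilon>)) ^ CARD('n)) * (\<integral>\<^sup>+x. ennreal ((f x)\<^sup>2) \<partial>lborel)
       = ennreal ((1 / (1 - \<epsilon>)) ^ CARD('n) * (1 - \<epsilon>) ^ CARD('n)) * (\<integral>\<^sup>+x. ennreal ((f ((1 - \<epsilon>) *\<^sub>R x + \<epsilon> *\<^sub>R y))\<^sup>2) \<partial>lborel)"
      using \<epsilon> by (simp add: ennreal_mult mult.assoc)
    also have "(1 / (1 - \<epsilon>)) ^ CARD('n) * (1 - \<epsilon>) ^ CARD('n) = 1"
      using \<epsilon> by (simp add: power_mult_distrib[symmetric])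
    finally show "(\<integral>\<^sup>+x. ennreal ((f ((1 - \<epsilon>) *\<^sub>R x + \<epsilon> *\<^sub>R y))\<^sup>2 * \<eta> y) \<partial>lborel)
       = ennreal ((1 / (1 - \<epsilon>)) ^ CARD('n)) * (\<integral>\<^sup>+x. ennreal ((f x)\<^sup>2) \<partial>lborel) * ennreal (\<eta> y)"
      using \<eta>_nonneg by (simp add: ennreal_mult nn_integral_multc)
  qed
  also have "\<dots> = ennreal ((1 / (1 - \<epsilon>)) ^ CARD('n)) * (\<integral>\<^sup>+x. ennreal ((f x)\<^sup>2) \<partial>lborel)"
    by (simp add: nn_integral_cmult \<eta>1)
  finally show ?thesis .
qed

lemma mol_add_integrable:
  assumes "f \<in> borel_measurable borel" "integrable lborel f" "0 < \<epsilon>"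
  shows "integrable lborel (\<lambda>y. f ((1 - \<epsilon>) *\<^sub>R x + \<epsilon> *\<^sub>R y) * \<eta> y)"
proof -
  have "integrable lborel (\<lambda>y. f ((1 - \<epsilon>) *\<^sub>R x + \<epsilon> *\<^sub>R y))"
    by (rule lborel_integrable_affine[OF assms(3,1,2)])
  from integrable_mult_csmooth[OF this csmooth_\<eta>, of "\<lambda>y. y"] show ?thesis by simp
qed

text \<open>The function is split as \<open>u = f + G\<close> with \<open>G\<close> a continuous
  function cut off to \<open>T\<close> and \<open>f\<close> small in the square mean. The
  contraction bound controls the mollified \<open>f\<close>. Uniform continuity controls
  \<open>G\<close>, whose jump at the boundary is never seen, because the mollification at points of
  \<open>T\<close> evaluates inside \<open>T\<close> only.\<close>

lemma mol_tendsto: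
  assumes u [measurable]: "u \<in> borel_measurable borel" and u_int: "integrable lborel u" "integrable lborel (\<lambda>x. (u x)\<^sup>2)"
    and u0: "\<And>x. x \<notin> T \<Longrightarrow> u x = 0" and "\<delta> > 0"
  shows "\<exists>\<epsilon>0>0. \<forall>\<epsilon>. 0 < \<epsilon> \<longrightarrow> \<epsilon> < \<epsilon>0 \<longrightarrow> \<epsilon> \<le> 1/2 \<longrightarrow>
     (\<integral>\<^sup>+x. ennreal ((mol \<epsilon> u x - u x)\<^sup>2) * indicator T x \<partial>lborel) \<le> ennreal \<delta>"
proof -
  let ?n = "CARD('n)"
  define m where "m = measure lborel T"
  have "emeasure lborel T < \<infinity>" using compact_T by (intro emeasure_bounded_finite compact_imp_bounded)
  then have mT: "emeasure lborel T = ennreal m" unfolding m_def by (intro emeasure_eq_ennreal_measure) auto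
  have m0: "m \<ge> 0" unfolding m_def by simp
  \<comment> \<open>Squaring a sum of three terms costs a factor three, and the contraction constant
    is at most \<open>2 ^ ?n\<close> for \<open>\<epsilon> \<le> 1/2\<close>. The two contributions
    of \<open>f\<close> then add up to at most \<open>\<delta> / 2\<close>; the choice of
    \<open>\<rho>\<close> below leaves at most \<open>\<delta> / 2\<close> for
    \<open>G\<close>.\<close>
  define \<gamma> where "\<gamma> = \<delta> / (6 * 2 ^ ?n + 6)"
  have \<gamma>: "\<gamma> > 0" unfolding \<gamma>_def using \<open>\<delta> > 0\<close> by (intro divide_pos_pos add_pos_pos) auto
  define \<rho> where "\<rho> = sqrt (\<delta> / (6 * (m + 1)))"
  have \<rho>: "\<rho> > 0" unfolding \<rho>_def using \<open>\<delta> > 0\<close> m0 by simp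
  obtain g where g: "continuous_on UNIV g" "integrable lborel (\<lambda>x. (u x - g x)\<^sup>2)" "(\<integral>x. (u x - g x)\<^sup>2 \<partial>lborel) \<le> \<gamma>"
    using L2_dense_continuous[OF u_int \<gamma>] by blast
  have gm [measurable]: "g \<in> borel_measurable borel" using g(1) by (rule borel_measurable_continuous_onI)
  have Tm [measurable]: "T \<in> sets borel" by (rule T_borel)
  define f where "f = (\<lambda>x. (u x - g x) * indicator T x)"
  define G where "G = (\<lambda>x. g x * indicator T x)"
  have fm [measurable]: "f \<in> borel_measurable borel" unfolding f_def by measurable
  have Gm [measurable]: "G \<in> borel_measurable borel" unfolding G_def by measurable
  have Gint: "integrable lborel G"
    using borel_integrable_compact[OF compact_T continuous_on_subset[OF g(1)]] unfolding G_def by (simp add: mult.commute)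
  have f_eq: "f = (\<lambda>x. u x - G x)" using u0 by (auto simp: f_def G_def indicator_def fun_eq_iff)
  have fint: "integrable lborel f" unfolding f_eq using u_int Gint by simp
  have f2: "(\<integral>\<^sup>+x. ennreal ((f x)\<^sup>2) \<partial>lborel) \<le> ennreal \<gamma>"
  proof -
    have "(\<integral>\<^sup>+x. ennreal ((f x)\<^sup>2) \<partial>lborel) \<le> (\<integral>\<^sup>+x. ennreal ((u x - g x)\<^sup>2) \<partial>lborel)"
      by (intro nn_integral_mono) (auto simp: f_def indicator_def)
    also have "\<dots> = ennreal (\<integral>x. (u x - g x)\<^sup>2 \<partial>lborel)" using g(2) by (intro nn_integral_eq_integral) auto
    finally show ?thesis using g(3) by (meson ennreal_leI order_trans)
  qed
  obtain d where d: "d > 0" "\<And>x z. x \<in> T \<Longrightarrow> z \<in> T \<Longrightarrow> dist z x < d \<Longrightarrow> dist (g z) (g x) < \<rho>"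
    using compact_uniformly_continuous[OF continuous_on_subset[OF g(1)] compact_T] \<rho>
    unfolding uniformly_continuous_on_def by (metis subset_UNIV)
  obtain R where R: "R > 0" "\<And>x. x \<in> T \<Longrightarrow> norm x \<le> R"
    using compact_imp_bounded[OF compact_T] unfolding bounded_pos by blast
  have gpt: "\<bar>mol \<epsilon> G x - g x\<bar> \<le> \<rho>" if x: "x \<in> T" and \<epsilon>: "0 < \<epsilon>" "\<epsilon> < d / (2 * R)" "\<epsilon> \<le> 1/2" for x \<epsilon>
  proof -
    have "mol \<epsilon> G x - g x = (\<integral>y. G ((1 - \<epsilon>) *\<^sub>R x + \<epsilon> *\<^sub>R y) * \<eta> y - g x * \<eta> y \<partial>lborel)"
      unfolding mol_def using mol_add_integrable[OF Gm Gint \<epsilon>(1)] \<eta>_integrable \<eta>_integral by simp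
    also have "\<bar>\<dots>\<bar> \<le> (\<integral>y. \<rho> * \<eta> y \<partial>lborel)"
    proof (rule integral_abs_bound_integral)
      show "\<bar>G ((1 - \<epsilon>) *\<^sub>R x + \<epsilon> *\<^sub>R y) * \<eta> y - g x * \<eta> y\<bar> \<le> \<rho> * \<eta> y" for y
      proof (cases "\<eta> y = 0")
        case False
        let ?z = "(1 - \<epsilon>) *\<^sub>R x + \<epsilon> *\<^sub>R y"
        have y: "y \<in> interior T" using \<eta>_support False by blast
        then have z: "?z \<in> T" using combination_interior[OF x y] \<epsilon> interior_subset by fastforce
        have "dist ?z x = \<epsilon> * norm (y - x)"
          using \<epsilon>(1) by (simp add: dist_norm algebra_simps flip: scaleR_diff_right)
        also have "\<dots> \<le> \<epsilon> * (2 * R)"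
          using R(2)[OF x] R(2)[of y] y interior_subset[of T] norm_triangle_ineq4[of y x] \<epsilon>(1)
          by (intro mult_left_mono) force+
        also have "\<dots> < d" using \<epsilon>(2) R(1) by (simp add: field_simps)
        finally have "\<bar>g ?z - g x\<bar> \<le> \<rho>" using d(2)[OF x z] by (simp add: dist_real_def)
        then have "\<bar>g ?z - g x\<bar> * \<eta> y \<le> \<rho> * \<eta> y" using \<eta>_nonneg by (intro mult_right_mono) auto
        then show ?thesis using z \<eta>_nonneg[of y] by (simp add: G_def left_diff_distrib[symmetric] abs_mult)
      qed simp
    qed (use mol_add_integrable[OF Gm Gint \<epsilon>(1)] \<eta>_integrable in auto)
    also have "\<dots> = \<rho>" using \<eta>_integral by simp
    finally show ?thesis .
  qed
  show ?thesis
  proof (intro exI conjI allI impI)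
    show "d / (2 * R) > 0" using d R by simp
    fix \<epsilon> :: real assume \<epsilon>: "0 < \<epsilon>" "\<epsilon> < d / (2 * R)" "\<epsilon> \<le> 1/2"
    have \<epsilon>1: "\<epsilon> < 1" using \<epsilon> by simp
    have mm [measurable]: "mol \<epsilon> f \<in> borel_measurable borel"
      by (intro borel_measurable_continuous_onI smooth_continuous smooth_mol fm fint \<epsilon>)
    have pt: "(mol \<epsilon> u x - u x)\<^sup>2 \<le> 3 * (mol \<epsilon> f x)\<^sup>2 + 3 * \<rho>\<^sup>2 + 3 * (f x)\<^sup>2" if x: "x \<in> T" for x
    proof -
      have "mol \<epsilon> u x = mol \<epsilon> f x + mol \<epsilon> G x"
        using mol_add_integrable[OF fm fint \<epsilon>(1), of x] mol_add_integrable[OF Gm Gint \<epsilon>(1), of x]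
        unfolding mol_def by (subst Bochner_Integration.integral_add[symmetric]) (simp_all add: f_eq algebra_simps)
      then have eq: "mol \<epsilon> u x - u x = mol \<epsilon> f x + (mol \<epsilon> G x - g x) + (- f x)" using x by (simp add: f_def)
      have "(mol \<epsilon> G x - g x)\<^sup>2 \<le> \<rho>\<^sup>2" using gpt[OF x \<epsilon>] \<rho> by (metis abs_le_square_iff abs_of_pos)
      moreover have "(a + b + c)\<^sup>2 \<le> 3 * a\<^sup>2 + 3 * b\<^sup>2 + 3 * c\<^sup>2" for a b c :: real
      proof -
        have "0 \<le> (a - b)\<^sup>2 + (b - c)\<^sup>2 + (a - c)\<^sup>2" by simp
        then show ?thesis by (simp add: power2_eq_square algebra_simps)
      qed
      from this[of "mol \<epsilon> f x" "mol \<epsilon> G x - g x" "- f x"] have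
        "(mol \<epsilon> u x - u x)\<^sup>2 \<le> 3 * (mol \<epsilon> f x)\<^sup>2 + 3 * (mol \<epsilon> G x - g x)\<^sup>2 + 3 * (f x)\<^sup>2" unfolding eq by simp
      ultimately show ?thesis by linarith
    qed
    have "(\<integral>\<^sup>+x. ennreal ((mol \<epsilon> u x - u x)\<^sup>2) * indicator T x \<partial>lborel)
      \<le> (\<integral>\<^sup>+x. 3 * ennreal ((mol \<epsilon> f x)\<^sup>2) + ennreal (3 * \<rho>\<^sup>2) * indicator T x + 3 * ennreal ((f x)\<^sup>2) \<partial>lborel)"
    proof (intro nn_integral_mono)
      fix x
      show "ennreal ((mol \<epsilon> u x - u x)\<^sup>2) * indicator T x \<le> 3 * ennreal ((mol \<epsilon> f x)\<^sup>2) + ennreal (3 * \<rho>\<^sup>2) * indicator T x + 3 * ennreal ((f x)\<^sup>2)"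
      proof (cases "x \<in> T")
        case True
        have "ennreal ((mol \<epsilon> u x - u x)\<^sup>2) \<le> ennreal (3 * (mol \<epsilon> f x)\<^sup>2 + 3 * \<rho>\<^sup>2 + 3 * (f x)\<^sup>2)"
          by (intro ennreal_leI pt True)
        also have "\<dots> = 3 * ennreal ((mol \<epsilon> f x)\<^sup>2) + ennreal (3 * \<rho>\<^sup>2) + 3 * ennreal ((f x)\<^sup>2)"
          by (simp add: ennreal_plus ennreal_mult)
        finally show ?thesis using True by simp
      qed simp
    qed
    also have "\<dots> = 3 * (\<integral>\<^sup>+x. ennreal ((mol \<epsilon> f x)\<^sup>2) \<partial>lborel) + ennreal (3 * \<rho>\<^sup>2) * ennreal m + 3 * (\<integral>\<^sup>+x. ennreal ((f x)\<^sup>2) \<partial>lborel)"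
      by (simp add: nn_integral_add nn_integral_cmult mT)
    also have "\<dots> \<le> 3 * (ennreal (2 ^ ?n) * ennreal \<gamma>) + ennreal (3 * \<rho>\<^sup>2) * ennreal m + 3 * ennreal \<gamma>"
    proof (intro add_mono mult_left_mono f2)
      have "(\<integral>\<^sup>+x. ennreal ((mol \<epsilon> f x)\<^sup>2) \<partial>lborel) \<le> ennreal ((1 / (1 - \<epsilon>)) ^ ?n) * (\<integral>\<^sup>+x. ennreal ((f x)\<^sup>2) \<partial>lborel)"
        by (rule mol_contraction[OF fm \<epsilon>(1) \<epsilon>1])
      also have "\<dots> \<le> ennreal (2 ^ ?n) * ennreal \<gamma>"
        using \<epsilon> by (intro mult_mono f2 ennreal_leI power_mono) (auto simp: field_simps)
      finally show "(\<integral>\<^sup>+x. ennreal ((mol \<epsilon> f x)\<^sup>2) \<partial>lborel) \<le> ennreal (2 ^ ?n) * ennreal \<gamma>" .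
    qed auto
    also have "\<dots> = ennreal (3 * (2 ^ ?n * \<gamma>) + 3 * \<rho>\<^sup>2 * m + 3 * \<gamma>)"
      using \<gamma> m0 by (simp add: ennreal_plus ennreal_mult)
    also have "\<dots> \<le> ennreal \<delta>"
    proof (rule ennreal_leI)
      have "3 * (2 ^ ?n * \<gamma>) + 3 * \<gamma> = \<delta> / 2"
      proof -
        have pos: "(6 * 2 ^ ?n + 6 :: real) > 0" by (simp add: add_pos_pos)
        have "3 * (2 ^ ?n * \<gamma>) + 3 * \<gamma> = (6 * 2 ^ ?n + 6) * \<gamma> / 2" by (simp add: algebra_simps)
        also have "(6 * 2 ^ ?n + 6) * \<gamma> = \<delta>" unfolding \<gamma>_def using pos by simp
        finally show ?thesis .
      qed
      moreover have "3 * \<rho>\<^sup>2 * m \<le> \<delta> / 2"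
      proof -
        have "\<rho>\<^sup>2 = \<delta> / (6 * (m + 1))" unfolding \<rho>_def using \<open>\<delta> > 0\<close> m0 by simp
        then have "3 * \<rho>\<^sup>2 * (m + 1) = \<delta> / 2" using m0 by (simp add: field_simps)
        moreover have "3 * \<rho>\<^sup>2 * m \<le> 3 * \<rho>\<^sup>2 * (m + 1)" by (intro mult_left_mono) auto
        ultimately show ?thesis by linarith
      qed
      ultimately show "3 * (2 ^ ?n * \<gamma>) + 3 * \<rho>\<^sup>2 * m + 3 * \<gamma> \<le> \<delta>" by linarith
    qed
    finally show "(\<integral>\<^sup>+x. ennreal ((mol \<epsilon> u x - u x)\<^sup>2) * indicator T x \<partial>lborel) \<le> ennreal \<delta>" .
  qed
qed

text \<open>The offset two keeps the parameter in the range \<open>\<epsilon> \<le> 1/2\<close> of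
  the convergence estimate for every \<open>j\<close>. The mollification acts on a Borel
  representative, since the values of \<open>u\<close> off \<open>T\<close> are arbitrary.\<close>

definition mollify :: "nat \<Rightarrow> (real^'n \<Rightarrow> real) \<Rightarrow> real^'n \<Rightarrow> real" where
  "mollify j u = mol (1 / (real j + 2)) (SOME u'. L2_rep T u u')"

lemma L2_rep_some: "u \<in> L2 (lebesgue_on T) \<Longrightarrow> L2_rep T u (SOME u'. L2_rep T u u')"
  using L2_rep_exists[OF compact_T] by (rule someI_ex)

lemma smooth_mollify:
  assumes "u \<in> L2 (lebesgue_on T)" shows "smooth (mollify j u)"
  unfolding mollify_def using L2_repD[OF L2_rep_some[OF assms]] by (intro smooth_mol) auto

lemma test_function_borel: "\<phi> \<in> test_functions U \<Longrightarrow> \<phi> \<in> borel_measurable borel"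
  "\<phi> \<in> test_functions U \<Longrightarrow> pderiv_at i \<phi> \<in> borel_measurable borel"
  unfolding test_functions_def
  by (auto intro!: borel_measurable_continuous_onI smooth_continuous smooth_pderiv)

lemma pderiv_mollify:
  assumes "u \<in> L2 (lebesgue_on T)" "w \<in> L2 (lebesgue_on T)" "is_weak_pderiv T i u w" "x \<in> T"
  shows "pderiv_at i (mollify j u) x = (1 - 1 / (real j + 2)) * mollify j w x"
  unfolding mollify_def
proof (rule pderiv_mol)
  note ru = L2_rep_some[OF assms(1)] and rw = L2_rep_some[OF assms(2)]
  fix \<phi> assume \<phi>: "\<phi> \<in> test_functions (interior T)"
  show "(\<integral>x. (SOME u'. L2_rep T u u') x * pderiv_at i \<phi> x \<partial>lborel) = - (\<integral>x. (SOME u'. L2_rep T w u') x * \<phi> x \<partial>lborel)"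
    using assms(3) \<phi> unfolding is_weak_pderiv_def
      L2_rep_integral[OF ru T_borel test_function_borel(2)[OF \<phi>] assms(1), symmetric]
      L2_rep_integral[OF rw T_borel test_function_borel(1)[OF \<phi>] assms(2), symmetric] by blast
qed (use L2_repD[OF L2_rep_some[OF assms(1)]] L2_repD[OF L2_rep_some[OF assms(2)]] assms(4) in auto)

lemma mollify_tendsto:
  assumes u: "u \<in> L2 (lebesgue_on T)"
  shows "(\<lambda>j. \<integral>x. (mollify j u x - u x)\<^sup>2 \<partial>lebesgue_on T) \<longlonglongrightarrow> 0"
proof (rule LIMSEQ_I)
  fix r :: real assume "r > 0"
  define u' where "u' = (SOME u'. L2_rep T u u')"
  have "L2_rep T u u'" unfolding u'_def by (rule L2_rep_some[OF u])
  then have u': "u' \<in> borel_measurable borel" "integrable lborel u'" "integrable lborel (\<lambda>x. (u' x)\<^sup>2)"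
    "\<And>x. x \<notin> T \<Longrightarrow> u' x = 0" "AE x in lebesgue_on T. u x = u' x"
    unfolding L2_rep_def by blast+
  obtain \<epsilon>0 where \<epsilon>0: "\<epsilon>0 > 0" "\<And>\<epsilon>. 0 < \<epsilon> \<Longrightarrow> \<epsilon> < \<epsilon>0 \<Longrightarrow> \<epsilon> \<le> 1/2 \<Longrightarrow>
     (\<integral>\<^sup>+x. ennreal ((mol \<epsilon> u' x - u' x)\<^sup>2) * indicator T x \<partial>lborel) \<le> ennreal (r / 2)"
    using mol_tendsto[OF u'(1-4), of "r / 2"] \<open>r > 0\<close> by auto
  obtain n where n: "1 / \<epsilon>0 < real n" using reals_Archimedean2 by blast
  have "norm ((\<integral>x. (mollify j u x - u x)\<^sup>2 \<partial>lebesgue_on T) - 0) < r" if "j \<ge> n" for j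
  proof -
    let ?\<epsilon> = "1 / (real j + 2)"
    have "1 / \<epsilon>0 < real j + 2" using n that by (meson of_nat_le_iff le_add_same_cancel1 less_le_trans order_trans zero_le_numeral)
    then have \<epsilon>: "0 < ?\<epsilon>" "?\<epsilon> < \<epsilon>0" "?\<epsilon> \<le> 1/2" using \<epsilon>0(1) by (auto simp: field_simps)
    have mu: "mollify j u = mol ?\<epsilon> u'" unfolding mollify_def u'_def ..
    have mm: "mollify j u \<in> borel_measurable borel"
      by (intro borel_measurable_continuous_onI smooth_continuous smooth_mollify u)
    have m1: "(\<lambda>x. (mollify j u x - u' x)\<^sup>2) \<in> borel_measurable borel" using mm u'(1) by measurable
    have "(\<integral>x. (mollify j u x - u x)\<^sup>2 \<partial>lebesgue_on T) = (\<integral>x. (mollify j u x - u' x)\<^sup>2 \<partial>lebesgue_on T)"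
    proof (rule integral_cong_AE)
      show "(\<lambda>x. (mollify j u x - u x)\<^sup>2) \<in> borel_measurable (lebesgue_on T)"
        using L2_measurable[OF u] borel_measurable_lebesgue_on[OF mm] by measurable
      show "AE x in lebesgue_on T. (mollify j u x - u x)\<^sup>2 = (mollify j u x - u' x)\<^sup>2"
        using u'(5) by eventually_elim simp
    qed (rule borel_measurable_lebesgue_on[OF m1])
    also have "\<dots> = (\<integral>x. indicator T x *\<^sub>R (mollify j u x - u' x)\<^sup>2 \<partial>lborel)"
      by (rule integral_lebesgue_on_lborel[OF T_borel m1])
    also have "\<dots> = enn2real (\<integral>\<^sup>+x. ennreal ((mol ?\<epsilon> u' x - u' x)\<^sup>2) * indicator T x \<partial>lborel)"
      unfolding mu[symmetric] using m1 T_borel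
      by (subst integral_eq_nn_integral) (auto intro!: arg_cong[where f=enn2real] nn_integral_cong simp: indicator_def)
    also have "\<dots> \<le> r / 2" using \<epsilon>0(2)[OF \<epsilon>] \<open>r > 0\<close> by (intro enn2real_leI) auto
    finally have "(\<integral>x. (mollify j u x - u x)\<^sup>2 \<partial>lebesgue_on T) \<le> r / 2" .
    moreover have "0 \<le> (\<integral>x. (mollify j u x - u x)\<^sup>2 \<partial>lebesgue_on T)"
      by (intro Bochner_Integration.integral_nonneg) auto
    ultimately show ?thesis using \<open>r > 0\<close> by (simp del: Bochner_Integration.integral_nonneg)
  qed
  then show "\<exists>no. \<forall>j\<ge>no. norm ((\<integral>x. (mollify j u x - u x)\<^sup>2 \<partial>lebesgue_on T) - 0) < r" by blast
qed

text \<open>Derivatives of mollifications carry the factor \<open>1 - 1 / (j + 2)\<close>, which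
  tends to one. The triangle inequality through \<open>(1 - 1 / (j + 2)) * u\<close> separates this
  factor from the mollification error.\<close>

lemma scaled_mollify_tendsto:
  assumes u: "u \<in> L2 (lebesgue_on T)"
  shows "(\<lambda>j. \<integral>x. ((1 - 1 / (real j + 2)) * mollify j u x - u x)\<^sup>2 \<partial>lebesgue_on T) \<longlonglongrightarrow> 0"
proof (rule tendsto_sandwich[of "\<lambda>_. 0"])
  let ?A = "\<lambda>j. \<integral>x. (mollify j u x - u x)\<^sup>2 \<partial>lebesgue_on T" and ?B = "\<integral>x. (u x)\<^sup>2 \<partial>lebesgue_on T"
  have mL: "mollify j u \<in> L2 (lebesgue_on T)" for j by (intro L2_smooth compact_T smooth_mollify u)
  show "\<forall>\<^sub>F j in sequentially. (\<integral>x. ((1 - 1 / (real j + 2)) * mollify j u x - u x)\<^sup>2 \<partial>lebesgue_on T)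
      \<le> 2 * ((1 - 1 / (real j + 2))\<^sup>2 * ?A j) + 2 * ((1 / (real j + 2))\<^sup>2 * ?B)"
  proof (intro always_eventually allI)
    fix j
    let ?c = "1 - 1 / (real j + 2)"
    have "(\<integral>x. (?c * mollify j u x - u x)\<^sup>2 \<partial>lebesgue_on T) \<le>
       2 * (\<integral>x. (?c * mollify j u x - ?c * u x)\<^sup>2 \<partial>lebesgue_on T) + 2 * (\<integral>x. (?c * u x - u x)\<^sup>2 \<partial>lebesgue_on T)"
      by (intro L2_dist_triangle L2_cmult mL u)
    also have "(\<integral>x. (?c * mollify j u x - ?c * u x)\<^sup>2 \<partial>lebesgue_on T) = ?c\<^sup>2 * ?A j"
      by (simp add: right_diff_distrib[symmetric] power_mult_distrib)
    also have "(\<integral>x. (?c * u x - u x)\<^sup>2 \<partial>lebesgue_on T) = (1 / (real j + 2))\<^sup>2 * ?B"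
    proof -
      have "(?c * u x - u x)\<^sup>2 = (1 / (real j + 2))\<^sup>2 * (u x)\<^sup>2" for x
        by (simp add: left_diff_distrib power_mult_distrib power_divide)
      then show ?thesis by simp
    qed
    finally show "(\<integral>x. (?c * mollify j u x - u x)\<^sup>2 \<partial>lebesgue_on T) \<le> 2 * (?c\<^sup>2 * ?A j) + 2 * ((1 / (real j + 2))\<^sup>2 * ?B)" .
  qed
  have e: "(\<lambda>j. 1 / (real j + 2)) \<longlonglongrightarrow> 0"
    using LIMSEQ_ignore_initial_segment[OF lim_1_over_n[where 'a=real], of 2] by (simp add: add.commute)
  have "(\<lambda>j. 2 * ((1 - 1 / (real j + 2))\<^sup>2 * ?A j) + 2 * ((1 / (real j + 2))\<^sup>2 * ?B)) \<longlonglongrightarrow> 2 * ((1 - 0)\<^sup>2 * 0) + 2 * (0\<^sup>2 * ?B)"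
    by (intro tendsto_intros e mollify_tendsto u)
  then show "(\<lambda>j. 2 * ((1 - 1 / (real j + 2))\<^sup>2 * ?A j) + 2 * ((1 / (real j + 2))\<^sup>2 * ?B)) \<longlonglongrightarrow> 0" by simp
qed auto

text \<open>For \<open>x\<close> in \<open>T\<close> the mollification kernel is itself a test
  function, so every mollification of \<open>w\<close> vanishes on \<open>T\<close>; but the
  mollifications converge to \<open>w\<close>.\<close>

lemma fundamental_lemma:
  assumes w: "w \<in> L2 (lebesgue_on T)"
    and orth: "\<And>\<phi>. \<phi> \<in> test_functions (interior T) \<Longrightarrow> (\<integral>x. w x * \<phi> x \<partial>lebesgue_on T) = 0"
  shows "AE x in lebesgue_on T. w x = 0"
proof -
  have zero: "mollify j w x = 0" if x: "x \<in> T" for j x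
  proof -
    define w' where "w' = (SOME u'. L2_rep T w u')"
    have rep: "L2_rep T w w'" unfolding w'_def by (rule L2_rep_some[OF w])
    then have m: "w' \<in> borel_measurable borel" unfolding L2_rep_def by blast
    have \<epsilon>: "0 < 1 / (real j + 2)" "1 / (real j + 2) < 1" by auto
    note ker = kernel_test_function(1)[OF x \<epsilon>]
    show ?thesis
      unfolding mollify_def w'_def[symmetric] mol_eq[OF m \<epsilon>(1)]
      by (subst L2_rep_integral[OF rep T_borel test_function_borel(1)[OF ker] w, symmetric],
          subst orth[OF ker]) simp
  qed
  have "(\<lambda>j. \<integral>x. (mollify j w x - w x)\<^sup>2 \<partial>lebesgue_on T) = (\<lambda>j. \<integral>x. (w x)\<^sup>2 \<partial>lebesgue_on T)"
    by (intro ext Bochner_Integration.integral_cong) (auto simp: zero)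
  then have "(\<integral>x. (w x)\<^sup>2 \<partial>lebesgue_on T) = 0"
    using mollify_tendsto[OF w] by (simp add: LIMSEQ_const_iff)
  then have "AE x in lebesgue_on T. (w x)\<^sup>2 = 0"
    using integral_nonneg_eq_0_iff_AE[OF L2_integrable_sq[OF w]] by simp
  then show ?thesis by eventually_elim simp
qed

end

section \<open>Weak derivatives\<close>

text \<open>A convex set with nonempty interior lies in the closure of its interior. A nonzero value
  at \<open>x\<close>, even on the boundary, would therefore persist on a nonempty open subset of
  \<open>T\<close>, which is not a null set.\<close>

lemma continuous_zero_AE:
  fixes f :: "'a::euclidean_space \<Rightarrow> real"
  assumes T: "compact T" "convex T" "interior T \<noteq> {}" and f: "continuous_on T f"
    and ae: "AE x in lebesgue_on T. f x = 0" and x: "x \<in> T"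
  shows "f x = 0"
proof (rule ccontr)
  assume nz: "f x \<noteq> 0"
  have "openin (top_of_set T) (T \<inter> f -` (- {0}))"
    using f by (intro continuous_openin_preimage_gen) auto
  then obtain U where U: "open U" "T \<inter> f -` (- {0}) = T \<inter> U" unfolding openin_open by blast
  have "x \<in> U" using U(2) x nz by blast
  moreover have "x \<in> closure (interior T)"
    using convex_closure_interior[OF T(2,3)] x closure_subset by blast
  ultimately have "U \<inter> interior T \<noteq> {}" using open_Int_closure_eq_empty[OF U(1), of "interior T"] by auto
  then have ne: "open (U \<inter> interior T)" "U \<inter> interior T \<noteq> {}" using U(1) by auto
  have T': "T \<inter> space lebesgue \<in> sets lebesgue" using T(1) by (simp add: borel_compact)
  have "AE x in lborel. x \<in> T \<longrightarrow> f x = 0"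
    using ae unfolding AE_restrict_space_iff[OF T'] by (simp add: AE_completion_iff)
  then have "AE x in lborel. x \<notin> U \<inter> interior T"
  proof eventually_elim
    case (elim x)
    then show ?case using U(2) interior_subset[of T] by blast
  qed
  then have "U \<inter> interior T \<in> null_sets lborel"
    using ne(1) by (subst (asm) AE_iff_null_sets[symmetric]) auto
  then have "negligible (U \<inter> interior T)"
    using negligible_iff_null_sets null_sets_completionI by blast
  then show False using open_not_negligible[OF ne] by blast
qed

context mollifier
begin

lemma interior_nonempty: "interior T \<noteq> {}"
proof
  assume "interior T = {}"
  then have "\<eta> = (\<lambda>y. 0)" using \<eta>_support by fastforce
  then show False using \<eta>_integral by simp
qed

text \<open>In the interior the values on \<open>T\<close> determine the derivative; at a boundary
  point the equality follows by continuity, because the interior is dense in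
  \<open>T\<close>.\<close>

lemma pderiv_cong:
  assumes "smooth f" "smooth g" "\<And>x. x \<in> T \<Longrightarrow> f x = g x" "x \<in> T"
  shows "pderiv_at i f x = pderiv_at i g x"
proof -
  let ?h = "\<lambda>x. pderiv_at i f x - pderiv_at i g x"
  have int: "?h x = 0" if x: "x \<in> interior T" for x
  proof -
    have "(f has_derivative (\<lambda>h. grad g x \<bullet> h)) (at x)"
      by (rule has_derivative_transform_within_open[OF has_derivative_grad[OF smooth_differentiable[OF assms(2)]] open_interior x])
         (use assms(3) interior_subset[of T] in \<open>auto simp: subset_iff\<close>)
    from pderiv_eqI[OF this] show ?thesis by (simp add: grad_def inner_axis)
  qed
  have "x \<in> closure (interior T)"
    using convex_closure_interior[OF convex_T interior_nonempty] assms(4) closure_subset by blast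
  then have "?h x = 0"
    by (rule continuous_constant_on_closure[rotated 2]) (auto simp: int[simplified] intro!: smooth_continuous smooth_diff smooth_pderiv assms)
  then show ?thesis by simp
qed

lemma test_function_L2: "\<phi> \<in> test_functions U \<Longrightarrow> \<phi> \<in> L2 (lebesgue_on T)"
  "\<phi> \<in> test_functions U \<Longrightarrow> pderiv_at i \<phi> \<in> L2 (lebesgue_on T)"
  unfolding test_functions_def by (auto intro!: L2_smooth compact_T smooth_pderiv)

section \<open>Linearity and uniqueness of weak derivatives\<close>

lemma is_weak_pderiv_add:
  assumes "u \<in> L2 (lebesgue_on T)" "u' \<in> L2 (lebesgue_on T)" "w \<in> L2 (lebesgue_on T)" "w' \<in> L2 (lebesgue_on T)"
    "is_weak_pderiv T i u w" "is_weak_pderiv T i u' w'"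
  shows "is_weak_pderiv T i (\<lambda>x. u x + u' x) (\<lambda>x. w x + w' x)"
  using assms unfolding is_weak_pderiv_def
  by (simp add: distrib_right L2_integrable_mult test_function_L2)

lemma is_weak_pderiv_cmult:
  assumes "is_weak_pderiv T i u w" shows "is_weak_pderiv T i (\<lambda>x. c * u x) (\<lambda>x. c * w x)"
  using assms unfolding is_weak_pderiv_def by (simp add: mult.assoc)

lemma is_weak_pderiv_sum:
  assumes "finite A" "\<And>a. a \<in> A \<Longrightarrow> u a \<in> L2 (lebesgue_on T)" "\<And>a. a \<in> A \<Longrightarrow> w a \<in> L2 (lebesgue_on T)"
    "\<And>a. a \<in> A \<Longrightarrow> is_weak_pderiv T i (u a) (w a)"
  shows "is_weak_pderiv T i (\<lambda>x. \<Sum>a\<in>A. u a x) (\<lambda>x. \<Sum>a\<in>A. w a x)"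
  using assms
proof (induction A rule: finite_induct)
  case empty
  then show ?case by (simp add: is_weak_pderiv_def)
next
  case (insert a A)
  then show ?case
    by (simp only: sum.insert[OF insert.hyps]) (intro is_weak_pderiv_add L2_sum; simp)
qed

lemma is_weak_pderiv_cong:
  assumes "u \<in> L2 (lebesgue_on T)" "u' \<in> L2 (lebesgue_on T)" "AE x in lebesgue_on T. u x = u' x" "is_weak_pderiv T i u w"
  shows "is_weak_pderiv T i u' w"
proof -
  have "(\<integral>x. u' x * pderiv_at i \<phi> x \<partial>lebesgue_on T) = (\<integral>x. u x * pderiv_at i \<phi> x \<partial>lebesgue_on T)"
    if "\<phi> \<in> test_functions (interior T)" for \<phi>
  proof (rule integral_cong_AE)
    show "AE x in lebesgue_on T. u' x * pderiv_at i \<phi> x = u x * pderiv_at i \<phi> x"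
      using assms(3) by eventually_elim simp
  qed (intro borel_measurable_times L2_measurable assms test_function_L2[OF that])+
  then show ?thesis using assms(4) unfolding is_weak_pderiv_def by simp
qed

lemma weak_pderiv_unique:
  assumes "w \<in> L2 (lebesgue_on T)" "w' \<in> L2 (lebesgue_on T)" "is_weak_pderiv T i u w" "is_weak_pderiv T i u w'"
  shows "AE x in lebesgue_on T. w x = w' x"
proof -
  have "AE x in lebesgue_on T. w x - w' x = 0"
  proof (rule fundamental_lemma)
    fix \<phi> assume "\<phi> \<in> test_functions (interior T)"
    then show "(\<integral>x. (w x - w' x) * \<phi> x \<partial>lebesgue_on T) = 0"
      using assms unfolding is_weak_pderiv_def
      by (simp add: left_diff_distrib L2_integrable_mult test_function_L2)
  qed (intro L2_diff assms)
  then show ?thesis by eventually_elim simp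
qed

lemma weak_pderiv_some:
  assumes "w \<in> L2 (lebesgue_on T)" "is_weak_pderiv T i u w"
  shows "weak_pderiv T i u \<in> L2 (lebesgue_on T)" "is_weak_pderiv T i u (weak_pderiv T i u)"
    "AE x in lebesgue_on T. weak_pderiv T i u x = w x"
proof -
  have "weak_pderiv T i u \<in> L2 (lebesgue_on T) \<and> is_weak_pderiv T i u (weak_pderiv T i u)"
    unfolding weak_pderiv_def by (rule someI[of "\<lambda>w. w \<in> L2 (lebesgue_on T) \<and> is_weak_pderiv T i u w" w]) (use assms in blast)
  then show *: "weak_pderiv T i u \<in> L2 (lebesgue_on T)" "is_weak_pderiv T i u (weak_pderiv T i u)" by blast+
  show "AE x in lebesgue_on T. weak_pderiv T i u x = w x"
    by (rule weak_pderiv_unique[OF *(1) assms(1) *(2) assms(2)])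
qed

lemma H1D:
  assumes "u \<in> H1 T"
  shows "u \<in> L2 (lebesgue_on T)" "weak_pderiv T i u \<in> L2 (lebesgue_on T)" "is_weak_pderiv T i u (weak_pderiv T i u)"
  using assms weak_pderiv_some unfolding H1_def by blast+

lemma H2D: assumes "u \<in> H2 T" shows "u \<in> H1 T" "weak_pderiv T i u \<in> H1 T"
  using assms unfolding H2_def by auto

lemma H1I: "u \<in> L2 (lebesgue_on T) \<Longrightarrow> (\<And>i. w i \<in> L2 (lebesgue_on T)) \<Longrightarrow> (\<And>i. is_weak_pderiv T i u (w i)) \<Longrightarrow> u \<in> H1 T"
  unfolding H1_def by blast

text \<open>The limit derivatives \<open>w\<close> are a separate argument, because
  \<open>weak_pderiv\<close> is a choice and hence linear only almost everywhere. Linear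
  combinations can then be formed with explicit derivatives.\<close>

definition H1_approx :: "(nat \<Rightarrow> real^'n \<Rightarrow> real) \<Rightarrow> (real^'n \<Rightarrow> real) \<Rightarrow> ('n \<Rightarrow> real^'n \<Rightarrow> real) \<Rightarrow> bool" where
  "H1_approx \<phi> u w \<longleftrightarrow> (\<forall>j. smooth (\<phi> j)) \<and> (\<lambda>j. \<integral>x. (\<phi> j x - u x)\<^sup>2 \<partial>lebesgue_on T) \<longlonglongrightarrow> 0 \<and>
     (\<forall>i. (\<lambda>j. \<integral>x. (pderiv_at i (\<phi> j) x - w i x)\<^sup>2 \<partial>lebesgue_on T) \<longlonglongrightarrow> 0)"

lemma mollify_H1_approx:
  assumes "u \<in> H1 T"
  shows "H1_approx (\<lambda>j. mollify j u) u (\<lambda>i. weak_pderiv T i u)"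
  unfolding H1_approx_def
proof (intro conjI allI)
  note u = H1D[OF assms]
  show "smooth (mollify j u)" for j by (rule smooth_mollify[OF u(1)])
  show "(\<lambda>j. \<integral>x. (mollify j u x - u x)\<^sup>2 \<partial>lebesgue_on T) \<longlonglongrightarrow> 0" by (rule mollify_tendsto[OF u(1)])
  fix i
  have "(\<integral>x. (pderiv_at i (mollify j u) x - weak_pderiv T i u x)\<^sup>2 \<partial>lebesgue_on T) =
     (\<integral>x. ((1 - 1 / (real j + 2)) * mollify j (weak_pderiv T i u) x - weak_pderiv T i u x)\<^sup>2 \<partial>lebesgue_on T)" for j
    by (intro Bochner_Integration.integral_cong) (auto simp: pderiv_mollify[OF u])
  then show "(\<lambda>j. \<integral>x. (pderiv_at i (mollify j u) x - weak_pderiv T i u x)\<^sup>2 \<partial>lebesgue_on T) \<longlonglongrightarrow> 0"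
    using scaled_mollify_tendsto[OF u(2)] by simp
qed

lemma mollify_pderiv_H1_approx:
  assumes "v \<in> H2 T"
  shows "H1_approx (\<lambda>j. pderiv_at i (mollify j v)) (weak_pderiv T i v) (\<lambda>k. weak_pderiv T k (weak_pderiv T i v))"
  unfolding H1_approx_def
proof (intro conjI allI)
  note v = H1D[OF H2D(1)[OF assms]] and vi = H1D[OF H2D(2)[OF assms]]
  show "smooth (pderiv_at i (mollify j v))" for j by (intro smooth_pderiv smooth_mollify v(1))
  show "(\<lambda>j. \<integral>x. (pderiv_at i (mollify j v) x - weak_pderiv T i v x)\<^sup>2 \<partial>lebesgue_on T) \<longlonglongrightarrow> 0"
    using mollify_H1_approx[OF H2D(1)[OF assms]] unfolding H1_approx_def by blast
  fix k
  let ?w = "weak_pderiv T k (weak_pderiv T i v)"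
  let ?c = "\<lambda>j. 1 - 1 / (real j + 2)"
  \<comment> \<open>The formula for the first derivative of the mollification holds on
    \<open>T\<close> only; \<open>pderiv_cong\<close> allows it to be differentiated up to the
    boundary. Each derivative contributes one factor \<open>?c j\<close>.\<close>
  have pd: "pderiv_at k (pderiv_at i (mollify j v)) x = ?c j * (?c j * mollify j ?w x)" if x: "x \<in> T" for j x
  proof -
    have "pderiv_at k (pderiv_at i (mollify j v)) x = pderiv_at k (\<lambda>x. ?c j * mollify j (weak_pderiv T i v) x) x"
      using pderiv_mollify[OF v] x
      by (intro pderiv_cong smooth_cmult smooth_pderiv smooth_mollify v vi) auto
    also have "\<dots> = ?c j * pderiv_at k (mollify j (weak_pderiv T i v)) x"
      by (intro pderiv_cmult smooth_differentiable smooth_mollify vi)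
    finally show ?thesis using pderiv_mollify[OF vi x] by simp
  qed
  have mL: "mollify j ?w \<in> L2 (lebesgue_on T)" for j by (intro L2_smooth compact_T smooth_mollify vi)
  show "(\<lambda>j. \<integral>x. (pderiv_at k (pderiv_at i (mollify j v)) x - ?w x)\<^sup>2 \<partial>lebesgue_on T) \<longlonglongrightarrow> 0"
  proof (rule tendsto_sandwich[of "\<lambda>_. 0"])
    let ?A = "\<lambda>j. \<integral>x. (?c j * mollify j ?w x - ?w x)\<^sup>2 \<partial>lebesgue_on T" and ?B = "\<integral>x. (?w x)\<^sup>2 \<partial>lebesgue_on T"
    show "\<forall>\<^sub>F j in sequentially. (\<integral>x. (pderiv_at k (pderiv_at i (mollify j v)) x - ?w x)\<^sup>2 \<partial>lebesgue_on T) \<le> 2 * ((?c j)\<^sup>2 * ?A j) + 2 * ((1 / (real j + 2))\<^sup>2 * ?B)"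
    proof (intro always_eventually allI)
      fix j
      have "(\<integral>x. (pderiv_at k (pderiv_at i (mollify j v)) x - ?w x)\<^sup>2 \<partial>lebesgue_on T)
         = (\<integral>x. (?c j * (?c j * mollify j ?w x) - ?w x)\<^sup>2 \<partial>lebesgue_on T)"
        by (intro Bochner_Integration.integral_cong) (auto simp: pd)
      also have "\<dots> \<le> 2 * (\<integral>x. (?c j * (?c j * mollify j ?w x) - ?c j * ?w x)\<^sup>2 \<partial>lebesgue_on T) + 2 * (\<integral>x. (?c j * ?w x - ?w x)\<^sup>2 \<partial>lebesgue_on T)"
        by (intro L2_dist_triangle L2_cmult mL vi)
      also have "(\<integral>x. (?c j * (?c j * mollify j ?w x) - ?c j * ?w x)\<^sup>2 \<partial>lebesgue_on T) = (?c j)\<^sup>2 * ?A j"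
        unfolding right_diff_distrib[symmetric] power_mult_distrib by simp
      also have "(\<integral>x. (?c j * ?w x - ?w x)\<^sup>2 \<partial>lebesgue_on T) = (1 / (real j + 2))\<^sup>2 * ?B"
      proof -
        have "(?c j * ?w x - ?w x)\<^sup>2 = (1 / (real j + 2))\<^sup>2 * (?w x)\<^sup>2" for x
          by (simp add: left_diff_distrib power_mult_distrib power_divide)
        then show ?thesis by simp
      qed
      finally show "(\<integral>x. (pderiv_at k (pderiv_at i (mollify j v)) x - ?w x)\<^sup>2 \<partial>lebesgue_on T) \<le> 2 * ((?c j)\<^sup>2 * ?A j) + 2 * ((1 / (real j + 2))\<^sup>2 * ?B)" .
    qed
    have e: "(\<lambda>j. 1 / (real j + 2)) \<longlonglongrightarrow> 0"
      using LIMSEQ_ignore_initial_segment[OF lim_1_over_n[where 'a=real], of 2] by (simp add: add.commute)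
    have "(\<lambda>j. 2 * ((?c j)\<^sup>2 * ?A j) + 2 * ((1 / (real j + 2))\<^sup>2 * ?B)) \<longlonglongrightarrow> 2 * ((1 - 0)\<^sup>2 * 0) + 2 * (0\<^sup>2 * ?B)"
      by (intro tendsto_intros e scaled_mollify_tendsto vi)
    then show "(\<lambda>j. 2 * ((?c j)\<^sup>2 * ?A j) + 2 * ((1 / (real j + 2))\<^sup>2 * ?B)) \<longlonglongrightarrow> 0" by simp
  qed auto
qed

text \<open>Serves the normal derivative, with \<open>a\<close> the components of a normal.
  Cauchy-Schwarz in the index \<open>i\<close> bounds the error of the combination by the errors of
  its terms.\<close>

lemma H1_approx_inner:
  fixes \<phi> :: "'i::finite \<Rightarrow> nat \<Rightarrow> real^'n \<Rightarrow> real"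
  assumes "\<And>i. H1_approx (\<lambda>j. \<phi> i j) (u i) (w i)"
    "\<And>i. u i \<in> L2 (lebesgue_on T)" "\<And>i k. w i k \<in> L2 (lebesgue_on T)"
  shows "H1_approx (\<lambda>j x. \<Sum>i\<in>UNIV. a i * \<phi> i j x) (\<lambda>x. \<Sum>i\<in>UNIV. a i * u i x) (\<lambda>k x. \<Sum>i\<in>UNIV. a i * w i k x)"
proof -
  have tend: "(\<lambda>j. \<integral>x. ((\<Sum>i\<in>UNIV. a i * f i j x) - (\<Sum>i\<in>UNIV. a i * g i x))\<^sup>2 \<partial>lebesgue_on T) \<longlonglongrightarrow> 0"
    if L: "\<And>i j. f i j \<in> L2 (lebesgue_on T)" "\<And>i. g i \<in> L2 (lebesgue_on T)"
      and lim: "\<And>i. (\<lambda>j. \<integral>x. (f i j x - g i x)\<^sup>2 \<partial>lebesgue_on T) \<longlonglongrightarrow> 0"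
    for f :: "'i \<Rightarrow> nat \<Rightarrow> real^'n \<Rightarrow> real" and g
  proof (rule tendsto_sandwich[of "\<lambda>_. 0"])
    let ?A = "\<Sum>i\<in>UNIV. (a i)\<^sup>2"
    have int: "integrable (lebesgue_on T) (\<lambda>x. (f i j x - g i x)\<^sup>2)" for i j
      by (intro L2_integrable_sq L2_diff L)
    show "\<forall>\<^sub>F j in sequentially. (\<integral>x. ((\<Sum>i\<in>UNIV. a i * f i j x) - (\<Sum>i\<in>UNIV. a i * g i x))\<^sup>2 \<partial>lebesgue_on T)
       \<le> ?A * (\<Sum>i\<in>UNIV. \<integral>x. (f i j x - g i x)\<^sup>2 \<partial>lebesgue_on T)"
    proof (intro always_eventually allI)
      fix j
      have "(\<integral>x. ((\<Sum>i\<in>UNIV. a i * f i j x) - (\<Sum>i\<in>UNIV. a i * g i x))\<^sup>2 \<partial>lebesgue_on T)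
         \<le> (\<integral>x. ?A * (\<Sum>i\<in>UNIV. (f i j x - g i x)\<^sup>2) \<partial>lebesgue_on T)"
      proof (rule integral_mono)
        show "integrable (lebesgue_on T) (\<lambda>x. ((\<Sum>i\<in>UNIV. a i * f i j x) - (\<Sum>i\<in>UNIV. a i * g i x))\<^sup>2)"
          by (intro L2_integrable_sq L2_diff L2_sum L2_cmult L)
        show "integrable (lebesgue_on T) (\<lambda>x. ?A * (\<Sum>i\<in>UNIV. (f i j x - g i x)\<^sup>2))"
          by (intro integrable_mult_right Bochner_Integration.integrable_sum int)
        fix x
        show "((\<Sum>i\<in>UNIV. a i * f i j x) - (\<Sum>i\<in>UNIV. a i * g i x))\<^sup>2 \<le> ?A * (\<Sum>i\<in>UNIV. (f i j x - g i x)\<^sup>2)"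
          using Cauchy_Schwarz_ineq_sum[of a "\<lambda>i. f i j x - g i x" UNIV]
          by (simp add: right_diff_distrib sum_subtractf)
      qed
      also have "\<dots> = ?A * (\<Sum>i\<in>UNIV. \<integral>x. (f i j x - g i x)\<^sup>2 \<partial>lebesgue_on T)"
        by (simp add: int)
      finally show "(\<integral>x. ((\<Sum>i\<in>UNIV. a i * f i j x) - (\<Sum>i\<in>UNIV. a i * g i x))\<^sup>2 \<partial>lebesgue_on T)
       \<le> ?A * (\<Sum>i\<in>UNIV. \<integral>x. (f i j x - g i x)\<^sup>2 \<partial>lebesgue_on T)" .
    qed
    have "(\<lambda>j. ?A * (\<Sum>i\<in>UNIV. \<integral>x. (f i j x - g i x)\<^sup>2 \<partial>lebesgue_on T)) \<longlonglongrightarrow> ?A * (\<Sum>i\<in>(UNIV::'i set). 0)"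
      by (intro tendsto_intros lim)
    then show "(\<lambda>j. ?A * (\<Sum>i\<in>UNIV. \<integral>x. (f i j x - g i x)\<^sup>2 \<partial>lebesgue_on T)) \<longlonglongrightarrow> 0" by simp
  qed auto
  have sm: "smooth (\<phi> i j)" for i j using assms(1) unfolding H1_approx_def by blast
  have pd: "pderiv_at k (\<lambda>x. \<Sum>i\<in>UNIV. a i * \<phi> i j x) = (\<lambda>x. \<Sum>i\<in>UNIV. a i * pderiv_at k (\<phi> i j) x)" for k j
    by (rule ext, subst pderiv_sum)
       (auto simp: pderiv_cmult smooth_differentiable[OF sm] intro!: differentiable_mult smooth_differentiable[OF sm])
  show ?thesis
    unfolding H1_approx_def pd
    using assms(1) unfolding H1_approx_def
    by (intro conjI allI tend smooth_sum smooth_cmult sm L2_smooth[OF compact_T] smooth_pderiv assms(2,3)) auto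
qed

end

section \<open>Completeness of the space of square-integrable functions\<close>

text \<open>Riesz-Fischer: a rapidly converging subsequence converges almost everywhere, and Fatou's
  lemma turns its pointwise limit into a limit of the whole sequence in the square mean.\<close>

lemma L2_complete:
  assumes L: "\<And>j. f j \<in> L2 M"
    and Cauchy: "\<And>e. e > 0 \<Longrightarrow> \<exists>N. \<forall>i\<ge>N. \<forall>j\<ge>N. (\<integral>x. (f i x - f j x)\<^sup>2 \<partial>M) < e"
  shows "\<exists>g\<in>L2 M. (\<lambda>j. \<integral>x. (f j x - g x)\<^sup>2 \<partial>M) \<longlonglongrightarrow> 0"
proof -
  note [measurable] = L2_measurable[OF L]
  have nn: "(\<integral>\<^sup>+x. ennreal ((f i x - f j x)\<^sup>2) \<partial>M) = ennreal (\<integral>x. (f i x - f j x)\<^sup>2 \<partial>M)" for i j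
    by (intro nn_integral_eq_integral L2_integrable_sq L2_diff L) auto
  \<comment> \<open>Squared distances below \<open>8^-k\<close> with weights \<open>4^k\<close>
    leave the summable bound \<open>2^-k\<close>; finiteness of the weighted sum then forces the
    increments below \<open>2^-k\<close> eventually.\<close>
  have "\<forall>k. \<exists>N. \<forall>i\<ge>N. \<forall>j\<ge>N. (\<integral>x. (f i x - f j x)\<^sup>2 \<partial>M) < (1/8) ^ k"
    using Cauchy by simp
  then obtain N where N: "\<And>k i j. i \<ge> N k \<Longrightarrow> j \<ge> N k \<Longrightarrow> (\<integral>x. (f i x - f j x)\<^sup>2 \<partial>M) < (1/8) ^ k" by metis
  \<comment> \<open>The maximum makes the indices nondecreasing and large enough for the threshold
    \<open>N k\<close>; adding \<open>k\<close> makes them tend to infinity.\<close>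
  define r where "r = (\<lambda>k. Max (N ` {..k}) + k)"
  have rN: "r k \<ge> N k" for k unfolding r_def by (intro trans_le_add1 Max_ge) auto
  have rk: "r k \<ge> k" for k unfolding r_def by simp
  have rmono: "r k \<le> r (Suc k)" for k unfolding r_def by (intro add_mono Max_mono) auto
  define a where "a = (\<lambda>k x. f (r (Suc k)) x - f (r k) x)"
  have [measurable]: "a k \<in> borel_measurable M" for k unfolding a_def by measurable
  have "(\<integral>\<^sup>+x. (\<Sum>k. ennreal (4 ^ k * (a k x)\<^sup>2)) \<partial>M) = (\<Sum>k. \<integral>\<^sup>+x. ennreal (4 ^ k * (a k x)\<^sup>2) \<partial>M)"
    by (intro nn_integral_suminf) measurable
  also have "\<dots> \<le> (\<Sum>k. ennreal ((1/2) ^ k))"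
  proof (intro suminf_le)
    fix k
    have "(\<integral>\<^sup>+x. ennreal (4 ^ k * (a k x)\<^sup>2) \<partial>M) = ennreal (4 ^ k) * ennreal (\<integral>x. (f (r (Suc k)) x - f (r k) x)\<^sup>2 \<partial>M)"
      unfolding nn[symmetric] a_def by (simp add: ennreal_mult nn_integral_cmult)
    also have "\<dots> \<le> ennreal (4 ^ k) * ennreal ((1/8) ^ k)"
      using N[of k "r (Suc k)" "r k"] rN[of k] rmono[of k] by (intro mult_left_mono ennreal_leI less_imp_le) auto
    also have "\<dots> = ennreal (4 ^ k * (1/8) ^ k)" by (simp add: ennreal_mult)
    also have "(4::real) ^ k * (1/8) ^ k = (1/2) ^ k" by (simp add: power_mult_distrib[symmetric])
    finally show "(\<integral>\<^sup>+x. ennreal (4 ^ k * (a k x)\<^sup>2) \<partial>M) \<le> ennreal ((1/2) ^ k)" .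
  qed auto
  also have "\<dots> = ennreal (\<Sum>k. (1/2) ^ k)" by (intro suminf_ennreal2) (auto intro: summable_geometric)
  finally have "(\<integral>\<^sup>+x. (\<Sum>k. ennreal (4 ^ k * (a k x)\<^sup>2)) \<partial>M) \<noteq> \<infinity>" by (auto simp: top_unique)
  then have "AE x in M. (\<Sum>k. ennreal (4 ^ k * (a k x)\<^sup>2)) \<noteq> \<infinity>"
    by (intro nn_integral_noteq_infinite) measurable
  then have conv: "AE x in M. convergent (\<lambda>k. f (r k) x)"
  proof eventually_elim
    case (elim x)
    have "summable (\<lambda>k. 4 ^ k * (a k x)\<^sup>2)"
      using elim by (intro summable_suminf_not_top) auto
    then have "(\<lambda>k. 4 ^ k * (a k x)\<^sup>2) \<longlonglongrightarrow> 0" by (rule summable_LIMSEQ_zero)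
    then have "\<forall>\<^sub>F k in sequentially. 4 ^ k * (a k x)\<^sup>2 < 1" by (rule order_tendstoD) simp
    then have ev: "\<forall>\<^sub>F k in sequentially. norm (a k x) \<le> (1/2) ^ k"
    proof eventually_elim
      case (elim k)
      have "(2 ^ k * a k x)\<^sup>2 \<le> 1\<^sup>2" using elim by (simp add: power_mult_distrib power2_eq_square[of "2 ^ k"] power_mult_distrib[symmetric])
      then have "\<bar>2 ^ k * a k x\<bar> \<le> \<bar>1\<bar>" unfolding abs_le_square_iff .
      then show ?case by (simp add: abs_mult field_simps)
    qed
    have "summable (\<lambda>k. a k x)"
      by (rule summable_comparison_test_ev[OF ev]) (auto intro: summable_geometric)
    then have "convergent (\<lambda>n. \<Sum>k<n. a k x)" unfolding summable_iff_convergent .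
    moreover have "(\<Sum>k<n. a k x) = f (r n) x - f (r 0) x" for n
      unfolding a_def by (rule sum_lessThan_telescope)
    ultimately have "convergent (\<lambda>n. f (r n) x - f (r 0) x)" by simp
    from convergent_add[OF this convergent_const[of "f (r 0) x"]] show ?case by simp
  qed
  define g where "g = (\<lambda>x. lim (\<lambda>k. f (r k) x))"
  have gm [measurable]: "g \<in> borel_measurable M" unfolding g_def by (intro borel_measurable_lim_metric) measurable
  have lim: "AE x in M. (\<lambda>k. f (r k) x) \<longlonglongrightarrow> g x"
    using conv unfolding g_def by eventually_elim (simp add: convergent_LIMSEQ_iff)
  have fatou: "(\<integral>\<^sup>+x. ennreal ((f j x - g x)\<^sup>2) \<partial>M) \<le> ennreal e"
    if e: "e > 0" and n: "\<forall>i\<ge>n. \<forall>j\<ge>n. (\<integral>x. (f i x - f j x)\<^sup>2 \<partial>M) < e" and j: "j \<ge> n" for e n j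
  proof -
    have "(\<integral>\<^sup>+x. ennreal ((f j x - g x)\<^sup>2) \<partial>M) = (\<integral>\<^sup>+x. liminf (\<lambda>k. ennreal ((f j x - f (r k) x)\<^sup>2)) \<partial>M)"
    proof (rule nn_integral_cong_AE)
      show "AE x in M. ennreal ((f j x - g x)\<^sup>2) = liminf (\<lambda>k. ennreal ((f j x - f (r k) x)\<^sup>2))"
        using lim
      proof eventually_elim
        case (elim x)
        then have "(\<lambda>k. ennreal ((f j x - f (r k) x)\<^sup>2)) \<longlonglongrightarrow> ennreal ((f j x - g x)\<^sup>2)"
          by (intro tendsto_intros tendsto_ennrealI)
        from lim_imp_Liminf[OF _ this] show ?case by simp
      qed
    qed
    also have "\<dots> \<le> liminf (\<lambda>k. \<integral>\<^sup>+x. ennreal ((f j x - f (r k) x)\<^sup>2) \<partial>M)"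
      by (rule nn_integral_liminf) measurable
    also have "\<dots> \<le> ennreal e"
    proof -
      have "(\<integral>\<^sup>+x. ennreal ((f j x - f (r k) x)\<^sup>2) \<partial>M) \<le> ennreal e" if "k \<ge> n" for k
        unfolding nn using n j rk[of k] that by (intro ennreal_leI less_imp_le) auto
      then have "\<forall>\<^sub>F k in sequentially. (\<integral>\<^sup>+x. ennreal ((f j x - f (r k) x)\<^sup>2) \<partial>M) \<le> ennreal e"
        unfolding eventually_sequentially by blast
      then have "limsup (\<lambda>k. \<integral>\<^sup>+x. ennreal ((f j x - f (r k) x)\<^sup>2) \<partial>M) \<le> ennreal e"
        by (rule Limsup_bounded)
      then show ?thesis
        using Liminf_le_Limsup[of sequentially "\<lambda>k. \<integral>\<^sup>+x. ennreal ((f j x - f (r k) x)\<^sup>2) \<partial>M"]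
        by simp
    qed
    finally show ?thesis .
  qed
  have int: "(\<lambda>x. f j x - g x) \<in> L2 M \<and> (\<integral>x. (f j x - g x)\<^sup>2 \<partial>M) \<le> e"
    if "e > 0" "\<forall>i\<ge>n. \<forall>j\<ge>n. (\<integral>x. (f i x - f j x)\<^sup>2 \<partial>M) < e" "j \<ge> n" for e n j
  proof -
    note le = fatou[OF that]
    have "integrable M (\<lambda>x. (f j x - g x)\<^sup>2)"
      using le by (intro integrableI_bounded) (auto intro: le_less_trans)
    moreover from this have "(\<integral>x. (f j x - g x)\<^sup>2 \<partial>M) \<le> e"
      using le that(1) by (subst (asm) nn_integral_eq_integral) (auto simp: ennreal_le_iff)
    ultimately show ?thesis unfolding L2_def by simp
  qed
  obtain n where "\<forall>i\<ge>n. \<forall>j\<ge>n. (\<integral>x. (f i x - f j x)\<^sup>2 \<partial>M) < 1" using Cauchy[of 1] by auto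
  from int[OF _ this, of n] have "(\<lambda>x. f n x - g x) \<in> L2 M" by simp
  from L2_diff[OF L[of n] this] have gL: "g \<in> L2 M" by simp
  have "(\<lambda>j. \<integral>x. (f j x - g x)\<^sup>2 \<partial>M) \<longlonglongrightarrow> 0"
  proof (rule LIMSEQ_I)
    fix e :: real assume "e > 0"
    then obtain n where n: "\<forall>i\<ge>n. \<forall>j\<ge>n. (\<integral>x. (f i x - f j x)\<^sup>2 \<partial>M) < e / 2" using Cauchy[of "e / 2"] by auto
    have "norm ((\<integral>x. (f j x - g x)\<^sup>2 \<partial>M) - 0) < e" if "j \<ge> n" for j
    proof -
      have "(\<integral>x. (f j x - g x)\<^sup>2 \<partial>M) \<le> e / 2" using int[OF _ n that] \<open>e > 0\<close> by simp
      moreover have "(\<integral>x. (f j x - g x)\<^sup>2 \<partial>M) \<ge> 0" by (intro Bochner_Integration.integral_nonneg) auto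
      ultimately show ?thesis using \<open>e > 0\<close> unfolding real_norm_def by linarith
    qed
    then show "\<exists>n. \<forall>j\<ge>n. norm ((\<integral>x. (f j x - g x)\<^sup>2 \<partial>M) - 0) < e" by blast
  qed
  then show ?thesis using gL by blast
qed

lemma l2_norm_tendsto_0_iff: "(\<lambda>j. l2_norm M (f j)) \<longlonglongrightarrow> 0 \<longleftrightarrow> (\<lambda>j. \<integral>x. f j x \<bullet> f j x \<partial>M) \<longlonglongrightarrow> 0"
proof
  have nn: "(\<integral>x. f j x \<bullet> f j x \<partial>M) \<ge> 0" for j by (intro Bochner_Integration.integral_nonneg) auto
  assume "(\<lambda>j. l2_norm M (f j)) \<longlonglongrightarrow> 0"
  then have "(\<lambda>j. (l2_norm M (f j))\<^sup>2) \<longlonglongrightarrow> 0\<^sup>2" by (intro tendsto_power)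
  then show "(\<lambda>j. \<integral>x. f j x \<bullet> f j x \<partial>M) \<longlonglongrightarrow> 0" using nn by (simp add: l2_norm_def l2_inner_def)
next
  assume "(\<lambda>j. \<integral>x. f j x \<bullet> f j x \<partial>M) \<longlonglongrightarrow> 0"
  then have "(\<lambda>j. sqrt (\<integral>x. f j x \<bullet> f j x \<partial>M)) \<longlonglongrightarrow> sqrt 0" by (intro tendsto_real_sqrt)
  then show "(\<lambda>j. l2_norm M (f j)) \<longlonglongrightarrow> 0" by (simp add: l2_norm_def l2_inner_def)
qed

lemma L2_surf_continuous:
  assumes "compact M" "continuous_on M f" shows "f \<in> L2 (surf M)"
  unfolding L2_def
  by (auto intro!: borel_measurable_surf_continuous integrable_surf_continuous continuous_intros assms)

section \<open>Traces on the sides of a simplex\<close>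

text \<open>The full-dimensional simplex seen in both ways, as the convex domain of the
  mollification and through its barycentric coordinates.\<close>

locale cell = mollifier T \<eta> + simplex_coords C w
  for T :: "(real^'n) set" and \<eta> and C :: "(real^'n) set" and w +
  assumes T_def: "T = convex hull C" and card_C: "card C = CARD('n) + 1"
begin

lemma direction_space_T: "direction_space T = UNIV"
proof -
  obtain a where a: "a \<in> C" using ex_other by blast
  have "affine hull C = UNIV" by (rule affine_independent_span_eq[OF indep]) (simp add: card_C)
  then have "v \<in> direction_space C" for v using affine_hull_iff_direction_space[OF a, of "v + a"] by simp
  then show ?thesis unfolding T_def direction_space_convex_hull by blast
qed

text \<open>The direction space is the whole space, with the standard basis as orthonormal basis. So
  \<open>surf T\<close> acts as Lebesgue measure on Borel functions, and the divergence theorem for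
  surface measures covers the cell.\<close>

lemma integral_surf_T:
  assumes "h \<in> borel_measurable borel" shows "(\<integral>x. h x \<partial>surf T) = (\<integral>x. (h x :: real) \<partial>lebesgue_on T)"
proof -
  obtain a where a: "a \<in> C" using ex_other by blast
  then have aT: "a \<in> T" unfolding T_def by (simp add: hull_inc)
  have onb: "onb Basis (direction_space T)"
    unfolding onb_def direction_space_T by (auto simp: pairwise_def orthogonal_def inner_Basis)
  have "aff_lborel a Basis = (lborel :: (real^'n) measure)"
    unfolding lborel_eq_aff_lborel by (rule aff_lborel_base) auto
  then show ?thesis
    using integral_surf[OF aT onb T_borel, of h] integral_lebesgue_on_lborel[OF T_borel assms] by simp
qed

lemma faces_T: "faces T = side ` C"
  unfolding T_def by (rule faces_eq)

lemma finite_faces: "finite (faces T)" unfolding faces_T using fin by simp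

lemma face_compact: "F \<in> faces T \<Longrightarrow> compact F" unfolding faces_T using compact_side by blast

lemma L2_surf_smooth: "F \<in> faces T \<Longrightarrow> smooth f \<Longrightarrow> f \<in> L2 (surf F)"
  by (intro L2_surf_continuous face_compact smooth_continuous)

lemma divergence_T:
  assumes "smooth f"
  shows "(\<integral>x. pderiv_at i f x \<partial>lebesgue_on T) = (\<Sum>F\<in>faces T. outer_normal T F $ i * (\<integral>x. f x \<partial>surf F))"
proof -
  have "(\<integral>x. dderiv (axis i 1) f x \<partial>surf T) = (\<Sum>F\<in>faces T. (axis i 1 \<bullet> outer_normal T F) * (\<integral>x. f x \<partial>surf F))"
    using divergence_theorem[of "axis i 1" f] assms direction_space_T unfolding T_def by simp
  then show ?thesis
    using integral_surf_T[of "pderiv_at i f"] assms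
    by (simp add: pderiv_at_def[symmetric] inner_axis' borel_measurable_continuous_onI smooth_continuous smooth_pderiv)
qed

lemma integration_by_parts_T:
  assumes "smooth f" "smooth g"
  shows "(\<integral>x. pderiv_at i f x * g x \<partial>lebesgue_on T) =
     (\<Sum>F\<in>faces T. outer_normal T F $ i * (\<integral>x. f x * g x \<partial>surf F)) - (\<integral>x. f x * pderiv_at i g x \<partial>lebesgue_on T)"
proof -
  have "pderiv_at i (\<lambda>x. f x * g x) = (\<lambda>x. pderiv_at i f x * g x + f x * pderiv_at i g x)"
    using assms pderiv_mult smooth_differentiable by blast
  then show ?thesis
    using divergence_T[OF smooth_mult[OF assms], of i] assms
    by (simp add: L2_integrable_mult L2_smooth compact_T smooth_pderiv)
qed

text \<open>Integration by parts; the boundary terms vanish because a test function is supported in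
  the interior, which is disjoint from every face.\<close>

lemma is_weak_pderiv_smooth:
  assumes "smooth f" shows "is_weak_pderiv T i f (pderiv_at i f)"
  unfolding is_weak_pderiv_def
proof
  fix \<phi> assume \<phi>: "\<phi> \<in> test_functions (interior T)"
  then have sm: "smooth \<phi>" unfolding test_functions_def by blast
  have "\<phi> x = 0" if F: "F \<in> faces T" and x: "x \<in> F" for F x
  proof -
    have "F face_of T" "F \<noteq> T" using F unfolding faces_def facet_of_def by auto
    then have "x \<notin> interior T" using face_of_disjoint_interior x by blast
    then show ?thesis using \<phi> closure_subset[of "{x. \<phi> x \<noteq> 0}"] unfolding test_functions_def by auto
  qed
  then have "(\<integral>x. f x * \<phi> x \<partial>surf F) = 0" if "F \<in> faces T" for F
    using that by (subst Bochner_Integration.integral_cong[where g="\<lambda>_. 0" and N="surf F"]) auto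
  then show "(\<integral>x. f x * pderiv_at i \<phi> x \<partial>lebesgue_on T) = - (\<integral>x. pderiv_at i f x * \<phi> x \<partial>lebesgue_on T)"
    using integration_by_parts_T[OF assms sm, of i] by simp
qed

text \<open>The divergence theorem for the field \<open>\<phi>\<^sup>2 (x - c)\<close>, where \<open>c\<close> is the vertex opposite to \<open>F\<close>:
  its normal component vanishes on all other sides and is a constant multiple of \<open>\<phi>\<^sup>2\<close> on \<open>F\<close>.\<close>
lemma trace_inequality:
  assumes F: "F \<in> faces T"
  shows "\<exists>K\<ge>0. \<forall>\<phi>. smooth \<phi> \<longrightarrow> (\<integral>x. (\<phi> x)\<^sup>2 \<partial>surf F) \<le>
    K * ((\<integral>x. (\<phi> x)\<^sup>2 \<partial>lebesgue_on T) + (\<Sum>i\<in>UNIV. \<integral>x. (pderiv_at i \<phi> x)\<^sup>2 \<partial>lebesgue_on T))"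
proof -
  obtain c where c: "c \<in> C" "F = side c" using F unfolding faces_T by blast
  obtain R where R: "R > 0" "\<And>x. x \<in> T \<Longrightarrow> norm (x - c) \<le> R"
    using compact_imp_bounded[OF compact_translation[OF compact_T, of "-c"]] unfolding bounded_pos by auto
  have wc: "norm (w c) > 0" using w_nonzero[OF c(1)] by simp
  let ?n = "real CARD('n)"
  have "(\<integral>x. (\<phi> x)\<^sup>2 \<partial>surf F) \<le> (norm (w c) * (?n * (1 + R\<^sup>2) + 1)) *
     ((\<integral>x. (\<phi> x)\<^sup>2 \<partial>lebesgue_on T) + (\<Sum>i\<in>UNIV. \<integral>x. (pderiv_at i \<phi> x)\<^sup>2 \<partial>lebesgue_on T))" if sm: "smooth \<phi>" for \<phi>
  proof -
    let ?A = "\<integral>x. (\<phi> x)\<^sup>2 \<partial>lebesgue_on T" and ?B = "\<Sum>i\<in>UNIV. \<integral>x. (pderiv_at i \<phi> x)\<^sup>2 \<partial>lebesgue_on T"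
    let ?q = "\<lambda>i x. (\<phi> x)\<^sup>2 * (x $ i - c $ i)"
    have sq: "smooth (?q i)" for i
      by (intro smooth_mult smooth_power sm smooth_diff smooth_nth smooth_const)
    have pq: "pderiv_at i (?q i) x = (\<phi> x)\<^sup>2 + 2 * \<phi> x * pderiv_at i \<phi> x * (x $ i - c $ i)" for i x
    proof -
      have "pderiv_at i (\<lambda>x. x $ i - c $ i) x = 1"
        using pderiv_add[of "\<lambda>x. x $ i" x "\<lambda>_. - c $ i" i] pderiv_inner[of i "axis i 1"] smooth_differentiable[OF smooth_nth[of i]]
        by (simp add: inner_axis)
      moreover have "pderiv_at i (\<lambda>x. (\<phi> x)\<^sup>2) x = 2 * \<phi> x * pderiv_at i \<phi> x"
        using pderiv_mult[of \<phi> x \<phi> i] smooth_differentiable[OF sm] by (simp add: power2_eq_square)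
      ultimately show ?thesis
        by (subst pderiv_mult) (auto intro!: smooth_differentiable smooth_power sm smooth_diff smooth_nth smooth_const)
    qed
    have intG: "integrable (surf G) (?q i)" if "G \<in> faces T" for G i
      using that by (intro integrable_surf_continuous face_compact smooth_continuous sq)
    have flux: "(\<Sum>i\<in>UNIV. outer_normal T G $ i * (\<integral>x. ?q i x \<partial>surf G)) = (if G = F then (\<integral>x. (\<phi> x)\<^sup>2 \<partial>surf F) / norm (w c) else 0)"
      if G: "G \<in> faces T" for G
    proof -
      obtain d where d: "d \<in> C" "G = side d" using G unfolding faces_T by blast
      have "(\<Sum>i\<in>UNIV. outer_normal T G $ i * (\<integral>x. ?q i x \<partial>surf G)) = (\<integral>x. (\<Sum>i\<in>UNIV. outer_normal T G $ i * ?q i x) \<partial>surf G)"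
        using intG[OF G] by simp
      also have "\<dots> = (\<integral>x. (\<phi> x)\<^sup>2 * (if d = c then 1 / norm (w c) else 0) \<partial>surf G)"
      proof (rule Bochner_Integration.integral_cong[OF refl])
        fix x assume "x \<in> space (surf G)"
        then have x: "x \<in> side d" using d by simp
        have "(\<Sum>i\<in>UNIV. outer_normal T G $ i * ?q i x) = (\<phi> x)\<^sup>2 * (outer_normal T G \<bullet> (x - c))"
          by (simp add: inner_vec_def sum_distrib_left algebra_simps)
        also have "outer_normal T G \<bullet> (x - c) = - (w d \<bullet> (x - c)) / norm (w d)"
          unfolding T_def d(2) outer_normal_side[OF d(1)] by (simp add: divide_inverse mult.commute)
        also have "w d \<bullet> (x - c) = bary d x - bary d c" by (simp add: bary_def inner_diff_right)
        also have "\<dots> = (if d = c then -1 else 0)"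
          using x side_iff[OF d(1)] bary_vertex[OF d(1) c(1)] by auto
        finally show "(\<Sum>i\<in>UNIV. outer_normal T G $ i * ?q i x) = (\<phi> x)\<^sup>2 * (if d = c then 1 / norm (w c) else 0)" by auto
      qed
      also have "\<dots> = (if d = c then (\<integral>x. (\<phi> x)\<^sup>2 \<partial>surf F) / norm (w c) else 0)" using c d by simp
      also have "(d = c) = (G = F)" using side_inj c d unfolding inj_on_def by blast
      finally show ?thesis .
    qed
    have "(\<integral>x. (\<phi> x)\<^sup>2 \<partial>surf F) / norm (w c) = (\<Sum>G\<in>faces T. if G = F then (\<integral>x. (\<phi> x)\<^sup>2 \<partial>surf F) / norm (w c) else 0)"
      using F finite_faces by simp
    also have "\<dots> = (\<Sum>G\<in>faces T. \<Sum>i\<in>UNIV. outer_normal T G $ i * (\<integral>x. ?q i x \<partial>surf G))"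
      using flux by (intro sum.cong) auto
    also have "\<dots> = (\<Sum>i\<in>UNIV. \<integral>x. pderiv_at i (?q i) x \<partial>lebesgue_on T)"
      unfolding divergence_T[OF sq] by (rule sum.swap)
    also have "\<dots> \<le> (\<Sum>i\<in>UNIV. (\<integral>x. (1 + R\<^sup>2) * (\<phi> x)\<^sup>2 + (pderiv_at i \<phi> x)\<^sup>2 \<partial>lebesgue_on T))"
    proof (intro sum_mono integral_mono)
      show "integrable (lebesgue_on T) (pderiv_at i (?q i))" for i
        by (intro L2_integrable finite_measure_lebesgue_on lmeasurable_compact compact_T L2_smooth smooth_pderiv sq)
      show "integrable (lebesgue_on T) (\<lambda>x. (1 + R\<^sup>2) * (\<phi> x)\<^sup>2 + (pderiv_at i \<phi> x)\<^sup>2)" for i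
        by (intro Bochner_Integration.integrable_add integrable_mult_right L2_integrable_sq L2_smooth compact_T smooth_pderiv sm)
      fix i x assume "x \<in> space (lebesgue_on T)"
      then have "\<bar>x $ i - c $ i\<bar> \<le> R" using R(2)[of x] component_le_norm_cart[of "x - c" i] by simp
      then have x2: "(x $ i - c $ i)\<^sup>2 \<le> R\<^sup>2" using R(1) by (metis abs_le_square_iff abs_of_pos)
      \<comment> \<open>Young's inequality trades the mixed term for two squares; the components of
        \<open>x - c\<close> are bounded by \<open>R\<close> on \<open>T\<close>.\<close>
      have "2 * \<phi> x * pderiv_at i \<phi> x * (x $ i - c $ i) \<le> (\<phi> x)\<^sup>2 * (x $ i - c $ i)\<^sup>2 + (pderiv_at i \<phi> x)\<^sup>2"
        using sum_squares_bound[of "\<phi> x * (x $ i - c $ i)" "pderiv_at i \<phi> x"] unfolding power_mult_distrib by (simp only: mult_ac)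
      also have "\<dots> \<le> (\<phi> x)\<^sup>2 * R\<^sup>2 + (pderiv_at i \<phi> x)\<^sup>2" using x2 by (intro add_mono mult_left_mono) auto
      finally show "pderiv_at i (?q i) x \<le> (1 + R\<^sup>2) * (\<phi> x)\<^sup>2 + (pderiv_at i \<phi> x)\<^sup>2"
        unfolding pq by (simp add: algebra_simps)
    qed
    also have "\<dots> = ?n * (1 + R\<^sup>2) * (\<integral>x. (\<phi> x)\<^sup>2 \<partial>lebesgue_on T) + (\<Sum>i\<in>UNIV. \<integral>x. (pderiv_at i \<phi> x)\<^sup>2 \<partial>lebesgue_on T)"
      by (subst Bochner_Integration.integral_add)
         (auto intro!: integrable_mult_right L2_integrable_sq L2_smooth compact_T smooth_pderiv sm simp: sum.distrib)
    finally have le: "(\<integral>x. (\<phi> x)\<^sup>2 \<partial>surf F) / norm (w c) \<le> ?n * (1 + R\<^sup>2) * ?A + ?B" .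
    have "?A \<ge> 0" "?B \<ge> 0" by (auto intro!: sum_nonneg Bochner_Integration.integral_nonneg)
    then have "?n * (1 + R\<^sup>2) * ?A + ?B \<le> (?n * (1 + R\<^sup>2) + 1) * (?A + ?B)"
      by (simp add: algebra_simps add_nonneg_nonneg)
    then have "(\<integral>x. (\<phi> x)\<^sup>2 \<partial>surf F) / norm (w c) \<le> (?n * (1 + R\<^sup>2) + 1) * (?A + ?B)" using le by linarith
    then show ?thesis using wc by (simp add: pos_divide_le_eq mult_ac)
  qed
  then show ?thesis using wc R by (intro exI[of _ "norm (w c) * (?n * (1 + R\<^sup>2) + 1)"]) auto
qed

definition H1_dist :: "(real^'n \<Rightarrow> real) \<Rightarrow> ('n \<Rightarrow> real^'n \<Rightarrow> real) \<Rightarrow> (real^'n \<Rightarrow> real) \<Rightarrow> real" where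
  "H1_dist u z f = (\<integral>x. (f x - u x)\<^sup>2 \<partial>lebesgue_on T) + (\<Sum>i\<in>UNIV. \<integral>x. (pderiv_at i f x - z i x)\<^sup>2 \<partial>lebesgue_on T)"

lemma H1_approx_H1_dist: "H1_approx \<psi> u z \<Longrightarrow> (\<lambda>j. H1_dist u z (\<psi> j)) \<longlonglongrightarrow> 0"
proof -
  assume "H1_approx \<psi> u z"
  then have "(\<lambda>j. H1_dist u z (\<psi> j)) \<longlonglongrightarrow> 0 + (\<Sum>i\<in>(UNIV::'n set). 0)"
    unfolding H1_approx_def H1_dist_def by (intro tendsto_intros) auto
  then show ?thesis by simp
qed

text \<open>The trace inequality for \<open>f - g\<close>, with \<open>u\<close> inserted between
  them. It shows both that approximating sequences are Cauchy on \<open>F\<close> and that two of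
  them have the same limit there.\<close>

lemma trace_difference:
  assumes F: "F \<in> faces T" and L: "u \<in> L2 (lebesgue_on T)" "\<And>i. z i \<in> L2 (lebesgue_on T)"
  shows "\<exists>K\<ge>0. \<forall>f g. smooth f \<longrightarrow> smooth g \<longrightarrow> (\<integral>x. (f x - g x)\<^sup>2 \<partial>surf F) \<le> K * (H1_dist u z f + H1_dist u z g)"
proof -
  obtain K where K: "K \<ge> 0" "\<And>\<phi>. smooth \<phi> \<Longrightarrow> (\<integral>x. (\<phi> x)\<^sup>2 \<partial>surf F) \<le>
    K * ((\<integral>x. (\<phi> x)\<^sup>2 \<partial>lebesgue_on T) + (\<Sum>i\<in>UNIV. \<integral>x. (pderiv_at i \<phi> x)\<^sup>2 \<partial>lebesgue_on T))"
    using trace_inequality[OF F] by blast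
  have "(\<integral>x. (f x - g x)\<^sup>2 \<partial>surf F) \<le> (2 * K) * (H1_dist u z f + H1_dist u z g)" if sm: "smooth f" "smooth g" for f g
  proof -
    note pd = pderiv_diff[OF sm]
    have tri: "(\<integral>x. (a x - b x)\<^sup>2 \<partial>lebesgue_on T) \<le> 2 * (\<integral>x. (a x - c x)\<^sup>2 \<partial>lebesgue_on T) + 2 * (\<integral>x. (b x - c x)\<^sup>2 \<partial>lebesgue_on T)"
      if "a \<in> L2 (lebesgue_on T)" "b \<in> L2 (lebesgue_on T)" "c \<in> L2 (lebesgue_on T)" for a b c
      using L2_dist_triangle[OF that(1,3,2)] by (simp add: power2_commute)
    note S = L2_smooth[OF compact_T]
    have "(\<integral>x. (f x - g x)\<^sup>2 \<partial>surf F) \<le> K * ((\<integral>x. (f x - g x)\<^sup>2 \<partial>lebesgue_on T) + (\<Sum>i\<in>UNIV. \<integral>x. (pderiv_at i f x - pderiv_at i g x)\<^sup>2 \<partial>lebesgue_on T))"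
      using K(2)[OF smooth_diff[OF sm]] unfolding pd .
    also have "\<dots> \<le> K * ((2 * (\<integral>x. (f x - u x)\<^sup>2 \<partial>lebesgue_on T) + 2 * (\<integral>x. (g x - u x)\<^sup>2 \<partial>lebesgue_on T)) +
       (\<Sum>i\<in>UNIV. 2 * (\<integral>x. (pderiv_at i f x - z i x)\<^sup>2 \<partial>lebesgue_on T) + 2 * (\<integral>x. (pderiv_at i g x - z i x)\<^sup>2 \<partial>lebesgue_on T)))"
      using sm by (intro mult_left_mono add_mono sum_mono tri S smooth_pderiv L K(1))
    also have "\<dots> = (2 * K) * (H1_dist u z f + H1_dist u z g)"
      unfolding H1_dist_def by (simp add: sum.distrib sum_distrib_left[symmetric] algebra_simps)
    finally show ?thesis .
  qed
  then show ?thesis using K(1) by (intro exI[of _ "2 * K"]) auto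
qed

text \<open>\<open>face_trace\<close> is an arbitrary trace, so two things are needed. Completeness
  provides some trace, which makes the choice legitimate; and the sequence belonging to the chosen
  trace differs from \<open>\<psi>\<close> on \<open>F\<close> by a null sequence, so
  \<open>\<psi>\<close> converges to the chosen one.\<close>

lemma trace_limit:
  assumes F: "F \<in> faces T" and u: "u \<in> H1 T" and z: "\<And>i. z i \<in> L2 (lebesgue_on T)" "\<And>i. is_weak_pderiv T i u (z i)"
    and \<psi>: "H1_approx \<psi> u z"
  shows "face_trace T F u \<in> L2 (surf F)" "(\<lambda>j. \<integral>x. (\<psi> j x - face_trace T F u x)\<^sup>2 \<partial>surf F) \<longlonglongrightarrow> 0"
proof -
  let ?z = "\<lambda>i. weak_pderiv T i u"
  note uL = H1D[OF u]
  have sm: "smooth (\<psi> j)" for j using \<psi> unfolding H1_approx_def by blast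
  have "(\<integral>x. (pderiv_at i (\<psi> j) x - z i x)\<^sup>2 \<partial>lebesgue_on T) = (\<integral>x. (pderiv_at i (\<psi> j) x - ?z i x)\<^sup>2 \<partial>lebesgue_on T)" for i j
  proof (rule integral_cong_AE)
    show "AE x in lebesgue_on T. (pderiv_at i (\<psi> j) x - z i x)\<^sup>2 = (pderiv_at i (\<psi> j) x - ?z i x)\<^sup>2"
      using weak_pderiv_unique[OF z(1) uL(2) z(2) uL(3), of i] by eventually_elim simp
  qed (intro borel_measurable_power borel_measurable_diff L2_measurable z uL L2_smooth compact_T smooth_pderiv sm)+
  then have \<psi>': "H1_approx \<psi> u ?z" using \<psi> unfolding H1_approx_def by simp
  obtain K where K0: "K \<ge> 0 \<and> (\<forall>f g. smooth f \<longrightarrow> smooth g \<longrightarrow> (\<integral>x. (f x - g x)\<^sup>2 \<partial>surf F) \<le> K * (H1_dist u ?z f + H1_dist u ?z g))"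
    using trace_difference[OF F uL(1), of ?z, OF uL(2)] by (elim exE)
  note K = conjunct1[OF K0] conjunct2[OF K0, rule_format]
  note \<psi>0 = H1_approx_H1_dist[OF \<psi>']
  have \<psi>L: "\<psi> j \<in> L2 (surf F)" for j by (intro L2_surf_smooth F sm)
  have gr: "(\<lambda>j. \<integral>x. (grad (f j) x - weak_grad T u x) \<bullet> (grad (f j) x - weak_grad T u x) \<partial>lebesgue_on T)
    = (\<lambda>j. \<Sum>i\<in>UNIV. \<integral>x. (pderiv_at i (f j) x - ?z i x)\<^sup>2 \<partial>lebesgue_on T)" if "\<And>j. smooth (f j)" for f :: "nat \<Rightarrow> real^'n \<Rightarrow> real"
  proof
    fix j
    have "(grad (f j) x - weak_grad T u x) \<bullet> (grad (f j) x - weak_grad T u x) = (\<Sum>i\<in>UNIV. (pderiv_at i (f j) x - ?z i x)\<^sup>2)" for x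
      by (simp add: inner_vec_def grad_def weak_grad_def power2_eq_square)
    then show "(\<integral>x. (grad (f j) x - weak_grad T u x) \<bullet> (grad (f j) x - weak_grad T u x) \<partial>lebesgue_on T) = (\<Sum>i\<in>UNIV. \<integral>x. (pderiv_at i (f j) x - ?z i x)\<^sup>2 \<partial>lebesgue_on T)"
      using that by (simp add: L2_integrable_sq L2_diff L2_smooth compact_T smooth_pderiv uL)
  qed
  have "\<exists>g\<in>L2 (surf F). (\<lambda>j. \<integral>x. (\<psi> j x - g x)\<^sup>2 \<partial>surf F) \<longlonglongrightarrow> 0"
  proof (rule L2_complete[OF \<psi>L])
    fix e :: real assume e: "e > 0"
    then have "\<forall>\<^sub>F j in sequentially. H1_dist u ?z (\<psi> j) < e / (2 * (K + 1))"
      using K(1) by (intro order_tendstoD[OF \<psi>0]) (simp add: add_nonneg_pos)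
    then obtain N where N: "\<And>j. j \<ge> N \<Longrightarrow> H1_dist u ?z (\<psi> j) < e / (2 * (K + 1))" unfolding eventually_sequentially by blast
    have "(\<integral>x. (\<psi> i x - \<psi> j x)\<^sup>2 \<partial>surf F) < e" if "i \<ge> N" "j \<ge> N" for i j
    proof -
      have "(\<integral>x. (\<psi> i x - \<psi> j x)\<^sup>2 \<partial>surf F) \<le> K * (H1_dist u ?z (\<psi> i) + H1_dist u ?z (\<psi> j))" by (intro K sm)
      also have "\<dots> \<le> K * (e / (2 * (K + 1)) + e / (2 * (K + 1)))"
        using N[OF that(1)] N[OF that(2)] K(1) by (intro mult_left_mono add_mono) auto
      also have "\<dots> < e"
      proof -
        define t where "t = e / (2 * (K + 1))"
        have "e = 2 * (K + 1) * t" "t > 0" using K(1) e by (auto simp: t_def)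
        then have "K * (t + t) < e" by (simp add: algebra_simps)
        then show ?thesis by (simp add: t_def)
      qed
      finally show ?thesis .
    qed
    then show "\<exists>N. \<forall>i\<ge>N. \<forall>j\<ge>N. (\<integral>x. (\<psi> i x - \<psi> j x)\<^sup>2 \<partial>surf F) < e" by blast
  qed
  then obtain g0 where g0: "g0 \<in> L2 (surf F)" "(\<lambda>j. \<integral>x. (\<psi> j x - g0 x)\<^sup>2 \<partial>surf F) \<longlonglongrightarrow> 0" by blast
  have "is_trace T F u g0"
    unfolding is_trace_def l2_norm_tendsto_0_iff
  proof (intro conjI exI[of _ \<psi>])
    show "(\<lambda>j. \<integral>x. (grad (\<psi> j) x - weak_grad T u x) \<bullet> (grad (\<psi> j) x - weak_grad T u x) \<partial>lebesgue_on T) \<longlonglongrightarrow> 0"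
    proof -
      have "(\<lambda>j. \<Sum>i\<in>UNIV. \<integral>x. (pderiv_at i (\<psi> j) x - ?z i x)\<^sup>2 \<partial>lebesgue_on T) \<longlonglongrightarrow> (\<Sum>i\<in>(UNIV::'n set). 0)"
        using \<psi>' unfolding H1_approx_def by (intro tendsto_sum) auto
      then show ?thesis unfolding gr[OF sm] by simp
    qed
  qed (use g0 sm \<psi>' in \<open>auto simp: H1_approx_def power2_eq_square\<close>)
  then have tr: "is_trace T F u (face_trace T F u)" unfolding face_trace_def by (rule someI[of "is_trace T F u"])
  then show gL: "face_trace T F u \<in> L2 (surf F)" unfolding is_trace_def by blast
  let ?g = "face_trace T F u"
  obtain \<phi> where \<phi>: "\<And>j. smooth (\<phi> j)"
    "(\<lambda>j. \<integral>x. (\<phi> j x - u x)\<^sup>2 \<partial>lebesgue_on T) \<longlonglongrightarrow> 0"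
    "(\<lambda>j. \<integral>x. (grad (\<phi> j) x - weak_grad T u x) \<bullet> (grad (\<phi> j) x - weak_grad T u x) \<partial>lebesgue_on T) \<longlonglongrightarrow> 0"
    "(\<lambda>j. \<integral>x. (\<phi> j x - ?g x)\<^sup>2 \<partial>surf F) \<longlonglongrightarrow> 0"
    using tr unfolding is_trace_def l2_norm_tendsto_0_iff by (auto simp: power2_eq_square)
  have \<phi>0: "(\<lambda>j. H1_dist u ?z (\<phi> j)) \<longlonglongrightarrow> 0"
    using tendsto_add[OF \<phi>(2) \<phi>(3)[unfolded gr[OF \<phi>(1)]]] unfolding H1_dist_def by simp
  show "(\<lambda>j. \<integral>x. (\<psi> j x - ?g x)\<^sup>2 \<partial>surf F) \<longlonglongrightarrow> 0"
  proof (rule tendsto_sandwich[of "\<lambda>_. 0"])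
    show "\<forall>\<^sub>F j in sequentially. (\<integral>x. (\<psi> j x - ?g x)\<^sup>2 \<partial>surf F) \<le>
       2 * (K * (H1_dist u ?z (\<psi> j) + H1_dist u ?z (\<phi> j))) + 2 * (\<integral>x. (\<phi> j x - ?g x)\<^sup>2 \<partial>surf F)"
    proof (intro always_eventually allI)
      fix j
      have "(\<integral>x. (\<psi> j x - ?g x)\<^sup>2 \<partial>surf F) \<le> 2 * (\<integral>x. (\<psi> j x - \<phi> j x)\<^sup>2 \<partial>surf F) + 2 * (\<integral>x. (\<phi> j x - ?g x)\<^sup>2 \<partial>surf F)"
        by (intro L2_dist_triangle \<psi>L gL L2_surf_smooth F \<phi>)
      then show "(\<integral>x. (\<psi> j x - ?g x)\<^sup>2 \<partial>surf F) \<le>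
       2 * (K * (H1_dist u ?z (\<psi> j) + H1_dist u ?z (\<phi> j))) + 2 * (\<integral>x. (\<phi> j x - ?g x)\<^sup>2 \<partial>surf F)"
        using K(2)[OF sm[of j] \<phi>(1)[of j]] by linarith
    qed
    have "(\<lambda>j. 2 * (K * (H1_dist u ?z (\<psi> j) + H1_dist u ?z (\<phi> j))) + 2 * (\<integral>x. (\<phi> j x - ?g x)\<^sup>2 \<partial>surf F)) \<longlonglongrightarrow> 2 * (K * (0 + 0)) + 2 * 0"
      by (intro tendsto_intros \<psi>0 \<phi>0 \<phi>)
    then show "(\<lambda>j. 2 * (K * (H1_dist u ?z (\<psi> j) + H1_dist u ?z (\<phi> j))) + 2 * (\<integral>x. (\<phi> j x - ?g x)\<^sup>2 \<partial>surf F)) \<longlonglongrightarrow> 0" by simp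
  qed auto
qed

lemma face_trace_limit:
  assumes "F \<in> faces T" "v \<in> H2 T"
  shows "face_trace T F v \<in> L2 (surf F)" "(\<lambda>j. \<integral>x. (mollify j v x - face_trace T F v x)\<^sup>2 \<partial>surf F) \<longlonglongrightarrow> 0"
  using trace_limit[OF assms(1) H2D(1)[OF assms(2)] H1D(2)[OF H2D(1)[OF assms(2)]] H1D(3)[OF H2D(1)[OF assms(2)]]
      mollify_H1_approx[OF H2D(1)[OF assms(2)]]] by blast+

text \<open>The normal derivative combines first weak derivatives with the constant components of
  the normal, hence lies in \<open>H1 T\<close> with explicit weak derivatives, which
  \<open>trace_limit\<close> accepts in place of the chosen ones.\<close>

lemma normal_trace_limit:
  assumes F: "F \<in> faces T" and v: "v \<in> H2 T"
  shows "normal_trace T F v \<in> L2 (surf F)" "(\<lambda>j. \<integral>x. (dn T F (mollify j v) x - normal_trace T F v x)\<^sup>2 \<partial>surf F) \<longlonglongrightarrow> 0"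
proof -
  let ?\<nu> = "outer_normal T F"
  let ?u = "\<lambda>x. \<Sum>i\<in>UNIV. ?\<nu> $ i * weak_pderiv T i v x"
  let ?z = "\<lambda>k x. \<Sum>i\<in>UNIV. ?\<nu> $ i * weak_pderiv T k (weak_pderiv T i v) x"
  note vi = H1D[OF H2D(2)[OF v]]
  have eq: "(\<lambda>x. weak_grad T v x \<bullet> ?\<nu>) = ?u" by (simp add: inner_vec_def weak_grad_def mult.commute)
  have eq2: "(\<lambda>j x. \<Sum>i\<in>UNIV. ?\<nu> $ i * pderiv_at i (mollify j v) x) = (\<lambda>j. dn T F (mollify j v))"
    by (simp add: dn_def[abs_def] inner_vec_def grad_def mult.commute)
  have uL: "?u \<in> L2 (lebesgue_on T)" by (intro L2_sum L2_cmult vi)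
  have zL: "?z k \<in> L2 (lebesgue_on T)" for k by (intro L2_sum L2_cmult vi)
  have zw: "is_weak_pderiv T k ?u (?z k)" for k
    by (intro is_weak_pderiv_sum is_weak_pderiv_cmult L2_cmult vi) simp
  have ap: "H1_approx (\<lambda>j x. \<Sum>i\<in>UNIV. ?\<nu> $ i * pderiv_at i (mollify j v) x) ?u ?z"
    by (intro H1_approx_inner mollify_pderiv_H1_approx v vi)
  have uH: "?u \<in> H1 T" by (rule H1I[OF uL zL zw])
  from trace_limit[OF F uH zL zw ap]
  show "normal_trace T F v \<in> L2 (surf F)" "(\<lambda>j. \<integral>x. (dn T F (mollify j v) x - normal_trace T F v x)\<^sup>2 \<partial>surf F) \<longlonglongrightarrow> 0"
    unfolding normal_trace_def eq fun_cong[OF eq2, symmetric] by blast+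
qed

end

section \<open>The Sobolev embedding in dimension at most three\<close>

text \<open>The squared Frobenius norm of the Hessian.\<close>

definition hess_sq :: "(real^'n \<Rightarrow> real) \<Rightarrow> real^'n \<Rightarrow> real" where
  "hess_sq f x = (\<Sum>i\<in>UNIV. \<Sum>k\<in>UNIV. (pderiv_at k (pderiv_at i f) x)\<^sup>2)"

lemma smooth_hess_sq: "smooth f \<Longrightarrow> smooth (hess_sq f)"
  unfolding hess_sq_def[abs_def] by (intro smooth_sum smooth_power smooth_pderiv)

lemma hess_sq_nonneg: "hess_sq f x \<ge> 0"
  unfolding hess_sq_def by (intro sum_nonneg) auto

lemma double_le_add_square_divide: "2 * a \<le> \<delta> + a\<^sup>2 / \<delta>" if "\<delta> > 0" for a \<delta> :: real
proof -
  have "0 \<le> (\<delta> - a)\<^sup>2 / \<delta>" using that by simp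
  also have "\<dots> = \<delta> - 2 * a + a\<^sup>2 / \<delta>" using that by (simp add: power2_eq_square field_simps)
  finally show ?thesis by linarith
qed

text \<open>Cauchy-Schwarz once in each index of the Hessian.\<close>

lemma second_derivative_bound:
  fixes f :: "real^'n \<Rightarrow> real"
  assumes "smooth f" shows "\<bar>dderiv e (dderiv e f) z\<bar> \<le> (norm e)\<^sup>2 * sqrt (hess_sq f z)"
proof -
  have e2: "(norm e)\<^sup>2 = (\<Sum>i\<in>UNIV. (e $ i)\<^sup>2)"
    unfolding power2_norm_eq_inner inner_vec_def by (simp add: power2_eq_square)
  have pd: "pderiv_at k (dderiv e f) z = (\<Sum>i\<in>UNIV. e $ i * pderiv_at k (pderiv_at i f) z)" for k
    unfolding dderiv_eq_sum[OF assms]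
    by (subst pderiv_sum) (auto simp: pderiv_cmult smooth_differentiable smooth_pderiv assms intro!: differentiable_mult)
  have "(dderiv e (dderiv e f) z)\<^sup>2 = (\<Sum>k\<in>UNIV. e $ k * pderiv_at k (dderiv e f) z)\<^sup>2"
    by (subst dderiv_eq_sum[OF smooth_dderiv(2)[OF assms]]) simp
  also have "\<dots> \<le> (norm e)\<^sup>2 * (\<Sum>k\<in>UNIV. (pderiv_at k (dderiv e f) z)\<^sup>2)"
    unfolding e2 by (rule Cauchy_Schwarz_ineq_sum)
  also have "\<dots> \<le> (norm e)\<^sup>2 * (\<Sum>k\<in>UNIV. (norm e)\<^sup>2 * (\<Sum>i\<in>UNIV. (pderiv_at k (pderiv_at i f) z)\<^sup>2))"
    unfolding pd by (intro mult_left_mono sum_mono) (auto simp: e2 intro: Cauchy_Schwarz_ineq_sum sum_nonneg)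
  also have "\<dots> = ((norm e)\<^sup>2)\<^sup>2 * hess_sq f z"
    unfolding hess_sq_def by (subst sum.swap) (simp add: sum_distrib_left[symmetric] power2_eq_square mult.assoc)
  also have "\<dots> = ((norm e)\<^sup>2 * sqrt (hess_sq f z))\<^sup>2"
    by (simp add: power_mult_distrib hess_sq_nonneg)
  finally show ?thesis
    using hess_sq_nonneg[of f z] by (metis abs_le_square_iff abs_of_nonneg mult_nonneg_nonneg real_sqrt_ge_zero zero_le_power2)
qed

text \<open>Taylor's formula along the segment from \<open>x\<close> to \<open>y\<close>, parametrised as \<open>x + r\<^sup>2 (y - x)\<close>. The
  quadratic parameter gives the weight \<open>r\<^sup>6\<close> on the squared second derivatives, which is exactly
  what the change of variables \<open>y \<mapsto> x + r\<^sup>2 (y - x)\<close> can absorb in dimension at most three.\<close>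
lemma pointwise_taylor_bound:
  fixes f :: "real^'n \<Rightarrow> real"
  assumes sm: "smooth f" and D: "norm (y - x) \<le> D" and \<delta>: "\<delta> > 0"
  shows "\<bar>f x\<bar> \<le> \<bar>f y\<bar> + D * norm (grad f y) +
     D\<^sup>2 * (\<integral>r. indicator {0..1} r * (\<delta> + r ^ 6 * hess_sq f (x + r\<^sup>2 *\<^sub>R (y - x)) / \<delta>) \<partial>lborel)"
proof -
  let ?e = "y - x"
  let ?z = "\<lambda>r. x + r\<^sup>2 *\<^sub>R ?e"
  \<comment> \<open>Its derivative in \<open>r\<close> is \<open>- 2 r^3\<close> times the second
    derivative along \<open>?e\<close>, since the first-order terms cancel. It equals
    \<open>f x\<close> at \<open>r = 0\<close> and involves only data at \<open>y\<close> for
    \<open>r = 1\<close>.\<close>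
  let ?\<Psi> = "\<lambda>r. f (?z r) - r\<^sup>2 * dderiv ?e f (?z r)"
  let ?g = "\<lambda>r. 2 * r ^ 3 * dderiv ?e (dderiv ?e f) (?z r)"
  let ?b = "\<lambda>r. \<delta> + r ^ 6 * hess_sq f (?z r) / \<delta>"
  have along: "((\<lambda>r. h (?z r)) has_real_derivative dderiv ?e h (?z r) * (2 * r)) (at r within A)" if "smooth h" for h r A
  proof -
    have "((\<lambda>s. h (x + s *\<^sub>R ?e)) has_real_derivative dderiv ?e h (?z r)) (at (r\<^sup>2))"
      using has_real_derivative_along[OF smooth_differentiable[OF that], where x=x and t="r\<^sup>2" and e="?e"] by (simp add: smooth_dderiv_grad[OF that])
    moreover have "((\<lambda>r. r\<^sup>2) has_real_derivative 2 * r) (at r within A)" by (auto intro!: derivative_eq_intros)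
    ultimately show ?thesis by (rule DERIV_chain2)
  qed
  have der: "(?\<Psi> has_vector_derivative - ?g r) (at r within {0..1})" for r
  proof -
    have "(?\<Psi> has_real_derivative dderiv ?e f (?z r) * (2 * r) -
       (2 * r * dderiv ?e f (?z r) + dderiv ?e (dderiv ?e f) (?z r) * (2 * r) * r\<^sup>2)) (at r within {0..1})"
      by (rule derivative_eq_intros along smooth_dderiv sm refl | simp)+
    then show ?thesis
      by (simp add: has_real_derivative_iff_has_vector_derivative[symmetric] algebra_simps power2_eq_square power3_eq_cube)
  qed
  have cz: "continuous_on A (\<lambda>r. h (?z r))" if "smooth h" for h A
    by (rule continuous_on_compose2[OF smooth_continuous[OF that, of UNIV]]) (auto intro!: continuous_intros)
  have cg: "continuous_on A ?g" for A by (intro continuous_intros cz smooth_dderiv sm)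
  have cb: "continuous_on A ?b" for A by (intro continuous_intros cz smooth_hess_sq sm) (use \<delta> in auto)
  have ib: "integrable lborel (\<lambda>r. indicator {0..1} r * ?b r)"
    using borel_integrable_compact[OF compact_Icc cb, of 0 1] by simp
  have "(\<integral>r. indicator {0..1} r *\<^sub>R (- ?g r) \<partial>lborel) = ?\<Psi> 1 - ?\<Psi> 0"
    by (rule integral_FTC_atLeastAtMost) (auto intro!: der continuous_on_minus cg)
  then have "f x = f y - dderiv ?e f y - (\<integral>r. indicator {0..1} r *\<^sub>R (- ?g r) \<partial>lborel)" by simp
  then have "\<bar>f x\<bar> \<le> \<bar>f y\<bar> + \<bar>dderiv ?e f y\<bar> + \<bar>\<integral>r. indicator {0..1} r *\<^sub>R (- ?g r) \<partial>lborel\<bar>" by linarith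
  moreover have "\<bar>dderiv ?e f y\<bar> \<le> D * norm (grad f y)"
  proof -
    have "\<bar>dderiv ?e f y\<bar> \<le> norm (grad f y) * norm ?e" unfolding smooth_dderiv_grad[OF sm] by (rule Cauchy_Schwarz_ineq2)
    also have "\<dots> \<le> norm (grad f y) * D" using D by (intro mult_left_mono) auto
    finally show ?thesis by (simp add: mult.commute)
  qed
  moreover have "\<bar>\<integral>r. indicator {0..1} r *\<^sub>R (- ?g r) \<partial>lborel\<bar> \<le> (\<integral>r. D\<^sup>2 * (indicator {0..1} r * ?b r) \<partial>lborel)"
  proof (rule integral_abs_bound_integral)
    show "integrable lborel (\<lambda>r. indicator {0..1} r *\<^sub>R (- ?g r))"
      by (intro borel_integrable_compact compact_Icc continuous_on_minus cg)
    show "integrable lborel (\<lambda>r. D\<^sup>2 * (indicator {0..1} r * ?b r))" using ib by (rule integrable_mult_right)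
    fix r :: real
    show "\<bar>indicator {0..1} r *\<^sub>R (- ?g r)\<bar> \<le> D\<^sup>2 * (indicator {0..1} r * ?b r)"
    proof (cases "r \<in> {0..1}")
      case True
      let ?h = "sqrt (hess_sq f (?z r))"
      have "\<bar>?g r\<bar> = 2 * r ^ 3 * \<bar>dderiv ?e (dderiv ?e f) (?z r)\<bar>" using True by (simp add: abs_mult)
      also have "\<dots> \<le> 2 * r ^ 3 * (D\<^sup>2 * ?h)"
      proof (intro mult_left_mono order_trans[OF second_derivative_bound[OF sm]] mult_right_mono power_mono D)
      qed (use True hess_sq_nonneg in auto)
      also have "\<dots> = D\<^sup>2 * (2 * (r ^ 3 * ?h))" by (simp add: mult_ac)
      \<comment> \<open>Young's inequality with the free parameter \<open>\<delta>\<close> turns the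
        norm of the Hessian into its square, the quantity whose integral over \<open>T\<close> is
        available.\<close>
      also have "\<dots> \<le> D\<^sup>2 * (\<delta> + (r ^ 3 * ?h)\<^sup>2 / \<delta>)" by (intro mult_left_mono double_le_add_square_divide \<delta>) auto
      also have "(r ^ 3 * ?h)\<^sup>2 = r ^ 6 * hess_sq f (?z r)"
        by (simp add: power_mult_distrib hess_sq_nonneg flip: power_mult)
      finally show ?thesis using True by simp
    qed simp
  qed
  ultimately show ?thesis by (simp only: integral_mult_right_zero)
qed

context mollifier
begin

definition H2_sq :: "(real^'n \<Rightarrow> real) \<Rightarrow> real" where
  "H2_sq f = (\<integral>x. (f x)\<^sup>2 \<partial>lebesgue_on T) + (\<Sum>i\<in>UNIV. \<integral>x. (pderiv_at i f x)\<^sup>2 \<partial>lebesgue_on T) +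
     (\<Sum>i\<in>UNIV. \<Sum>k\<in>UNIV. \<integral>x. (pderiv_at k (pderiv_at i f) x)\<^sup>2 \<partial>lebesgue_on T)"

lemma nn_integral_T:
  assumes "continuous_on UNIV g" "\<And>x. g x \<ge> 0"
  shows "(\<integral>\<^sup>+x. ennreal (g x) * indicator T x \<partial>lborel) = ennreal (\<integral>x. g x \<partial>lebesgue_on T)"
proof -
  have m: "g \<in> borel_measurable borel" using assms(1) by (rule borel_measurable_continuous_onI)
  have "integrable lborel (\<lambda>x. indicator T x *\<^sub>R g x)"
    by (intro borel_integrable_compact compact_T continuous_on_subset[OF assms(1)]) auto
  then have "(\<integral>\<^sup>+x. ennreal (indicator T x *\<^sub>R g x) \<partial>lborel) = ennreal (\<integral>x. indicator T x *\<^sub>R g x \<partial>lborel)"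
    by (intro nn_integral_eq_integral) (auto simp: assms(2))
  also have "(\<integral>\<^sup>+x. ennreal (indicator T x *\<^sub>R g x) \<partial>lborel) = (\<integral>\<^sup>+x. ennreal (g x) * indicator T x \<partial>lborel)"
    by (intro nn_integral_cong) (auto simp: indicator_def)
  finally show ?thesis using integral_lebesgue_on_lborel[OF T_borel m] by simp
qed

lemma measure_T: "emeasure lborel T = ennreal (measure lborel T)" "measure lborel T > 0"
proof -
  have "emeasure lborel T < \<infinity>" using compact_T by (intro emeasure_bounded_finite compact_imp_bounded)
  then show eq: "emeasure lborel T = ennreal (measure lborel T)" by (intro emeasure_eq_ennreal_measure) auto
  have "measure lborel T \<noteq> 0"
  proof
    assume "measure lborel T = 0"
    then have "T \<in> null_sets lborel" using eq T_borel by (intro null_setsI) auto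
    then have "negligible T" using negligible_iff_null_sets null_sets_completionI by blast
    then have "negligible (interior T)" using negligible_subset interior_subset by blast
    then show False using open_not_negligible[OF open_interior interior_nonempty] by blast
  qed
  then show "measure lborel T > 0" using measure_nonneg[of lborel T] by linarith
qed

text \<open>The pointwise Taylor bound is integrated over all \<open>y\<close> in \<open>T\<close>,
  which replaces values at \<open>y\<close> by integrals; Tonelli then permits the substitution for
  fixed \<open>r\<close>. The parameter \<open>\<delta>\<close> stays free and is chosen
  afterwards.\<close>

lemma sobolev_bound:
  assumes n: "CARD('n) \<le> 3" and D: "\<And>x y. x \<in> T \<Longrightarrow> y \<in> T \<Longrightarrow> norm (y - x) \<le> D" "D \<ge> 0"
    and f: "smooth f" and x: "x \<in> T" and \<delta>: "\<delta> > 0"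
  shows "\<bar>f x\<bar> * measure lborel T \<le> (1 + D + D\<^sup>2) * (\<delta> * measure lborel T + H2_sq f / \<delta>)"
proof -
  let ?m = "measure lborel T"
  let ?h = "hess_sq f"
  let ?z = "\<lambda>r y. x + r\<^sup>2 *\<^sub>R (y - x)"
  let ?A = "\<lambda>y. (\<delta> + (f y)\<^sup>2 / \<delta>) + D * (\<delta> + (norm (grad f y))\<^sup>2 / \<delta>)"
  let ?b = "\<lambda>y r. \<delta> + r ^ 6 * ?h (?z r y) / \<delta>"
  have hm [measurable]: "?h \<in> borel_measurable borel"
    by (intro borel_measurable_continuous_onI smooth_continuous smooth_hess_sq f)
  have Tm [measurable]: "T \<in> sets borel" by (rule T_borel)
  have cz: "continuous_on S (\<lambda>r. ?h (?z r y))" for S y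
    by (rule continuous_on_compose2[OF smooth_continuous[OF smooth_hess_sq[OF f], of UNIV]]) (auto intro!: continuous_intros)
  have b0: "?b y r \<ge> 0" if "r \<in> {0..1}" for y r
    using that \<delta> hess_sq_nonneg[of f] by (intro add_nonneg_nonneg divide_nonneg_pos mult_nonneg_nonneg) auto
  have ib: "integrable lborel (\<lambda>r. indicator {0..1} r * ?b y r)" for y
    using borel_integrable_compact[OF compact_Icc, of 0 1 "?b y"] \<delta>
    by (simp add: continuous_on_add continuous_on_mult continuous_on_divide continuous_on_power cz)
  have A0: "?A y \<ge> 0" for y using \<delta> D(2) by (intro add_nonneg_nonneg mult_nonneg_nonneg) auto
  have pt: "ennreal \<bar>f x\<bar> \<le> ennreal (?A y) + ennreal (D\<^sup>2) * (\<integral>\<^sup>+r. ennreal (?b y r) * indicator {0..1} r \<partial>lborel)"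
    if y: "y \<in> T" for y
  proof -
    let ?I = "\<integral>r. indicator {0..1} r * ?b y r \<partial>lborel"
    have "\<bar>f x\<bar> \<le> \<bar>f y\<bar> + D * norm (grad f y) + D\<^sup>2 * ?I"
      by (rule pointwise_taylor_bound[OF f D(1)[OF x y] \<delta>])
    also have "\<bar>f y\<bar> \<le> \<delta> + (f y)\<^sup>2 / \<delta>" using double_le_add_square_divide[OF \<delta>, of "\<bar>f y\<bar>"] by simp
    also have "D * norm (grad f y) \<le> D * (\<delta> + (norm (grad f y))\<^sup>2 / \<delta>)"
      using double_le_add_square_divide[OF \<delta>, of "norm (grad f y)"] norm_ge_zero[of "grad f y"] by (intro mult_left_mono D(2)) linarith
    finally have le: "\<bar>f x\<bar> \<le> ?A y + D\<^sup>2 * ?I" by simp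
    have I0: "?I \<ge> 0" using b0[of _ y] by (intro Bochner_Integration.integral_nonneg) (auto simp: indicator_def)
    have "ennreal ?I = (\<integral>\<^sup>+r. ennreal (indicator {0..1} r * ?b y r) \<partial>lborel)"
      using b0[of _ y] by (intro nn_integral_eq_integral[symmetric] ib AE_I2) (auto simp: indicator_def)
    also have "\<dots> = (\<integral>\<^sup>+r. ennreal (?b y r) * indicator {0..1} r \<partial>lborel)"
      by (intro nn_integral_cong) (auto simp: indicator_def)
    finally have I: "ennreal ?I = (\<integral>\<^sup>+r. ennreal (?b y r) * indicator {0..1} r \<partial>lborel)" .
    have "ennreal \<bar>f x\<bar> \<le> ennreal (?A y + D\<^sup>2 * ?I)" using le by (rule ennreal_leI)
    also have "\<dots> = ennreal (?A y) + ennreal (D\<^sup>2) * ennreal ?I"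
      using A0[of y] I0 by (simp add: ennreal_plus ennreal_mult del: ennreal_plus[symmetric])
    finally show ?thesis unfolding I .
  qed
  have inner: "(\<integral>\<^sup>+y. ennreal (?b y r) * indicator {0..1} r * indicator T y \<partial>lborel)
      \<le> ennreal (\<delta> * ?m + (\<integral>y. ?h y \<partial>lebesgue_on T) / \<delta>) * indicator {0..1} r" for r
  proof (cases "r \<in> {0..1}")
    case True
    let ?H = "\<integral>y. ?h y \<partial>lebesgue_on T"
    have H0: "?H \<ge> 0" by (intro Bochner_Integration.integral_nonneg) (simp add: hess_sq_nonneg)
    have H: "(\<integral>\<^sup>+y. ennreal (?h y) * indicator T y \<partial>lborel) = ennreal ?H"
      by (intro nn_integral_T smooth_continuous smooth_hess_sq f hess_sq_nonneg)
    have shrink: "(\<integral>\<^sup>+y. ennreal (r ^ 6 * ?h (?z r y)) * indicator T y \<partial>lborel) \<le> ennreal ?H"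
    proof (cases "r = 0")
      case False
      then have r: "r > 0" "r \<le> 1" using True by auto
      have zT: "?z r y \<in> T" if "y \<in> T" for y
      proof -
        have "(1 - r\<^sup>2) *\<^sub>R x + r\<^sup>2 *\<^sub>R y \<in> T"
          using convex_T x that r unfolding convex_alt by (simp add: power_le_one)
        then show ?thesis by (simp add: algebra_simps)
      qed
      have "(\<integral>\<^sup>+y. ennreal (r ^ 6 * ?h (?z r y)) * indicator T y \<partial>lborel)
         \<le> (\<integral>\<^sup>+y. ennreal ((r\<^sup>2) ^ CARD('n)) * (ennreal (?h (?z r y)) * indicator T (?z r y)) \<partial>lborel)"
      proof (rule nn_integral_mono)
        fix y
        \<comment> \<open>The Jacobian of the substitution is \<open>(r^2) ^ n\<close> with
          \<open>r \<le> 1\<close>; this is where \<open>n \<le> 3\<close> is used. Convexity keeps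
          the image \<open>?z r y\<close> in \<open>T\<close>, so the integral over the image is at
          most the one over \<open>T\<close>.\<close>
        have "r ^ 6 \<le> (r\<^sup>2) ^ CARD('n)"
          using r n by (subst power_mult[symmetric]) (intro power_decreasing; simp)
        then have "r ^ 6 * ?h (?z r y) \<le> (r\<^sup>2) ^ CARD('n) * ?h (?z r y)" using hess_sq_nonneg by (intro mult_right_mono)
        then have "ennreal (r ^ 6 * ?h (?z r y)) \<le> ennreal ((r\<^sup>2) ^ CARD('n)) * ennreal (?h (?z r y))"
          by (simp add: ennreal_mult'[symmetric] ennreal_leI hess_sq_nonneg)
        then show "ennreal (r ^ 6 * ?h (?z r y)) * indicator T y \<le> ennreal ((r\<^sup>2) ^ CARD('n)) * (ennreal (?h (?z r y)) * indicator T (?z r y))"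
          using zT[of y] by (auto simp: indicator_def)
      qed
      also have "\<dots> = ennreal ((r\<^sup>2) ^ CARD('n)) * (\<integral>\<^sup>+y. ennreal (?h (?z r y)) * indicator T (?z r y) \<partial>lborel)"
        by (rule nn_integral_cmult) measurable
      also have "\<dots> = (\<integral>\<^sup>+y. ennreal (?h y) * indicator T y \<partial>lborel)"
        using lborel_nn_integral_affine[of "r\<^sup>2" "\<lambda>y. ennreal (?h y) * indicator T y" "x - r\<^sup>2 *\<^sub>R x"] r
        by (simp add: algebra_simps)
      finally show ?thesis unfolding H .
    qed simp
    have "(\<integral>\<^sup>+y. ennreal (?b y r) * indicator T y \<partial>lborel)
       = (\<integral>\<^sup>+y. ennreal \<delta> * indicator T y + ennreal (1 / \<delta>) * (ennreal (r ^ 6 * ?h (?z r y)) * indicator T y) \<partial>lborel)"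
    proof (rule nn_integral_cong)
      fix y
      have "r ^ 6 * ?h (?z r y) \<ge> 0" using True hess_sq_nonneg[of f] by (intro mult_nonneg_nonneg) auto
      then have "ennreal (?b y r) = ennreal \<delta> + ennreal (1 / \<delta>) * ennreal (r ^ 6 * ?h (?z r y))"
        using \<delta> by (simp add: ennreal_plus[symmetric] ennreal_mult'[symmetric] del: ennreal_plus)
      then show "ennreal (?b y r) * indicator T y = ennreal \<delta> * indicator T y + ennreal (1 / \<delta>) * (ennreal (r ^ 6 * ?h (?z r y)) * indicator T y)"
        by (simp add: distrib_right mult.assoc)
    qed
    also have "\<dots> = ennreal \<delta> * emeasure lborel T + ennreal (1 / \<delta>) * (\<integral>\<^sup>+y. ennreal (r ^ 6 * ?h (?z r y)) * indicator T y \<partial>lborel)"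
      by (simp add: nn_integral_add nn_integral_cmult)
    also have "\<dots> \<le> ennreal \<delta> * ennreal ?m + ennreal (1 / \<delta>) * ennreal ?H"
      unfolding measure_T(1) by (intro add_mono mult_left_mono shrink) auto
    also have "\<dots> = ennreal (\<delta> * ?m + ?H / \<delta>)"
      using \<delta> H0 measure_T(2) by (simp add: ennreal_plus[symmetric] ennreal_mult'[symmetric] del: ennreal_plus)
    finally show ?thesis using True by simp
  qed simp
  let ?X = "\<integral>x. (f x)\<^sup>2 \<partial>lebesgue_on T" and ?Y = "\<Sum>i\<in>UNIV. \<integral>x. (pderiv_at i f x)\<^sup>2 \<partial>lebesgue_on T"
    and ?H = "\<integral>y. ?h y \<partial>lebesgue_on T"
  have X0: "?X \<ge> 0" and Y0: "?Y \<ge> 0" and H0: "?H \<ge> 0"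
    by (auto intro!: Bochner_Integration.integral_nonneg sum_nonneg simp: hess_sq_nonneg)
  have sqi: "integrable (lebesgue_on T) (\<lambda>x. (g x)\<^sup>2)" if "smooth g" for g
    by (intro L2_integrable_sq L2_smooth compact_T that)
  have Y: "(\<integral>y. (norm (grad f y))\<^sup>2 \<partial>lebesgue_on T) = ?Y"
    unfolding power2_norm_eq_inner inner_vec_def grad_def
    by (simp add: sqi[unfolded power2_eq_square] smooth_pderiv f power2_eq_square)
  have H: "?H = (\<Sum>i\<in>UNIV. \<Sum>k\<in>UNIV. \<integral>x. (pderiv_at k (pderiv_at i f) x)\<^sup>2 \<partial>lebesgue_on T)"
    unfolding hess_sq_def by (simp add: sqi smooth_pderiv f)
  have mT: "measure lebesgue T = ?m" by (simp add: measure_completion)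
  have fin1: "integrable (lebesgue_on T) (\<lambda>_. c::real)" for c
    by (rule finite_measure.integrable_const[OF finite_measure_lebesgue_on[OF lmeasurable_compact[OF compact_T]]])
  have gi: "integrable (lebesgue_on T) (\<lambda>y. (norm (grad f y))\<^sup>2)"
    unfolding power2_norm_eq_inner inner_vec_def grad_def
    by (auto intro!: Bochner_Integration.integrable_sum simp: sqi[unfolded power2_eq_square] smooth_pderiv f)
  have IA: "(\<integral>y. ?A y \<partial>lebesgue_on T) = (\<delta> * ?m + ?X / \<delta>) + D * (\<delta> * ?m + ?Y / \<delta>)"
    using sqi[OF f] gi fin1 by (simp add: Y mT measure_restrict_space lmeasurable_compact[OF compact_T] fmeasurableD mult.commute)
  have "ennreal (\<bar>f x\<bar> * ?m) = (\<integral>\<^sup>+y. ennreal \<bar>f x\<bar> * indicator T y \<partial>lborel)"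
    by (simp add: nn_integral_cmult measure_T(1) ennreal_mult)
  also have "\<dots> \<le> (\<integral>\<^sup>+y. ennreal (?A y) * indicator T y + ennreal (D\<^sup>2) * (\<integral>\<^sup>+r. ennreal (?b y r) * indicator {0..1} r * indicator T y \<partial>lborel) \<partial>lborel)"
  proof (rule nn_integral_mono)
    fix y
    show "ennreal \<bar>f x\<bar> * indicator T y \<le> ennreal (?A y) * indicator T y + ennreal (D\<^sup>2) * (\<integral>\<^sup>+r. ennreal (?b y r) * indicator {0..1} r * indicator T y \<partial>lborel)"
      using pt[of y] by (cases "y \<in> T") auto
  qed
  also have "\<dots> = (\<integral>\<^sup>+y. ennreal (?A y) * indicator T y \<partial>lborel) + ennreal (D\<^sup>2) * (\<integral>\<^sup>+y. (\<integral>\<^sup>+r. ennreal (?b y r) * indicator {0..1} r * indicator T y \<partial>lborel) \<partial>lborel)"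
  proof -
    have [measurable]: "f \<in> borel_measurable borel" "grad f \<in> borel_measurable borel"
      by (auto intro!: borel_measurable_continuous_onI smooth_continuous continuous_on_grad f)
    show ?thesis by (subst nn_integral_add) (auto simp: nn_integral_cmult)
  qed
  also have "(\<integral>\<^sup>+y. (\<integral>\<^sup>+r. ennreal (?b y r) * indicator {0..1} r * indicator T y \<partial>lborel) \<partial>lborel)
     = (\<integral>\<^sup>+r. (\<integral>\<^sup>+y. ennreal (?b y r) * indicator {0..1} r * indicator T y \<partial>lborel) \<partial>lborel)"
    by (rule lborel_pair.Fubini') measurable
  also have "\<dots> \<le> (\<integral>\<^sup>+r. ennreal (\<delta> * ?m + ?H / \<delta>) * indicator {0..1} r \<partial>(lborel :: real measure))"
    by (intro nn_integral_mono inner)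
  also have "\<dots> = ennreal (\<delta> * ?m + ?H / \<delta>)" by (simp add: nn_integral_cmult)
  also have "(\<integral>\<^sup>+y. ennreal (?A y) * indicator T y \<partial>lborel) = ennreal (\<integral>y. ?A y \<partial>lebesgue_on T)"
    using \<delta> by (intro nn_integral_T A0 continuous_intros smooth_continuous continuous_on_grad f) auto
  finally have "ennreal (\<bar>f x\<bar> * ?m) \<le> ennreal (\<integral>y. ?A y \<partial>lebesgue_on T) + ennreal (D\<^sup>2) * ennreal (\<delta> * ?m + ?H / \<delta>)"
    by (simp add: add_left_mono mult_left_mono)
  also have "\<dots> = ennreal ((\<delta> * ?m + ?X / \<delta>) + D * (\<delta> * ?m + ?Y / \<delta>) + D\<^sup>2 * (\<delta> * ?m + ?H / \<delta>))"
    unfolding IA using \<delta> D(2) X0 Y0 H0 measure_T(2)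
    by (subst ennreal_mult[symmetric], simp, simp, subst ennreal_plus[symmetric]) (auto intro!: add_nonneg_nonneg mult_nonneg_nonneg)
  finally have le: "\<bar>f x\<bar> * ?m \<le> (\<delta> * ?m + ?X / \<delta>) + D * (\<delta> * ?m + ?Y / \<delta>) + D\<^sup>2 * (\<delta> * ?m + ?H / \<delta>)"
    by (subst (asm) ennreal_le_iff)
       (use \<delta> D(2) X0 Y0 H0 measure_T(2) in \<open>auto intro!: add_nonneg_nonneg mult_nonneg_nonneg\<close>)
  have N: "H2_sq f = ?X + ?Y + ?H" unfolding H2_sq_def H by simp
  have "?X / \<delta> \<le> H2_sq f / \<delta>" "?Y / \<delta> \<le> H2_sq f / \<delta>" "?H / \<delta> \<le> H2_sq f / \<delta>"
    unfolding N using \<delta> X0 Y0 H0 by (intro divide_right_mono; simp)+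
  then have "(\<delta> * ?m + ?X / \<delta>) + D * (\<delta> * ?m + ?Y / \<delta>) + D\<^sup>2 * (\<delta> * ?m + ?H / \<delta>)
     \<le> (\<delta> * ?m + H2_sq f / \<delta>) + D * (\<delta> * ?m + H2_sq f / \<delta>) + D\<^sup>2 * (\<delta> * ?m + H2_sq f / \<delta>)"
    using D(2) by (intro add_mono mult_left_mono order_refl) auto
  then show ?thesis using le by (simp add: algebra_simps)
qed


lemma diameter_bound: "\<exists>D\<ge>0. \<forall>x\<in>T. \<forall>y\<in>T. norm (y - x) \<le> D"
proof -
  obtain R where R: "R > 0" "\<forall>x\<in>T. norm x \<le> R"
    using compact_imp_bounded[OF compact_T] unfolding bounded_pos by blast
  have "norm (y - x) \<le> 2 * R" if "x \<in> T" "y \<in> T" for x y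
    using R(2)[rule_format, OF that(1)] R(2)[rule_format, OF that(2)] norm_triangle_ineq4[of y x] by linarith
  then show ?thesis using R(1) by (intro exI[of _ "2 * R"]) auto
qed

lemma sobolev_small:
  assumes n: "CARD('n) \<le> 3" and e: "e > 0"
  shows "\<exists>\<kappa>>0. \<forall>f. smooth f \<longrightarrow> H2_sq f \<le> \<kappa> \<longrightarrow> (\<forall>x\<in>T. \<bar>f x\<bar> \<le> e)"
proof -
  obtain D where D: "D \<ge> 0" "\<And>x y. x \<in> T \<Longrightarrow> y \<in> T \<Longrightarrow> norm (y - x) \<le> D" using diameter_bound by blast
  let ?m = "measure lborel T"
  define K where "K = 1 + D + D\<^sup>2"
  have K: "K > 0" using D by (simp add: K_def add_pos_nonneg)
  have m: "?m > 0" by (rule measure_T)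
  \<comment> \<open>With \<open>\<kappa> = \<delta>^2 ?m\<close> both terms of the Sobolev bound are
    at most \<open>\<delta> * ?m\<close>, and \<open>2 * K * \<delta> = e\<close>.\<close>
  define \<delta> where "\<delta> = e / (2 * K)"
  have \<delta>: "\<delta> > 0" using e K by (simp add: \<delta>_def)
  define \<kappa> where "\<kappa> = \<delta> * \<delta> * ?m"
  have "\<bar>f x\<bar> \<le> e" if f: "smooth f" "H2_sq f \<le> \<kappa>" and x: "x \<in> T" for f x
  proof -
    have "\<bar>f x\<bar> * ?m \<le> K * (\<delta> * ?m + H2_sq f / \<delta>)"
      unfolding K_def by (rule sobolev_bound[OF n D(2,1) f(1) x \<delta>])
    also have "\<dots> \<le> K * (\<delta> * ?m + \<kappa> / \<delta>)"
      using f(2) K \<delta> by (intro mult_left_mono add_left_mono divide_right_mono) auto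
    also have "\<dots> = (2 * K * \<delta>) * ?m" using \<delta> by (simp add: \<kappa>_def algebra_simps)
    also have "2 * K * \<delta> = e" using K by (simp add: \<delta>_def)
    finally show ?thesis using m by simp
  qed
  then show ?thesis using \<delta> m by (intro exI[of _ \<kappa>]) (auto simp: \<kappa>_def)
qed

text \<open>Differences of mollifications are smooth and, together with their first and second
  derivatives, small in the square mean, because all of these converge. The Sobolev bound turns this
  into a uniform Cauchy property.\<close>

lemma mollify_uniformly_convergent:
  assumes n: "CARD('n) \<le> 3" and v: "v \<in> H2 T"
  shows "uniformly_convergent_on T (\<lambda>j. mollify j v)"
proof (rule Cauchy_uniformly_convergent, rule uniformly_Cauchy_onI)
  fix e :: real assume "e > 0"
  note v1 = H1D[OF H2D(1)[OF v]] and v2 = H1D[OF H2D(2)[OF v]]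
  let ?z = "\<lambda>i. weak_pderiv T i v" and ?y = "\<lambda>i k. weak_pderiv T k (weak_pderiv T i v)"
  let ?\<phi> = "\<lambda>j. mollify j v"
  have sm: "smooth (?\<phi> j)" for j by (rule smooth_mollify[OF v1(1)])
  define dev where "dev = (\<lambda>f. (\<integral>x. (f x - v x)\<^sup>2 \<partial>lebesgue_on T) + (\<Sum>i\<in>UNIV. \<integral>x. (pderiv_at i f x - ?z i x)\<^sup>2 \<partial>lebesgue_on T) +
     (\<Sum>i\<in>UNIV. \<Sum>k\<in>UNIV. \<integral>x. (pderiv_at k (pderiv_at i f) x - ?y i k x)\<^sup>2 \<partial>lebesgue_on T))"
  have "(\<lambda>j. dev (?\<phi> j)) \<longlonglongrightarrow> 0 + (\<Sum>i\<in>(UNIV::'n set). 0) + (\<Sum>i\<in>(UNIV::'n set). \<Sum>k\<in>(UNIV::'n set). 0)"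
    using mollify_H1_approx[OF H2D(1)[OF v]] mollify_pderiv_H1_approx[OF v]
    unfolding dev_def H1_approx_def by (intro tendsto_intros) auto
  then have dev0: "(\<lambda>j. dev (?\<phi> j)) \<longlonglongrightarrow> 0" by simp
  obtain \<kappa> where \<kappa>: "\<kappa> > 0" "\<And>f x. smooth f \<Longrightarrow> H2_sq f \<le> \<kappa> \<Longrightarrow> x \<in> T \<Longrightarrow> \<bar>f x\<bar> \<le> e / 2"
    using sobolev_small[OF n, of "e / 2"] \<open>e > 0\<close> by auto
  have "\<forall>\<^sub>F j in sequentially. dev (?\<phi> j) < \<kappa> / 4" using \<kappa>(1) by (intro order_tendstoD[OF dev0]) simp
  then obtain N where N: "\<And>j. j \<ge> N \<Longrightarrow> dev (?\<phi> j) < \<kappa> / 4" unfolding eventually_sequentially by blast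
  have tri: "(\<integral>x. (a x - b x)\<^sup>2 \<partial>lebesgue_on T) \<le> 2 * (\<integral>x. (a x - c x)\<^sup>2 \<partial>lebesgue_on T) + 2 * (\<integral>x. (b x - c x)\<^sup>2 \<partial>lebesgue_on T)"
    if "a \<in> L2 (lebesgue_on T)" "b \<in> L2 (lebesgue_on T)" "c \<in> L2 (lebesgue_on T)" for a b c
    using L2_dist_triangle[OF that(1,3,2)] by (simp add: power2_commute)
  note S = L2_smooth[OF compact_T]
  note pd = pderiv_diff
  have H2d: "H2_sq (\<lambda>x. ?\<phi> i x - ?\<phi> j x) \<le> 2 * dev (?\<phi> i) + 2 * dev (?\<phi> j)" for i j
  proof -
    have "H2_sq (\<lambda>x. ?\<phi> i x - ?\<phi> j x) \<le>
       (2 * (\<integral>x. (?\<phi> i x - v x)\<^sup>2 \<partial>lebesgue_on T) + 2 * (\<integral>x. (?\<phi> j x - v x)\<^sup>2 \<partial>lebesgue_on T)) +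
       (\<Sum>a\<in>UNIV. 2 * (\<integral>x. (pderiv_at a (?\<phi> i) x - ?z a x)\<^sup>2 \<partial>lebesgue_on T) + 2 * (\<integral>x. (pderiv_at a (?\<phi> j) x - ?z a x)\<^sup>2 \<partial>lebesgue_on T)) +
       (\<Sum>a\<in>UNIV. \<Sum>k\<in>UNIV. 2 * (\<integral>x. (pderiv_at k (pderiv_at a (?\<phi> i)) x - ?y a k x)\<^sup>2 \<partial>lebesgue_on T) + 2 * (\<integral>x. (pderiv_at k (pderiv_at a (?\<phi> j)) x - ?y a k x)\<^sup>2 \<partial>lebesgue_on T))"
      unfolding H2_sq_def pd[OF sm sm] pd[OF smooth_pderiv[OF sm] smooth_pderiv[OF sm]]
      by (intro add_mono sum_mono tri S smooth_pderiv sm v1 v2)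
    also have "\<dots> = 2 * dev (?\<phi> i) + 2 * dev (?\<phi> j)"
      unfolding dev_def by (simp add: sum.distrib sum_distrib_left[symmetric] algebra_simps)
    finally show ?thesis .
  qed
  have "dist (?\<phi> i x) (?\<phi> j x) < e" if "x \<in> T" "i \<ge> N" "j \<ge> N" for x i j
  proof -
    have "H2_sq (\<lambda>x. ?\<phi> i x - ?\<phi> j x) \<le> \<kappa>" using H2d[of i j] N[OF that(2)] N[OF that(3)] by linarith
    then have "\<bar>?\<phi> i x - ?\<phi> j x\<bar> \<le> e / 2" using \<kappa>(2)[OF smooth_diff[OF sm sm] _ that(1)] by blast
    then show ?thesis using \<open>e > 0\<close> by (simp add: dist_real_def)
  qed
  then show "\<exists>M. \<forall>x\<in>T. \<forall>m\<ge>M. \<forall>n\<ge>M. dist (?\<phi> m x) (?\<phi> n x) < e" by blast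
qed

text \<open>The uniform limit is continuous and, by Fatou's lemma, equal to \<open>v\<close> almost
  everywhere, so the choice in \<open>cont_rep\<close> is not void. Whatever was chosen agrees with
  this limit almost everywhere, hence everywhere on \<open>T\<close> by continuity.\<close>

lemma cont_rep_limit:
  assumes n: "CARD('n) \<le> 3" and v: "v \<in> H2 T"
  shows "continuous_on T (cont_rep T v)" "uniform_limit T (\<lambda>j. mollify j v) (cont_rep T v) sequentially"
proof -
  note v1 = H1D[OF H2D(1)[OF v]]
  let ?\<phi> = "\<lambda>j. mollify j v"
  have sm: "smooth (?\<phi> j)" for j by (rule smooth_mollify[OF v1(1)])
  obtain u where u: "uniform_limit T ?\<phi> u sequentially"
    using mollify_uniformly_convergent[OF n v] unfolding uniformly_convergent_on_def by blast
  have uc: "continuous_on T u"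
    by (rule uniform_limit_theorem[OF always_eventually u]) (auto intro: smooth_continuous sm)
  have um: "u \<in> borel_measurable (lebesgue_on T)"
    using T_borel by (intro continuous_imp_measurable_on_sets_lebesgue uc) auto
  have vm: "v \<in> borel_measurable (lebesgue_on T)" by (rule L2_measurable[OF v1(1)])
  have \<phi>L: "?\<phi> j \<in> L2 (lebesgue_on T)" for j by (intro L2_smooth compact_T sm)
  have "(\<integral>\<^sup>+x. ennreal ((u x - v x)\<^sup>2) \<partial>lebesgue_on T) = (\<integral>\<^sup>+x. liminf (\<lambda>j. ennreal ((?\<phi> j x - v x)\<^sup>2)) \<partial>lebesgue_on T)"
  proof (rule nn_integral_cong)
    fix x assume "x \<in> space (lebesgue_on T)"
    then have "(\<lambda>j. ?\<phi> j x) \<longlonglongrightarrow> u x" using tendsto_uniform_limitI[OF u] by simp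
    then have "(\<lambda>j. ennreal ((?\<phi> j x - v x)\<^sup>2)) \<longlonglongrightarrow> ennreal ((u x - v x)\<^sup>2)"
      by (intro tendsto_intros tendsto_ennrealI)
    from lim_imp_Liminf[OF _ this] show "ennreal ((u x - v x)\<^sup>2) = liminf (\<lambda>j. ennreal ((?\<phi> j x - v x)\<^sup>2))" by simp
  qed
  also have "\<dots> \<le> liminf (\<lambda>j. \<integral>\<^sup>+x. ennreal ((?\<phi> j x - v x)\<^sup>2) \<partial>lebesgue_on T)"
    using vm L2_measurable[OF \<phi>L] by (intro nn_integral_liminf) measurable
  also have "\<dots> = 0"
  proof -
    have "(\<integral>\<^sup>+x. ennreal ((?\<phi> j x - v x)\<^sup>2) \<partial>lebesgue_on T) = ennreal (\<integral>x. (?\<phi> j x - v x)\<^sup>2 \<partial>lebesgue_on T)" for j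
      by (intro nn_integral_eq_integral L2_integrable_sq L2_diff \<phi>L v1) auto
    moreover have "(\<lambda>j. ennreal (\<integral>x. (?\<phi> j x - v x)\<^sup>2 \<partial>lebesgue_on T)) \<longlonglongrightarrow> ennreal 0"
      by (intro tendsto_ennrealI mollify_tendsto v1)
    ultimately show ?thesis using lim_imp_Liminf[of sequentially] by simp
  qed
  finally have "(\<integral>\<^sup>+x. ennreal ((u x - v x)\<^sup>2) \<partial>lebesgue_on T) = 0" by simp
  then have "AE x in lebesgue_on T. ennreal ((u x - v x)\<^sup>2) = 0"
    using um vm by (subst (asm) nn_integral_0_iff_AE) auto
  then have ae: "AE x in lebesgue_on T. u x = v x" by eventually_elim simp
  have c: "continuous_on T (cont_rep T v) \<and> (AE x in lebesgue_on T. cont_rep T v x = v x)"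
    unfolding cont_rep_def by (rule someI[of "\<lambda>w. continuous_on T w \<and> (AE x in lebesgue_on T. w x = v x)" u]) (use uc ae in blast)
  then show "continuous_on T (cont_rep T v)" by blast
  have "cont_rep T v x - u x = 0" if "x \<in> T" for x
  proof (rule continuous_zero_AE[OF compact_T convex_T interior_nonempty])
    show "continuous_on T (\<lambda>x. cont_rep T v x - u x)" using c uc by (intro continuous_on_diff) auto
    show "AE x in lebesgue_on T. cont_rep T v x - u x = 0"
      using conjunct2[OF c] ae by eventually_elim simp
  qed (rule that)
  then show "uniform_limit T ?\<phi> (cont_rep T v) sequentially"
    using u by (subst uniform_limit_cong'[of _ _ ?\<phi> _ u]) auto
qed

text \<open>Uniform convergence on \<open>T\<close> together with finiteness of
  \<open>surf E\<close>. The set \<open>E\<close> may be a single point, where \<open>surf E\<close>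
  is a point mass; this is the case of the vertices for \<open>n = 2\<close>.\<close>

lemma cont_rep_limit_surf:
  assumes n: "CARD('n) \<le> 3" and v: "v \<in> H2 T" and E: "compact E" "E \<subseteq> T"
  shows "cont_rep T v \<in> L2 (surf E)" "(\<lambda>j. \<integral>x. (mollify j v x - cont_rep T v x)\<^sup>2 \<partial>surf E) \<longlonglongrightarrow> 0"
proof -
  let ?c = "cont_rep T v"
  note lim = cont_rep_limit[OF n v]
  have sm: "smooth (mollify j v)" for j by (rule smooth_mollify[OF H1D(1)[OF H2D(1)[OF v]]])
  show cL: "?c \<in> L2 (surf E)" by (rule L2_surf_continuous[OF E(1) continuous_on_subset[OF lim(1) E(2)]])
  interpret finite_measure "surf E" by (rule finite_measure_surf[OF E(1)])
  have mL: "mollify j v \<in> L2 (surf E)" for j by (intro L2_surf_continuous E smooth_continuous sm)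
  let ?\<mu> = "measure (surf E) (space (surf E))"
  show "(\<lambda>j. \<integral>x. (mollify j v x - ?c x)\<^sup>2 \<partial>surf E) \<longlonglongrightarrow> 0"
  proof (rule LIMSEQ_I)
    fix r :: real assume r: "r > 0"
    define e where "e = sqrt (r / (?\<mu> + 1))"
    have \<mu>: "?\<mu> \<ge> 0" by simp
    have e: "e > 0" "e\<^sup>2 = r / (?\<mu> + 1)" using r \<mu> by (simp_all add: e_def add_nonneg_pos del: measure_nonneg)
    obtain N where N: "\<And>j x. j \<ge> N \<Longrightarrow> x \<in> T \<Longrightarrow> dist (mollify j v x) (?c x) < e"
      using uniform_limitD[OF lim(2) e(1)] unfolding eventually_sequentially by blast
    have "norm ((\<integral>x. (mollify j v x - ?c x)\<^sup>2 \<partial>surf E) - 0) < r" if "j \<ge> N" for j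
    proof -
      have "(\<integral>x. (mollify j v x - ?c x)\<^sup>2 \<partial>surf E) \<le> (\<integral>x. e\<^sup>2 \<partial>surf E)"
      proof (rule integral_mono)
        show "integrable (surf E) (\<lambda>x. (mollify j v x - ?c x)\<^sup>2)" by (intro L2_integrable_sq L2_diff mL cL)
        fix x assume "x \<in> space (surf E)"
        then have "\<bar>mollify j v x - ?c x\<bar> \<le> e" using N[OF that, of x] E(2) by (auto simp: dist_real_def)
        then show "(mollify j v x - ?c x)\<^sup>2 \<le> e\<^sup>2" using e(1) by (metis abs_le_square_iff abs_of_pos)
      qed simp
      also have "\<dots> = e\<^sup>2 * ?\<mu>" by simp
      also have "\<dots> < e\<^sup>2 * (?\<mu> + 1)" using e(1) by (intro mult_strict_left_mono) auto
      also have "\<dots> = r" unfolding e(2) using \<mu> by (simp add: add_nonneg_eq_0_iff del: measure_nonneg)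
      finally have "(\<integral>x. (mollify j v x - ?c x)\<^sup>2 \<partial>surf E) < r" .
      moreover have "(\<integral>x. (mollify j v x - ?c x)\<^sup>2 \<partial>surf E) \<ge> 0" by (intro Bochner_Integration.integral_nonneg) auto
      ultimately show ?thesis unfolding real_norm_def by linarith
    qed
    then show "\<exists>N. \<forall>j\<ge>N. norm ((\<integral>x. (mollify j v x - ?c x)\<^sup>2 \<partial>surf E) - 0) < r" by blast
  qed
qed

end

section \<open>Green's formula for the Hessian\<close>

lemma onb_Parseval:
  assumes "onb B UNIV" shows "x \<bullet> y = (\<Sum>b\<in>B. (x \<bullet> b) * (y \<bullet> b))"
proof -
  have "x \<bullet> y = (\<Sum>b\<in>B. (x \<bullet> b) *\<^sub>R b) \<bullet> y" using onb_expand[OF assms, of x] by simp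
  also have "\<dots> = (\<Sum>b\<in>B. (x \<bullet> b) * (y \<bullet> b))" by (simp add: inner_sum_left inner_commute[of y])
  finally show ?thesis .
qed

lemma dderiv_mult:
  fixes f g :: "real^'n \<Rightarrow> real"
  assumes "smooth f" "smooth g"
  shows "dderiv e (\<lambda>x. f x * g x) = (\<lambda>x. dderiv e f x * g x + f x * dderiv e g x)"
proof
  fix x
  have "((\<lambda>x. f x * g x) has_derivative (\<lambda>h. f x * (grad g x \<bullet> h) + grad f x \<bullet> h * g x)) (at x)"
    using assms by (intro has_derivative_mult has_derivative_grad smooth_differentiable)
  from dderiv_eqI[OF this] show "dderiv e (\<lambda>x. f x * g x) x = dderiv e f x * g x + f x * dderiv e g x"
    by (simp add: smooth_dderiv_grad assms)
qed

lemma smooth_dn: "smooth p \<Longrightarrow> smooth (dn T F p)"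
  unfolding dn_def[abs_def] by (rule smooth_inner_grad)

context cell
begin

text \<open>A face is the simplex on the remaining vertices, at least two of them as
  \<open>n \<ge> 2\<close>, so the same divergence theorem applies; its facets are exactly the edges
  of \<open>T\<close> contained in it. For \<open>n = 2\<close> the formula is the fundamental
  theorem of calculus on a segment.\<close>

lemma divergence_face: "CARD('n) \<ge> 2 \<Longrightarrow> F \<in> faces T \<Longrightarrow> e \<in> direction_space F \<Longrightarrow> smooth f \<Longrightarrow>
  (\<integral>x. dderiv e f x \<partial>surf F) = (\<Sum>E\<in>face_edges T F. (e \<bullet> outer_normal F E) * (\<integral>x. f x \<partial>surf E))"
proof -
  assume n: "CARD('n) \<ge> 2" and F: "F \<in> faces T" and e: "e \<in> direction_space F" and f: "smooth f"
  obtain c where c: "c \<in> C" "F = side c" using F unfolding faces_T by blast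
  have ind: "\<not> affine_dependent (C - {c})" using indep affine_independent_subset by blast
  have cd: "card (C - {c}) \<ge> 2" using c fin card_C n by simp
  obtain w' where w': "simplex_coords (C - {c}) w'"
    using simplex_heights[OF ind cd] ind cd unfolding simplex_coords_def by metis
  have "face_edges T F = faces F"
  proof -
    have FT: "F face_of T" "aff_dim F = aff_dim T - 1" using F unfolding faces_def facet_of_def by auto
    have "aff_dim T = int CARD('n)"
      using aff_dim_convex_hull[of C] aff_dim_affine_independent[OF indep] card_C by (simp add: T_def)
    \<comment> \<open>Excludes the empty face: it has dimension \<open>-1\<close>, while the edges
      in question have dimension at least zero.\<close>
    then have dF: "aff_dim F \<ge> 1" using FT(2) n by simp
    show ?thesis
    proof (intro set_eqI iffI)
      fix E assume "E \<in> face_edges T F"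
      then have E: "E face_of T" "aff_dim E = aff_dim T - 2" "E \<subseteq> F" unfolding face_edges_def edges_def by auto
      have "E face_of F" using face_of_subset[OF E(1) E(3)] face_of_imp_subset[OF FT(1)] by blast
      moreover have "E \<noteq> {}" using E(2) FT(2) dF by auto
      ultimately show "E \<in> faces F" unfolding faces_def facet_of_def using E(2) FT(2) by simp
    next
      fix E assume "E \<in> faces F"
      then have E: "E face_of F" "aff_dim E = aff_dim F - 1" unfolding faces_def facet_of_def by auto
      then show "E \<in> face_edges T F"
        using face_of_trans[OF E(1) FT(1)] face_of_imp_subset[OF E(1)] FT(2) unfolding face_edges_def edges_def by simp
    qed
  qed
  then show ?thesis
    using simplex_coords.divergence_theorem[OF w', of e f] e f c by simp
qed

lemma face_subset_edge: "E \<in> face_edges T F \<Longrightarrow> E \<in> edges T"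
  unfolding face_edges_def by blast

lemma edge_compact: "E \<in> edges T \<Longrightarrow> compact E" and edge_subset: "E \<in> edges T \<Longrightarrow> E \<subseteq> T"
  and edge_convex: "E \<in> edges T \<Longrightarrow> convex E"
  unfolding edges_def using compact_T convex_T
  by (auto intro: face_of_imp_compact face_of_imp_convex dest: face_of_imp_subset)

text \<open>Tangent basis and unit normal form an orthonormal basis of the whole space. The sign of
  the normal cancels because it occurs twice.\<close>

lemma normal_decomposition:
  assumes F: "F \<in> faces T"
  shows "x \<bullet> y = (x \<bullet> outer_normal T F) * (y \<bullet> outer_normal T F) + (\<Sum>b\<in>tangent_basis F. (x \<bullet> b) * (y \<bullet> b))"
proof -
  obtain c where c: "c \<in> C" "F = side c" using F unfolding faces_T by blast
  let ?\<nu> = "w c /\<^sub>R norm (w c)"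
  note o = onb_side[OF c(1) tangent_basis_onb[of "side c"]]
  have "onb (insert ?\<nu> (tangent_basis F)) UNIV" using o(1) direction_space_T unfolding T_def c(2) by simp
  from onb_Parseval[OF this, of x y]
  have "x \<bullet> y = (x \<bullet> ?\<nu>) * (y \<bullet> ?\<nu>) + (\<Sum>b\<in>tangent_basis F. (x \<bullet> b) * (y \<bullet> b))"
    using o(2) onb_finite[OF tangent_basis_onb[of F]] unfolding c(2) by simp
  moreover have "outer_normal T F = - ?\<nu>" unfolding T_def c(2) by (rule outer_normal_side[OF c(1)])
  ultimately show ?thesis by simp
qed

text \<open>The gradients are split into normal and tangential parts. Only the tangential parts are
  integrated by parts within the flat side, one basis direction at a time; the last sum is the flux
  through the edges.\<close>

lemma green_side:
  assumes n: "CARD('n) \<ge> 2" and F: "F \<in> faces T" and \<phi>: "smooth \<phi>" and q: "smooth q"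
  shows "(\<integral>x. grad \<phi> x \<bullet> grad q x \<partial>surf F) =
    (\<integral>x. (grad \<phi> x \<bullet> outer_normal T F) * (grad q x \<bullet> outer_normal T F) \<partial>surf F)
    - (\<integral>x. \<phi> x * tlaplacian F q x \<partial>surf F)
    + (\<Sum>E\<in>face_edges T F. \<integral>x. \<phi> x * (tgrad F q x \<bullet> outer_normal F E) \<partial>surf E)"
proof -
  let ?B = "tangent_basis F" and ?\<nu> = "outer_normal T F"
  have B: "b \<in> direction_space F" if "b \<in> ?B" for b
    using tangent_basis_onb[of F] that span_base[of b ?B] unfolding onb_def by blast
  have int: "integrable (surf F) f" if "smooth f" for f
    by (intro integrable_surf_continuous face_compact F smooth_continuous that)
  have intE: "integrable (surf E) f" if "smooth f" "E \<in> face_edges T F" for f E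
    by (intro integrable_surf_continuous edge_compact face_subset_edge[OF that(2)] smooth_continuous that)
  note sm = smooth_mult smooth_dderiv(2) \<phi> q smooth_inner_grad
  have one: "(\<integral>x. dderiv b \<phi> x * dderiv b q x \<partial>surf F) =
     (\<Sum>E\<in>face_edges T F. (b \<bullet> outer_normal F E) * (\<integral>x. \<phi> x * dderiv b q x \<partial>surf E)) - (\<integral>x. \<phi> x * dderiv b (dderiv b q) x \<partial>surf F)"
    if b: "b \<in> ?B" for b
  proof -
    have "(\<integral>x. dderiv b (\<lambda>x. \<phi> x * dderiv b q x) x \<partial>surf F) = (\<Sum>E\<in>face_edges T F. (b \<bullet> outer_normal F E) * (\<integral>x. \<phi> x * dderiv b q x \<partial>surf E))"
      by (rule divergence_face[OF n F B[OF b]]) (intro sm)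
    moreover have "(\<integral>x. dderiv b (\<lambda>x. \<phi> x * dderiv b q x) x \<partial>surf F) =
       (\<integral>x. dderiv b \<phi> x * dderiv b q x \<partial>surf F) + (\<integral>x. \<phi> x * dderiv b (dderiv b q) x \<partial>surf F)"
      unfolding dderiv_mult[OF \<phi> smooth_dderiv(2)[OF q]]
      by (intro Bochner_Integration.integral_add int sm)
    ultimately show ?thesis by linarith
  qed
  have "(\<integral>x. grad \<phi> x \<bullet> grad q x \<partial>surf F) = (\<integral>x. (grad \<phi> x \<bullet> ?\<nu>) * (grad q x \<bullet> ?\<nu>) + (\<Sum>b\<in>?B. dderiv b \<phi> x * dderiv b q x) \<partial>surf F)"
    by (intro Bochner_Integration.integral_cong refl, subst normal_decomposition[OF F])
       (simp only: smooth_dderiv_grad[OF \<phi>] smooth_dderiv_grad[OF q])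
  also have "\<dots> = (\<integral>x. (grad \<phi> x \<bullet> ?\<nu>) * (grad q x \<bullet> ?\<nu>) \<partial>surf F) + (\<Sum>b\<in>?B. \<integral>x. dderiv b \<phi> x * dderiv b q x \<partial>surf F)"
    by (subst Bochner_Integration.integral_add, intro int sm, intro int smooth_sum sm,
        subst Bochner_Integration.integral_sum) (auto intro!: int sm)
  also have "(\<Sum>b\<in>?B. \<integral>x. dderiv b \<phi> x * dderiv b q x \<partial>surf F) =
     (\<Sum>b\<in>?B. \<Sum>E\<in>face_edges T F. (b \<bullet> outer_normal F E) * (\<integral>x. \<phi> x * dderiv b q x \<partial>surf E)) - (\<Sum>b\<in>?B. \<integral>x. \<phi> x * dderiv b (dderiv b q) x \<partial>surf F)"
    by (simp add: one sum_subtractf)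
  also have "(\<Sum>b\<in>?B. \<integral>x. \<phi> x * dderiv b (dderiv b q) x \<partial>surf F) = (\<integral>x. \<phi> x * tlaplacian F q x \<partial>surf F)"
    unfolding tlaplacian_def sum_distrib_left
    by (rule Bochner_Integration.integral_sum[symmetric]) (intro int sm)
  also have "(\<Sum>b\<in>?B. \<Sum>E\<in>face_edges T F. (b \<bullet> outer_normal F E) * (\<integral>x. \<phi> x * dderiv b q x \<partial>surf E)) =
     (\<Sum>E\<in>face_edges T F. \<integral>x. \<phi> x * (tgrad F q x \<bullet> outer_normal F E) \<partial>surf E)"
  proof (subst sum.swap, rule sum.cong[OF refl])
    fix E assume E: "E \<in> face_edges T F"
    have "(\<Sum>b\<in>?B. (b \<bullet> outer_normal F E) * (\<integral>x. \<phi> x * dderiv b q x \<partial>surf E)) =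
       (\<integral>x. (\<Sum>b\<in>?B. (b \<bullet> outer_normal F E) * (\<phi> x * dderiv b q x)) \<partial>surf E)"
      by (subst Bochner_Integration.integral_sum) (auto intro!: integrable_mult_right intE E sm)
    also have "\<dots> = (\<integral>x. \<phi> x * (tgrad F q x \<bullet> outer_normal F E) \<partial>surf E)"
      by (intro Bochner_Integration.integral_cong) (auto simp: tgrad_def inner_sum_left sum_distrib_left intro!: sum.cong)
    finally show "(\<Sum>b\<in>?B. (b \<bullet> outer_normal F E) * (\<integral>x. \<phi> x * dderiv b q x \<partial>surf E)) = (\<integral>x. \<phi> x * (tgrad F q x \<bullet> outer_normal F E) \<partial>surf E)" .
  qed
  finally show ?thesis by linarith
qed

lemma hess_inner: "(A :: real^'n^'n) \<bullet> B = (\<Sum>i\<in>UNIV. \<Sum>j\<in>UNIV. A $ i $ j * B $ i $ j)"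
  by (simp add: inner_vec_def)

text \<open>Two integrations by parts on \<open>T\<close> move all derivatives in the cell from
  \<open>\<phi>\<close> to \<open>p\<close>. The first one leaves
  \<open>grad \<phi> \<bullet> grad (dn T F p)\<close> on each side, which \<open>green_side\<close>
  with \<open>q = dn T F p\<close> reduces to terms with \<open>\<phi>\<close> and its normal
  derivative.\<close>

lemma green_formula:
  assumes n: "CARD('n) \<ge> 2" and \<phi>: "smooth \<phi>" and p: "p \<in> polys k"
  shows "(\<Sum>i\<in>UNIV. \<Sum>j\<in>UNIV. \<integral>x. pderiv_at j (pderiv_at i \<phi>) x * pderiv_at j (pderiv_at i p) x \<partial>lebesgue_on T) =
     (\<integral>x. \<phi> x * laplacian (laplacian p) x \<partial>lebesgue_on T)
     - (\<Sum>F\<in>faces T. \<integral>x. \<phi> x * dn T F (laplacian p) x \<partial>surf F)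
     + (\<Sum>F\<in>faces T. \<integral>x. dn T F \<phi> x * dnn T F p x \<partial>surf F)
     - (\<Sum>F\<in>faces T. \<integral>x. \<phi> x * tlaplacian F (dn T F p) x \<partial>surf F)
     + (\<Sum>F\<in>faces T. \<Sum>E\<in>face_edges T F. \<integral>x. \<phi> x * (dtn T F p x \<bullet> outer_normal F E) \<partial>surf E)"
proof -
  have sp: "smooth p" using p by (rule smooth_polys)
  note sm = smooth_pderiv smooth_mult \<phi> sp smooth_laplacian
  let ?\<nu> = "\<lambda>F. outer_normal T F"
  have intF: "integrable (surf F) f" if "smooth f" "F \<in> faces T" for f F
    by (intro integrable_surf_continuous face_compact that smooth_continuous)
  have intT: "integrable (lebesgue_on T) f" if "smooth f" for f
    by (intro L2_integrable finite_measure_lebesgue_on lmeasurable_compact compact_T L2_smooth that)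
  have pdc: "pderiv_at a (pderiv_at b p) = pderiv_at b (pderiv_at a p)" for a b by (rule polys_pderiv_commute[OF p])
  have plap: "(\<Sum>j\<in>UNIV. pderiv_at j (pderiv_at j (pderiv_at i p)) x) = pderiv_at i (laplacian p) x" for i x
  proof -
    have "pderiv_at i (laplacian p) x = (\<Sum>j\<in>UNIV. pderiv_at i (pderiv_at j (pderiv_at j p)) x)"
      unfolding laplacian_def[abs_def] by (rule pderiv_sum) (intro smooth_differentiable sm)
    also have "\<dots> = (\<Sum>j\<in>UNIV. pderiv_at j (pderiv_at j (pderiv_at i p)) x)"
      using polys_pderiv_commute[OF polys_pderiv[OF p]] pdc by (intro sum.cong) metis+
    finally show ?thesis by simp
  qed
  \<comment> \<open>\<open>dn T F p\<close> is formed with the constant normal of \<open>F\<close>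
    and is thus defined on the whole space; by symmetry of second derivatives its gradient is the
    Hessian applied to the normal.\<close>
  have gq: "grad (dn T F p) x $ i = (\<Sum>j\<in>UNIV. ?\<nu> F $ j * pderiv_at j (pderiv_at i p) x)" for F x i
  proof -
    have "dn T F p = (\<lambda>x. \<Sum>j\<in>UNIV. ?\<nu> F $ j * pderiv_at j p x)"
      by (simp add: dn_def[abs_def] inner_vec_def grad_def mult.commute)
    then have "pderiv_at i (dn T F p) x = (\<Sum>j\<in>UNIV. pderiv_at i (\<lambda>x. ?\<nu> F $ j * pderiv_at j p x) x)"
      by (simp add: pderiv_sum smooth_differentiable smooth_cmult smooth_pderiv sp)
    also have "\<dots> = (\<Sum>j\<in>UNIV. ?\<nu> F $ j * pderiv_at j (pderiv_at i p) x)"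
      by (intro sum.cong refl) (simp add: pderiv_cmult smooth_differentiable smooth_pderiv sp pdc[of i])
    finally show ?thesis by (simp add: grad_def)
  qed
  have dnn: "grad (dn T F p) x \<bullet> ?\<nu> F = dnn T F p x" for F x
  proof -
    have "grad (dn T F p) x \<bullet> ?\<nu> F = (\<Sum>i\<in>UNIV. \<Sum>j\<in>UNIV. ?\<nu> F $ i * (pderiv_at j (pderiv_at i p) x * ?\<nu> F $ j))"
      unfolding inner_vec_def[of "grad (dn T F p) x"] gq by (simp add: sum_distrib_right sum_distrib_left mult_ac)
    then show ?thesis
      by (simp add: dnn_def inner_vec_def matrix_vector_mult_def hess_def sum_distrib_left)
  qed
  have "(\<Sum>i\<in>UNIV. \<Sum>j\<in>UNIV. \<integral>x. pderiv_at j (pderiv_at i \<phi>) x * pderiv_at j (pderiv_at i p) x \<partial>lebesgue_on T) =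
     (\<Sum>i\<in>UNIV. \<Sum>j\<in>UNIV. \<Sum>F\<in>faces T. ?\<nu> F $ j * (\<integral>x. pderiv_at i \<phi> x * pderiv_at j (pderiv_at i p) x \<partial>surf F))
     - (\<Sum>i\<in>UNIV. \<Sum>j\<in>UNIV. \<integral>x. pderiv_at i \<phi> x * pderiv_at j (pderiv_at j (pderiv_at i p)) x \<partial>lebesgue_on T)"
    by (simp add: integration_by_parts_T sm sum_subtractf)
  also have "(\<Sum>i\<in>UNIV. \<Sum>j\<in>UNIV. \<integral>x. pderiv_at i \<phi> x * pderiv_at j (pderiv_at j (pderiv_at i p)) x \<partial>lebesgue_on T) =
     (\<Sum>i\<in>UNIV. \<integral>x. pderiv_at i \<phi> x * pderiv_at i (laplacian p) x \<partial>lebesgue_on T)"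
    unfolding plap[symmetric] sum_distrib_left
    by (intro sum.cong refl Bochner_Integration.integral_sum[symmetric] intT sm)
  also have "\<dots> = (\<Sum>i\<in>UNIV. \<Sum>F\<in>faces T. ?\<nu> F $ i * (\<integral>x. \<phi> x * pderiv_at i (laplacian p) x \<partial>surf F)) -
     (\<Sum>i\<in>UNIV. \<integral>x. \<phi> x * pderiv_at i (pderiv_at i (laplacian p)) x \<partial>lebesgue_on T)"
    by (simp add: integration_by_parts_T sm sum_subtractf)
  also have "(\<Sum>i\<in>UNIV. \<integral>x. \<phi> x * pderiv_at i (pderiv_at i (laplacian p)) x \<partial>lebesgue_on T) = (\<integral>x. \<phi> x * laplacian (laplacian p) x \<partial>lebesgue_on T)"
    unfolding laplacian_def[of "laplacian p"] sum_distrib_left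
    by (intro Bochner_Integration.integral_sum[symmetric] intT sm)
  also have "(\<Sum>i\<in>UNIV. \<Sum>F\<in>faces T. ?\<nu> F $ i * (\<integral>x. \<phi> x * pderiv_at i (laplacian p) x \<partial>surf F)) =
     (\<Sum>F\<in>faces T. \<integral>x. \<phi> x * dn T F (laplacian p) x \<partial>surf F)"
  proof (subst sum.swap, rule sum.cong[OF refl])
    fix F assume F: "F \<in> faces T"
    have "(\<Sum>i\<in>UNIV. ?\<nu> F $ i * (\<integral>x. \<phi> x * pderiv_at i (laplacian p) x \<partial>surf F)) =
       (\<integral>x. (\<Sum>i\<in>UNIV. ?\<nu> F $ i * (\<phi> x * pderiv_at i (laplacian p) x)) \<partial>surf F)"
      by (subst Bochner_Integration.integral_sum) (auto intro!: integrable_mult_right intF sm F)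
    also have "\<dots> = (\<integral>x. \<phi> x * dn T F (laplacian p) x \<partial>surf F)"
      by (intro Bochner_Integration.integral_cong) (auto simp: dn_def inner_vec_def grad_def sum_distrib_left intro!: sum.cong)
    finally show "(\<Sum>i\<in>UNIV. ?\<nu> F $ i * (\<integral>x. \<phi> x * pderiv_at i (laplacian p) x \<partial>surf F)) = (\<integral>x. \<phi> x * dn T F (laplacian p) x \<partial>surf F)" .
  qed
  also have "(\<Sum>i\<in>UNIV. \<Sum>j\<in>UNIV. \<Sum>F\<in>faces T. ?\<nu> F $ j * (\<integral>x. pderiv_at i \<phi> x * pderiv_at j (pderiv_at i p) x \<partial>surf F)) =
     (\<Sum>F\<in>faces T. \<integral>x. grad \<phi> x \<bullet> grad (dn T F p) x \<partial>surf F)"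
  proof -
    have "(\<Sum>i\<in>UNIV. \<Sum>j\<in>UNIV. \<Sum>F\<in>faces T. ?\<nu> F $ j * (\<integral>x. pderiv_at i \<phi> x * pderiv_at j (pderiv_at i p) x \<partial>surf F)) =
       (\<Sum>F\<in>faces T. \<Sum>i\<in>UNIV. \<Sum>j\<in>UNIV. ?\<nu> F $ j * (\<integral>x. pderiv_at i \<phi> x * pderiv_at j (pderiv_at i p) x \<partial>surf F))"
      by (subst (2) sum.swap, subst sum.swap) (rule refl)
    also have "\<dots> = (\<Sum>F\<in>faces T. \<integral>x. grad \<phi> x \<bullet> grad (dn T F p) x \<partial>surf F)"
    proof (rule sum.cong[OF refl])
      fix F assume F: "F \<in> faces T"
      have "(\<Sum>i\<in>UNIV. \<Sum>j\<in>UNIV. ?\<nu> F $ j * (\<integral>x. pderiv_at i \<phi> x * pderiv_at j (pderiv_at i p) x \<partial>surf F)) =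
        (\<integral>x. (\<Sum>i\<in>UNIV. \<Sum>j\<in>UNIV. ?\<nu> F $ j * (pderiv_at i \<phi> x * pderiv_at j (pderiv_at i p) x)) \<partial>surf F)"
        by (subst Bochner_Integration.integral_sum, intro Bochner_Integration.integrable_sum integrable_mult_right intF sm F,
            subst Bochner_Integration.integral_sum) (auto intro!: integrable_mult_right intF sm F)
      also have "\<dots> = (\<integral>x. grad \<phi> x \<bullet> grad (dn T F p) x \<partial>surf F)"
      proof (intro Bochner_Integration.integral_cong refl)
        fix x
        show "(\<Sum>i\<in>UNIV. \<Sum>j\<in>UNIV. ?\<nu> F $ j * (pderiv_at i \<phi> x * pderiv_at j (pderiv_at i p) x)) = grad \<phi> x \<bullet> grad (dn T F p) x"
          unfolding inner_vec_def gq by (simp add: grad_def sum_distrib_left mult_ac)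
      qed
      finally show "(\<Sum>i\<in>UNIV. \<Sum>j\<in>UNIV. ?\<nu> F $ j * (\<integral>x. pderiv_at i \<phi> x * pderiv_at j (pderiv_at i p) x \<partial>surf F)) = (\<integral>x. grad \<phi> x \<bullet> grad (dn T F p) x \<partial>surf F)" .
    qed
    finally show ?thesis .
  qed
  also have "(\<Sum>F\<in>faces T. \<integral>x. grad \<phi> x \<bullet> grad (dn T F p) x \<partial>surf F) =
      (\<Sum>F\<in>faces T. \<integral>x. dn T F \<phi> x * dnn T F p x \<partial>surf F)
     - (\<Sum>F\<in>faces T. \<integral>x. \<phi> x * tlaplacian F (dn T F p) x \<partial>surf F)
     + (\<Sum>F\<in>faces T. \<Sum>E\<in>face_edges T F. \<integral>x. \<phi> x * (dtn T F p x \<bullet> outer_normal F E) \<partial>surf E)"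
    by (simp add: green_side[OF n _ \<phi> smooth_dn[OF sp]] dnn sum.distrib sum_subtractf dtn_def dn_def[of T _ \<phi>])
  finally show ?thesis by linarith
qed

lemma smooth_tlaplacian: "smooth q \<Longrightarrow> smooth (tlaplacian F q)"
  unfolding tlaplacian_def[abs_def] by (intro smooth_sum smooth_dderiv)

lemma smooth_dnn: "smooth p \<Longrightarrow> smooth (dnn T F p)"
  unfolding dnn_def[abs_def] inner_vec_def matrix_vector_mult_def hess_def
  by (simp add: mult.assoc) (intro smooth_sum smooth_mult smooth_const smooth_pderiv; assumption)

lemma smooth_dtn: "smooth p \<Longrightarrow> smooth (\<lambda>x. dtn T F p x \<bullet> e)"
  unfolding dtn_def tgrad_def inner_sum_left inner_scaleR_left
  by (intro smooth_sum smooth_mult smooth_const smooth_dderiv smooth_dn)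

text \<open>One sequence of mollifications converges in all the required senses at once: with its
  second derivatives on \<open>T\<close>, together with its normal derivative on each side, and on
  each edge. So the limit can be taken term by term.\<close>

lemma green_formula_H2:
  assumes n: "CARD('n) \<in> {2, 3}" and v: "v \<in> H2 T" and p: "p \<in> polys k"
  shows "(\<integral>x. weak_hess T v x \<bullet> hess p x \<partial>lebesgue_on T) =
     (\<integral>x. v x * laplacian (laplacian p) x \<partial>lebesgue_on T)
     - (\<Sum>F\<in>faces T. \<integral>x. face_trace T F v x * dn T F (laplacian p) x \<partial>surf F)
     + (\<Sum>F\<in>faces T. \<integral>x. normal_trace T F v x * dnn T F p x \<partial>surf F)
     - (\<Sum>F\<in>faces T. \<integral>x. face_trace T F v x * tlaplacian F (dn T F p) x \<partial>surf F)
     + (\<Sum>F\<in>faces T. \<Sum>E\<in>face_edges T F. \<integral>x. cont_rep T v x * (dtn T F p x \<bullet> outer_normal F E) \<partial>surf E)"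
proof -
  have n2: "CARD('n) \<ge> 2" and n3: "CARD('n) \<le> 3" using n by auto
  have sp: "smooth p" using p by (rule smooth_polys)
  note v1 = H1D[OF H2D(1)[OF v]] and v2 = H1D[OF H2D(2)[OF v]]
  let ?\<phi> = "\<lambda>m. mollify m v"
  have sm: "smooth (?\<phi> m)" for m by (rule smooth_mollify[OF v1(1)])
  note S = L2_smooth[OF compact_T]
  let ?L = "\<lambda>m. \<Sum>i\<in>UNIV. \<Sum>j\<in>UNIV. \<integral>x. pderiv_at j (pderiv_at i (?\<phi> m)) x * pderiv_at j (pderiv_at i p) x \<partial>lebesgue_on T"
  have L: "?L \<longlonglongrightarrow> (\<Sum>i\<in>UNIV. \<Sum>j\<in>UNIV. \<integral>x. weak_pderiv T j (weak_pderiv T i v) x * pderiv_at j (pderiv_at i p) x \<partial>lebesgue_on T)"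
    using mollify_pderiv_H1_approx[OF v] unfolding H1_approx_def
    by (intro tendsto_sum L2_tendsto_mult S smooth_pderiv sm sp v2) auto
  let ?R = "\<lambda>m. (\<integral>x. ?\<phi> m x * laplacian (laplacian p) x \<partial>lebesgue_on T)
     - (\<Sum>F\<in>faces T. \<integral>x. ?\<phi> m x * dn T F (laplacian p) x \<partial>surf F)
     + (\<Sum>F\<in>faces T. \<integral>x. dn T F (?\<phi> m) x * dnn T F p x \<partial>surf F)
     - (\<Sum>F\<in>faces T. \<integral>x. ?\<phi> m x * tlaplacian F (dn T F p) x \<partial>surf F)
     + (\<Sum>F\<in>faces T. \<Sum>E\<in>face_edges T F. \<integral>x. ?\<phi> m x * (dtn T F p x \<bullet> outer_normal F E) \<partial>surf E)"
  let ?lim = "(\<integral>x. v x * laplacian (laplacian p) x \<partial>lebesgue_on T)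
     - (\<Sum>F\<in>faces T. \<integral>x. face_trace T F v x * dn T F (laplacian p) x \<partial>surf F)
     + (\<Sum>F\<in>faces T. \<integral>x. normal_trace T F v x * dnn T F p x \<partial>surf F)
     - (\<Sum>F\<in>faces T. \<integral>x. face_trace T F v x * tlaplacian F (dn T F p) x \<partial>surf F)
     + (\<Sum>F\<in>faces T. \<Sum>E\<in>face_edges T F. \<integral>x. cont_rep T v x * (dtn T F p x \<bullet> outer_normal F E) \<partial>surf E)"
  have R: "?R \<longlonglongrightarrow> ?lim"
  proof (intro tendsto_add tendsto_diff tendsto_sum)
    show "(\<lambda>m. \<integral>x. ?\<phi> m x * laplacian (laplacian p) x \<partial>lebesgue_on T) \<longlonglongrightarrow> (\<integral>x. v x * laplacian (laplacian p) x \<partial>lebesgue_on T)"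
      by (intro L2_tendsto_mult S sm v1 smooth_laplacian sp mollify_tendsto)
  next
    fix F assume F: "F \<in> faces T"
    show "(\<lambda>m. \<integral>x. ?\<phi> m x * dn T F (laplacian p) x \<partial>surf F) \<longlonglongrightarrow> (\<integral>x. face_trace T F v x * dn T F (laplacian p) x \<partial>surf F)"
      by (intro L2_tendsto_mult L2_surf_smooth face_trace_limit F v sm smooth_dn smooth_laplacian sp)
    show "(\<lambda>m. \<integral>x. dn T F (?\<phi> m) x * dnn T F p x \<partial>surf F) \<longlonglongrightarrow> (\<integral>x. normal_trace T F v x * dnn T F p x \<partial>surf F)"
      by (intro L2_tendsto_mult L2_surf_smooth normal_trace_limit F v smooth_dn sm smooth_dnn sp)
    show "(\<lambda>m. \<integral>x. ?\<phi> m x * tlaplacian F (dn T F p) x \<partial>surf F) \<longlonglongrightarrow> (\<integral>x. face_trace T F v x * tlaplacian F (dn T F p) x \<partial>surf F)"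
      by (intro L2_tendsto_mult L2_surf_smooth face_trace_limit F v sm smooth_tlaplacian smooth_dn sp)
    fix E assume "E \<in> face_edges T F"
    then have E: "compact E" "E \<subseteq> T" using face_subset_edge edge_compact edge_subset by blast+
    show "(\<lambda>m. \<integral>x. ?\<phi> m x * (dtn T F p x \<bullet> outer_normal F E) \<partial>surf E) \<longlonglongrightarrow> (\<integral>x. cont_rep T v x * (dtn T F p x \<bullet> outer_normal F E) \<partial>surf E)"
      by (intro L2_tendsto_mult L2_surf_continuous cont_rep_limit_surf n3 v E smooth_continuous sm smooth_dtn sp)
  qed
  have "?L = ?R" using green_formula[OF n2 sm p] by (intro ext)
  then have "(\<Sum>i\<in>UNIV. \<Sum>j\<in>UNIV. \<integral>x. weak_pderiv T j (weak_pderiv T i v) x * pderiv_at j (pderiv_at i p) x \<partial>lebesgue_on T) = ?lim"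
    using LIMSEQ_unique[OF L] R by simp
  moreover have "(\<integral>x. weak_hess T v x \<bullet> hess p x \<partial>lebesgue_on T) =
      (\<Sum>i\<in>UNIV. \<Sum>j\<in>UNIV. \<integral>x. weak_pderiv T j (weak_pderiv T i v) x * pderiv_at j (pderiv_at i p) x \<partial>lebesgue_on T)"
    unfolding hess_inner weak_hess_def hess_def
    by (simp add: L2_integrable_mult v2 S smooth_pderiv sp)
  ultimately show ?thesis by simp
qed

end

section \<open>Finite-dimensional projections\<close>

text \<open>On the line through a point of \<open>U\<close> and an arbitrary \<open>y\<close> the
  polynomial depends on one variable and has infinitely many zeros.\<close>

lemma polys_zero_on_open:
  fixes p :: "real^'n \<Rightarrow> real"
  assumes p: "p \<in> polys k" and U: "open U" "U \<noteq> {}" "\<And>x. x \<in> U \<Longrightarrow> p x = 0"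
  shows "p = (\<lambda>x. 0)"
proof
  fix y
  obtain x where x: "x \<in> U" using U(2) by blast
  obtain e where e: "e > 0" "ball x e \<subseteq> U" using U(1) x openE by blast
  let ?l = "\<lambda>t::real. x + t *\<^sub>R (y - x)"
  have "polynomial_function ?l"
    by (intro polynomial_function_add polynomial_function_const polynomial_function_bounded_linear bounded_linear_scaleR_left)
  from real_polynomial_function_compose[OF this polys_real_polynomial[OF p]]
  obtain a n where an: "p \<circ> ?l = (\<lambda>t. \<Sum>i\<le>n. a i * t ^ i)"
    using real_polynomial_function_imp_sum by blast
  \<comment> \<open>Keeps the points of the line with parameter below \<open>d\<close> inside the
    ball of radius \<open>e\<close>; the summand one covers \<open>y = x\<close>.\<close>
  define d where "d = e / (norm (y - x) + 1)"
  have d: "d > 0" using e by (simp add: d_def add_nonneg_pos)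
  have "{0<..<d} \<subseteq> {t. (\<Sum>i\<le>n. a i * t ^ i) = 0}"
  proof
    fix t assume t: "t \<in> {0<..<d}"
    have "norm (t *\<^sub>R (y - x)) = t * norm (y - x)" using t by simp
    also have "\<dots> \<le> t * (norm (y - x) + 1)" using t by (intro mult_left_mono) auto
    also have "\<dots> < d * (norm (y - x) + 1)" using t by (intro mult_strict_right_mono) (auto simp: add_nonneg_pos)
    also have "\<dots> = e"
    proof -
      have "norm (y - x) + 1 > 0" by (simp add: add_nonneg_pos)
      then show ?thesis by (simp add: d_def)
    qed
    finally have "?l t \<in> U" using e(2) by (auto simp: dist_norm subset_iff)
    then have "(p \<circ> ?l) t = 0" using U(3) by simp
    then show "t \<in> {t. (\<Sum>i\<le>n. a i * t ^ i) = 0}" unfolding an by simp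
  qed
  then have "infinite {t. (\<Sum>i\<le>n. a i * t ^ i) = 0}"
    using infinite_Ioo[OF d] finite_subset by blast
  then have "\<forall>i\<le>n. a i = 0" using polyfun_finite_roots[of a n] by blast
  then have "(p \<circ> ?l) 1 = 0" unfolding an by simp
  then show "p y = 0" by simp
qed

text \<open>The span of a list of functions, by recursion on the list, so that the representation
  theorem below can be proved by induction over generators. The generators may be linearly
  dependent.\<close>

primrec lin_comb :: "('a \<Rightarrow> real) list \<Rightarrow> ('a \<Rightarrow> real) set" where
  "lin_comb [] = {\<lambda>x. 0}"
| "lin_comb (b # bs) = {\<lambda>x. c * b x + p x | c p. p \<in> lin_comb bs}"

lemma lin_comb_add: "f \<in> lin_comb bs \<Longrightarrow> g \<in> lin_comb bs \<Longrightarrow> (\<lambda>x. f x + g x) \<in> lin_comb bs"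
proof (induction bs arbitrary: f g)
  case (Cons b bs)
  then obtain c p d q where "f = (\<lambda>x. c * b x + p x)" "p \<in> lin_comb bs" "g = (\<lambda>x. d * b x + q x)" "q \<in> lin_comb bs"
    by auto
  moreover from this have "(\<lambda>x. f x + g x) = (\<lambda>x. (c + d) * b x + (p x + q x))" by (simp add: algebra_simps)
  moreover have "(\<lambda>x. p x + q x) \<in> lin_comb bs" using Cons.IH calculation by blast
  ultimately show ?case unfolding lin_comb.simps mem_Collect_eq by (intro exI conjI)
qed simp

lemma lin_comb_cmult: "f \<in> lin_comb bs \<Longrightarrow> (\<lambda>x. a * f x) \<in> lin_comb bs"
proof (induction bs arbitrary: f)
  case (Cons b bs)
  then obtain c p where "f = (\<lambda>x. c * b x + p x)" "p \<in> lin_comb bs" by auto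
  moreover from this have "(\<lambda>x. a * f x) = (\<lambda>x. (a * c) * b x + a * p x)" by (simp add: algebra_simps)
  moreover have "(\<lambda>x. a * p x) \<in> lin_comb bs" using Cons.IH calculation by blast
  ultimately show ?case unfolding lin_comb.simps mem_Collect_eq by (intro exI conjI)
qed simp

lemma polys_eq_lin_comb: "\<exists>bs. set bs \<subseteq> (polys k :: (real^'n \<Rightarrow> real) set) \<and> polys k = lin_comb bs"
proof -
  obtain xs :: "('n \<Rightarrow> nat) list" where xs: "set xs = {\<alpha>. sum \<alpha> UNIV \<le> k}" "distinct xs"
    using finite_distinct_list[OF finite_multi_index[where 'n='n and k=k]] by (elim exE conjE)
  let ?bs = "map monom_fun xs"
  have sub: "set ?bs \<subseteq> polys k" using xs by (auto intro: monom_in_polys)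
  have 1: "lin_comb bs \<subseteq> polys k" if "set bs \<subseteq> polys k" for bs :: "(real^'n \<Rightarrow> real) list"
    using that by (induction bs) (auto intro!: polys_zero polys_add polys_cmult)
  have 2: "(\<lambda>x. \<Sum>\<alpha>\<in>set ys. c \<alpha> * monom_fun \<alpha> x) \<in> lin_comb (map monom_fun ys)" if "distinct ys" for ys :: "('n \<Rightarrow> nat) list" and c
    using that
  proof (induction ys)
    case (Cons y ys)
    then have "(\<lambda>x. \<Sum>\<alpha>\<in>set (y # ys). c \<alpha> * monom_fun \<alpha> x) = (\<lambda>x. c y * monom_fun y x + (\<Sum>\<alpha>\<in>set ys. c \<alpha> * monom_fun \<alpha> x))"
      by simp
    then show ?case using Cons unfolding list.map lin_comb.simps mem_Collect_eq by (intro exI conjI) auto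
  qed simp
  have "polys k \<subseteq> lin_comb ?bs"
    unfolding polys_altdef xs(1)[symmetric] using 2[OF xs(2)] by auto
  then show ?thesis using sub 1[OF sub] by blast
qed

text \<open>Gram-Schmidt without positive definiteness. The form may degenerate, as the Hessian form
  does on affine functions and the inner product on a side does on polynomials vanishing there, so
  \<open>L\<close> has to vanish on the null functions of the form.\<close>

lemma Riesz_polys:
  fixes a :: "(real^'n \<Rightarrow> real) \<Rightarrow> (real^'n \<Rightarrow> real) \<Rightarrow> real"
  assumes add: "\<And>f g h. f \<in> polys k \<Longrightarrow> g \<in> polys k \<Longrightarrow> h \<in> polys k \<Longrightarrow> a (\<lambda>x. f x + g x) h = a f h + a g h"
    and cmult: "\<And>c f h. f \<in> polys k \<Longrightarrow> h \<in> polys k \<Longrightarrow> a (\<lambda>x. c * f x) h = c * a f h"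
    and sym: "\<And>f g. a f g = a g f"
    and pos: "\<And>f. a f f \<ge> 0"
    and L: "\<And>f g. f \<in> polys k \<Longrightarrow> g \<in> polys k \<Longrightarrow> L (\<lambda>x. f x + g x) = L f + L g"
      "\<And>c f. f \<in> polys k \<Longrightarrow> L (\<lambda>x. c * f x) = c * L f"
      "\<And>f. f \<in> polys k \<Longrightarrow> a f f = 0 \<Longrightarrow> L f = 0"
  shows "\<exists>r\<in>polys k. \<forall>p\<in>polys k. a r p = L p"
proof -
  let ?P = "polys k :: (real^'n \<Rightarrow> real) set"
  have null: "a f g = 0" if f: "f \<in> ?P" "a f f = 0" and g: "g \<in> ?P" for f g
  proof (rule ccontr)
    assume nz: "a f g \<noteq> 0"
    \<comment> \<open>As \<open>a f f = 0\<close>, the form evaluated at \<open>t * f + g\<close> is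
      affine in \<open>t\<close>; this \<open>t\<close> brings its value to
      \<open>-1\<close>.\<close>
    define t where "t = - (a g g + 1) / (2 * a f g)"
    have tf: "(\<lambda>x. t * f x) \<in> ?P" using f by (intro polys_cmult)
    have tg: "(\<lambda>x. t * f x + g x) \<in> ?P" by (intro polys_add tf g)
    have "a (\<lambda>x. t * f x + g x) (\<lambda>x. t * f x + g x) = t * a f (\<lambda>x. t * f x + g x) + a g (\<lambda>x. t * f x + g x)"
      using tf g tg f by (simp add: add cmult)
    also have "a f (\<lambda>x. t * f x + g x) = a f g"
      using tf g f by (subst sym) (simp add: add cmult sym[of g f])
    also have "a g (\<lambda>x. t * f x + g x) = t * a f g + a g g"
      using tf g f by (subst sym) (simp add: add cmult)
    finally have "a (\<lambda>x. t * f x + g x) (\<lambda>x. t * f x + g x) = 2 * t * a f g + a g g" by simp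
    also have "2 * t * a f g = - (a g g + 1)" using nz by (simp add: t_def)
    finally show False using pos[of "\<lambda>x. t * f x + g x"] by simp
  qed
  have main: "\<exists>r\<in>lin_comb bs. \<forall>p\<in>lin_comb bs. a r p = L p"
    if "set bs \<subseteq> ?P" "\<And>f g. f \<in> ?P \<Longrightarrow> g \<in> ?P \<Longrightarrow> L (\<lambda>x. f x + g x) = L f + L g"
      "\<And>c f. f \<in> ?P \<Longrightarrow> L (\<lambda>x. c * f x) = c * L f" "\<And>f. f \<in> ?P \<Longrightarrow> a f f = 0 \<Longrightarrow> L f = 0"
    for bs L
    using that
  proof (induction bs arbitrary: L)
    case Nil
    have z: "(\<lambda>x. 0) \<in> ?P" by (rule polys_zero)
    have "L (\<lambda>x. 0) = 0" using Nil(3)[OF z, of 0] by simp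
    moreover have "a (\<lambda>x. 0) (\<lambda>x. 0) = 0" using cmult[OF z z, of 0] by simp
    ultimately show ?case by simp
  next
    case (Cons b bs)
    have b: "b \<in> ?P" and bs: "set bs \<subseteq> ?P" using Cons.prems(1) by auto
    have lP: "lin_comb bs \<subseteq> ?P" using bs by (induction bs) (auto intro!: polys_zero polys_add polys_cmult)
    obtain r1 where r1: "r1 \<in> lin_comb bs" "\<And>p. p \<in> lin_comb bs \<Longrightarrow> a r1 p = L p"
      using Cons.IH[where L=L, OF bs Cons.prems(2-4)] by blast
    \<comment> \<open>\<open>r0\<close> represents \<open>b\<close> on the span of the remaining
      generators, so \<open>q = b - r0\<close> is orthogonal to that span.\<close>
    obtain r0 where r0: "r0 \<in> lin_comb bs" "\<And>p. p \<in> lin_comb bs \<Longrightarrow> a r0 p = a b p"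
    proof -
      have "\<exists>r\<in>lin_comb bs. \<forall>p\<in>lin_comb bs. a r p = a b p"
      proof (rule Cons.IH[where L="a b", OF bs])
        show "a b (\<lambda>x. f x + g x) = a b f + a b g" if "f \<in> ?P" "g \<in> ?P" for f g
          using add[OF that b] sym by metis
        show "a b (\<lambda>x. c * f x) = c * a b f" if "f \<in> ?P" for c f using cmult[OF that b] sym by metis
        show "a b f = 0" if "f \<in> ?P" "a f f = 0" for f using null[OF that b] sym by metis
      qed
      then show ?thesis using that by blast
    qed
    have P: "r1 \<in> ?P" "r0 \<in> ?P" using r1 r0 lP by auto
    define q where "q = (\<lambda>x. b x + (-1) * r0 x)"
    have qP: "q \<in> ?P" unfolding q_def by (intro polys_add polys_cmult b P)
    have orth: "a q p = 0" if "p \<in> lin_comb bs" for p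
    proof -
      have "p \<in> ?P" using that lP by blast
      have "a q p = a b p + a (\<lambda>x. (-1) * r0 x) p"
        unfolding q_def by (rule add[OF b polys_cmult[OF P(2)] \<open>p \<in> ?P\<close>])
      also have "a (\<lambda>x. (-1) * r0 x) p = (-1) * a r0 p" by (rule cmult[OF P(2) \<open>p \<in> ?P\<close>])
      finally show ?thesis using r0(2)[OF that] by simp
    qed
    \<comment> \<open>If \<open>a q q = 0\<close>, then \<open>L q = 0\<close> as well, and any
      coefficient of \<open>q\<close> would do.\<close>
    define t where "t = (if a q q = 0 then 0 else L q / a q q)"
    define r where "r = (\<lambda>x. t * q x + r1 x)"
    have tq: "a (\<lambda>x. t * q x) q = L q" using Cons.prems(4)[OF qP] cmult[OF qP qP, of t] by (auto simp: t_def)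
    have "r = (\<lambda>x. t * b x + (r1 x + (- t) * r0 x))" unfolding r_def q_def by (simp add: algebra_simps)
    then have rl: "r \<in> lin_comb (b # bs)"
      using lin_comb_add[OF r1(1) lin_comb_cmult[OF r0(1), of "- t"]]
      unfolding lin_comb.simps mem_Collect_eq by (intro exI conjI)
    have "a r p = L p" if p: "p \<in> lin_comb (b # bs)" for p
    proof -
      obtain c p0 where p0: "p = (\<lambda>x. c * b x + p0 x)" "p0 \<in> lin_comb bs" using p by auto
      define s where "s = (\<lambda>x. p0 x + c * r0 x)"
      have s: "s \<in> lin_comb bs" unfolding s_def by (intro lin_comb_add lin_comb_cmult p0 r0)
      then have sP: "s \<in> ?P" using lP by blast
      have p_eq: "p = (\<lambda>x. c * q x + s x)" unfolding p0(1) q_def s_def by (simp add: algebra_simps)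
      have cq: "(\<lambda>x. c * q x) \<in> ?P" and tqP: "(\<lambda>x. t * q x) \<in> ?P" by (intro polys_cmult qP)+
      have pP: "p \<in> ?P" unfolding p_eq by (intro polys_add cq sP)
      have "a r p = a (\<lambda>x. t * q x) p + a r1 p" unfolding r_def by (rule add[OF tqP P(1) pP])
      also have "a (\<lambda>x. t * q x) p = c * L q"
      proof -
        have "a (\<lambda>x. t * q x) p = a p (\<lambda>x. t * q x)" by (rule sym)
        also have "\<dots> = c * a q (\<lambda>x. t * q x) + a s (\<lambda>x. t * q x)"
          unfolding p_eq using add[OF cq sP tqP] cmult[OF qP tqP, of c] by simp
        also have "a s (\<lambda>x. t * q x) = t * a q s" using sym[of s "\<lambda>x. t * q x"] cmult[OF qP sP, of t] by simp
        also have "a q s = 0" by (rule orth[OF s])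
        also have "a q (\<lambda>x. t * q x) = L q" using tq sym by metis
        finally show ?thesis by simp
      qed
      also have "a r1 p = L s"
      proof -
        have "a r1 p = a p r1" by (rule sym)
        also have "\<dots> = c * a q r1 + a s r1"
          unfolding p_eq using add[OF cq sP P(1)] cmult[OF qP P(1), of c] by simp
        also have "a q r1 = 0" by (rule orth[OF r1(1)])
        also have "a s r1 = L s" using r1(2)[OF s] sym by metis
        finally show ?thesis by simp
      qed
      also have "c * L q + L s = L p" unfolding p_eq using Cons.prems(2)[OF cq sP] Cons.prems(3)[OF qP, of c] by simp
      finally show ?thesis .
    qed
    then show ?case using rl by blast
  qed
  obtain bs where "set bs \<subseteq> ?P" "?P = lin_comb bs" using polys_eq_lin_comb by blast
  then show ?thesis using main[of bs L] L by simp
qed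

lemma L2_Riesz_polys:
  assumes L2: "\<And>p. p \<in> polys k \<Longrightarrow> p \<in> L2 \<mu>" and g: "g \<in> L2 \<mu>"
  shows "\<exists>r\<in>polys k. \<forall>p\<in>polys k. (\<integral>x. r x * p x \<partial>\<mu>) = (\<integral>x. g x * p x \<partial>\<mu>)"
proof (rule Riesz_polys)
  show "(\<integral>x. g x * f x \<partial>\<mu>) = 0" if "f \<in> polys k" "(\<integral>x. f x * f x \<partial>\<mu>) = 0" for f
  proof -
    have "(\<integral>x. (f x)\<^sup>2 \<partial>\<mu>) = 0" using that(2) by (simp add: power2_eq_square)
    then show ?thesis using L2_Cauchy_Schwarz[OF g L2[OF that(1)]] by simp
  qed
qed (use L2 g in \<open>auto simp: distrib_left distrib_right L2_integrable_mult mult_ac intro!: Bochner_Integration.integral_nonneg\<close>)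

text \<open>The argument of the full-dimensional case, relative to the affine hull: a convex set
  lies in the closure of its relative interior, and balls around relative interior points have
  positive mass.\<close>

lemma continuous_zero_surf:
  fixes f :: "real^'n \<Rightarrow> real"
  assumes M: "compact M" "convex M" and f: "continuous_on M f"
    and z: "(\<integral>x. (f x)\<^sup>2 \<partial>surf M) = 0" and x: "x \<in> M"
  shows "f x = 0"
proof (rule ccontr)
  assume nz: "f x \<noteq> 0"
  have "openin (top_of_set M) (M \<inter> f -` (- {0}))"
    using f by (intro continuous_openin_preimage_gen) auto
  then obtain U where U: "open U" "M \<inter> f -` (- {0}) = M \<inter> U" unfolding openin_open by blast
  have "x \<in> U" using U(2) x nz by blast
  moreover have "x \<in> closure (rel_interior M)"
    using convex_closure_rel_interior[OF M(2)] x closure_subset by blast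
  ultimately have "U \<inter> rel_interior M \<noteq> {}" using open_Int_closure_eq_empty[OF U(1), of "rel_interior M"] by auto
  then obtain y where y: "y \<in> U" "y \<in> rel_interior M" by blast
  obtain e1 where e1: "e1 > 0" "ball y e1 \<inter> affine hull M \<subseteq> M" using y(2) unfolding mem_rel_interior_ball by blast
  obtain e2 where e2: "e2 > 0" "ball y e2 \<subseteq> U" using U(1) y(1) openE by blast
  define e where "e = min e1 e2"
  have e: "e > 0" using e1 e2 by (simp add: e_def)
  have yM: "y \<in> M" using y(2) rel_interior_subset by blast
  let ?B = "tangent_basis M"
  note B = tangent_basis_onb[of M]
  have Mb: "M \<in> sets borel" using M by (simp add: borel_compact)
  have int: "integrable (surf M) (\<lambda>x. (f x)\<^sup>2)" by (intro integrable_surf_continuous M continuous_intros f)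
  have "AE x in surf M. f x = 0"
    using integral_nonneg_eq_0_iff_AE[OF int] z by simp
  then have "AE x in aff_lborel y ?B. x \<in> M \<longrightarrow> f x = 0"
    unfolding surf_eq[OF yM B] using Mb by (subst (asm) AE_restrict_space_iff) auto
  moreover have "AE x in aff_lborel y ?B. x \<in> affine hull M"
  proof (rule AE_aff_lborel)
    show "x \<in> affine hull M" if "x - y \<in> span ?B" for x
      using that B affine_hull_iff_direction_space[OF yM] unfolding onb_def by simp
    have "affine hull M \<in> sets borel" by (simp add: borel_closed)
    then show "Measurable.pred borel (\<lambda>x. x \<in> affine hull M)" unfolding pred_def by simp
  qed
  ultimately have "AE x in aff_lborel y ?B. x \<notin> ball y e"
  proof eventually_elim
    case (elim x)
    show ?case
    proof
      assume xb: "x \<in> ball y e"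
      then have "x \<in> M" using elim(2) e1(2) by (auto simp: e_def)
      moreover have "x \<in> U" using xb e2(2) by (auto simp: e_def)
      ultimately show False using elim(1) U(2) by blast
    qed
  qed
  then have "emeasure (aff_lborel y ?B) (ball y e) = 0"
    by (subst (asm) AE_iff_measurable[of "ball y e"]) auto
  then show False using emeasure_aff_lborel_ball(1)[OF B e, of y] by simp
qed

text \<open>Two polynomials that represent the projection may differ off \<open>M\<close>. The
  projection is unique since \<open>polys_on\<close> keeps only the values on \<open>M\<close>,
  where the difference vanishes by \<open>continuous_zero_surf\<close>.\<close>

lemma proj_side_spec:
  fixes g :: "real^'n \<Rightarrow> real"
  assumes M: "compact M" "convex M" and g: "g \<in> L2 (surf M)"
  shows "proj_side k M g \<in> polys_on k M"
    and "\<And>p. p \<in> polys k \<Longrightarrow> (\<integral>x. proj_side k M g x * p x \<partial>surf M) = (\<integral>x. g x * p x \<partial>surf M)"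
proof -
  have pL: "p \<in> L2 (surf M)" if "p \<in> polys k" for p k
    by (intro L2_surf_continuous M smooth_continuous smooth_polys[OF that])
  obtain r where r: "r \<in> polys k" "\<And>p. p \<in> polys k \<Longrightarrow> (\<integral>x. r x * p x \<partial>surf M) = (\<integral>x. g x * p x \<partial>surf M)"
    using L2_Riesz_polys[OF pL[where k=k] g] by blast
  let ?ext = "\<lambda>p x. if x \<in> M then p x else 0 :: real"
  have on: "(\<integral>x. h (?ext p x) x \<partial>surf M) = (\<integral>x. h (p x) x \<partial>surf M)" for p and h :: "real \<Rightarrow> real^'n \<Rightarrow> real"
    by (intro Bochner_Integration.integral_cong) auto
  have orth: "l2_inner (surf M) (\<lambda>x. g x - ?ext q x) (?ext p) = (\<integral>x. g x * p x \<partial>surf M) - (\<integral>x. q x * p x \<partial>surf M)"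
    if "p \<in> polys k" "q \<in> polys k" for p q
  proof -
    have "l2_inner (surf M) (\<lambda>x. g x - ?ext q x) (?ext p) = (\<integral>x. g x * p x - q x * p x \<partial>surf M)"
      unfolding l2_inner_def by (intro Bochner_Integration.integral_cong) (auto simp: left_diff_distrib)
    then show ?thesis using that g pL by (simp add: L2_integrable_mult)
  qed
  have "proj_side k M g = ?ext r"
    unfolding proj_side_def l2_proj_def
  proof (rule the_equality)
    show "?ext r \<in> polys_on k M \<and> (\<forall>p\<in>polys_on k M. l2_inner (surf M) (\<lambda>x. g x - ?ext r x) p = 0)"
      unfolding polys_on_def using r orth by auto
  next
    fix q assume q: "q \<in> polys_on k M \<and> (\<forall>p\<in>polys_on k M. l2_inner (surf M) (\<lambda>x. g x - q x) p = 0)"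
    then obtain q0 where q0: "q0 \<in> polys k" "q = ?ext q0" unfolding polys_on_def by blast
    let ?d = "\<lambda>x. q0 x - r x"
    have d: "?d \<in> polys k" by (intro polys_diff q0 r)
    have "?ext ?d \<in> polys_on k M" unfolding polys_on_def using d by (intro imageI)
    then have "l2_inner (surf M) (\<lambda>x. g x - ?ext q0 x) (?ext ?d) = 0" using q unfolding q0(2) by blast
    then have "(\<integral>x. q0 x * ?d x \<partial>surf M) = (\<integral>x. r x * ?d x \<partial>surf M)"
      using orth[OF d q0(1)] r(2)[OF d] by simp
    then have "(\<integral>x. (?d x)\<^sup>2 \<partial>surf M) = 0"
      using L2_integrable_mult[OF pL[OF q0(1)] pL[OF d]] L2_integrable_mult[OF pL[OF r(1)] pL[OF d]]
      by (simp add: power2_eq_square left_diff_distrib)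
    then have "?d x = 0" if "x \<in> M" for x
      by (rule continuous_zero_surf[OF M smooth_continuous[OF smooth_polys[OF d]] _ that])
    then show "q = ?ext r" unfolding q0(2) by auto
  qed
  then show "proj_side k M g \<in> polys_on k M"
    and "\<And>p. p \<in> polys k \<Longrightarrow> (\<integral>x. proj_side k M g x * p x \<partial>surf M) = (\<integral>x. g x * p x \<partial>surf M)"
    using r on[of "\<lambda>a x. a * _ x" r] unfolding polys_on_def by auto
qed

context mollifier
begin

text \<open>Vanishing almost everywhere on \<open>T\<close> becomes vanishing on the interior by
  continuity, and then vanishing everywhere. This makes the projection on the cell unique within
  \<open>polys k\<close>, without passing to restrictions.\<close>

lemma polys_zero_AE:
  assumes "p \<in> polys k" "(\<integral>x. (p x)\<^sup>2 \<partial>lebesgue_on T) = 0" shows "p = (\<lambda>x. 0)"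
proof -
  have sm: "smooth p" using assms(1) by (rule smooth_polys)
  have "AE x in lebesgue_on T. (p x)\<^sup>2 = 0"
    using integral_nonneg_eq_0_iff_AE[OF L2_integrable_sq[OF L2_smooth[OF compact_T sm]]] assms(2) by simp
  then have "AE x in lebesgue_on T. p x = 0" by eventually_elim simp
  then have "p x = 0" if "x \<in> T" for x
    by (rule continuous_zero_AE[OF compact_T convex_T interior_nonempty smooth_continuous[OF sm] _ that])
  then show ?thesis
    using polys_zero_on_open[OF assms(1) open_interior interior_nonempty] interior_subset by blast
qed

lemma proj_cell_spec:
  assumes g: "g \<in> L2 (lebesgue_on T)"
  shows "proj_cell k T g \<in> polys k"
    and "\<And>p. p \<in> polys k \<Longrightarrow> (\<integral>x. proj_cell k T g x * p x \<partial>lebesgue_on T) = (\<integral>x. g x * p x \<partial>lebesgue_on T)"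
proof -
  have pL: "p \<in> L2 (lebesgue_on T)" if "p \<in> polys k" for p k
    by (intro L2_smooth compact_T smooth_polys[OF that])
  obtain r where r: "r \<in> polys k" "\<And>p. p \<in> polys k \<Longrightarrow> (\<integral>x. r x * p x \<partial>lebesgue_on T) = (\<integral>x. g x * p x \<partial>lebesgue_on T)"
    using L2_Riesz_polys[OF pL[where k=k] g] by blast
  have orth: "l2_inner (lebesgue_on T) (\<lambda>x. g x - q x) p = (\<integral>x. g x * p x \<partial>lebesgue_on T) - (\<integral>x. q x * p x \<partial>lebesgue_on T)"
    if "p \<in> polys k" "q \<in> polys k" for p q
    unfolding l2_inner_def using that g pL by (simp add: left_diff_distrib L2_integrable_mult)
  have "proj_cell k T g = r"
    unfolding proj_cell_def l2_proj_def
  proof (rule the_equality)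
    show "r \<in> polys k \<and> (\<forall>p\<in>polys k. l2_inner (lebesgue_on T) (\<lambda>x. g x - r x) p = 0)" using r orth by auto
  next
    fix q assume q: "q \<in> polys k \<and> (\<forall>p\<in>polys k. l2_inner (lebesgue_on T) (\<lambda>x. g x - q x) p = 0)"
    let ?d = "\<lambda>x. q x - r x"
    have d: "?d \<in> polys k" using q r by (intro polys_diff) auto
    then have "(\<integral>x. q x * ?d x \<partial>lebesgue_on T) = (\<integral>x. r x * ?d x \<partial>lebesgue_on T)"
      using orth[OF d, of q] r(2)[OF d] q by simp
    then have "(\<integral>x. (?d x)\<^sup>2 \<partial>lebesgue_on T) = 0"
      using L2_integrable_mult[OF pL pL[OF d], of q k] L2_integrable_mult[OF pL[OF r(1)] pL[OF d]] q
      by (simp add: power2_eq_square left_diff_distrib)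
    then have "?d = (\<lambda>x. 0)" by (rule polys_zero_AE[OF d])
    then show "q = r" by (auto simp: fun_eq_iff)
  qed
  then show "proj_cell k T g \<in> polys k"
    and "\<And>p. p \<in> polys k \<Longrightarrow> (\<integral>x. proj_cell k T g x * p x \<partial>lebesgue_on T) = (\<integral>x. g x * p x \<partial>lebesgue_on T)"
    using r by auto
qed

end

section \<open>The reconstruction\<close>

lemma polys_dn: "p \<in> polys k \<Longrightarrow> dn T F p \<in> polys (k - 1)"
  unfolding dn_def[abs_def] using polys_dderiv[of p k "outer_normal T F"] smooth_dderiv_grad[OF smooth_polys, of p k] by simp

lemma polys_dnn: "p \<in> polys (k + 2) \<Longrightarrow> dnn T F p \<in> polys k"
proof -
  assume p: "p \<in> polys (k + 2)"
  have pp: "pderiv_at j (pderiv_at i p) \<in> polys k" for i j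
    using polys_pderiv[OF polys_pderiv[OF p]] by simp
  have "dnn T F p = (\<lambda>x. \<Sum>i\<in>UNIV. \<Sum>j\<in>UNIV. (outer_normal T F $ i * outer_normal T F $ j) * pderiv_at j (pderiv_at i p) x)"
    by (simp add: dnn_def[abs_def] inner_vec_def matrix_vector_mult_def hess_def sum_distrib_left mult_ac)
  then show ?thesis by (simp only:) (intro polys_sum polys_cmult pp)
qed

lemma polys_tlaplacian: "q \<in> polys k \<Longrightarrow> tlaplacian F q \<in> polys (k - 2)"
  unfolding tlaplacian_def[abs_def] using polys_dderiv[OF polys_dderiv, of q k]
  by (intro polys_sum) (simp add: numeral_2_eq_2)

lemma polys_dtn:
  assumes "p \<in> polys (k + 2)" shows "(\<lambda>x. dtn T F p x \<bullet> e) \<in> polys k"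
proof -
  have "dderiv b (dn T F p) \<in> polys k" for b using polys_dderiv[OF polys_dn[OF assms]] by simp
  moreover have "(\<lambda>x. dtn T F p x \<bullet> e) = (\<lambda>x. \<Sum>b\<in>tangent_basis F. (b \<bullet> e) * dderiv b (dn T F p) x)"
    by (simp add: dtn_def tgrad_def inner_sum_left mult.commute)
  ultimately show ?thesis by (simp only:) (intro polys_sum polys_cmult)
qed

lemma smooth_constI:
  fixes f :: "real^'n \<Rightarrow> real"
  assumes f: "smooth f" and z: "\<And>i x. pderiv_at i f x = 0"
  shows "f x = f y"
proof -
  have "grad f x = 0" for x by (simp add: grad_def z vec_eq_iff)
  then have "\<forall>t. ((\<lambda>s. f (x + s *\<^sub>R (y - x))) has_real_derivative 0) (at t)"
    using has_real_derivative_along[OF smooth_differentiable[OF f], where x=x and e="y - x"] by simp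
  from DERIV_isconst_all[OF this, of 0 1] show ?thesis by simp
qed

context cell
begin

text \<open>\<open>weak_pderiv\<close> is determined only almost everywhere, so the chosen
  derivatives of the difference need not be literal differences. Weak derivatives ignore changes of
  the function on null sets, which carries the first identity through the second derivative.\<close>

lemma weak_hess_diff:
  assumes v: "v \<in> H2 T" and q: "smooth q"
  shows "weak_pderiv T j (weak_pderiv T i (\<lambda>x. v x - q x)) \<in> L2 (lebesgue_on T)"
    and "AE x in lebesgue_on T. weak_pderiv T j (weak_pderiv T i (\<lambda>x. v x - q x)) x
       = weak_pderiv T j (weak_pderiv T i v) x - pderiv_at j (pderiv_at i q) x"
proof -
  note v1 = H1D[OF H2D(1)[OF v]] and v2 = H1D[OF H2D(2)[OF v]]
  note S = L2_smooth[OF compact_T]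
  have diff: "is_weak_pderiv T k (\<lambda>x. f x - g x) (\<lambda>x. f' x - pderiv_at k g x)"
    if "f \<in> L2 (lebesgue_on T)" "f' \<in> L2 (lebesgue_on T)" "is_weak_pderiv T k f f'" "smooth g" for f f' g k
    using is_weak_pderiv_add[OF that(1) L2_cmult[OF S[OF that(4)], where c="-1"] that(2) L2_cmult[OF S[OF smooth_pderiv[OF that(4)]], where c="-1"]
      that(3) is_weak_pderiv_cmult[OF is_weak_pderiv_smooth[OF that(4)], where c="-1"]] by simp
  let ?u = "\<lambda>x. v x - q x"
  let ?w = "\<lambda>x. weak_pderiv T i v x - pderiv_at i q x"
  let ?z = "\<lambda>x. weak_pderiv T j (weak_pderiv T i v) x - pderiv_at j (pderiv_at i q) x"
  have wL: "?w \<in> L2 (lebesgue_on T)" by (intro L2_diff v1 S smooth_pderiv q)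
  have zL: "?z \<in> L2 (lebesgue_on T)" by (intro L2_diff v2 S smooth_pderiv q)
  note W = weak_pderiv_some[OF wL diff[OF v1 q]]
  have ae: "AE x in lebesgue_on T. ?w x = weak_pderiv T i ?u x" using W(3) by eventually_elim simp
  have "is_weak_pderiv T j (weak_pderiv T i ?u) ?z"
    by (rule is_weak_pderiv_cong[OF wL W(1) ae diff[OF v2 smooth_pderiv[OF q]]])
  from weak_pderiv_some[OF zL this]
  show "weak_pderiv T j (weak_pderiv T i ?u) \<in> L2 (lebesgue_on T)"
    "AE x in lebesgue_on T. weak_pderiv T j (weak_pderiv T i ?u) x = ?z x" by blast+
qed

text \<open>The squared distance of the Hessians, written with the second weak derivatives of
  \<open>v\<close> itself so that the squares can be expanded termwise.\<close>

definition misfit :: "(real^'n \<Rightarrow> real) \<Rightarrow> (real^'n \<Rightarrow> real) \<Rightarrow> real" where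
  "misfit v q = (\<Sum>i\<in>UNIV. \<Sum>j\<in>UNIV. \<integral>x. (weak_pderiv T j (weak_pderiv T i v) x - pderiv_at j (pderiv_at i q) x)\<^sup>2 \<partial>lebesgue_on T)"

lemma weak_hess_diff_inner:
  assumes v: "v \<in> H2 T" and q: "smooth q" and p: "smooth p"
  shows "l2_inner (lebesgue_on T) (weak_hess T (\<lambda>x. v x - q x)) (hess p) =
     (\<Sum>i\<in>UNIV. \<Sum>j\<in>UNIV. \<integral>x. (weak_pderiv T j (weak_pderiv T i v) x - pderiv_at j (pderiv_at i q) x) * pderiv_at j (pderiv_at i p) x \<partial>lebesgue_on T)"
proof -
  note D = weak_hess_diff[OF v q] and v2 = H1D[OF H2D(2)[OF v]]
  note S = L2_smooth[OF compact_T]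
  have "l2_inner (lebesgue_on T) (weak_hess T (\<lambda>x. v x - q x)) (hess p) =
     (\<Sum>i\<in>UNIV. \<Sum>j\<in>UNIV. \<integral>x. weak_pderiv T j (weak_pderiv T i (\<lambda>x. v x - q x)) x * pderiv_at j (pderiv_at i p) x \<partial>lebesgue_on T)"
    unfolding l2_inner_def hess_inner weak_hess_def hess_def
    by (simp add: L2_integrable_mult D(1) S smooth_pderiv p)
  also have "\<dots> = (\<Sum>i\<in>UNIV. \<Sum>j\<in>UNIV. \<integral>x. (weak_pderiv T j (weak_pderiv T i v) x - pderiv_at j (pderiv_at i q) x) * pderiv_at j (pderiv_at i p) x \<partial>lebesgue_on T)"
  proof (intro sum.cong refl integral_cong_AE)
    fix i j
    show "AE x in lebesgue_on T. weak_pderiv T j (weak_pderiv T i (\<lambda>x. v x - q x)) x * pderiv_at j (pderiv_at i p) x =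
       (weak_pderiv T j (weak_pderiv T i v) x - pderiv_at j (pderiv_at i q) x) * pderiv_at j (pderiv_at i p) x"
      using D(2)[of j i] by eventually_elim simp
  qed (intro borel_measurable_times borel_measurable_diff L2_measurable D(1) v2 S smooth_pderiv q p)+
  finally show ?thesis .
qed

lemma weak_hess_diff_norm:
  assumes v: "v \<in> H2 T" and q: "smooth q"
  shows "l2_norm (lebesgue_on T) (weak_hess T (\<lambda>x. v x - q x)) = sqrt (misfit v q)"
proof -
  note D = weak_hess_diff[OF v q] and v2 = H1D[OF H2D(2)[OF v]]
  note S = L2_smooth[OF compact_T]
  have "l2_inner (lebesgue_on T) (weak_hess T (\<lambda>x. v x - q x)) (weak_hess T (\<lambda>x. v x - q x)) =
     (\<Sum>i\<in>UNIV. \<Sum>j\<in>UNIV. \<integral>x. weak_pderiv T j (weak_pderiv T i (\<lambda>x. v x - q x)) x * weak_pderiv T j (weak_pderiv T i (\<lambda>x. v x - q x)) x \<partial>lebesgue_on T)"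
    unfolding l2_inner_def hess_inner weak_hess_def
    by (simp add: L2_integrable_mult D(1))
  also have "\<dots> = misfit v q"
    unfolding misfit_def
  proof (intro sum.cong refl integral_cong_AE)
    fix i j
    show "AE x in lebesgue_on T. weak_pderiv T j (weak_pderiv T i (\<lambda>x. v x - q x)) x * weak_pderiv T j (weak_pderiv T i (\<lambda>x. v x - q x)) x =
       (weak_pderiv T j (weak_pderiv T i v) x - pderiv_at j (pderiv_at i q) x)\<^sup>2"
      using D(2)[of j i] by eventually_elim (simp add: power2_eq_square)
  qed (intro borel_measurable_times borel_measurable_power borel_measurable_diff L2_measurable D(1) v2 S smooth_pderiv q)+
  finally show ?thesis unfolding l2_norm_def by simp
qed

section \<open>The Hessian form and unique solvability of the reconstruction\<close>

definition hess_form :: "(real^'n \<Rightarrow> real) \<Rightarrow> (real^'n \<Rightarrow> real) \<Rightarrow> real" where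
  "hess_form f g = (\<Sum>i\<in>UNIV. \<Sum>j\<in>UNIV. \<integral>x. pderiv_at j (pderiv_at i f) x * pderiv_at j (pderiv_at i g) x \<partial>lebesgue_on T)"

lemma hess_form_eq:
  assumes "smooth f" "smooth g" shows "l2_inner (lebesgue_on T) (hess f) (hess g) = hess_form f g"
  unfolding l2_inner_def hess_inner hess_def hess_form_def
  by (simp add: L2_integrable_mult L2_smooth compact_T smooth_pderiv assms)

lemma hess_form_add:
  assumes "smooth f" "smooth g" "smooth h" shows "hess_form (\<lambda>x. f x + g x) h = hess_form f h + hess_form g h"
  unfolding hess_form_def
  by (simp add: pderiv2_add distrib_right L2_integrable_mult L2_smooth compact_T smooth_pderiv assms sum.distrib)

lemma hess_form_cmult:
  assumes "smooth f" shows "hess_form (\<lambda>x. c * f x) h = c * hess_form f h"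
  unfolding hess_form_def by (simp add: pderiv2_cmult assms mult.assoc sum_distrib_left)

text \<open>A vanishing sum of integrals of squares makes every second derivative vanish almost
  everywhere on \<open>T\<close>, and these are polynomials, hence zero everywhere.\<close>

lemma hess_form_null:
  assumes p: "p \<in> polys k" and z: "hess_form p p = 0"
  shows "pderiv_at j (pderiv_at i p) = (\<lambda>x. 0)"
proof -
  have nn: "(\<integral>x. pderiv_at j (pderiv_at i p) x * pderiv_at j (pderiv_at i p) x \<partial>lebesgue_on T) \<ge> 0" for i j
    by (intro Bochner_Integration.integral_nonneg) auto
  have "(\<integral>x. pderiv_at j (pderiv_at i p) x * pderiv_at j (pderiv_at i p) x \<partial>lebesgue_on T) = 0"
    using z nn unfolding hess_form_def
    by (simp add: sum_nonneg_eq_0_iff sum_nonneg)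
  then show ?thesis
    by (intro polys_zero_AE[OF polys_pderiv[OF polys_pderiv[OF p]]]) (simp add: power2_eq_square)
qed

lemma integrable_T: "smooth f \<Longrightarrow> integrable (lebesgue_on T) f"
  by (intro L2_integrable finite_measure_lebesgue_on lmeasurable_compact compact_T L2_smooth)

lemma integral_const_T: "(\<integral>x. c \<partial>lebesgue_on T) = measure lborel T * (c :: real)"
proof -
  have "(\<integral>x. c \<partial>lebesgue_on T) = (\<integral>x. indicator T x *\<^sub>R c \<partial>lborel)"
    by (rule integral_lebesgue_on_lborel[OF T_borel]) simp
  then show ?thesis using T_borel measure_T(1) by simp
qed

lemma integral_grad_nth:
  assumes "smooth r" shows "(\<integral>x. grad r x \<partial>lebesgue_on T) $ i = (\<integral>x. pderiv_at i r x \<partial>lebesgue_on T)"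
proof -
  have gi: "integrable (lebesgue_on T) (grad r)"
  proof -
    have "integrable lborel (\<lambda>x. indicator T x *\<^sub>R grad r x)"
      by (intro borel_integrable_compact compact_T continuous_on_grad assms)
    then show ?thesis
      by (subst integrable_lebesgue_on_lborel[OF T_borel]) (auto intro!: borel_measurable_continuous_onI continuous_on_grad assms)
  qed
  have "(\<integral>x. grad r x \<partial>lebesgue_on T) \<bullet> axis i 1 = (\<integral>x. grad r x \<bullet> axis i 1 \<partial>lebesgue_on T)"
    by (rule integral_inner_left[symmetric]) (use gi in simp)
  then show ?thesis by (simp add: inner_axis grad_def)
qed

text \<open>The Hessian form determines \<open>r\<close> up to an affine function, and the two mean value conditions
  fix the latter.\<close>
lemma reconstruction_exists_unique:
  assumes L: "\<And>f g. f \<in> polys k \<Longrightarrow> g \<in> polys k \<Longrightarrow> L (\<lambda>x. f x + g x) = L f + L g"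
      "\<And>c f. f \<in> polys k \<Longrightarrow> L (\<lambda>x. c * f x) = c * L f"
      "\<And>f. f \<in> polys k \<Longrightarrow> hess_form f f = 0 \<Longrightarrow> L f = 0" and k: "k \<ge> 1"
  shows "\<exists>!r. r \<in> polys k \<and> (\<forall>p\<in>polys k. l2_inner (lebesgue_on T) (hess r) (hess p) = L p) \<and>
     (\<integral>x. grad r x \<partial>lebesgue_on T) = G \<and> (\<integral>x. r x \<partial>lebesgue_on T) = (c :: real)"
proof -
  let ?m = "measure lborel T"
  have m: "?m > 0" by (rule measure_T)
  have "\<exists>r\<in>polys k. \<forall>p\<in>polys k. hess_form r p = L p"
  proof (rule Riesz_polys)
    show "hess_form f g = hess_form g f" for f g unfolding hess_form_def by (simp add: mult.commute)
    show "hess_form f f \<ge> 0" for f unfolding hess_form_def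
      by (intro sum_nonneg Bochner_Integration.integral_nonneg) auto
  qed (use L in \<open>auto intro: hess_form_add hess_form_cmult smooth_polys\<close>)
  then obtain r0 where r0: "r0 \<in> polys k" "\<And>p. p \<in> polys k \<Longrightarrow> hess_form r0 p = L p" by blast
  have s0: "smooth r0" using r0 smooth_polys by blast
  \<comment> \<open>The affine correction: adding \<open>x \<bullet> d\<close> changes the integral
    of the gradient by \<open>?m *\<^sub>R d\<close>, and adding \<open>e\<close> changes the
    integral of the function by \<open>?m * e\<close>. Second derivatives are not affected.\<close>
  define d where "d = (1 / ?m) *\<^sub>R (G - (\<integral>x. grad r0 x \<partial>lebesgue_on T))"
  define e where "e = (1 / ?m) * (c - (\<integral>x. r0 x + x \<bullet> d \<partial>lebesgue_on T))"
  define r where "r = (\<lambda>x. (r0 x + x \<bullet> d) + e)"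
  have "(\<lambda>x. x \<bullet> d) \<in> polys k" using polys_mono[OF polys_inner[of d 0], of k] k by simp
  then have rP: "r \<in> polys k" unfolding r_def by (intro polys_add r0 polys_const)
  have pr: "pderiv_at i r = (\<lambda>x. pderiv_at i r0 x + d $ i)" for i
  proof
    fix x
    have "pderiv_at i r x = pderiv_at i (\<lambda>x. r0 x + x \<bullet> d) x + pderiv_at i (\<lambda>x. e) x"
      unfolding r_def by (intro pderiv_add smooth_differentiable smooth_add s0 smooth_inner smooth_const)
    also have "pderiv_at i (\<lambda>x. r0 x + x \<bullet> d) x = pderiv_at i r0 x + pderiv_at i (\<lambda>x. x \<bullet> d) x"
      by (intro pderiv_add smooth_differentiable s0 smooth_inner)
    finally show "pderiv_at i r x = pderiv_at i r0 x + d $ i" by (simp add: pderiv_inner)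
  qed
  have "pderiv_at j (pderiv_at i r) = pderiv_at j (pderiv_at i r0)" for i j
  proof
    fix x
    have "pderiv_at j (\<lambda>x. pderiv_at i r0 x + d $ i) x = pderiv_at j (pderiv_at i r0) x + pderiv_at j (\<lambda>x. d $ i) x"
      by (intro pderiv_add smooth_differentiable smooth_pderiv s0 smooth_const)
    then show "pderiv_at j (pderiv_at i r) x = pderiv_at j (pderiv_at i r0) x" unfolding pr by simp
  qed
  then have hr: "hess_form r p = hess_form r0 p" for p unfolding hess_form_def by simp
  have gr: "(\<integral>x. grad r x \<partial>lebesgue_on T) = G"
    unfolding vec_eq_iff
  proof
    fix i
    have "(\<integral>x. grad r x \<partial>lebesgue_on T) $ i = (\<integral>x. pderiv_at i r0 x \<partial>lebesgue_on T) + ?m * (d $ i)"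
      unfolding integral_grad_nth[OF smooth_polys[OF rP]] pr
      by (subst Bochner_Integration.integral_add[OF integrable_T[OF smooth_pderiv[OF s0]] integrable_T[OF smooth_const]])
        (simp only: integral_const_T)
    also have "?m * (d $ i) = G $ i - (\<integral>x. pderiv_at i r0 x \<partial>lebesgue_on T)"
      using m by (simp add: d_def integral_grad_nth[OF s0])
    finally show "(\<integral>x. grad r x \<partial>lebesgue_on T) $ i = G $ i" by simp
  qed
  have ir: "(\<integral>x. r x \<partial>lebesgue_on T) = c"
  proof -
    have "(\<integral>x. r x \<partial>lebesgue_on T) = (\<integral>x. r0 x + x \<bullet> d \<partial>lebesgue_on T) + ?m * e"
      unfolding r_def
      by (subst Bochner_Integration.integral_add[OF integrable_T[OF smooth_add[OF s0 smooth_inner]] integrable_T[OF smooth_const]])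
        (simp only: integral_const_T)
    then show ?thesis using m by (simp add: e_def)
  qed
  show ?thesis
  proof (rule ex1I[of _ r])
    show "r \<in> polys k \<and> (\<forall>p\<in>polys k. l2_inner (lebesgue_on T) (hess r) (hess p) = L p) \<and>
     (\<integral>x. grad r x \<partial>lebesgue_on T) = G \<and> (\<integral>x. r x \<partial>lebesgue_on T) = c"
      using rP gr ir r0(2) hr by (auto simp: hess_form_eq smooth_polys)
  next
    fix q assume q: "q \<in> polys k \<and> (\<forall>p\<in>polys k. l2_inner (lebesgue_on T) (hess q) (hess p) = L p) \<and>
     (\<integral>x. grad q x \<partial>lebesgue_on T) = G \<and> (\<integral>x. q x \<partial>lebesgue_on T) = c"
    have sq: "smooth q" and sr: "smooth r" using q rP smooth_polys by blast+
    let ?d = "\<lambda>x. q x + (-1) * r x"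
    have dP: "?d \<in> polys k" using q rP by (intro polys_add polys_cmult) auto
    have sd: "smooth ?d" using dP smooth_polys by blast
    have pd: "pderiv_at i ?d = (\<lambda>x. pderiv_at i q x - pderiv_at i r x)" for i
      using pderiv_diff[OF sq sr, of i] by simp
    have "hess_form ?d ?d = hess_form q ?d + (-1) * hess_form r ?d"
      using hess_form_add[OF sq smooth_cmult[OF sr] sd, of "-1"] hess_form_cmult[OF sr, of "-1"] by simp
    also have "\<dots> = 0" using q r0(2)[OF dP] hr dP hess_form_eq[OF sq sd] by auto
    finally have z: "hess_form ?d ?d = 0" .
    \<comment> \<open>With vanishing second derivatives the gradient of the difference is constant,
      and its mean is zero; then the difference itself is constant with mean zero.\<close>
    have cst: "pderiv_at i ?d x = pderiv_at i ?d y" for i x y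
      by (rule smooth_constI[OF smooth_pderiv[OF sd]]) (simp only: hess_form_null[OF dP z])
    have "pderiv_at i ?d x = 0" for i x
    proof -
      have "(\<integral>y. pderiv_at i ?d y \<partial>lebesgue_on T) = (\<integral>y. pderiv_at i q y \<partial>lebesgue_on T) - (\<integral>y. pderiv_at i r y \<partial>lebesgue_on T)"
        unfolding pd by (intro Bochner_Integration.integral_diff integrable_T smooth_pderiv sq sr)
      also have "\<dots> = 0" using q gr integral_grad_nth[OF sq, of i] integral_grad_nth[OF sr, of i] by simp
      finally have "(\<integral>y. pderiv_at i ?d y \<partial>lebesgue_on T) = 0" .
      moreover have "(\<integral>y. pderiv_at i ?d y \<partial>lebesgue_on T) = ?m * pderiv_at i ?d x"
        unfolding integral_const_T[symmetric] by (intro Bochner_Integration.integral_cong refl cst)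
      ultimately show ?thesis using m by simp
    qed
    then have cd: "?d x = ?d y" for x y by (rule smooth_constI[OF sd])
    have "?d x = 0" for x
    proof -
      have "(\<integral>y. ?d y \<partial>lebesgue_on T) = (\<integral>y. q y \<partial>lebesgue_on T) - (\<integral>y. r y \<partial>lebesgue_on T)"
        using integrable_T[OF sq] integrable_T[OF sr] by simp
      also have "\<dots> = 0" using q ir by simp
      finally have "(\<integral>y. ?d y \<partial>lebesgue_on T) = 0" .
      moreover have "(\<integral>y. ?d y \<partial>lebesgue_on T) = ?m * ?d x"
        unfolding integral_const_T[symmetric] by (intro Bochner_Integration.integral_cong refl cd)
      ultimately show ?thesis using m by simp
    qed
    then show "q = r" by (auto simp: fun_eq_iff)
  qed
qed

lemma face_convex: "F \<in> faces T \<Longrightarrow> convex F"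
  unfolding faces_T by (auto simp: convex_convex_hull)

text \<open>\<open>reconstruction\<close> is a restricted function with its meaning on
  \<open>local_space\<close> only, so membership of the interpolant is required before the
  description can be unfolded.\<close>

lemma interpolation_in_local_space:
  assumes n: "CARD('n) \<in> {2, 3}" and v: "v \<in> H2 T"
  shows "interpolation k l T v \<in> local_space k l T"
proof -
  have "proj_side (k - 1) F (face_trace T F v) \<in> polys_on (k - 1) F" "proj_side k F (normal_trace T F v) \<in> polys_on k F"
    if "F \<in> faces T" for F
    by (rule proj_side_spec(1)[OF face_compact[OF that] face_convex[OF that] face_trace_limit(1)[OF that v]],
        rule proj_side_spec(1)[OF face_compact[OF that] face_convex[OF that] normal_trace_limit(1)[OF that v]])
  moreover have "proj_side k E (cont_rep T v) \<in> polys_on k E" if "E \<in> edges T" for E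
  proof -
    have "cont_rep T v \<in> L2 (surf E)" using n that by (intro cont_rep_limit_surf(1) v edge_compact edge_subset) auto
    from proj_side_spec(1)[OF edge_compact[OF that] edge_convex[OF that] this] show ?thesis .
  qed
  ultimately show ?thesis
    unfolding interpolation_def local_space_def using proj_cell_spec(1)[OF H1D(1)[OF H2D(1)[OF v]]] by simp
qed

text \<open>Degree count for \<open>p\<close> of degree \<open>k + 2\<close>, with truncated
  subtraction throughout: the bilaplacian has degree \<open>k - 2 \<le> l\<close>, the two factors
  of the face trace have degree \<open>k - 1\<close>, and \<open>dnn\<close> and \<open>dtn\<close>
  have degree \<open>k\<close>. So each projection may be replaced by the function that is
  projected, and Green's formula applies.\<close>

lemma interpolation_rhs:
  assumes n: "CARD('n) \<in> {2, 3}" and v: "v \<in> H2 T" and l: "l \<ge> k - 2" and p: "p \<in> polys (k + 2)"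
  shows "l2_inner (lebesgue_on T) (proj_cell l T v) (laplacian (laplacian p))
          - (\<Sum>F\<in>faces T. l2_inner (surf F) ((\<lambda>F\<in>faces T. proj_side (k - 1) F (face_trace T F v)) F) (dn T F (laplacian p)))
          + (\<Sum>F\<in>faces T. l2_inner (surf F) ((\<lambda>F\<in>faces T. proj_side k F (normal_trace T F v)) F) (dnn T F p))
          - (\<Sum>F\<in>faces T. l2_inner (surf F) ((\<lambda>F\<in>faces T. proj_side (k - 1) F (face_trace T F v)) F) (tlaplacian F (dn T F p)))
          + (\<Sum>F\<in>faces T. \<Sum>E\<in>face_edges T F.
               l2_inner (surf E) ((\<lambda>E\<in>edges T. proj_side k E (cont_rep T v)) E) (\<lambda>x. dtn T F p x \<bullet> outer_normal F E))
     = (\<integral>x. weak_hess T v x \<bullet> hess p x \<partial>lebesgue_on T)"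
proof -
  have lap: "laplacian p \<in> polys k" using polys_laplacian[OF p] by simp
  have 1: "l2_inner (lebesgue_on T) (proj_cell l T v) (laplacian (laplacian p)) = (\<integral>x. v x * laplacian (laplacian p) x \<partial>lebesgue_on T)"
    using proj_cell_spec(2)[OF H1D(1)[OF H2D(1)[OF v]] polys_mono[OF polys_laplacian[OF lap] l]] by (simp add: l2_inner_def)
  have F: "l2_inner (surf F) ((\<lambda>F\<in>faces T. proj_side (k - 1) F (face_trace T F v)) F) q = (\<integral>x. face_trace T F v x * q x \<partial>surf F)"
    if "F \<in> faces T" "q \<in> polys (k - 1)" for F q
    using proj_side_spec(2)[OF face_compact[OF that(1)] face_convex[OF that(1)] face_trace_limit(1)[OF that(1) v] that(2)] that(1)
    by (simp add: l2_inner_def)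
  have N: "l2_inner (surf F) ((\<lambda>F\<in>faces T. proj_side k F (normal_trace T F v)) F) (dnn T F p) = (\<integral>x. normal_trace T F v x * dnn T F p x \<partial>surf F)"
    if "F \<in> faces T" for F
    using proj_side_spec(2)[OF face_compact[OF that(1)] face_convex[OF that(1)] normal_trace_limit(1)[OF that(1) v] polys_dnn[OF p]] that(1)
    by (simp add: l2_inner_def)
  have E: "l2_inner (surf E) ((\<lambda>E\<in>edges T. proj_side k E (cont_rep T v)) E) (\<lambda>x. dtn T F p x \<bullet> outer_normal F E) =
      (\<integral>x. cont_rep T v x * (dtn T F p x \<bullet> outer_normal F E) \<partial>surf E)" if "E \<in> face_edges T F" for E F
  proof -
    have E: "E \<in> edges T" using that by (rule face_subset_edge)
    have cL: "cont_rep T v \<in> L2 (surf E)" using n by (intro cont_rep_limit_surf(1) v edge_compact edge_subset E) auto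
    show ?thesis
      using proj_side_spec(2)[OF edge_compact[OF E] edge_convex[OF E] cL polys_dtn[OF p]] E by (simp add: l2_inner_def)
  qed
  have t: "tlaplacian F (dn T F p) \<in> polys (k - 1)" for F
    using polys_tlaplacian[OF polys_dn[OF p]] by (simp add: numeral_2_eq_2)
  show ?thesis
    unfolding green_formula_H2[OF n v p] 1
    by (simp only: F[OF _ polys_dn[OF lap]] F[OF _ t] N E cong: sum.cong)
qed

text \<open>With the right-hand side rewritten as the product of \<open>weak_hess T v\<close> and
  \<open>hess p\<close>, its solvability condition is evident: it vanishes whenever the Hessian of
  \<open>p\<close> does. Existence and uniqueness then evaluate the description in
  \<open>reconstruction\<close>.\<close>

lemma reconstruction_interpolation:
  assumes n: "CARD('n) \<in> {2, 3}" and v: "v \<in> H2 T" and l: "l \<ge> k - 2"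
  defines "r \<equiv> reconstruction k l T (interpolation k l T v)"
  shows "r \<in> polys (k + 2)"
    and "\<And>p. p \<in> polys (k + 2) \<Longrightarrow> hess_form r p = (\<integral>x. weak_hess T v x \<bullet> hess p x \<partial>lebesgue_on T)"
proof -
  note v2 = H1D[OF H2D(2)[OF v]]
  note S = L2_smooth[OF compact_T]
  let ?L = "\<lambda>p. \<integral>x. weak_hess T v x \<bullet> hess p x \<partial>lebesgue_on T"
  have L_eq: "?L p = (\<Sum>i\<in>UNIV. \<Sum>j\<in>UNIV. \<integral>x. weak_pderiv T j (weak_pderiv T i v) x * pderiv_at j (pderiv_at i p) x \<partial>lebesgue_on T)"
    if "smooth p" for p
    unfolding hess_inner weak_hess_def hess_def
    by (simp add: L2_integrable_mult v2 S smooth_pderiv that)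
  have recon: "is_reconstruction k T (interpolation k l T v) q \<longleftrightarrow>
     q \<in> polys (k + 2) \<and> (\<forall>p\<in>polys (k + 2). l2_inner (lebesgue_on T) (hess q) (hess p) = ?L p) \<and>
     (\<integral>x. grad q x \<partial>lebesgue_on T) = (\<Sum>F\<in>faces T. \<integral>x. (\<lambda>F\<in>faces T. proj_side (k - 1) F (face_trace T F v)) F x *\<^sub>R outer_normal T F \<partial>surf F) \<and>
     (\<integral>x. q x \<partial>lebesgue_on T) = (\<integral>x. proj_cell l T v x \<partial>lebesgue_on T)" for q
    unfolding is_reconstruction_def interpolation_def prod.case
    using interpolation_rhs[OF n v l] by (simp only: cong: ball_cong)
  have ex1: "\<exists>!q. is_reconstruction k T (interpolation k l T v) q"
    unfolding recon
  proof (rule reconstruction_exists_unique)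
    show "?L (\<lambda>x. f x + g x) = ?L f + ?L g" if "f \<in> polys (k + 2)" "g \<in> polys (k + 2)" for f g
    proof -
      have sm: "smooth f" "smooth g" using that smooth_polys by blast+
      then show ?thesis
        by (simp add: L_eq smooth_add pderiv2_add distrib_left L2_integrable_mult v2 S smooth_pderiv sum.distrib)
    qed
    show "?L (\<lambda>x. c * f x) = c * ?L f" if "f \<in> polys (k + 2)" for c f
      using smooth_polys[OF that] by (simp add: L_eq smooth_cmult pderiv2_cmult sum_distrib_left mult.left_commute)
    show "?L f = 0" if "f \<in> polys (k + 2)" "hess_form f f = 0" for f
      using smooth_polys[OF that(1)] by (simp add: L_eq hess_form_null[OF that])
  qed simp
  have "r = (THE q. is_reconstruction k T (interpolation k l T v) q)"
    unfolding r_def reconstruction_def using interpolation_in_local_space[OF n v] by simp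
  then have "is_reconstruction k T (interpolation k l T v) r" using theI'[OF ex1] by simp
  then have *: "r \<in> polys (k + 2)" "\<And>p. p \<in> polys (k + 2) \<Longrightarrow> l2_inner (lebesgue_on T) (hess r) (hess p) = ?L p"
    unfolding recon by blast+
  then show "r \<in> polys (k + 2)" by blast
  show "hess_form r p = ?L p" if "p \<in> polys (k + 2)" for p
    using *(2)[OF that] hess_form_eq[OF smooth_polys[OF *(1)] smooth_polys[OF that]] by simp
qed

text \<open>Pythagoras: \<open>v - p\<close> is \<open>v - r\<close> plus \<open>r - p\<close>, and
  the latter is an admissible polynomial, so the mixed term vanishes by orthogonality.\<close>

lemma reconstruction_best_approximation:
  assumes n: "CARD('n) \<in> {2, 3}" and v: "v \<in> H2 T" and l: "l \<ge> k - 2"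
  defines "r \<equiv> reconstruction k l T (interpolation k l T v)"
  shows "r \<in> polys (k + 2)"
    and "\<And>p. p \<in> polys (k + 2) \<Longrightarrow> l2_inner (lebesgue_on T) (weak_hess T (\<lambda>x. v x - r x)) (hess p) = 0"
    and "\<And>p. p \<in> polys (k + 2) \<Longrightarrow>
       l2_norm (lebesgue_on T) (weak_hess T (\<lambda>x. v x - r x)) \<le> l2_norm (lebesgue_on T) (weak_hess T (\<lambda>x. v x - p x))"
proof -
  note R = reconstruction_interpolation[OF n v l, folded r_def]
  note v2 = H1D[OF H2D(2)[OF v]]
  note S = L2_smooth[OF compact_T]
  show rP: "r \<in> polys (k + 2)" by (rule R(1))
  have sr: "smooth r" using rP by (rule smooth_polys)
  show orth: "l2_inner (lebesgue_on T) (weak_hess T (\<lambda>x. v x - r x)) (hess p) = 0" if p: "p \<in> polys (k + 2)" for p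
  proof -
    have sp: "smooth p" using p by (rule smooth_polys)
    have "l2_inner (lebesgue_on T) (weak_hess T (\<lambda>x. v x - r x)) (hess p) =
       (\<Sum>i\<in>UNIV. \<Sum>j\<in>UNIV. \<integral>x. weak_pderiv T j (weak_pderiv T i v) x * pderiv_at j (pderiv_at i p) x \<partial>lebesgue_on T) - hess_form r p"
      unfolding weak_hess_diff_inner[OF v sr sp] hess_form_def
      by (simp add: left_diff_distrib L2_integrable_mult v2 S smooth_pderiv sr sp sum_subtractf)
    also have "(\<Sum>i\<in>UNIV. \<Sum>j\<in>UNIV. \<integral>x. weak_pderiv T j (weak_pderiv T i v) x * pderiv_at j (pderiv_at i p) x \<partial>lebesgue_on T) =
       (\<integral>x. weak_hess T v x \<bullet> hess p x \<partial>lebesgue_on T)"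
      unfolding hess_inner weak_hess_def hess_def
      by (simp add: L2_integrable_mult v2 S smooth_pderiv sp)
    finally show ?thesis using R(2)[OF p] by simp
  qed
  show "l2_norm (lebesgue_on T) (weak_hess T (\<lambda>x. v x - r x)) \<le> l2_norm (lebesgue_on T) (weak_hess T (\<lambda>x. v x - p x))"
    if p: "p \<in> polys (k + 2)" for p
  proof -
    have sp: "smooth p" using p by (rule smooth_polys)
    let ?d = "\<lambda>x. r x - p x"
    have dP: "?d \<in> polys (k + 2)" by (intro polys_diff rP p)
    let ?z = "\<lambda>i j. weak_pderiv T j (weak_pderiv T i v)" and ?r = "\<lambda>i j. pderiv_at j (pderiv_at i r)" and ?p = "\<lambda>i j. pderiv_at j (pderiv_at i p)"
    have d2: "pderiv_at j (pderiv_at i ?d) = (\<lambda>x. ?r i j x - ?p i j x)" for i j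
      by (simp add: pderiv_diff sr sp smooth_pderiv)
    \<comment> \<open>Adding the vanishing mixed term makes the comparison pointwise: the integrands
      then differ by the squares of the Hessian entries of \<open>r - p\<close>.\<close>
    have "misfit v r = misfit v r + 2 * (\<Sum>i\<in>UNIV. \<Sum>j\<in>UNIV. \<integral>x. (?z i j x - ?r i j x) * (?r i j x - ?p i j x) \<partial>lebesgue_on T)"
      using orth[OF dP] unfolding weak_hess_diff_inner[OF v sr smooth_polys[OF dP]] d2 by simp
    also have "\<dots> = (\<Sum>i\<in>UNIV. \<Sum>j\<in>UNIV. (\<integral>x. (?z i j x - ?r i j x)\<^sup>2 + 2 * ((?z i j x - ?r i j x) * (?r i j x - ?p i j x)) \<partial>lebesgue_on T))"
      unfolding misfit_def
      by (simp add: L2_integrable_mult L2_integrable_sq L2_diff v2 S smooth_pderiv sr sp sum.distrib sum_distrib_left)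
    also have "\<dots> \<le> misfit v p"
      unfolding misfit_def
    proof (intro sum_mono integral_mono)
      fix i j x
      have "0 \<le> (?r i j x - ?p i j x)\<^sup>2" by simp
      then show "(?z i j x - ?r i j x)\<^sup>2 + 2 * ((?z i j x - ?r i j x) * (?r i j x - ?p i j x)) \<le> (?z i j x - ?p i j x)\<^sup>2"
        by (simp add: power2_eq_square algebra_simps)
    qed (intro Bochner_Integration.integrable_add integrable_mult_right L2_integrable_mult L2_integrable_sq L2_diff v2 S smooth_pderiv sr sp)+
    finally show ?thesis unfolding weak_hess_diff_norm[OF v sr] weak_hess_diff_norm[OF v sp] by simp
  qed
qed

end

text \<open>Provides the data of the locale for a given simplex: vertices, height vectors and a bump
  in the interior, which is nonempty because there are \<open>CARD('n) + 1\<close> affinely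
  independent vertices.\<close>

lemma simplex_cell:
  fixes T :: "(real^'n) set"
  assumes "int CARD('n) simplex T" "CARD('n) \<ge> 1"
  shows "\<exists>\<eta> C w. cell T \<eta> C w"
proof -
  obtain C where C: "finite C" "\<not> affine_dependent C" "int (card C) = int CARD('n) + 1" "T = convex hull C"
    using assms(1) unfolding simplex by blast
  have c2: "card C \<ge> 2" using C(3) assms(2) by linarith
  obtain w where "simplex_coords C w"
    using simplex_heights[OF C(2) c2] C(2) c2 unfolding simplex_coords_def by metis
  moreover have "interior T \<noteq> {}"
    using interior_convex_hull_eq_empty[of C] C by simp
  then obtain \<eta> where \<eta>: "\<eta> \<in> test_functions (interior T)" "\<And>x. \<eta> x \<ge> 0" "(\<integral>x. \<eta> x \<partial>lborel) = 1"
    using test_function_exists[OF open_interior] by blast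
  moreover have "mollifier T \<eta>"
    using C \<eta> by unfold_locales (auto intro: finite_imp_compact_convex_hull convex_convex_hull)
  ultimately have "cell T \<eta> C w"
    unfolding cell_def cell_axioms_def using C by simp
  then show ?thesis by blast
qed

theorem lemma2p1:
  fixes T :: "(real^'n) set" and v :: "real^'n \<Rightarrow> real" and k l :: nat
  assumes "CARD('n) \<in> {2, 3}"
    and "int CARD('n) simplex T"
    and "l \<ge> max (k - 2) 1"
    and "v \<in> H2 T"
  shows "(\<forall>p\<in>polys (k + 2).
      l2_inner (lebesgue_on T)
        (weak_hess T (\<lambda>x. v x - reconstruction k l T (interpolation k l T v) x)) (hess p) = 0)
    \<and> is_arg_min (\<lambda>p. l2_norm (lebesgue_on T) (weak_hess T (\<lambda>x. v x - p x)))
        (\<lambda>p. p \<in> polys (k + 2)) (reconstruction k l T (interpolation k l T v))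
    \<and> l2_norm (lebesgue_on T)
        (weak_hess T (\<lambda>x. v x - reconstruction k l T (interpolation k l T v) x))
      = (INF p\<in>polys (k + 2). l2_norm (lebesgue_on T) (weak_hess T (\<lambda>x. v x - p x)))"
proof -
  let ?r = "reconstruction k l T (interpolation k l T v)"
  let ?N = "\<lambda>p. l2_norm (lebesgue_on T) (weak_hess T (\<lambda>x. v x - p x))"
  obtain \<eta> C w where "cell T \<eta> C w" using simplex_cell[OF assms(2)] assms(1) by auto
  then interpret cell T \<eta> C w .
  have l: "l \<ge> k - 2" using assms(3) by simp
  note m = reconstruction_best_approximation[OF assms(1,4) l]
  have "?N ?r = (INF p\<in>polys (k + 2). ?N p)"
  \<comment> \<open>The infimum is attained at the reconstruction, whose own value is the lower
    bound that \<open>cINF_lower\<close> asks for.\<close>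
  proof (rule antisym)
    show "?N ?r \<le> (INF p\<in>polys (k + 2). ?N p)" using m(1,3) by (intro cINF_greatest) auto
    show "(INF p\<in>polys (k + 2). ?N p) \<le> ?N ?r"
      using m(1,3) by (intro cINF_lower bdd_belowI2[of _ "?N ?r"]) auto
  qed
  then show ?thesis
    unfolding is_arg_min_def using m by (auto simp: not_less)
qed

end
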